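(* Connected Vertex Cover admits an EPTAS on unit disk graphs and on map graphs.
   Context: In Connected Vertex Cover, given a graph $G$, one seeks a minimum-size set $S\subseteq V(G)$ such that $G[S]$ is connected and every edge of $G$ has at least one endpoint in $S$. A unit disk graph is the intersection graph of a finite family of closed unit disks in $\mathbb{R}^2$. A map is a pair $(\mathscr{E},\omega)$ with $\mathscr{E}$ a plane graph whose connected components are biconnected and $\omega$ assigning $0$ or $1$ to each face, faces assigned $1$ (nations) having a cycle as boundary; its map graph has nations as vertices, adjacent iff they share a vertex of $\mathscr{E}$. An EPTAS outputs, for $\epsilon>0$, a feasible solution of size at most $(1+\epsilon)$ times optimal in time $g(1/\epsilon)\cdot n^{O(1)}$. *)

theory Defs
  imports "HOL-Analysis.Analysis" "Graph_Theory.Graph_Theory"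
begin

text \<open>
  Finite simple graphs are the finite symmetric loop-free digraphs \<^const>\<open>pair_graph\<close>.
  The graph-theoretic \<^const>\<open>Digraph_Component.connected\<close> excludes the null graph.
\<close>

section \<open>Connected vertex cover\<close>

definition connected_vertex_cover :: "'a pair_pre_digraph \<Rightarrow> 'a set \<Rightarrow> bool" where
  "connected_vertex_cover G S \<longleftrightarrow>
     S \<subseteq> pverts G \<and>
     Digraph_Component.connected (with_proj G \<restriction> S) \<and>
     (\<forall>(u, v) \<in> parcs G. u \<in> S \<or> v \<in> S)"

section \<open>Unit disk graphs\<close>

text \<open>The family of disks is indexed by the vertices, so a disk may occur repeatedly.\<close>

definition unit_disk_graph :: "'a pair_pre_digraph \<Rightarrow> bool" where
  "unit_disk_graph G \<longleftrightarrow>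
     finite (pverts G) \<and>
     (\<exists>c :: 'a \<Rightarrow> real^2.
        parcs G = {(u, v). u \<in> pverts G \<and> v \<in> pverts G \<and> u \<noteq> v \<and>
                           cball (c u) 1 \<inter> cball (c v) 1 \<noteq> {}})"

section \<open>Plane graphs\<close>

text \<open>
  A plane graph is given by its vertices (points) and its edges (point sets of arcs).
  An edge meets the vertex set exactly in its two ends, so the ends of \<open>e\<close> are \<open>e \<inter> V\<close>.
  Distinct edges meet only in vertices and have different sets of ends.
\<close>

definition plane_graph :: "(real^2) set \<Rightarrow> (real^2) set set \<Rightarrow> bool" where
  "plane_graph V E \<longleftrightarrow>
     finite V \<and> finite E \<and>
     (\<forall>e \<in> E. \<exists>\<gamma>. Path_Connected.arc \<gamma> \<and> path_image \<gamma> = e \<and>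
                   e \<inter> V = {pathstart \<gamma>, pathfinish \<gamma>}) \<and>
     (\<forall>e \<in> E. \<forall>e' \<in> E. e \<noteq> e' \<longrightarrow> e \<inter> e' \<subseteq> V \<and> e \<inter> V \<noteq> e' \<inter> V)"

definition graph_of :: "(real^2) set \<Rightarrow> (real^2) set set \<Rightarrow> (real^2) pair_pre_digraph" where
  "graph_of V E = \<lparr> pverts = V, parcs = {(u, v). u \<noteq> v \<and> (\<exists>e \<in> E. e \<inter> V = {u, v})} \<rparr>"

definition faces :: "(real^2) set \<Rightarrow> (real^2) set set \<Rightarrow> (real^2) set set" where
  "faces V E = components (- (V \<union> \<Union>E))"

text \<open>In a symmetric digraph \<open>u, v, u\<close> is a directed cycle, hence the bound on the length.\<close>

definition bounded_by_cycle ::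
    "(real^2) set \<Rightarrow> (real^2) set set \<Rightarrow> (real^2) set \<Rightarrow> bool" where
  "bounded_by_cycle V E f \<longleftrightarrow>
     (\<exists>p. pre_digraph.cycle (with_proj (graph_of V E)) p \<and> 3 \<le> length p \<and>
          frontier f = \<Union>{e \<in> E. \<exists>(u, v) \<in> set p. e \<inter> V = {u, v}})"

definition biconnected :: "('a, 'b) pre_digraph \<Rightarrow> bool" where
  "biconnected G \<longleftrightarrow>
     Digraph_Component.connected G \<and>
     (\<forall>v \<in> verts G. Digraph_Component.connected (G \<restriction> (verts G - {v})))"

section \<open>Maps and map graphs\<close>

definition is_map ::
    "(real^2) set \<Rightarrow> (real^2) set set \<Rightarrow> ((real^2) set \<Rightarrow> nat) \<Rightarrow> bool" where
  "is_map V E \<omega> \<longleftrightarrow>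
     plane_graph V E \<and>
     (\<forall>H. pre_digraph.max_subgraph (with_proj (graph_of V E)) Digraph_Component.connected H
            \<longrightarrow> biconnected H) \<and>
     (\<forall>f \<in> faces V E. \<omega> f \<in> {0, 1}) \<and>
     (\<forall>f \<in> faces V E. \<omega> f = 1 \<longrightarrow> bounded_by_cycle V E f)"

definition nations ::
    "(real^2) set \<Rightarrow> (real^2) set set \<Rightarrow> ((real^2) set \<Rightarrow> nat) \<Rightarrow> (real^2) set set" where
  "nations V E \<omega> = {f \<in> faces V E. \<omega> f = 1}"

definition map_graph :: "'a pair_pre_digraph \<Rightarrow> bool" where
  "map_graph G \<longleftrightarrow>
     (\<exists>V E \<omega> \<phi>. is_map V E \<omega> \<and> bij_betw \<phi> (pverts G) (nations V E \<omega>) \<and>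
        parcs G = {(u, v). u \<in> pverts G \<and> v \<in> pverts G \<and> u \<noteq> v \<and>
                           (\<exists>x \<in> V. x \<in> frontier (\<phi> u) \<and> x \<in> frontier (\<phi> v))})"

section \<open>Turing machines\<close>

text \<open>
  Deterministic machines with one two-way infinite tape; states and tape symbols are
  initial segments of the naturals. State 0 is initial, state 1 is halting,
  symbol 0 is the blank, and symbols 1, 2, 3 are used for input and output.
\<close>

record tm =
  states :: nat
  symbols :: nat
  trans :: "nat \<Rightarrow> nat \<Rightarrow> nat \<times> nat \<times> int"

definition turing_machine :: "tm \<Rightarrow> bool" where
  "turing_machine M \<longleftrightarrow>
     2 \<le> states M \<and> 4 \<le> symbols M \<and>
     (\<forall>q < states M. \<forall>a < symbols M.
        trans M q a \<in> {..<states M} \<times> {..<symbols M} \<times> {-1, 0, 1})"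

type_synonym tm_config = "nat \<times> (int \<Rightarrow> nat) \<times> int"

fun tm_step :: "tm \<Rightarrow> tm_config \<Rightarrow> tm_config" where
  "tm_step M (q, t, h) =
     (if q = 1 then (q, t, h)
      else (let (q', b, d) = trans M q (t h) in (q', t(h := b), h + d)))"

definition tm_start :: "nat list \<Rightarrow> tm_config" where
  "tm_start w = (0, (\<lambda>i. if 0 \<le> i \<and> i < int (length w) then w ! nat i else 0), 0)"

definition tm_halts_within :: "tm \<Rightarrow> nat list \<Rightarrow> nat \<Rightarrow> bool" where
  "tm_halts_within M w k \<longleftrightarrow> fst ((tm_step M ^^ k) (tm_start w)) = 1"

text \<open>The output is the word on the tape from cell 0 up to the next blank.\<close>

definition tm_outputs :: "tm \<Rightarrow> nat list \<Rightarrow> nat list \<Rightarrow> bool" where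
  "tm_outputs M w out \<longleftrightarrow>
     (\<exists>k t h. (tm_step M ^^ k) (tm_start w) = (1, t, h) \<and>
        (\<forall>i < length out. t (int i) = out ! i) \<and> t (int (length out)) = 0)"

section \<open>Encodings\<close>

definition bit_symbol :: "bool \<Rightarrow> nat" where
  "bit_symbol b = (if b then 2 else 1)"

text \<open>
  A graph on the vertices \<open>0, \<dots>, n - 1\<close> is encoded by its adjacency matrix, preceded by \<open>n\<close>
  in unary. The number \<open>\<epsilon>\<close> is encoded by its reduced numerator and denominator in unary;
  as the running time may depend arbitrarily on \<open>1/\<epsilon>\<close>, the length of this code is immaterial.
\<close>

definition encode_graph :: "nat \<Rightarrow> nat pair_pre_digraph \<Rightarrow> nat list" where
  "encode_graph n G =
     replicate n 2 @ [3] @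
     concat (map (\<lambda>i. map (\<lambda>j. bit_symbol ((i, j) \<in> parcs G)) [0..<n]) [0..<n])"

definition encode_rat :: "rat \<Rightarrow> nat list" where
  "encode_rat \<epsilon> =
     (let (p, q) = quotient_of \<epsilon> in replicate (nat p) 2 @ [3] @ replicate (nat q) 2)"

definition encode_set :: "nat \<Rightarrow> nat set \<Rightarrow> nat list" where
  "encode_set n S = map (\<lambda>i. bit_symbol (i \<in> S)) [0..<n]"

section \<open>Efficient polynomial-time approximation schemes\<close>

definition opt_size :: "('a pair_pre_digraph \<Rightarrow> 'a set \<Rightarrow> bool) \<Rightarrow> 'a pair_pre_digraph \<Rightarrow> nat" where
  "opt_size P G = (LEAST k. \<exists>S. P G S \<and> card S = k)"

text \<open>
  \<open>P G S\<close> says that the vertex set \<open>S\<close> is a feasible solution of the minimisation problem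
  on \<open>G\<close>, and \<open>C\<close> is the class of inputs. One machine serves all \<open>\<epsilon>\<close>; it sees only the
  abstract graph. Instances without a feasible solution constrain only the running time.
  The successor in the bound covers the null graph.
\<close>

definition admits_EPTAS ::
    "(nat pair_pre_digraph \<Rightarrow> nat set \<Rightarrow> bool) \<Rightarrow> (nat pair_pre_digraph \<Rightarrow> bool) \<Rightarrow> bool" where
  "admits_EPTAS P C \<longleftrightarrow>
     (\<exists>M (g :: rat \<Rightarrow> nat) c. turing_machine M \<and>
        (\<forall>n G (\<epsilon> :: rat). pair_graph G \<and> pverts G = {..<n} \<and> C G \<and> 0 < \<epsilon> \<longrightarrow>
           (let w = encode_rat \<epsilon> @ [3] @ encode_graph n G in
              tm_halts_within M w (g (1 / \<epsilon>) * Suc n ^ c) \<and>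
              ((\<exists>S. P G S) \<longrightarrow>
                 (\<exists>S \<subseteq> {..<n}. tm_outputs M w (encode_set n S) \<and> P G S \<and>
                    of_nat (card S) \<le> (1 + \<epsilon>) * of_nat (opt_size P G))))))"

end

theory Submission imports Defs "HOL-Library.Nat_Bijection" begin

text \<open>
 Local search. Both classes are tame: there are few edges between an independent set and a disjoint set, an
 independent set sees few distinct neighbourhoods, and subgraphs of bounded degree fall into pieces of bounded
 size after deleting a small fraction of the vertices. For unit disk graphs this follows by packing disks into a
 grid; for map graphs it is read off the planar incidence graph of nations and boundary vertices, of which only the
 absence of a \<open>K\<^sub>3\<^sub>,\<^sub>3\<close> minor is used (decomposition of Klein, Plotkin and Rao).

 In a tame graph all but a bounded number of twins may be discarded, and every vertex of large degree in the
 remaining kernel may be forced into the solution. Among the vertex covers of the kernel obeying this, minimise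
 the size plus twice the number of components, where a move toggles vertices inside a single vertex or inside a
 bounded connected set of vertices of small degree. Cutting an optimal solution and a local optimum into bounded
 pieces shows that a local optimum is connected and within a factor \<open>1 + 1/q\<close> of the optimum.

 A bounded connected set of vertices of small degree is described by a start vertex and a bounded word over a
 bounded alphabet, so that one round of the search tries linearly many moves, and linearly many rounds suffice.
 The search is written as a loop program, whose loops have bounds fixed in advance, and compiled to a Turing machine
 that keeps each variable as a mark on its own track.
\<close>


text \<open>The obstacle is connectivity. Exchanging a local optimum for another solution inside one
  bounded piece may break it into components, each costing 2, and summed over all pieces this is not
  obviously small. It is controlled by charging: a new component that contains neither an inserted
  cut vertex nor a fixed root is charged to a component of the solution restricted to hubs and cut
  vertices, and breadth-first distance from the root makes the charge injective. Components of that
  restriction are few: each contains a cut vertex or consists of hubs, and one hub from each of the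
  latter gives an independent set of vertices of large degree, which sparsity keeps small.

  All losses must be measured against the optimum rather than against n. This is what the kernel is
  for: its size is linear in that of any vertex cover, so a small fraction of the kernel is a small
  fraction of the optimum.

  With q the denominator of the given number, the target is the ratio 1 + 1/q, which is at most the
  required one. No loop bound changes once the search has begun, so the running time is polynomial
  in these bounds, with an exponent read off the nesting of the loops and hence independent of
  q.\<close>

section \<open>Drawings of the complete bipartite graph\<close>

text \<open>The topological core of the nonplanarity of K_{3,3}. The arcs \<open>c1\<close> and
  \<open>c3\<close> form a Jordan curve, and \<open>c2\<close> lies on the side of \<open>w\<close>
  because \<open>Q2\<close> reaches it from there. A point \<open>v\<close> of the other side is
  joined to \<open>w\<close> off \<open>c1\<close> and \<open>c2\<close> (across \<open>c3\<close>,
  then along \<open>Q3\<close>) and also off \<open>c2\<close> and \<open>c3\<close> (across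
  \<open>c1\<close>, then along \<open>Q1\<close>). The two obstacles meet in the connected set
  \<open>c2\<close>, so by Janiszewski's theorem \<open>v\<close> and \<open>w\<close> are joined
  off all three arcs, which the Jordan curve forbids.\<close>

lemma theta_graph_no_common_touching:
 fixes c1 c2 c3 :: "real => complex"
 assumes arcs: "Path_Connected.arc c1" "Path_Connected.arc c2" "Path_Connected.arc c3"
  and ends: "pathstart c1 = a" "pathfinish c1 = b" "pathstart c2 = a" "pathfinish c2 = b"
   "pathstart c3 = a" "pathfinish c3 = b"
  and meet: "path_image c1 \<inter> path_image c2 \<subseteq> {a,b}" "path_image c1 \<inter> path_image c3 \<subseteq> {a,b}"
   "path_image c2 \<inter> path_image c3 \<subseteq> {a,b}"
  and Q: "Topological_Spaces.connected Q1" "Topological_Spaces.connected Q2" "Topological_Spaces.connected Q3"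
  and w: "w \<in> Q1" "w \<in> Q2" "w \<in> Q3"
  and hit: "Q1 \<inter> path_image c1 ~= {}" "Q2 \<inter> path_image c2 ~= {}" "Q3 \<inter> path_image c3 ~= {}"
  and avoid: "Q1 \<inter> (path_image c2 \<union> path_image c3) = {}" "Q2 \<inter> (path_image c1 \<union> path_image c3) = {}"
   "Q3 \<inter> (path_image c1 \<union> path_image c2) = {}"
 shows False
proof -
 let ?p1 = "path_image c1" and ?p2 = "path_image c2" and ?p3 = "path_image c3"
 have ab: "a ~= b" using arcs(1) ends(1,2) arc_distinct_ends by blast
 have abin: "a \<in> ?p1" "b \<in> ?p1" "a \<in> ?p2" "b \<in> ?p2" "a \<in> ?p3" "b \<in> ?p3"
  using ends by (metis pathstart_in_path_image pathfinish_in_path_image)+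
 have open_arc: "Topological_Spaces.connected (path_image c - {a,b})"
  if "Path_Connected.arc c" "pathstart c = a" "pathfinish c = b" for c :: "real => complex"
  using connected_simple_path_endless[OF arc_imp_simple_path[OF that(1)]] that by simp
 let ?j = "c1 +++ reversepath c3"
 have j: "simple_path ?j" "pathfinish ?j = pathstart ?j" "path_image ?j = ?p1 \<union> ?p3"
  using arcs ends meet by (auto intro!: simple_path_join_loop simp: path_image_join arc_reversepath)
 note J = Jordan_inside_outside[OF j(1,2), unfolded j(3)]
 have wJ: "w \<notin> ?p1 \<union> ?p3" using w avoid by auto
 have un: "inside (?p1 \<union> ?p3) \<union> outside (?p1 \<union> ?p3) = - (?p1 \<union> ?p3)" by (simp add: inside_Un_outside)
 have io: "inside (?p1 \<union> ?p3) \<inter> outside (?p1 \<union> ?p3) = {}" by (rule inside_Int_outside)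
 \<comment> \<open>\<open>V\<close> is the side of the Jordan curve that misses \<open>w\<close>,
   and \<open>U\<close> the side that contains it; which of them is the inside is left open.\<close>
 define V where "V = (if w \<in> inside (?p1 \<union> ?p3) then outside (?p1 \<union> ?p3) else inside (?p1 \<union> ?p3))"
 define U where "U = (if w \<in> inside (?p1 \<union> ?p3) then inside (?p1 \<union> ?p3) else outside (?p1 \<union> ?p3))"
 have UV: "U \<inter> V = {}" "U \<union> V = - (?p1 \<union> ?p3)" "w \<in> U" "open U" "open V" "Topological_Spaces.connected V"
  "V ~= {}" "frontier V = ?p1 \<union> ?p3"
  using J un io wJ unfolding V_def U_def by (cases "w \<in> inside (?p1 \<union> ?p3)"; simp; blast)+
 have inU: "A \<subseteq> U" if "Topological_Spaces.connected A" "A \<inter> (?p1 \<union> ?p3) = {}" "A \<inter> U ~= {}" for A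
  using that connectedD[of A U V] UV by blast
 have Q2U: "Q2 \<subseteq> U" using inU[of Q2] Q(2) avoid(2) w UV(3) by blast
 have c2U: "?p2 - {a,b} \<subseteq> U"
 proof (rule inU)
  show "Topological_Spaces.connected (?p2 - {a,b})" using open_arc arcs ends by blast
  show "(?p2 - {a,b}) \<inter> (?p1 \<union> ?p3) = {}" using meet by blast
  show "(?p2 - {a,b}) \<inter> U ~= {}" using hit(2) avoid(2) Q2U abin by blast
 qed
 obtain v where v: "v \<in> V" using UV by blast
 have cl: "closure V = V \<union> (?p1 \<union> ?p3)" using UV(8,5) by (metis closure_Un_frontier)
 have V2: "V \<inter> ?p2 = {}" using c2U UV abin by blast
 \<comment> \<open>Adding the open arc \<open>d\<close> to \<open>V\<close> keeps the set connected,
   since \<open>d\<close> lies in the closure of \<open>V\<close>; from there \<open>R\<close> leads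
   on to \<open>w\<close>.\<close>
 have conn: "connected_component (- (?p2 \<union> path_image c)) v w"
  if "Topological_Spaces.connected R" "w \<in> R" "R \<inter> (?p2 \<union> path_image c) = {}" "R \<inter> path_image d ~= {}"
   "path_image d - {a,b} \<subseteq> closure V" "Topological_Spaces.connected (path_image d - {a,b})"
   "path_image d \<inter> path_image c \<subseteq> {a,b}" "path_image d \<inter> ?p2 \<subseteq> {a,b}" "V \<inter> path_image c = {}"
  for R c d
 proof -
  have "Topological_Spaces.connected (V \<union> (path_image d - {a,b}))"
   by (rule connected_intermediate_closure[OF UV(6)]) (use that(5) closure_subset[of V] in auto)
  moreover have "(V \<union> (path_image d - {a,b})) \<inter> R ~= {}" using that abin by blast
  ultimately have "Topological_Spaces.connected (V \<union> (path_image d - {a,b}) \<union> R)" using that(1) by (simp add: connected_Un)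
  moreover have "V \<union> (path_image d - {a,b}) \<union> R \<subseteq> - (?p2 \<union> path_image c)"
   using that V2 by blast
  ultimately show ?thesis unfolding connected_component_def using v that(2) by blast
 qed
 have VJ: "V \<inter> (?p1 \<union> ?p3) = {}" using UV by blast
 have s1: "connected_component (- (?p2 \<union> ?p1)) v w"
  by (rule conn[OF Q(3) w(3), of c1 c3]) (use avoid hit cl open_arc arcs ends meet VJ in auto)
 have s3: "connected_component (- (?p2 \<union> ?p3)) v w"
  by (rule conn[OF Q(1) w(1), of c3 c1]) (use avoid hit cl open_arc arcs ends meet VJ in auto)
 have "(?p2 \<union> ?p1) \<inter> (?p2 \<union> ?p3) = ?p2" using meet abin by blast
 moreover have "Topological_Spaces.connected ?p2" using arcs connected_arc_image by blast
 ultimately have "connected_component (- ((?p2 \<union> ?p1) \<union> (?p2 \<union> ?p3))) v w"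
  using Janiszewski[OF _ _ _ s1 s3] arcs by (simp add: compact_Un compact_arc_image closed_Un closed_arc_image)
 then obtain T where T: "Topological_Spaces.connected T" "v \<in> T" "w \<in> T" "T \<inter> (?p1 \<union> ?p3) = {}"
  unfolding connected_component_def by blast
 with inU[of T] UV v show False by blast
qed

text \<open>An arc \<open>g\<close> from \<open>x\<close> to \<open>y\<close> supplies two legs; a
  path from \<open>z\<close>, stopped where it first meets \<open>g\<close>, supplies the third, and
  that point is the centre \<open>b\<close>. Injectivity of \<open>g\<close> makes its two halves
  meet in \<open>b\<close> only. For \<open>x = y\<close> two of the legs shrink to a point.\<close>

lemma path_connected_tripod:
 fixes S :: "'a::euclidean_space set"
 assumes "path_connected S" "compact S" "x \<in> S" "y \<in> S" "z \<in> S"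
 obtains b T1 T2 T3 where "b \<in> T1" "b \<in> T2" "b \<in> T3" "x \<in> T1" "y \<in> T2" "z \<in> T3"
  "T1 \<union> T2 \<union> T3 \<subseteq> S" "path_connected T1" "path_connected T2" "path_connected T3"
  "compact T1" "compact T2" "compact T3"
  "T1 \<inter> T2 \<subseteq> {b}" "T1 \<inter> T3 \<subseteq> {b}" "T2 \<inter> T3 \<subseteq> {b}"
proof (cases "x = y")
 case True
 show ?thesis
 proof (rule that[of x "{x}" "{x}" S])
 qed (use assms True in auto)
next
 case False
 obtain g where g: "Path_Connected.arc g" "path_image g \<subseteq> S" "pathstart g = x" "pathfinish g = y"
  using assms False by (meson path_connected_arcwise)
 obtain d where d: "path d" "path_image d \<subseteq> S" "pathstart d = z" "pathfinish d = x"
  using assms unfolding path_connected_def by blast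
 have clo: "closed (path_image g)" using g closed_arc_image by blast
 have "\<exists>h. path h \<and> path_image h \<subseteq> S \<and> pathstart h = z \<and> path_image h \<inter> path_image g = {pathfinish h}"
 proof (cases "z \<in> path_image g")
  case True
  thus ?thesis by (intro exI[of _ "linepath z z"]) (use assms in auto)
 next
  case False
  hence "pathstart d \<in> closure (- path_image g)" "pathfinish d \<notin> - path_image g"
   using d g(3) closure_subset[of "- path_image g"] pathstart_in_path_image[of g] by auto
  then obtain h where h: "path h" "pathstart h = pathstart d" "path_image h \<subseteq> path_image d"
   "path_image h - {pathfinish h} \<subseteq> interior (- path_image g)" "pathfinish h \<in> frontier (- path_image g)"
   using exists_path_subpath_to_frontier[OF d(1)] by blast
  have "pathfinish h \<in> path_image g" using h(5) clo by (metis DiffD1 closure_closed frontier_complement frontier_def)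
  moreover have "path_image h - {pathfinish h} \<subseteq> - path_image g" using h(4) interior_subset by blast
  ultimately have "path_image h \<inter> path_image g = {pathfinish h}" using pathfinish_in_path_image[of h] by blast
  thus ?thesis using h d by (intro exI[of _ h]) auto
 qed
 then obtain h where h: "path h" "path_image h \<subseteq> S" "pathstart h = z" "path_image h \<inter> path_image g = {pathfinish h}" by blast
 hence "pathfinish h \<in> path_image g" by blast
 then obtain s where s: "s \<in> {0..1}" "g s = pathfinish h" unfolding path_image_def by auto
 have inj: "inj_on g {0..1}" using g(1) by (simp add: arc_def)
 show ?thesis
 proof (rule that[of "g s" "g ` {0..s}" "g ` {s..1}" "path_image h"])
  show "path_connected (g ` {0..s})" "path_connected (g ` {s..1})"
   using g(1) s by (auto intro!: path_connected_continuous_image continuous_on_subset[of "{0..1}" g]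
     simp: arc_def path_def is_interval_path_connected is_interval_cc)
  show "compact (g ` {0..s})" "compact (g ` {s..1})"
   using g(1) s by (auto intro!: compact_continuous_image continuous_on_subset[of "{0..1}" g]
     simp: arc_def path_def)
  show "compact (path_image h)" using h compact_path_image by blast
  show "g ` {0..s} \<inter> g ` {s..1} \<subseteq> {g s}"
  proof
   fix p assume "p \<in> g ` {0..s} \<inter> g ` {s..1}"
   then obtain i j where "i \<in> {0..s}" "j \<in> {s..1}" "p = g i" "p = g j" by blast
   moreover from this have "i = j" using inj s by (auto dest: inj_onD)
   ultimately show "p \<in> {g s}" by auto
  qed
  show "path_connected (path_image h)" using h path_connected_path_image by blast
  show "x \<in> g ` {0..s}" using g(3) s by (auto simp: pathstart_def)
  show "y \<in> g ` {s..1}" using g(4) s by (auto simp: pathfinish_def)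
  show "z \<in> path_image h" using h by (metis pathstart_in_path_image)
  have "g ` {0..s} \<subseteq> path_image g" "g ` {s..1} \<subseteq> path_image g" using s by (auto simp: path_image_def)
  thus "g ` {0..s} \<union> g ` {s..1} \<union> path_image h \<subseteq> S" "g ` {0..s} \<inter> path_image h \<subseteq> {g s}"
   "g ` {s..1} \<inter> path_image h \<subseteq> {g s}" using g h s by auto
  show "g s \<in> g ` {0..s}" "g s \<in> g ` {s..1}" using s(1) by auto
  show "g s \<in> path_image h" using s by (metis pathfinish_in_path_image)
 qed
qed

text \<open>The map \<open>\<phi>\<close> identifies \<open>real^2\<close> with the complex plane;
  being continuous and injective, it preserves all hypotheses.\<close>

lemma theta_graph_no_common_touching_real2:
 fixes c :: "nat => real => real^2"
 assumes arcs: "\<And>i. i < 3 ==> Path_Connected.arc (c i) \<and> pathstart (c i) = a \<and> pathfinish (c i) = b"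
  and meet: "\<And>i k. i < 3 ==> k < 3 ==> i ~= k ==> path_image (c i) \<inter> path_image (c k) \<subseteq> {a,b}"
  and Q: "\<And>i. i < 3 ==> Topological_Spaces.connected (Q i) \<and> w \<in> Q i \<and> Q i \<inter> path_image (c i) ~= {}"
  and avoid: "\<And>i k. i < 3 ==> k < 3 ==> i ~= k ==> Q i \<inter> path_image (c k) = {}"
 shows False
proof -
 define \<phi> :: "real^2 => complex" where "\<phi> x = Complex (x $ 1) (x $ 2)" for x
 have cont: "continuous_on X \<phi>" for X
  unfolding \<phi>_def by (intro continuous_intros)
 have inj: "inj \<phi>" by (auto simp: inj_def \<phi>_def vec_eq_iff forall_2)
 have arc: "Path_Connected.arc (\<phi> \<circ> c i)" if "i < 3" for i
  using arcs[OF that] inj cont by (auto simp: arc_def intro!: path_continuous_image comp_inj_on inj_on_subset[OF inj])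
 have img: "path_image (\<phi> \<circ> c i) = \<phi> ` path_image (c i)" for i by (simp add: path_image_compose)
 have ends: "pathstart (\<phi> \<circ> c i) = \<phi> a" "pathfinish (\<phi> \<circ> c i) = \<phi> b" if "i < 3" for i
  using arcs[OF that] by (simp_all add: pathstart_compose pathfinish_compose)
 have m: "path_image (\<phi> \<circ> c i) \<inter> path_image (\<phi> \<circ> c k) \<subseteq> {\<phi> a, \<phi> b}" if "i < 3" "k < 3" "i ~= k" for i k
  unfolding img image_Int[OF inj, symmetric] using meet[OF that] by auto
 have QQ: "Topological_Spaces.connected (\<phi> ` Q i)" "\<phi> w \<in> \<phi> ` Q i" "\<phi> ` Q i \<inter> path_image (\<phi> \<circ> c i) ~= {}"
  if "i < 3" for i
  using Q[OF that] cont by (auto simp: img intro!: connected_continuous_image)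
 have av: "\<phi> ` Q i \<inter> path_image (\<phi> \<circ> c k) = {}" if "i < 3" "k < 3" "i ~= k" for i k
  unfolding img image_Int[OF inj, symmetric] using avoid[OF that] by auto
 show False
  by (rule theta_graph_no_common_touching[of "\<phi> \<circ> c 0" "\<phi> \<circ> c 1" "\<phi> \<circ> c 2" "\<phi> a" "\<phi> b"
     "\<phi> ` Q 0" "\<phi> ` Q 1" "\<phi> ` Q 2" "\<phi> w"])
   (use arc ends m QQ av in \<open>simp_all add: Int_Un_distrib\<close>)
qed

text \<open>In \<open>B 0\<close> and \<open>B 1\<close> tripods are chosen with centres
  \<open>b0\<close> and \<open>b1\<close>, whose legs end where the three connections arrive.
  Through \<open>A i\<close> and its two connections, leg \<open>i\<close> of one tripod is joined
  to leg \<open>i\<close> of the other, which gives three arcs from \<open>b0\<close> to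
  \<open>b1\<close> meeting only at their ends. \<open>B 2\<close> with its three connections
  touches each of these arcs separately. The vertices of the drawing are sets rather than points
  because a minor contracts sets.\<close>

lemma no_fat_K33_drawing:
 fixes A B :: "nat => (real^2) set" and h :: "nat => nat => real => real^2"
 assumes A: "\<And>i. i < 3 ==> path_connected (A i)"
  and B: "\<And>j. j < 3 ==> path_connected (B j) \<and> compact (B j)"
  and AA: "\<And>i k. i < 3 ==> k < 3 ==> i ~= k ==> A i \<inter> A k = {}"
  and BB: "\<And>i k. i < 3 ==> k < 3 ==> i ~= k ==> B i \<inter> B k = {}"
  and AB: "\<And>i k. i < 3 ==> k < 3 ==> A i \<inter> B k = {}"
  and h: "\<And>i j. i < 3 ==> j < 3 ==> path (h i j) \<and> pathstart (h i j) \<in> A i \<and> pathfinish (h i j) \<in> B j"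
  and hA: "\<And>i j k. i < 3 ==> j < 3 ==> k < 3 ==> k ~= i ==> path_image (h i j) \<inter> A k = {}"
  and hB: "\<And>i j k. i < 3 ==> j < 3 ==> k < 3 ==> k ~= j ==> path_image (h i j) \<inter> B k = {}"
  and hBj: "\<And>i j. i < 3 ==> j < 3 ==> path_image (h i j) \<inter> B j \<subseteq> {pathfinish (h i j)}"
  and hh: "\<And>i j k l. i < 3 ==> j < 3 ==> k < 3 ==> l < 3 ==> (i,j) ~= (k,l) ==>
    path_image (h i j) \<inter> path_image (h k l) \<subseteq> (\<Union>i<3. A i) \<union> (\<Union>j<3. B j)"
 shows False
proof -
 let ?H = "\<lambda>i j. path_image (h i j)"
 define P where "P j b T \<longleftrightarrow> (\<forall>i<3::nat. b \<in> T i \<and> pathfinish (h i j) \<in> T i \<and> T i \<subseteq> B j \<and> path_connected (T i) \<and> compact (T i)) \<and>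
  (\<forall>i<3. \<forall>k<3. i ~= k --> T i \<inter> T k \<subseteq> {b})" for j b T
 have trip: "\<exists>b T. P j b T" if j: "j < 3" for j
 proof -
  have "path_connected (B j)" "compact (B j)" "pathfinish (h 0 j) \<in> B j" "pathfinish (h 1 j) \<in> B j" "pathfinish (h 2 j) \<in> B j"
   using B h j by auto
  then obtain b T1 T2 T3 where T: "b \<in> T1" "b \<in> T2" "b \<in> T3" "pathfinish (h 0 j) \<in> T1" "pathfinish (h 1 j) \<in> T2" "pathfinish (h 2 j) \<in> T3"
  "T1 \<union> T2 \<union> T3 \<subseteq> B j" "path_connected T1" "path_connected T2" "path_connected T3"
  "compact T1" "compact T2" "compact T3"
  "T1 \<inter> T2 \<subseteq> {b}" "T1 \<inter> T3 \<subseteq> {b}" "T2 \<inter> T3 \<subseteq> {b}" by (rule path_connected_tripod)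
  have lt: "(\<forall>i<3::nat. P i) \<longleftrightarrow> P 0 \<and> P 1 \<and> P 2" for P by (auto simp: less_Suc_eq numeral_3_eq_3 numeral_2_eq_2)
  show ?thesis
   unfolding P_def
   apply (rule exI[of _ b], rule exI[of _ "\<lambda>i. if i = 0 then T1 else if i = 1 then T2 else T3"])
   unfolding lt using T by (auto simp: Int_commute)
 qed
 obtain b0 T0 where P0: "P 0 b0 T0" using trip[of 0] by auto
 hence T0: "\<And>i. i < 3 ==> b0 \<in> T0 i \<and> pathfinish (h i 0) \<in> T0 i \<and> T0 i \<subseteq> B 0 \<and> path_connected (T0 i) \<and> compact (T0 i)"
  "\<And>i k. i < 3 ==> k < 3 ==> i ~= k ==> T0 i \<inter> T0 k \<subseteq> {b0}" unfolding P_def by blast+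
 obtain b1 T1 where P1: "P 1 b1 T1" using trip[of 1] by auto
 hence T1: "\<And>i. i < 3 ==> b1 \<in> T1 i \<and> pathfinish (h i 1) \<in> T1 i \<and> T1 i \<subseteq> B 1 \<and> path_connected (T1 i) \<and> compact (T1 i)"
  "\<And>i k. i < 3 ==> k < 3 ==> i ~= k ==> T1 i \<inter> T1 k \<subseteq> {b1}" unfolding P_def by blast+
 define Y where "Y i = T0 i \<union> ?H i 0 \<union> A i \<union> ?H i 1 \<union> T1 i" for i
 have b01: "b0 \<in> B 0" "b1 \<in> B 1" "b0 ~= b1" using T0(1)[of 0] T1(1)[of 0] BB[of 0 1] by auto
 have pc: "path_connected (?H i j)" "pathstart (h i j) \<in> ?H i j" "pathfinish (h i j) \<in> ?H i j" if "i < 3" "j < 3" for i j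
  using h[OF that] by (auto simp: path_connected_path_image)
 have Ypc: "path_connected (Y i)" if "i < 3" for i
  unfolding Y_def using T0(1)[OF that] T1(1)[OF that] A[OF that] h[OF that, of 0] h[OF that, of 1] pc[OF that, of 0] pc[OF that, of 1]
  by (intro path_connected_Un) auto
 have "\<exists>c. Path_Connected.arc c \<and> path_image c \<subseteq> Y i \<and> pathstart c = b0 \<and> pathfinish c = b1" if "i < 3" for i
 proof -
  have "b0 \<in> Y i" "b1 \<in> Y i" using T0(1)[OF that] T1(1)[OF that] by (auto simp: Y_def)
  thus ?thesis using Ypc[OF that] b01(3) by (meson path_connected_arcwise)
 qed
 then obtain c where c: "\<And>i. i < 3 ==> Path_Connected.arc (c i) \<and> path_image (c i) \<subseteq> Y i \<and> pathstart (c i) = b0 \<and> pathfinish (c i) = b1"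
  by metis
 have hh': "?H i j \<inter> ?H k l \<subseteq> (if i = k then A i else {}) \<union> (if j = l then {pathfinish (h i j)} \<inter> {pathfinish (h k l)} else {})"
  if "i < 3" "j < 3" "k < 3" "l < 3" "(i,j) ~= (k,l)" for i j k l
 proof
  fix x assume x: "x \<in> ?H i j \<inter> ?H k l"
  with hh[OF that] consider m where "m < 3" "x \<in> A m" | m where "m < 3" "x \<in> B m" by auto
  thus "x \<in> (if i = k then A i else {}) \<union> (if j = l then {pathfinish (h i j)} \<inter> {pathfinish (h k l)} else {})"
  proof cases
   case 1
   hence "m = i" "m = k" using hA[of i j m] hA[of k l m] x that by auto
   thus ?thesis using 1 by auto
  next
   case 2
   hence "m = j" "m = l" using hB[of i j m] hB[of k l m] x that by auto
   thus ?thesis using 2 hBj[of i j] hBj[of k l] x that by auto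
  qed
 qed
 have YY: "Y i \<inter> Y k \<subseteq> {b0, b1}" if ik: "i < 3" "k < 3" "i ~= k" for i k
 proof -
  note t = T0(1)[OF ik(1)] T0(1)[OF ik(2)] T1(1)[OF ik(1)] T1(1)[OF ik(2)]
  have "T0 i \<inter> T0 k \<subseteq> {b0,b1}" "T1 i \<inter> T1 k \<subseteq> {b0,b1}" using T0(2)[OF ik] T1(2)[OF ik] by auto
  moreover have "T0 i \<inter> T1 k \<subseteq> {b0,b1}" "T1 i \<inter> T0 k \<subseteq> {b0,b1}" using t BB[of 0 1] by auto
  moreover have "T0 i \<inter> ?H k 0 \<subseteq> {b0,b1}" "?H i 0 \<inter> T0 k \<subseteq> {b0,b1}" "T1 i \<inter> ?H k 1 \<subseteq> {b0,b1}" "?H i 1 \<inter> T1 k \<subseteq> {b0,b1}"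
   using t hBj[OF ik(2), of 0] hBj[OF ik(1), of 0] hBj[OF ik(2), of 1] hBj[OF ik(1), of 1] T0(2)[OF ik] T1(2)[OF ik] by auto
  moreover have "T0 i \<inter> ?H k 1 \<subseteq> {b0,b1}" "?H i 1 \<inter> T0 k \<subseteq> {b0,b1}" "T1 i \<inter> ?H k 0 \<subseteq> {b0,b1}" "?H i 0 \<inter> T1 k \<subseteq> {b0,b1}"
   using t hB[OF ik(2), of 1 0] hB[OF ik(1), of 1 0] hB[OF ik(2), of 0 1] hB[OF ik(1), of 0 1] by auto
  moreover have "T0 i \<inter> A k \<subseteq> {b0,b1}" "A i \<inter> T0 k \<subseteq> {b0,b1}" "T1 i \<inter> A k \<subseteq> {b0,b1}" "A i \<inter> T1 k \<subseteq> {b0,b1}"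
   using t AB[OF ik(2), of 0] AB[OF ik(1), of 0] AB[OF ik(2), of 1] AB[OF ik(1), of 1] by auto
  moreover have "?H i 0 \<inter> A k \<subseteq> {b0,b1}" "A i \<inter> ?H k 0 \<subseteq> {b0,b1}" "?H i 1 \<inter> A k \<subseteq> {b0,b1}" "A i \<inter> ?H k 1 \<subseteq> {b0,b1}"
   using hA[OF ik(1) _ ik(2), of 0] hA[OF ik(1) _ ik(2), of 1] hA[OF ik(2) _ ik(1), of 0] hA[OF ik(2) _ ik(1), of 1] ik by auto
  moreover have "?H i 0 \<inter> ?H k 0 \<subseteq> {b0,b1}" "?H i 1 \<inter> ?H k 1 \<subseteq> {b0,b1}"
   using hh'[OF ik(1) _ ik(2), of 0 0] hh'[OF ik(1) _ ik(2), of 1 1] ik t T0(2)[OF ik] T1(2)[OF ik] by auto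
  moreover have "?H i 0 \<inter> ?H k 1 \<subseteq> {b0,b1}" "?H i 1 \<inter> ?H k 0 \<subseteq> {b0,b1}"
   using hh'[OF ik(1) _ ik(2), of 0 1] hh'[OF ik(1) _ ik(2), of 1 0] ik by auto
  moreover have "A i \<inter> A k \<subseteq> {b0,b1}" using AA ik by auto
  ultimately show ?thesis unfolding Y_def Int_Un_distrib Int_Un_distrib2 by (intro Un_least) assumption+
 qed
 \<comment> \<open>Without \<open>A i\<close>, the region \<open>Y i\<close> falls into a closed
   part near \<open>B 0\<close> and a closed part near \<open>B 1\<close>; the arc
   \<open>c i\<close> is connected and meets both.\<close>
 have cA: "path_image (c i) \<inter> A i ~= {}" if i: "i < 3" for i
 proof
  assume e: "path_image (c i) \<inter> A i = {}"
  note t = T0(1)[OF i] T1(1)[OF i]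
  let ?F = "T0 i \<union> ?H i 0" and ?F' = "T1 i \<union> ?H i 1"
  have "closed ?F" "closed ?F'" using t h[OF i, of 0] h[OF i, of 1] by (auto intro!: closed_Un compact_imp_closed compact_path_image)
  moreover have "Topological_Spaces.connected (path_image (c i))" using c[OF i] connected_arc_image by blast
  moreover have "path_image (c i) \<subseteq> ?F \<union> ?F'" using c[OF i] e by (auto simp: Y_def)
  moreover have "?F \<inter> ?F' \<subseteq> A i"
  proof -
   have "T0 i \<inter> T1 i = {}" using t BB[of 0 1] by auto
   moreover have "T0 i \<inter> ?H i 1 = {}" "T1 i \<inter> ?H i 0 = {}" using t hB[OF i, of 1 0] hB[OF i, of 0 1] by auto
   moreover have "?H i 0 \<inter> ?H i 1 \<subseteq> A i" using hh'[OF i _ i, of 0 1] by auto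
   ultimately show ?thesis by auto
  qed
  moreover have "b0 \<in> ?F \<inter> path_image (c i)" "b1 \<in> ?F' \<inter> path_image (c i)"
   using t c[OF i] pathstart_in_path_image[of "c i"] pathfinish_in_path_image[of "c i"] by auto
  ultimately show False using e connected_closedD[of "path_image (c i)" ?F ?F'] by blast
 qed
 obtain w where w: "w \<in> B 2" using h[of 0 2] by auto
 show False
 proof (rule theta_graph_no_common_touching_real2[of c b0 b1 "\<lambda>i. A i \<union> ?H i 2 \<union> B 2" w])
  show "Path_Connected.arc (c i) \<and> pathstart (c i) = b0 \<and> pathfinish (c i) = b1" if "i < 3" for i using c[OF that] by auto
  show "path_image (c i) \<inter> path_image (c k) \<subseteq> {b0,b1}" if "i < 3" "k < 3" "i ~= k" for i k
   using YY[OF that] c that by blast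
  show "Topological_Spaces.connected (A i \<union> ?H i 2 \<union> B 2) \<and> w \<in> A i \<union> ?H i 2 \<union> B 2 \<and>
    (A i \<union> ?H i 2 \<union> B 2) \<inter> path_image (c i) ~= {}" if i: "i < 3" for i
  proof -
   have "path_connected (A i \<union> ?H i 2 \<union> B 2)"
    using A[OF i] h[OF i, of 2] pc[OF i, of 2] B[of 2] by (intro path_connected_Un) auto
   thus ?thesis using w cA[OF i] by (auto intro: path_connected_imp_connected)
  qed
  show "(A i \<union> ?H i 2 \<union> B 2) \<inter> path_image (c k) = {}" if ik: "i < 3" "k < 3" "i ~= k" for i k
  proof -
   note t = T0(1)[OF ik(2)] T1(1)[OF ik(2)]
   have "A i \<inter> Y k = {}" unfolding Y_def using t AB[OF ik(1), of 0] AB[OF ik(1), of 1] AA[OF ik] hA[OF ik(2) _ ik(1), of 0] hA[OF ik(2) _ ik(1), of 1] ik by auto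
   moreover have "B 2 \<inter> Y k = {}" unfolding Y_def using t BB[of 0 2] BB[of 1 2] AB[OF ik(2), of 2] hB[OF ik(2), of 0 2] hB[OF ik(2), of 1 2] by auto
   moreover have "?H i 2 \<inter> Y k = {}" unfolding Y_def using t hB[OF ik(1), of 2 0] hB[OF ik(1), of 2 1] hA[OF ik(1) _ ik(2), of 2]
    hh'[OF ik(1) _ ik(2), of 2 0] hh'[OF ik(1) _ ik(2), of 2 1] ik by auto
   ultimately show ?thesis using c[OF ik(2)] by blast
  qed
 qed
qed

section \<open>Excluded minors\<close>

text \<open>Nonemptiness is part of the notion, in agreement with the convention for
  \<open>connected_vertex_cover\<close>.\<close>

definition conn :: "('a \<times> 'a) set => 'a set => bool" where
 "conn R A \<longleftrightarrow> A ~= {} \<and> (\<forall>x\<in>A. \<forall>y\<in>A. (x, y) \<in> (R \<inter> A \<times> A)\<^sup>*)"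

text \<open>The six sets are the branch sets of a K_{3,3} minor.\<close>

definition k33_model :: "'a set => ('a \<times> 'a) set => (nat => 'a set) => (nat => 'a set) => bool" where
 "k33_model N R A B \<longleftrightarrow>
  (\<forall>i<3. A i \<subseteq> N \<and> B i \<subseteq> N \<and> conn R (A i) \<and> conn R (B i)) \<and>
  (\<forall>i<3. \<forall>k<3. i ~= k --> A i \<inter> A k = {} \<and> B i \<inter> B k = {}) \<and>
  (\<forall>i<3. \<forall>j<3. A i \<inter> B j = {} \<and> (\<exists>a\<in>A i. \<exists>b\<in>B j. (a, b) \<in> R))"

definition k33_free :: "'a set => ('a \<times> 'a) set => bool" where
 "k33_free N R \<longleftrightarrow> \<not> (\<exists>A B. k33_model N R A B)"

lemma rtrancl_restrict_mono: "A \<subseteq> B ==> (x, y) \<in> (R \<inter> A \<times> A)\<^sup>* ==> (x, y) \<in> (R \<inter> B \<times> B)\<^sup>*"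
 by (meson Int_mono Sigma_mono order_refl rtrancl_mono subsetD)

lemma rtrancl_restrict_in: "(x, y) \<in> (R \<inter> A \<times> A)\<^sup>* ==> x \<in> A ==> y \<in> A"
 by (induction rule: rtrancl_induct) auto

lemma rtrancl_restrict_sym: "sym R ==> (x, y) \<in> (R \<inter> A \<times> A)\<^sup>* ==> (y, x) \<in> (R \<inter> A \<times> A)\<^sup>*"
 by (rule symD[OF sym_rtrancl]) (auto simp: sym_def)

lemma conn_Union_image:
 assumes X: "conn R' X" and "\<And>x. x \<in> X ==> conn R (\<mu> x)"
  and edge: "\<And>x y. x \<in> X ==> y \<in> X ==> (x, y) \<in> R' ==> \<exists>a\<in>\<mu> x. \<exists>b\<in>\<mu> y. (a, b) \<in> R"
 shows "conn R (\<Union>(\<mu> ` X))"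
proof -
 let ?U = "\<Union>(\<mu> ` X)"
 have inner: "(a, b) \<in> (R \<inter> ?U \<times> ?U)\<^sup>*" if "x \<in> X" "a \<in> \<mu> x" "b \<in> \<mu> x" for x a b
  using assms(2)[OF that(1)] that rtrancl_restrict_mono[of "\<mu> x" ?U a b R] by (auto simp: conn_def)
 have "\<forall>b\<in>\<mu> y. (a, b) \<in> (R \<inter> ?U \<times> ?U)\<^sup>*" if "x \<in> X" "a \<in> \<mu> x" "(x, y) \<in> (R' \<inter> X \<times> X)\<^sup>*" for x y a
  using that(3)
 proof (induction rule: rtrancl_induct)
  case base
  thus ?case using inner that by blast
 next
  case (step y z)
  then obtain u v where uv: "u \<in> \<mu> y" "v \<in> \<mu> z" "(u, v) \<in> R" using edge by blast
  have "(a, u) \<in> (R \<inter> ?U \<times> ?U)\<^sup>*" using step.IH uv by blast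
  moreover have "(u, v) \<in> R \<inter> ?U \<times> ?U" using uv step.hyps by blast
  ultimately have "(a, v) \<in> (R \<inter> ?U \<times> ?U)\<^sup>*" by (rule rtrancl_into_rtrancl)
  moreover have "z \<in> X" using step.hyps by auto
  ultimately show ?case using inner[of z v] uv(2) rtrancl_trans by fast
 qed
 moreover have "?U ~= {}" using assms by (force simp: conn_def)
 ultimately show ?thesis using X unfolding conn_def by blast
qed

text \<open>Minors compose: branch sets in the contracted graph are pulled back to unions of the
  bags \<open>\<mu> x\<close>. Later applications choose the bags so that the graph whose edges or
  cliques are to be counted becomes a minor.\<close>

lemma k33_free_minor:
 assumes "k33_free N R"
  and "\<And>x. x \<in> N' ==> conn R (\<mu> x) \<and> \<mu> x \<subseteq> N"
  and disj: "\<And>x y. x \<in> N' ==> y \<in> N' ==> x ~= y ==> \<mu> x \<inter> \<mu> y = {}"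
  and edge: "\<And>x y. x \<in> N' ==> y \<in> N' ==> (x, y) \<in> R' ==> \<exists>a\<in>\<mu> x. \<exists>b\<in>\<mu> y. (a, b) \<in> R"
 shows "k33_free N' R'"
 unfolding k33_free_def k33_model_def
proof (rule notI, elim exE conjE)
 fix A B :: "nat => 'b set"
 assume 1: "\<forall>i<3. A i \<subseteq> N' \<and> B i \<subseteq> N' \<and> conn R' (A i) \<and> conn R' (B i)"
  and 2: "\<forall>i<3. \<forall>k<3. i ~= k --> A i \<inter> A k = {} \<and> B i \<inter> B k = {}"
  and 3: "\<forall>i<3. \<forall>j<3. A i \<inter> B j = {} \<and> (\<exists>a\<in>A i. \<exists>b\<in>B j. (a, b) \<in> R')"
 have c: "conn R (\<Union>(\<mu> ` X))" if "conn R' X" "X \<subseteq> N'" for X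
  by (rule conn_Union_image[OF that(1)]) (use assms that in blast)+
 have d: "\<Union>(\<mu> ` X) \<inter> \<Union>(\<mu> ` Y) = {}" if "X \<subseteq> N'" "Y \<subseteq> N'" "X \<inter> Y = {}" for X Y
  using disj that by blast
 have "k33_model N R (\<lambda>i. \<Union>(\<mu> ` A i)) (\<lambda>i. \<Union>(\<mu> ` B i))" unfolding k33_model_def
 proof (intro conjI allI impI)
  fix i j :: nat assume "i < 3" "j < 3"
  then obtain a b where "a \<in> A i" "b \<in> B j" "(a, b) \<in> R'" "a \<in> N'" "b \<in> N'" using 1 3 by blast
  thus "\<exists>a\<in>\<Union> (\<mu> ` A i). \<exists>b\<in>\<Union> (\<mu> ` B j). (a, b) \<in> R" using edge[of a b] by blast
 next
  fix i k :: nat assume "i < 3" "k < 3"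
  thus "\<Union>(\<mu> ` A i) \<inter> \<Union>(\<mu> ` B k) = {}" using 1 3 by (intro d) auto
  assume "i ~= k"
  thus "\<Union>(\<mu> ` A i) \<inter> \<Union>(\<mu> ` A k) = {}" "\<Union>(\<mu> ` B i) \<inter> \<Union>(\<mu> ` B k) = {}"
   using 1 2 \<open>i < 3\<close> \<open>k < 3\<close> by (intro d; simp)+
 next
  fix i :: nat assume "i < 3"
  thus "\<Union>(\<mu> ` A i) \<subseteq> N" "\<Union>(\<mu> ` B i) \<subseteq> N" using 1 assms(2) by blast+
  show "conn R (\<Union>(\<mu> ` A i))" "conn R (\<Union>(\<mu> ` B i))" using 1 \<open>i < 3\<close> by (intro c; simp)+
 qed
 thus False using assms(1) unfolding k33_free_def by blast
qed

lemma k33_free_subset: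
 assumes "k33_free N R" "N' \<subseteq> N" "R' \<subseteq> R"
 shows "k33_free N' R'"
proof (rule k33_free_minor[OF assms(1), where \<mu> = "\<lambda>x. {x}"])
qed (use assms in \<open>auto simp: conn_def\<close>)

text \<open>A branch set \<open>X\<close> of a supposed minor is realised in the plane by
  \<open>Z X\<close>, the fat points of its members together with the curves of the edges inside
  \<open>X\<close>. These regions are compact, path-connected and disjoint, so they form a fat
  drawing of K_{3,3}. The curves \<open>L\<close> have a direction; \<open>h0\<close> traverses them
  either way.\<close>

lemma k33_free_of_fat_drawing:
 fixes P :: "'w => (real^2) set" and L :: "'w => 'w => real => real^2"
 assumes fin: "finite N" and sub: "E \<subseteq> N \<times> N"
  and P: "\<And>w. w \<in> N ==> compact (P w) \<and> path_connected (P w) \<and> P w ~= {}"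
  and PP: "\<And>v w. v \<in> N ==> w \<in> N ==> v ~= w ==> P v \<inter> P w = {}"
  and L: "\<And>f x. (f, x) \<in> E ==> path (L f x) \<and> pathstart (L f x) \<in> P f \<and> pathfinish (L f x) \<in> P x \<and>
   path_image (L f x) \<inter> P f \<subseteq> {pathstart (L f x)} \<and> path_image (L f x) \<inter> P x \<subseteq> {pathfinish (L f x)}"
  and LP: "\<And>f x w. (f, x) \<in> E ==> w \<in> N ==> w ~= f ==> w ~= x ==> path_image (L f x) \<inter> P w = {}"
  and LL: "\<And>f x g y. (f, x) \<in> E ==> (g, y) \<in> E ==> (f, x) ~= (g, y) ==>
   path_image (L f x) \<inter> path_image (L g y) \<subseteq> \<Union>(P ` N)"
 shows "k33_free N (E \<union> E\<inverse>)"
 unfolding k33_free_def k33_model_def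
proof (rule notI, elim exE conjE)
 let ?R = "E \<union> E\<inverse>"
 fix A B :: "nat => 'w set"
 assume 1: "\<forall>i<3. A i \<subseteq> N \<and> B i \<subseteq> N \<and> conn ?R (A i) \<and> conn ?R (B i)"
  and 2: "\<forall>i<3. \<forall>k<3. i ~= k --> A i \<inter> A k = {} \<and> B i \<inter> B k = {}"
  and 3: "\<forall>i<3. \<forall>j<3. A i \<inter> B j = {} \<and> (\<exists>a\<in>A i. \<exists>b\<in>B j. (a, b) \<in> ?R)"
 define Z where "Z X = \<Union>(P ` X) \<union> (\<Union>(f,x)\<in>E \<inter> X \<times> X. path_image (L f x))" for X
 have finE: "finite E" using fin sub by (meson finite_SigmaI finite_subset)
 have LLw: "\<exists>w. w \<in> {f,x} \<inter> {g,y} \<and> p \<in> P w"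
  if a: "(f, x) \<in> E" "(g, y) \<in> E" "(f, x) ~= (g, y)" "p \<in> path_image (L f x)" "p \<in> path_image (L g y)" for f x g y p
 proof -
  obtain w where w: "w \<in> N" "p \<in> P w" using LL[OF a(1-3)] a(4,5) by blast
  hence "w \<in> {f,x}" "w \<in> {g,y}" using LP[OF a(1), of w] LP[OF a(2), of w] a(4,5) by blast+
  thus ?thesis using w by blast
 qed
 have Zc: "compact (Z X)" if "X \<subseteq> N" for X
  unfolding Z_def using that P L fin finE
  by (intro compact_Un compact_UN) (auto intro: finite_subset compact_path_image)
 have Zp: "path_connected (Z X)" if X: "X \<subseteq> N" "conn ?R X" for X
 proof -
  obtain r where r: "r \<in> X" using X by (auto simp: conn_def)
  obtain p where p: "p \<in> P r" using P X r by blast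
  have in_comp: "path_component (Z X) a b" if "w \<in> X" "a \<in> P w" "b \<in> P w" for w a b
  proof -
   have "P w \<subseteq> Z X" using that(1) unfolding Z_def by blast
   moreover have "path_component (P w) a b" using P[of w] that X(1) unfolding path_connected_component by blast
   ultimately show ?thesis using path_component_of_subset by blast
  qed
  have ed: "path_component (Z X) (pathstart (L f x)) q" if "(f, x) \<in> E" "f \<in> X" "x \<in> X" "q \<in> path_image (L f x)" for f x q
  proof -
   have "path_component (path_image (L f x)) (pathstart (L f x)) q"
    using L[OF that(1)] that(4) path_connected_path_image[of "L f x"] pathstart_in_path_image[of "L f x"]
    unfolding path_connected_component by blast
   moreover have "path_image (L f x) \<subseteq> Z X" using that unfolding Z_def by blast
   ultimately show ?thesis using path_component_of_subset by blast
  qed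
  have reach: "\<forall>q\<in>P w. path_component (Z X) p q" if "(r, w) \<in> (?R \<inter> X \<times> X)\<^sup>*" for w
   using that
  proof (induction rule: rtrancl_induct)
   case base
   thus ?case using in_comp r p by blast
  next
   case (step y z)
   hence yz: "y \<in> X" "z \<in> X" "(y, z) \<in> E \<or> (z, y) \<in> E" by auto
   have "\<exists>s\<in>P y. \<exists>t\<in>P z. path_component (Z X) s t"
   proof (cases "(y, z) \<in> E")
    case True
    thus ?thesis using ed[OF True yz(1,2) pathfinish_in_path_image] L[OF True] by blast
   next
    case False
    hence "(z, y) \<in> E" using yz by blast
    thus ?thesis using ed[OF _ yz(2,1) pathfinish_in_path_image] L path_component_sym by blast
   qed
   thus ?case using step.IH in_comp[OF yz(2)] by (meson path_component_trans)
  qed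
  have "path_component (Z X) p q" if "q \<in> Z X" for q
  proof -
   from that consider w where "w \<in> X" "q \<in> P w" | f x where "(f, x) \<in> E" "f \<in> X" "x \<in> X" "q \<in> path_image (L f x)"
    unfolding Z_def by blast
   thus ?thesis
   proof cases
    case 1 thus ?thesis using reach X r unfolding conn_def by blast
   next
    case 2
    hence "path_component (Z X) p (pathstart (L f x))" using reach X r L unfolding conn_def by blast
    thus ?thesis using ed[OF 2] path_component_trans by blast
   qed
  qed
  thus ?thesis unfolding path_connected_component by (meson path_component_sym path_component_trans)
 qed
 have ZE: "(\<exists>w\<in>X. p \<in> P w) \<or> (\<exists>f x. (f, x) \<in> E \<and> f \<in> X \<and> x \<in> X \<and> p \<in> path_image (L f x))" if "p \<in> Z X" for p X
  using that unfolding Z_def by blast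
 have Zd: "Z X \<inter> Z Y = {}" if XY: "X \<subseteq> N" "Y \<subseteq> N" "X \<inter> Y = {}" for X Y
 proof -
  have b: "P w \<inter> path_image (L f x) = {}" if "(f, x) \<in> E" "f \<in> X" "x \<in> X" "w \<in> Y" "X \<inter> Y = {}" "Y \<subseteq> N" for f x w X Y
   using LP[of f x w] that by blast
  have c: "path_image (L f x) \<inter> path_image (L g y) = {}"
   if "(f, x) \<in> E" "f \<in> X" "x \<in> X" "(g, y) \<in> E" "g \<in> Y" "y \<in> Y" for f x g y
   using LLw[of f x g y] that XY by blast
  have YX: "Y \<inter> X = {}" using XY by blast
  show ?thesis
  proof (rule equals0I)
   fix p assume p: "p \<in> Z X \<inter> Z Y"
   have pX: "p \<notin> P w" if "w \<in> X" for w
   proof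
    assume "p \<in> P w"
    moreover have "\<not> (\<exists>v\<in>Y. p \<in> P v)" using PP[of w] calculation that XY by blast
    ultimately show False using ZE[of p Y] p b[OF _ _ _ that YX XY(1)] by blast
   qed
   have pY: "p \<notin> P w" if "w \<in> Y" for w
    using ZE[of p X] p b[OF _ _ _ that XY(3,2)] pX by blast
   show False using ZE[of p X] ZE[of p Y] p pX pY c by blast
  qed
 qed
 define h0 where "h0 a b = (if (a, b) \<in> E then L a b else reversepath (L b a))" for a b
 have h0: "path (h0 a b) \<and> pathstart (h0 a b) \<in> P a \<and> pathfinish (h0 a b) \<in> P b \<and> path_image (h0 a b) \<inter> P b \<subseteq> {pathfinish (h0 a b)}
   \<and> (\<exists>f x. (f, x) \<in> E \<and> {f, x} = {a, b} \<and> path_image (h0 a b) = path_image (L f x))"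
  if "(a, b) \<in> ?R" for a b
 proof (cases "(a, b) \<in> E")
  case True thus ?thesis using L[OF True] unfolding h0_def by auto
 next
  case False
  hence "(b, a) \<in> E" using that by auto
  thus ?thesis using L[of b a] False unfolding h0_def by auto
 qed
 have "\<exists>a b. \<forall>i<3::nat. \<forall>j<3::nat. a i j \<in> A i \<and> b i j \<in> B j \<and> (a i j, b i j) \<in> ?R" using 3 by metis
 then obtain a b where ab: "\<And>i j. i < 3 ==> j < 3 ==> a i j \<in> A i \<and> b i j \<in> B j \<and> (a i j, b i j) \<in> ?R" by metis
 define h where "h i j = h0 (a i j) (b i j)" for i j
 have hL: "\<exists>f x. (f, x) \<in> E \<and> {f, x} = {a i j, b i j} \<and> path_image (h i j) = path_image (L f x)" if "i < 3" "j < 3" for i j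
  using h0[of "a i j" "b i j"] ab[OF that] unfolding h_def by blast
 have hZ: "path_image (h i j) \<inter> Z X \<subseteq> (if b i j \<in> X then path_image (h i j) \<inter> P (b i j) else {})"
  if ij: "i < 3" "j < 3" and X: "X \<subseteq> N" "a i j \<notin> X" for i j X
 proof -
  obtain f x where fx: "(f, x) \<in> E" "{f, x} = {a i j, b i j}" "path_image (h i j) = path_image (L f x)" using hL[OF ij] by blast
  have p: "path_image (L f x) \<inter> P w = {}" if "w \<in> X" "w ~= b i j" for w
  proof (rule LP[OF fx(1)])
   show "w \<in> N" using that X by auto
   have "w ~= a i j" using that X by auto
   thus "w ~= f" "w ~= x" using that(2) fx(2) by auto
  qed
  have q: "path_image (L f x) \<inter> path_image (L g y) \<subseteq> (if b i j \<in> X then P (b i j) else {})" if gy: "(g, y) \<in> E" "g \<in> X" "y \<in> X" for g y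
  proof
   fix p assume p: "p \<in> path_image (L f x) \<inter> path_image (L g y)"
   have "(f, x) ~= (g, y)" using gy X fx(2) by auto
   then obtain w where "w \<in> {f,x} \<inter> {g,y}" "p \<in> P w" using LLw[OF fx(1) gy(1)] p by blast
   moreover have "w \<in> X" using calculation gy by auto
   moreover have "w = b i j" using calculation X fx(2) by auto
   ultimately show "p \<in> (if b i j \<in> X then P (b i j) else {})" by auto
  qed
  have r: "path_image (L f x) \<inter> P w \<subseteq> (if b i j \<in> X then P (b i j) else {})" if "w \<in> X" for w
   using p[OF that] that by (cases "w = b i j") auto
  show ?thesis
  proof
   fix p assume p: "p \<in> path_image (h i j) \<inter> Z X"
   hence "p \<in> (if b i j \<in> X then P (b i j) else {})" using ZE[of p X] q r unfolding fx(3) by blast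
   thus "p \<in> (if b i j \<in> X then path_image (h i j) \<inter> P (b i j) else {})" using p by (simp split: if_splits)
  qed
 qed
 have AN: "A i \<subseteq> N" "B i \<subseteq> N" "conn ?R (A i)" "conn ?R (B i)" if "i < 3" for i using 1 that by auto
 have dA: "A i \<inter> A k = {}" "B i \<inter> B k = {}" if "i < 3" "k < 3" "i ~= k" for i k using 2 that by auto
 have dAB: "A i \<inter> B k = {}" if "i < 3" "k < 3" for i k using 3 that by auto
 show False
 proof (rule no_fat_K33_drawing[of "\<lambda>i. Z (A i)" "\<lambda>j. Z (B j)" h])
  fix i j k l :: nat
  show "path_connected (Z (A i))" if "i < 3" using Zp[OF AN(1,3)] that by simp
  show "path_connected (Z (B j)) \<and> compact (Z (B j))" if "j < 3" using Zp[OF AN(2,4)] Zc[OF AN(2)] that by simp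
  show "Z (A i) \<inter> Z (A k) = {}" if "i < 3" "k < 3" "i ~= k" using Zd[OF AN(1) AN(1) dA(1)] that by simp
  show "Z (B i) \<inter> Z (B k) = {}" if "i < 3" "k < 3" "i ~= k" using Zd[OF AN(2) AN(2) dA(2)] that by simp
  show "Z (A i) \<inter> Z (B k) = {}" if "i < 3" "k < 3" using Zd[OF AN(1) AN(2) dAB] that by simp
  have PZ: "P w \<subseteq> Z X" if "w \<in> X" for w X using that unfolding Z_def by blast
  show "path (h i j) \<and> pathstart (h i j) \<in> Z (A i) \<and> pathfinish (h i j) \<in> Z (B j)" if "i < 3" "j < 3"
   using h0[of "a i j" "b i j"] ab[OF that] PZ unfolding h_def by blast
  show "path_image (h i j) \<inter> Z (A k) = {}" if "i < 3" "j < 3" "k < 3" "k ~= i"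
  proof -
   have "A k \<subseteq> N" "a i j \<notin> A k" "b i j \<notin> A k" using AN(1)[of k] dA(1)[of k i] dAB[of k j] ab[of i j] that by auto
   thus ?thesis using hZ[of i j "A k"] that by simp
  qed
  show "path_image (h i j) \<inter> Z (B k) = {}" if "i < 3" "j < 3" "k < 3" "k ~= j"
  proof -
   have "B k \<subseteq> N" "a i j \<notin> B k" "b i j \<notin> B k" using AN(2)[of k] dA(2)[of k j] dAB[of i k] ab[of i j] that by auto
   thus ?thesis using hZ[of i j "B k"] that by simp
  qed
  show "path_image (h i j) \<inter> Z (B j) \<subseteq> {pathfinish (h i j)}" if "i < 3" "j < 3"
  proof -
   have "B j \<subseteq> N" "a i j \<notin> B j" "b i j \<in> B j" using AN(2)[of j] dAB[of i j] ab[of i j] that by auto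
   moreover have "path_image (h i j) \<inter> P (b i j) \<subseteq> {pathfinish (h i j)}"
    using h0[of "a i j" "b i j"] ab[OF that] unfolding h_def by blast
   ultimately show ?thesis using hZ[of i j "B j"] that by auto
  qed
  show "path_image (h i j) \<inter> path_image (h k l) \<subseteq> (\<Union>i<3. Z (A i)) \<union> (\<Union>j<3. Z (B j))"
   if ij: "i < 3" "j < 3" "k < 3" "l < 3" "(i, j) ~= (k, l)"
  proof
   fix p assume p: "p \<in> path_image (h i j) \<inter> path_image (h k l)"
   obtain f x where fx: "(f, x) \<in> E" "{f, x} = {a i j, b i j}" "path_image (h i j) = path_image (L f x)" using hL[OF ij(1,2)] by blast
   obtain g y where gy: "(g, y) \<in> E" "{g, y} = {a k l, b k l}" "path_image (h k l) = path_image (L g y)" using hL[OF ij(3,4)] by blast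
   have "{f, x} ~= {g, y}"
   proof
    assume "{f, x} = {g, y}"
    hence "{a i j, b i j} = {a k l, b k l}" using fx gy by simp
    moreover have "a i j ~= b k l" using ab[of i j] ab[of k l] dAB[of i l] ij by auto
    ultimately have "a i j = a k l" "b i j = b k l" by (auto simp: doubleton_eq_iff)
    hence "i = k" "j = l" using ab[of i j] ab[of k l] dA(1)[of i k] dA(2)[of j l] ij by auto
    thus False using ij by simp
   qed
   hence "(f, x) ~= (g, y)" by auto
   then obtain w where "w \<in> {f,x}" "p \<in> P w" using LLw[OF fx(1) gy(1)] p fx gy by blast
   hence "w = a i j \<or> w = b i j" using fx by auto
   hence "p \<in> Z (A i) \<or> p \<in> Z (B j)" using ab[OF ij(1,2)] \<open>p \<in> P w\<close> PZ[of w "A i"] PZ[of w "B j"] by auto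
   thus "p \<in> (\<Union>i<3. Z (A i)) \<union> (\<Union>j<3. Z (B j))" using ij by auto
  qed
 qed
qed

section \<open>Fat drawings obtained from plane graphs\<close>

lemma path_tail_in_open:
 fixes g :: "real => 'a::metric_space"
 assumes "path g" "open U" "pathfinish g \<in> U" "\<tau> < 1"
 obtains \<tau>' where "\<tau> \<le> \<tau>'" "0 \<le> \<tau>'" "\<tau>' < 1" "g ` {\<tau>'..1} \<subseteq> U"
proof -
 obtain e where e: "e > 0" "ball (g 1) e \<subseteq> U"
  using assms(2,3) by (auto simp: pathfinish_def open_contains_ball)
 have "continuous_on {0..1} g" using assms(1) by (simp add: path_def)
 then obtain d where d: "d > 0" "\<And>x. x \<in> {0..1} ==> dist x 1 < d ==> dist (g x) (g 1) < e"
  using e(1) unfolding continuous_on_iff by (metis atLeastAtMost_iff zero_le_one order_refl)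
 define t where "t = Max {\<tau>, 0, 1 - d/2}"
 have t: "\<tau> \<le> t" "0 \<le> t" "1 - d/2 \<le> t" "t < 1" using assms(4) d(1) by (auto simp: t_def)
 have "g x \<in> U" if "x \<in> {t..1}" for x
 proof -
  have "dist x 1 < d" "x \<in> {0..1}" using that t d(1) by (auto simp: dist_real_def)
  hence "dist (g x) (g 1) < e" using d(2) by blast
  thus ?thesis using e(2) by (auto simp: dist_commute)
 qed
 thus ?thesis using that[of t] t by blast
qed

text \<open>Each arc \<open>g x\<close> is cut twice. Beyond \<open>t x\<close> the arcs are
  pairwise disjoint, because their ends are distinct; beyond the later \<open>s x\<close> they also
  avoid the compact set \<open>K\<close> of all that lies before the first cuts. The core
  \<open>C\<close> takes the arcs up to \<open>s x\<close>, and the tails are the rest. A point of a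
  tail that belongs to \<open>C\<close> is outside \<open>K\<close>, so it lies on some arc beyond
  the first cut; by disjointness this is the same arc, and by injectivity the point is the start of
  the tail.\<close>

lemma open_set_core_with_disjoint_tails:
 fixes f :: "'a::euclidean_space set" and g :: "'x => real => 'a"
 assumes f: "open f" "Topological_Spaces.connected f" "f ~= {}" and fin: "finite X"
  and g: "\<And>x. x \<in> X ==> Path_Connected.arc (g x) \<and> g x ` {0..<1} \<subseteq> f \<and> pathfinish (g x) \<notin> f"
  and dist: "inj_on (\<lambda>x. pathfinish (g x)) X"
 obtains C L where "compact C" "path_connected C" "C ~= {}" "C \<subseteq> f"
  "\<And>x. x \<in> X ==> path (L x) \<and> pathstart (L x) \<in> C \<and> pathfinish (L x) = pathfinish (g x) \<and>
   path_image (L x) \<inter> C \<subseteq> {pathstart (L x)} \<and> path_image (L x) \<subseteq> insert (pathfinish (g x)) f"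
  "\<And>x y. x \<in> X ==> y \<in> X ==> x ~= y ==> path_image (L x) \<inter> path_image (L y) = {}"
proof -
 have pf: "path_connected f" using f by (simp add: connected_open_path_connected)
 obtain p0 where p0: "p0 \<in> f" using f by blast
 have g0: "g x 0 \<in> f" if "x \<in> X" for x using g[OF that] by auto
 have "\<exists>c. path c \<and> path_image c \<subseteq> f \<and> pathstart c = p0 \<and> pathfinish c = g x 0" if "x \<in> X" for x
  using pf p0 g0[OF that] unfolding path_connected_def by blast
 then obtain c where c: "\<And>x. x \<in> X ==> path (c x) \<and> path_image (c x) \<subseteq> f \<and> pathstart (c x) = p0 \<and> pathfinish (c x) = g x 0"
  by metis
 define Y where "Y = insert p0 (\<Union>x\<in>X. path_image (c x))"
 have gc: "continuous_on {0..1} (g x)" "inj_on (g x) {0..1}" "path (g x)" if "x \<in> X" for x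
  using g[OF that] by (auto simp: arc_def path_def)
 have "\<exists>t. \<forall>x\<in>X. 0 \<le> t x \<and> t x < 1 \<and> (\<forall>y\<in>X. x ~= y --> g x ` {t x..1} \<inter> g y ` {t y..1} = {})"
 proof -
  let ?z = "\<lambda>x. pathfinish (g x)"
  have "finite (?z ` X)" using fin by blast
  then obtain e where e: "e > 0" "\<And>x y. x \<in> X ==> y \<in> X ==> ?z x ~= ?z y ==> e \<le> dist (?z x) (?z y)"
   using finite_set_avoid
  proof -
   define S where "S = insert 1 ((\<lambda>(x,y). dist (?z x) (?z y)) ` {(x,y). x \<in> X \<and> y \<in> X \<and> ?z x ~= ?z y})"
   have "finite {(x,y). x \<in> X \<and> y \<in> X \<and> ?z x ~= ?z y}"
    by (rule finite_subset[of _ "X \<times> X"]) (use fin in auto)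
   hence S: "finite S" "S ~= {}" unfolding S_def by auto
   have "Min S > 0" using S by (auto simp: S_def)
   moreover have "Min S \<le> dist (?z x) (?z y)" if "x \<in> X" "y \<in> X" "?z x ~= ?z y" for x y
    by (rule Min_le[OF S(1)]) (use that in \<open>auto simp: S_def\<close>)
   ultimately show ?thesis using that by blast
  qed
  have "\<exists>t. 0 \<le> t \<and> t < 1 \<and> g x ` {t..1} \<subseteq> ball (?z x) (e/2)" if x: "x \<in> X" for x
  proof -
   have "?z x \<in> ball (?z x) (e/2)" using e(1) by simp
   from path_tail_in_open[OF gc(3)[OF x] open_ball this zero_less_one] show ?thesis by metis
  qed
  then obtain t where t: "\<And>x. x \<in> X ==> 0 \<le> t x \<and> t x < 1 \<and> g x ` {t x..1} \<subseteq> ball (?z x) (e/2)" by metis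
  have "g x ` {t x..1} \<inter> g y ` {t y..1} = {}" if "x \<in> X" "y \<in> X" "x ~= y" for x y
  proof -
   have "?z x ~= ?z y" using dist that by (auto dest: inj_onD)
   hence "ball (?z x) (e/2) \<inter> ball (?z y) (e/2) = {}"
    using e(2)[OF that(1,2)] by (intro disjoint_ballI) auto
   thus ?thesis using t[OF that(1)] t[OF that(2)] by blast
  qed
  thus ?thesis using t by blast
 qed
 then obtain t where t0: "\<forall>x\<in>X. 0 \<le> t x \<and> t x < 1 \<and> (\<forall>y\<in>X. x ~= y --> g x ` {t x..1} \<inter> g y ` {t y..1} = {})" ..
 hence t: "\<And>x. x \<in> X ==> 0 \<le> t x \<and> t x < 1"
  "\<And>x y. x \<in> X ==> y \<in> X ==> x ~= y ==> g x ` {t x..1} \<inter> g y ` {t y..1} = {}" by auto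
 have sg: "compact (g x ` {a..b})" "path_connected (g x ` {a..b})" if "x \<in> X" "0 \<le> a" "b \<le> 1" for x a b
  using gc(1)[OF that(1)] that(2,3)
  by (auto intro!: compact_continuous_image path_connected_continuous_image continuous_on_subset[of "{0..1}" "g x"]
     simp: is_interval_path_connected is_interval_cc)
 have Yc: "compact Y" "Y \<subseteq> f" unfolding Y_def using c fin p0
  by (auto intro!: compact_insert compact_UN compact_path_image)
 define K where "K = Y \<union> (\<Union>x\<in>X. g x ` {0..t x})"
 have seg_f: "g x ` {0..s} \<subseteq> f" if "x \<in> X" "s < 1" for x s using g[OF that(1)] that(2) by force
 have K: "compact K" unfolding K_def using Yc fin t(1) by (intro compact_Un compact_UN sg) (auto simp: less_imp_le)
 have Kf: "K \<subseteq> f" unfolding K_def using Yc seg_f t(1) by blast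
 have "\<exists>s. t x \<le> s \<and> 0 \<le> s \<and> s < 1 \<and> g x ` {s..1} \<subseteq> - K" if "x \<in> X" for x
 proof -
  have "open (- K)" "pathfinish (g x) \<in> - K" using K Kf g[OF that] compact_imp_closed by auto
  thus ?thesis using path_tail_in_open[OF gc(3)[OF that], of "- K" "t x"] t(1)[OF that] by metis
 qed
 then obtain s where s: "\<And>x. x \<in> X ==> t x \<le> s x \<and> 0 \<le> s x \<and> s x < 1 \<and> g x ` {s x..1} \<subseteq> - K" by metis
 define C where "C = Y \<union> (\<Union>x\<in>X. g x ` {0..s x})"
 define L where "L x = subpath (s x) 1 (g x)" for x
 have Limg: "path_image (L x) = g x ` {s x..1}" if "x \<in> X" for x
  unfolding L_def using s[OF that] by (simp add: path_image_subpath)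
 have Lse: "pathstart (L x) = g x (s x)" "pathfinish (L x) = g x 1" for x by (simp_all add: L_def)
 show ?thesis
 proof (rule that[of C L])
  show "compact C" unfolding C_def using Yc fin s by (intro compact_Un compact_UN sg) (auto simp: less_imp_le)
  show "C ~= {}" by (auto simp: C_def Y_def)
  show "C \<subseteq> f" unfolding C_def using Yc seg_f s by blast
  show "path_connected C"
  proof -
   have 1: "path_component C p0 q" if "x \<in> X" "q \<in> path_image (c x)" for x q
   proof -
    have "path_component (path_image (c x)) p0 q"
     using c[OF that(1)] that(2) path_connected_path_image[of "c x"] pathstart_in_path_image[of "c x"]
     unfolding path_connected_component by auto
    moreover have "path_image (c x) \<subseteq> C" using that unfolding C_def Y_def by blast
    ultimately show ?thesis using path_component_of_subset by blast
   qed
   have 2: "path_component C p0 q" if "x \<in> X" "q \<in> g x ` {0..s x}" for x q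
   proof -
    have "path_connected (g x ` {0..s x})" using sg s that by (simp add: less_imp_le)
    moreover have "g x 0 \<in> g x ` {0..s x}" using s[OF that(1)] by auto
    ultimately have "path_component (g x ` {0..s x}) (g x 0) q"
     using that(2) unfolding path_connected_component by blast
    moreover have "g x ` {0..s x} \<subseteq> C" using that unfolding C_def by blast
    ultimately have "path_component C (g x 0) q" using path_component_of_subset by blast
    moreover have "path_component C p0 (g x 0)" using 1[OF that(1), of "g x 0"] c[OF that(1)] pathfinish_in_path_image[of "c x"] by auto
    ultimately show ?thesis using path_component_trans by blast
   qed
   have "path_component C p0 q" if "q \<in> C" for q
   proof -
    have "q = p0 \<or> (\<exists>x\<in>X. q \<in> path_image (c x)) \<or> (\<exists>x\<in>X. q \<in> g x ` {0..s x})" using that unfolding C_def Y_def by blast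
    moreover have "path_component C p0 p0" by (simp add: path_component_refl_eq C_def Y_def)
    ultimately show ?thesis using 1 2 by blast
   qed
   thus ?thesis unfolding path_connected_component by (meson path_component_sym path_component_trans)
  qed
  fix x assume x: "x \<in> X"
  show "path (L x) \<and> pathstart (L x) \<in> C \<and> pathfinish (L x) = pathfinish (g x) \<and>
   path_image (L x) \<inter> C \<subseteq> {pathstart (L x)} \<and> path_image (L x) \<subseteq> insert (pathfinish (g x)) f"
  proof (intro conjI)
   show "path (L x)" unfolding L_def using gc(3)[OF x] s[OF x] by (simp add: path_subpath)
   have "g x (s x) \<in> g x ` {0..s x}" using s[OF x] by auto
   thus "pathstart (L x) \<in> C" unfolding Lse C_def using x by blast
   show "pathfinish (L x) = pathfinish (g x)" unfolding Lse by (simp add: pathfinish_def)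
   show "path_image (L x) \<subseteq> insert (pathfinish (g x)) f"
   proof
    fix p assume "p \<in> path_image (L x)"
    then obtain r where r: "r \<in> {s x..1}" "p = g x r" using Limg[OF x] by auto
    show "p \<in> insert (pathfinish (g x)) f"
    proof (cases "r = 1")
     case True thus ?thesis using r by (simp add: pathfinish_def)
    next
     case False
     hence "r \<in> {0..<1}" using r s[OF x] by auto
     thus ?thesis using r g[OF x] by blast
    qed
   qed
   show "path_image (L x) \<inter> C \<subseteq> {pathstart (L x)}"
   proof
    fix p assume p: "p \<in> path_image (L x) \<inter> C"
    then obtain r where r: "r \<in> {s x..1}" "p = g x r" using Limg[OF x] by auto
    have "p \<notin> K" using p s[OF x] Limg[OF x] by blast
    then obtain y u where y: "y \<in> X" "u \<in> {0..s y}" "p = g y u" using p unfolding C_def K_def by blast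
    hence "t y \<le> u" using \<open>p \<notin> K\<close> unfolding K_def by (cases "u \<le> t y") auto
    hence "p \<in> g y ` {t y..1}" using y s[OF y(1)] by auto
    moreover have "p \<in> g x ` {t x..1}" using r s[OF x] by auto
    ultimately have "y = x" using t(2)[OF x y(1)] by blast
    hence "u = r" using y r gc(2)[OF x] s[OF x] by (auto dest!: inj_onD)
    hence "r = s x" using y r \<open>y = x\<close> by auto
    thus "p \<in> {pathstart (L x)}" using r Lse by simp
   qed
  qed
  fix y assume y: "y \<in> X" "x ~= y"
  have "g x ` {s x..1} \<subseteq> g x ` {t x..1}" "g y ` {s y..1} \<subseteq> g y ` {t y..1}" using s[OF x] s[OF y(1)] by auto
  thus "path_image (L x) \<inter> path_image (L y) = {}" using t(2)[OF x y] unfolding Limg[OF x] Limg[OF y(1)] by fast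
 qed
qed

text \<open>Accessible points are dense in the frontier of a face, which by itself does not make a
  prescribed vertex accessible. The vertex is therefore fattened to a star consisting of the initial
  pieces of its edges; on any such piece contained in the frontier, density provides an accessible
  point. Pieces of one third keep the stars at the two ends of an edge disjoint.\<close>

lemma plane_graph_star:
 assumes pg: "plane_graph V E"
 obtains st where "\<And>x. x \<in> V ==> compact (st x) \<and> path_connected (st x) \<and> x \<in> st x \<and> st x \<subseteq> V \<union> \<Union>E"
  "\<And>x y. x \<in> V ==> y \<in> V ==> x ~= y ==> st x \<inter> st y = {}"
  "\<And>x f e. x \<in> V ==> f \<in> faces V E ==> e \<in> E ==> x \<in> e ==> e \<subseteq> frontier f ==>
   \<exists>g. Path_Connected.arc g \<and> g ` {0..<1} \<subseteq> f \<and> pathfinish g \<in> st x"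
proof -
 have fin: "finite V" "finite E"
  and ar: "\<And>e. e \<in> E ==> \<exists>\<gamma>. Path_Connected.arc \<gamma> \<and> path_image \<gamma> = e \<and> e \<inter> V = {pathstart \<gamma>, pathfinish \<gamma>}"
  and ee: "\<And>e e'. e \<in> E ==> e' \<in> E ==> e ~= e' ==> e \<inter> e' \<subseteq> V"
  using pg unfolding plane_graph_def by blast+
 from ar obtain \<gamma> where \<gamma>: "\<And>e. e \<in> E ==> Path_Connected.arc (\<gamma> e) \<and> path_image (\<gamma> e) = e \<and> e \<inter> V = {pathstart (\<gamma> e), pathfinish (\<gamma> e)}"
  by metis
 define \<delta> where "\<delta> e x = (if pathstart (\<gamma> e) = x then \<gamma> e else reversepath (\<gamma> e))" for e x
 have \<delta>: "Path_Connected.arc (\<delta> e x)" "path_image (\<delta> e x) = e" "\<delta> e x 0 = x" "inj_on (\<delta> e x) {0..1}" "continuous_on {0..1} (\<delta> e x)"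
  "e \<inter> V = {\<delta> e x 0, \<delta> e x 1}"
  if "e \<in> E" "x \<in> V" "x \<in> e" for e x
 proof -
  have "x = pathstart (\<gamma> e) \<or> x = pathfinish (\<gamma> e)" using \<gamma>[OF that(1)] that by blast
  thus "Path_Connected.arc (\<delta> e x)" "path_image (\<delta> e x) = e" "\<delta> e x 0 = x" "e \<inter> V = {\<delta> e x 0, \<delta> e x 1}" using \<gamma>[OF that(1)]
   by (auto simp: \<delta>_def arc_reversepath) (auto simp: pathstart_def pathfinish_def reversepath_def)
  thus "inj_on (\<delta> e x) {0..1}" "continuous_on {0..1} (\<delta> e x)" by (auto simp: arc_def path_def)
 qed
 have opp: "\<delta> e y u = \<delta> e x (1 - u)" if "e \<in> E" "x \<in> V" "x \<in> e" "y \<in> V" "y \<in> e" "x ~= y" for e x y u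
 proof -
  have "x \<in> {pathstart (\<gamma> e), pathfinish (\<gamma> e)}" "y \<in> {pathstart (\<gamma> e), pathfinish (\<gamma> e)}" using \<gamma>[OF that(1)] that by blast+
  thus ?thesis using that(6) by (auto simp: \<delta>_def reversepath_def)
 qed
 define sg where "sg e x = \<delta> e x ` {0..1/3}" for e x
 have sgE: "sg e x \<subseteq> e" "sg e x \<inter> V \<subseteq> {x}" if "e \<in> E" "x \<in> V" "x \<in> e" for e x
 proof -
  show "sg e x \<subseteq> e" using \<delta>(2)[OF that] unfolding sg_def path_image_def by force
  show "sg e x \<inter> V \<subseteq> {x}"
  proof
   fix p assume p: "p \<in> sg e x \<inter> V"
   then obtain u where u: "u \<in> {0..1/3}" "p = \<delta> e x u" unfolding sg_def by blast
   have "p \<in> {\<delta> e x 0, \<delta> e x 1}" using p \<open>sg e x \<subseteq> e\<close> \<delta>(6)[OF that] by blast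
   moreover have "p ~= \<delta> e x 1" using u inj_onD[OF \<delta>(4)[OF that], of u 1] by auto
   ultimately show "p \<in> {x}" using \<delta>(3)[OF that] by simp
  qed
 qed
 define st where "st x = insert x (\<Union>e\<in>{e\<in>E. x \<in> e}. sg e x)" for x
 have seg: "compact (sg e x)" "path_connected (sg e x)" "x \<in> sg e x" if "e \<in> E" "x \<in> V" "x \<in> e" for e x
 proof -
  have c: "continuous_on {0..1/3} (\<delta> e x)" using continuous_on_subset[OF \<delta>(5)[OF that], of "{0..1/3}"] by auto
  thus "compact (sg e x)" "path_connected (sg e x)"
   unfolding sg_def by (auto intro!: compact_continuous_image path_connected_continuous_image simp: is_interval_path_connected is_interval_cc)
  have "\<delta> e x 0 \<in> sg e x" unfolding sg_def by (intro imageI) auto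
  thus "x \<in> sg e x" using \<delta>(3)[OF that] by simp
 qed
 show ?thesis
 proof (rule that[of st])
  fix x assume x: "x \<in> V"
  have st: "st x = \<Union>(insert {x} ((\<lambda>e. sg e x) ` {e\<in>E. x \<in> e}))" unfolding st_def by blast
  have "compact (st x)" unfolding st using fin seg x by (intro compact_Union) auto
  moreover have "path_connected (st x)"
  proof -
   have "path_component (st x) x q" if qx: "q \<in> st x" for q
   proof (cases "q = x")
    case False
    then obtain e where e: "e \<in> E" "x \<in> e" "q \<in> sg e x" using qx by (auto simp: st_def)
    hence "path_component (sg e x) x q" using seg[OF e(1) x e(2)] unfolding path_connected_component by blast
    moreover have "sg e x \<subseteq> st x" using e unfolding st_def by blast
    ultimately show ?thesis using path_component_of_subset by blast
   qed (simp add: path_component_refl_eq st_def)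
   thus ?thesis unfolding path_connected_component by (meson path_component_sym path_component_trans)
  qed
  moreover have "st x \<subseteq> V \<union> \<Union>E" unfolding st_def using sgE(1) x by blast
  ultimately show "compact (st x) \<and> path_connected (st x) \<and> x \<in> st x \<and> st x \<subseteq> V \<union> \<Union>E" by (simp add: st_def)
 next
  fix x y assume xy: "x \<in> V" "y \<in> V" "x ~= y"
  have yx: "y \<notin> sg e x" if "e \<in> E" "x \<in> e" for e using sgE(2)[OF that(1) xy(1) that(2)] xy by blast
  have xy': "x \<notin> sg e y" if "e \<in> E" "y \<in> e" for e using sgE(2)[OF that(1) xy(2) that(2)] xy by blast
  have ss: "sg e x \<inter> sg e' y = {}" if "e \<in> E" "x \<in> e" "e' \<in> E" "y \<in> e'" for e e'
  proof (cases "e = e'")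
   case True
   show ?thesis
   proof (rule equals0I)
    fix p assume "p \<in> sg e x \<inter> sg e' y"
    then obtain u v where uv: "u \<in> {0..1/3}" "v \<in> {0..1/3}" "\<delta> e x u = p" "\<delta> e y v = p" unfolding sg_def True by auto
    hence "\<delta> e x u = \<delta> e x (1 - v)" using opp[of e x y v] that True xy by simp
    hence "u = 1 - v" using inj_onD[OF \<delta>(4)[OF that(1) xy(1) that(2)], of u "1 - v"] uv by auto
    thus False using uv by auto
   qed
  next
   case False
   have "sg e x \<subseteq> e" "sg e' y \<subseteq> e'" "sg e x \<inter> V \<subseteq> {x}" "sg e' y \<inter> V \<subseteq> {y}" using sgE that xy by auto
   thus ?thesis using ee[OF that(1,3) False] xy by blast
  qed
  show "st x \<inter> st y = {}" unfolding st_def using yx xy' ss xy(3) by blast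
 next
  fix x f e assume x: "x \<in> V" and f: "f \<in> faces V E" and e: "e \<in> E" "x \<in> e" "e \<subseteq> frontier f"
  let ?S = "V \<union> \<Union>E"
  have edgec: "compact e" if "e \<in> E" for e using \<gamma>[OF that] compact_arc_image by metis
  have clS: "closed ?S" using fin edgec by (intro closed_Un closed_Union) (auto intro: finite_imp_closed compact_imp_closed)
  have fr: "frontier f \<subseteq> ?S" using f clS unfolding faces_def by (metis frontier_of_components_closed_complement)
  have of: "open f" using f clS unfolding faces_def by (metis open_Compl open_components)
  let ?C = "V \<union> \<Union>(E - {e}) \<union> \<delta> e x ` {1/3..1}"
  have "compact (\<delta> e x ` {1/3..1})" using continuous_on_subset[OF \<delta>(5)[OF e(1) x e(2)], of "{1/3..1}"] by (intro compact_continuous_image) auto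
  hence clC: "closed ?C" using fin edgec by (intro closed_Un closed_Union) (auto intro: finite_imp_closed compact_imp_closed)
  have "openin (top_of_set (frontier f)) (frontier f \<inter> - ?C)" by (rule openin_open_Int[OF open_Compl[OF clC]])
  \<comment> \<open>Any parameter strictly between 0 and 1/3 would do: its point witnesses that the
    part of the frontier that avoids everything except the piece of \<open>e\<close> at
    \<open>x\<close> is nonempty, so that density applies to it.\<close>
  moreover have "\<delta> e x (1/6) \<in> frontier f \<inter> - ?C"
  proof -
   have "\<delta> e x (1/6) \<in> sg e x" unfolding sg_def by auto
   hence "\<delta> e x (1/6) \<in> e" using sgE(1)[OF e(1) x e(2)] by blast
   moreover have "\<delta> e x (1/6) ~= x" using inj_onD[OF \<delta>(4)[OF e(1) x e(2)], of "1/6" 0] \<delta>(3)[OF e(1) x e(2)] by auto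
   hence nV: "\<delta> e x (1/6) \<notin> V" using sgE(2)[OF e(1) x e(2)] \<open>\<delta> e x (1/6) \<in> sg e x\<close> by blast
   moreover have "\<delta> e x (1/6) \<notin> \<Union>(E - {e})" using ee[OF e(1)] nV \<open>\<delta> e x (1/6) \<in> e\<close> by blast
   moreover have "\<delta> e x (1/6) \<notin> \<delta> e x ` {1/3..1}"
   proof
    assume "\<delta> e x (1/6) \<in> \<delta> e x ` {1/3..1}"
    then obtain u where "u \<in> {1/3..1}" "\<delta> e x (1/6) = \<delta> e x u" by blast
    thus False using inj_onD[OF \<delta>(4)[OF e(1) x e(2)], of "1/6" u] by auto
   qed
   ultimately show ?thesis using e(3) by blast
  qed
  ultimately obtain g where g: "Path_Connected.arc g" "g ` {0..<1} \<subseteq> f" "pathfinish g \<in> frontier f \<inter> - ?C"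
   using dense_accessible_frontier_points[OF of] by (metis empty_iff)
  hence "pathfinish g \<in> e" using fr by blast
  then obtain u where "u \<in> {0..1}" "pathfinish g = \<delta> e x u" using \<delta>(2)[OF e(1) x e(2)] unfolding path_image_def by blast
  moreover from this have "u < 1/3" using g(3) by (cases "u < 1/3") auto
  ultimately have "pathfinish g \<in> sg e x" unfolding sg_def by auto
  thus "\<exists>g. Path_Connected.arc g \<and> g ` {0..<1} \<subseteq> f \<and> pathfinish g \<in> st x"
   using g e x unfolding st_def by blast
 qed
qed

section \<open>Sparsity of graphs without a K_{3,3} minor\<close>

lemma card_rel_eq_sum_degrees:
 assumes "finite N" "R \<subseteq> N \<times> N"
 shows "card R = (\<Sum>v\<in>N. card (R `` {v}))"
proof -
 have "R = Sigma N (\<lambda>v. R `` {v})" using assms(2) by auto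
 moreover have "finite (R `` {v})" for v using finite_subset[of "R `` {v}" N] assms by auto
 ultimately show ?thesis using card_SigmaI[OF assms(1), of "\<lambda>v. R `` {v}"] by simp
qed

text \<open>Pairs of a vertex and a triple of its neighbours are counted twice. Each vertex has at
  least 1140 triples, which is 20 choose 3. If every triple had at most two common neighbours, the
  number of pairs would be at most twice (\<open>card U\<close> choose 3), that is, at most 41 * 40
  / 3 per vertex, which is less.\<close>

lemma dense_graph_has_K33:
 assumes fin: "finite U" "U ~= {}" "card U \<le> 42"
  and deg: "\<And>u. u \<in> U ==> 20 \<le> card (R `` {u} \<inter> U)"
 obtains T Y where "T \<subseteq> U" "Y \<subseteq> U" "card T = 3" "card Y = 3" "Y \<times> T \<subseteq> R"
proof -
 define S where "S = Sigma U (\<lambda>u. {T. T \<subseteq> R `` {u} \<inter> U \<and> card T = 3})"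
 let ?TT = "{T. T \<subseteq> U \<and> card T = 3}"
 define F where "F T = {u \<in> U. T \<subseteq> R `` {u}}" for T
 have finT: "finite ?TT" using fin by simp
 have "card S = (\<Sum>u\<in>U. card {T. T \<subseteq> R `` {u} \<inter> U \<and> card T = 3})"
  unfolding S_def using fin by (intro card_SigmaI) auto
 also have "\<dots> = (\<Sum>u\<in>U. card (R `` {u} \<inter> U) choose 3)"
  using fin by (intro sum.cong n_subsets) auto
 also have "\<dots> \<ge> (\<Sum>u\<in>U. 20 choose 3)"
  by (intro sum_mono binomial_right_mono deg)
 finally have low: "card U * (20 choose 3) \<le> card S" by simp
 have c3: "20 choose 3 = (1140::nat)" by (simp add: numeral_eq_Suc)
 have "\<exists>T\<in>?TT. 3 \<le> card (F T)"
 proof (rule ccontr)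
  assume "\<not> ?thesis"
  hence le: "card (F T) \<le> 2" if "T \<in> ?TT" for T using that by force
  have "card S \<le> card (\<Union>T\<in>?TT. F T \<times> {T})"
   by (intro card_mono) (use fin finT in \<open>auto simp: S_def F_def\<close>)
  also have "\<dots> \<le> (\<Sum>T\<in>?TT. card (F T \<times> {T}))" by (rule card_UN_le[OF finT])
  also have "\<dots> \<le> (\<Sum>T\<in>?TT. 2)" by (intro sum_mono) (use le in \<open>simp add: card_cartesian_product\<close>)
  also have "\<dots> = 2 * (card U choose 3)" using n_subsets[OF fin(1), of 3] by simp
  finally have "card U * 1140 \<le> 2 * (card U choose 3)" using low c3 by simp
  moreover have "6 * (card U choose 3) \<le> card U * 41 * 40"
  proof -
   have "6 * (card U choose 3) = card U * (card U - 1) * (card U - 2)"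
   proof -
    have "3 * (card U choose 3) = card U * ((card U - 1) choose 2)" "2 * ((card U - 1) choose 2) = (card U - 1) * (card U - 2)"
     using binomial_absorption[of 2 "card U"] binomial_absorption[of 1 "card U - 1"] by (simp_all add: numeral_eq_Suc)
    moreover from this(1) have "6 * (card U choose 3) = card U * (2 * ((card U - 1) choose 2))" by simp
    ultimately show ?thesis by (simp add: mult.assoc)
   qed
   also have "\<dots> \<le> card U * 41 * 40" using fin(3) by (intro mult_mono) auto
   finally show ?thesis .
  qed
  moreover have "card U > 0" using fin by (simp add: card_gt_0_iff)
  ultimately show False by simp
 qed
 then obtain T where T: "T \<subseteq> U" "card T = 3" "3 \<le> card (F T)" by blast
 then obtain Y where Y: "Y \<subseteq> F T" "card Y = 3" by (meson obtain_subset_with_card_n)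
 show ?thesis by (rule that[of T Y]) (use T Y in \<open>auto simp: F_def\<close>)
qed

lemma k33_free_no_K33:
 assumes "k33_free N R" "T \<subseteq> N" "Y \<subseteq> N" "card T = 3" "card Y = 3" "Y \<times> T \<subseteq> R" "irrefl R"
 shows False
proof -
 have fin: "finite T" "finite Y" using assms by (auto intro: card_ge_0_finite)
 obtain a where a: "bij_betw a {0..<3::nat} T" using ex_bij_betw_nat_finite[OF fin(1)] assms(4) by auto
 obtain b where b: "bij_betw b {0..<3::nat} Y" using ex_bij_betw_nat_finite[OF fin(2)] assms(5) by auto
 have aT: "a i \<in> T" "b i \<in> Y" if "i < 3" for i using a b that by (auto simp: bij_betw_def)
 have inj: "a i ~= a k" "b i ~= b k" if "i < 3" "k < 3" "i ~= k" for i k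
  using a b that by (auto simp: bij_betw_def inj_on_def)
 have R: "(b i, a j) \<in> R" if "i < 3" "j < 3" for i j using aT that assms(6) by blast
 have ne: "b i ~= a j" if "i < 3" "j < 3" for i j using R[OF that] assms(7) by (auto simp: irrefl_def)
 have "k33_model N R (\<lambda>i. {b i}) (\<lambda>i. {a i})"
  using aT inj R ne assms(2,3) by (auto simp: k33_model_def conn_def)
 thus False using assms(1) unfolding k33_free_def by blast
qed

lemma conn_pair: "(u, v) \<in> R ==> sym R ==> conn R {u, v}"
 unfolding conn_def by (auto dest: symD)

text \<open>An extremal argument in the style of Mader; \<open>R\<close> counts ordered pairs, so
  the bound says that the average degree is at most 40. In a minimal counterexample, deleting one
  edge shows that the excess is at most 2, and contracting an edge must lose at least 41 ordered
  pairs, so that every edge lies in at least 20 triangles. Some vertex has degree at most 42, and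
  inside its neighbourhood all degrees are at least 20, which forces a K_{3,3}.\<close>

lemma k33_free_card_edges:
 assumes "finite N" "R \<subseteq> N \<times> N" "sym R" "irrefl R" "k33_free N R"
 shows "card R \<le> 40 * card N"
 using assms
proof (induction "card N + card R" arbitrary: N R rule: less_induct)
 case less
 show ?case
 proof (rule ccontr)
  assume "\<not> card R \<le> 40 * card N"
  hence big: "card R > 40 * card N" by simp
  have finR: "finite R" using less.prems by (meson finite_SigmaI finite_subset)
  have small: "card R \<le> 40 * card N + 2"
  proof -
   obtain u v where uv: "(u, v) \<in> R" using big by (cases "R = {}") auto
   let ?R = "R - {(u,v),(v,u)}"
   have "(v, u) \<in> R" "u ~= v" using uv less.prems by (auto dest: symD simp: irrefl_def)
   hence c: "card ?R = card R - 2" using uv finR by (subst card_Diff_subset) auto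
   moreover have "card R \<ge> 2" using card_mono[OF finR, of "{(u,v),(v,u)}"] uv \<open>(v, u) \<in> R\<close> \<open>u ~= v\<close> by auto
   moreover have "card ?R \<le> 40 * card N"
    by (rule less.hyps) (use less.prems c calculation k33_free_subset[of N R N ?R] in \<open>auto simp: sym_def irrefl_def\<close>)
   ultimately show ?thesis by linarith
  qed
  have fN: "finite (R `` {v})" for v using finite_subset[of "R `` {v}" N] less.prems by auto
  have nN: "card N > 0" using big less.prems by (cases "N = {}") (auto simp: card_gt_0_iff)
  have common: "20 \<le> card (R `` {u} \<inter> R `` {v})" if uv: "(u, v) \<in> R" for u v
  proof -
   have ne: "u ~= v" "u \<in> N" "v \<in> N" "(v, u) \<in> R" using uv less.prems by (auto dest: symD simp: irrefl_def)
   let ?N = "N - {v}"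
   define R1 where "R1 = R \<inter> ?N \<times> ?N"
   \<comment> \<open>\<open>D\<close> is the set of neighbours that \<open>u\<close> gains from
     \<open>v\<close> by the contraction; what is lost is the edge itself and one edge per common
     neighbour.\<close>
   define D where "D = R `` {v} - {u} - R `` {u}"
   define R2 where "R2 = {u} \<times> D \<union> D \<times> {u}"
   have DN: "D \<subseteq> ?N" "u \<notin> D" "finite D" using less.prems fN[of v] by (auto simp: D_def irrefl_def)
   have "k33_free ?N (R1 \<union> R2)"
   proof (rule k33_free_minor[OF less.prems(5), where \<mu> = "\<lambda>x. if x = u then {u, v} else {x}"])
    fix x assume "x \<in> ?N"
    thus "conn R (if x = u then {u, v} else {x}) \<and> (if x = u then {u, v} else {x}) \<subseteq> N"
     using conn_pair[OF uv less.prems(3)] ne by (auto simp: conn_def)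
   next
    fix x y assume "x \<in> ?N" "y \<in> ?N" "x ~= y"
    thus "(if x = u then {u, v} else {x}) \<inter> (if y = u then {u, v} else {y}) = {}" by auto
   next
    fix x y assume "x \<in> ?N" "y \<in> ?N" and xy: "(x, y) \<in> R1 \<union> R2"
    thus "\<exists>a\<in>if x = u then {u, v} else {x}. \<exists>b\<in>if y = u then {u, v} else {y}. (a, b) \<in> R"
     using less.prems(3) unfolding R1_def R2_def D_def by (auto dest: symD)
   qed
   moreover have "sym (R1 \<union> R2)" "irrefl (R1 \<union> R2)" "R1 \<union> R2 \<subseteq> ?N \<times> ?N"
    using less.prems(3,4) DN ne unfolding R1_def R2_def by (auto simp: sym_def irrefl_def)
   moreover have cR: "card R = card R1 + 2 * card (R `` {v})"
   proof -
    have e: "R = R1 \<union> ({v} \<times> R `` {v} \<union> (R `` {v}) \<times> {v})" using less.prems(2,3) unfolding R1_def by (auto dest: symD)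
    have "card R = card R1 + card ({v} \<times> R `` {v} \<union> (R `` {v}) \<times> {v})"
     by (subst e, rule card_Un_disjoint) (use finR fN in \<open>auto simp: R1_def\<close>)
    also have "card ({v} \<times> R `` {v} \<union> (R `` {v}) \<times> {v}) = card ({v} \<times> R `` {v}) + card ((R `` {v}) \<times> {v})"
     by (rule card_Un_disjoint) (use fN less.prems(4) in \<open>auto simp: irrefl_def\<close>)
    finally show ?thesis by (simp add: card_cartesian_product)
   qed
   moreover have cR12: "card (R1 \<union> R2) = card R1 + 2 * card D"
   proof -
    have "card (R1 \<union> R2) = card R1 + card R2"
     by (rule card_Un_disjoint) (use finR DN less.prems(3) in \<open>auto simp: R1_def R2_def D_def dest: symD\<close>)
    also have "card R2 = card ({u} \<times> D) + card (D \<times> {u})"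
     unfolding R2_def by (rule card_Un_disjoint) (use DN in auto)
    finally show ?thesis by (simp add: card_cartesian_product)
   qed
   moreover have cD: "card D + 1 + card (R `` {u} \<inter> R `` {v}) = card (R `` {v})"
   proof -
    have e: "R `` {v} = D \<union> ({u} \<union> (R `` {u} \<inter> R `` {v}))" using ne unfolding D_def by auto
    have "card (R `` {v}) = card D + card ({u} \<union> (R `` {u} \<inter> R `` {v}))"
     by (subst e, rule card_Un_disjoint) (use fN in \<open>auto simp: D_def\<close>)
    also have "card ({u} \<union> (R `` {u} \<inter> R `` {v})) = 1 + card (R `` {u} \<inter> R `` {v})"
     using less.prems(4) fN by (subst card_Un_disjoint) (auto simp: irrefl_def)
    finally show ?thesis by simp
   qed
   moreover have cN: "card ?N = card N - 1" using ne less.prems by simp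
   ultimately have "card (R1 \<union> R2) \<le> 40 * card ?N"
    using nN less.prems(1) by (intro less.hyps) auto
   thus ?thesis using cR cR12 cD cN big nN by auto
  qed
  have "\<exists>v\<in>N. card (R `` {v}) \<le> 42"
  proof (rule ccontr)
   assume "\<not> ?thesis"
   hence "(\<Sum>v\<in>N. 43) \<le> (\<Sum>v\<in>N. card (R `` {v}))" by (intro sum_mono) force
   thus False using card_rel_eq_sum_degrees[OF less.prems(1,2)] small nN by simp
  qed
  then obtain v where v: "v \<in> N" "card (R `` {v}) \<le> 42" by blast
  have "R `` {v} ~= {}"
  proof
   assume e: "R `` {v} = {}"
   hence "R \<subseteq> (N - {v}) \<times> (N - {v})" using less.prems by (auto dest: symD)
   hence "card R \<le> 40 * card (N - {v})"
    using less.prems v nN k33_free_subset[of N R "N - {v}" R] by (intro less.hyps) (auto simp: card_Diff_singleton)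
   thus False using big card_mono[of N "N - {v}"] less.prems(1) by auto
  qed
  moreover have "20 \<le> card (R `` {u} \<inter> R `` {v})" if "u \<in> R `` {v}" for u
   using common[of u v] that less.prems(3) by (auto dest: symD)
  ultimately obtain T Y where "T \<subseteq> R `` {v}" "Y \<subseteq> R `` {v}" "card T = 3" "card Y = 3" "Y \<times> T \<subseteq> R"
   using dense_graph_has_K33[of "R `` {v}" R] v fN by blast
  moreover have "R `` {v} \<subseteq> N" using less.prems by auto
  ultimately show False using k33_free_no_K33[OF less.prems(5), of T Y] less.prems(4) by blast
 qed
qed

text \<open>By the edge bound some vertex \<open>v\<close> has degree at most 40. A clique through
  \<open>v\<close> consists of \<open>v\<close> and a subset of its neighbourhood, so there are at
  most \<open>2 ^ 40\<close> of them, and all other cliques survive the removal of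
  \<open>v\<close>.\<close>

lemma k33_free_card_cliques:
 assumes "finite N" "R \<subseteq> N \<times> N" "sym R" "irrefl R" "k33_free N R"
 shows "card {Q. Q \<subseteq> N \<and> (\<forall>x\<in>Q. \<forall>y\<in>Q. x ~= y --> (x, y) \<in> R)} \<le> 2 ^ 40 * card N + 1"
 using assms
proof (induction "card N" arbitrary: N R)
 case 0
 hence "{Q. Q \<subseteq> N \<and> (\<forall>x\<in>Q. \<forall>y\<in>Q. x ~= y --> (x, y) \<in> R)} = {{}}" by auto
 thus ?case by simp
next
 case (Suc n)
 let ?cl = "\<lambda>N R. {Q. Q \<subseteq> N \<and> (\<forall>x\<in>Q. \<forall>y\<in>Q. x ~= y --> (x, y) \<in> R)}"
 have "\<exists>v\<in>N. card (R `` {v}) \<le> 40"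
 proof (rule ccontr)
  assume "\<not> ?thesis"
  hence "(\<Sum>v\<in>N. 41) \<le> (\<Sum>v\<in>N. card (R `` {v}))" by (intro sum_mono) force
  thus False using card_rel_eq_sum_degrees[OF Suc.prems(1,2)] k33_free_card_edges[OF Suc.prems] Suc.hyps(2) by simp
 qed
 then obtain v where v: "v \<in> N" "card (R `` {v}) \<le> 40" by blast
 let ?N = "N - {v}" let ?R = "R \<inter> ?N \<times> ?N"
 have IH: "card (?cl ?N ?R) \<le> 2 ^ 40 * card ?N + 1"
  by (rule Suc.hyps(1)) (use Suc.prems Suc.hyps(2) v k33_free_subset[of N R ?N ?R] in \<open>auto simp: sym_def irrefl_def\<close>)
 have fN: "finite (R `` {v})" using finite_subset[of "R `` {v}" N] Suc.prems by auto
 have "?cl N R \<subseteq> ?cl ?N ?R \<union> insert v ` Pow (R `` {v})"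
 proof
  fix Q assume Q: "Q \<in> ?cl N R"
  show "Q \<in> ?cl ?N ?R \<union> insert v ` Pow (R `` {v})"
  proof (cases "v \<in> Q")
   case True
   hence "Q = insert v (Q - {v})" "Q - {v} \<subseteq> R `` {v}" using Q by auto
   thus ?thesis by blast
  qed (use Q in auto)
 qed
 moreover have "finite (?cl ?N ?R)" using Suc.prems(1) by simp
 ultimately have "card (?cl N R) \<le> card (?cl ?N ?R \<union> insert v ` Pow (R `` {v}))"
  using fN by (intro card_mono) auto
 also have "\<dots> \<le> card (?cl ?N ?R) + card (insert v ` Pow (R `` {v}))" by (rule card_Un_le)
 also have "card (insert v ` Pow (R `` {v})) \<le> card (Pow (R `` {v}))" using fN by (intro card_image_le) auto
 also have "card (Pow (R `` {v})) \<le> 2 ^ 40" using v fN by (simp add: card_Pow del: power_numeral numeral_power_eq_of_nat_cancel_iff)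
 finally have "card (?cl N R) \<le> (2 ^ 40 * card ?N + 1) + 2 ^ 40" using IH by linarith
 also have "\<dots> = 2 ^ 40 * card N + 1" using Suc.prems(1) v Suc.hyps(2) by simp
 finally show ?case .
qed

text \<open>Of a map only the incidences between nations and the vertices on their boundaries are kept; their planarity
 is used in the form that \<open>K\<^sub>3\<^sub>,\<^sub>3\<close> is not a minor.\<close>

definition incidence :: "'a set => ('a => 'p set) => (('a + 'p) \<times> ('a + 'p)) set" where
 "incidence M pt = {(Inl a, Inr p) |a p. a \<in> M \<and> p \<in> pt a}"

definition map_like :: "'a set => ('a \<times> 'a) set => ('a => 'p set) => bool" where
 "map_like M E pt \<longleftrightarrow> finite M \<and> (\<forall>a\<in>M. finite (pt a)) \<and>
  E = {(a, b). a \<in> M \<and> b \<in> M \<and> a ~= b \<and> pt a \<inter> pt b ~= {}} \<and>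
  k33_free (Inl ` M \<union> Inr ` (\<Union>(pt ` M))) (incidence M pt \<union> (incidence M pt)\<inverse>)"

lemma conn_nation_with_points:
 assumes "a \<in> M"
 shows "conn (incidence M pt \<union> (incidence M pt)\<inverse>) (insert (Inl a) (Inr ` pt a))"
proof -
 let ?R = "incidence M pt \<union> (incidence M pt)\<inverse>" let ?A = "insert (Inl a) (Inr ` pt a)"
 have 1: "(Inl a, x) \<in> (?R \<inter> ?A \<times> ?A)\<^sup>*" if xA: "x \<in> ?A" for x
 proof (cases "x = Inl a")
  case False
  then obtain p where "x = Inr p" "p \<in> pt a" using xA by auto
  hence "(Inl a, x) \<in> ?R \<inter> ?A \<times> ?A" using assms by (auto simp: incidence_def)
  thus ?thesis by blast
 qed simp
 have "sym ?R" by (auto simp: sym_def)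
 hence "(x, Inl a) \<in> (?R \<inter> ?A \<times> ?A)\<^sup>*" if "x \<in> ?A" for x using 1[OF that] rtrancl_restrict_sym by metis
 thus ?thesis using 1 unfolding conn_def by (blast intro: rtrancl_trans)
qed

text \<open>Nonadjacent nations have no boundary vertex in common, so each nation of the independent
  set \<open>I\<close> can swallow all of its boundary vertices. After this contraction the
  adjacencies between \<open>I\<close> and \<open>J\<close> are edges of a minor.\<close>

lemma map_like_bipartite_edges:
 assumes ml: "map_like M E pt" and IJ: "I \<subseteq> M" "J \<subseteq> M" "I \<inter> J = {}" and ind: "E \<inter> I \<times> I = {}"
 shows "card (E \<inter> I \<times> J) \<le> 20 * (card I + card J)"
proof -
 let ?N = "Inl ` M \<union> Inr ` (\<Union>(pt ` M))" and ?W = "incidence M pt \<union> (incidence M pt)\<inverse>"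
 have E: "E = {(a, b). a \<in> M \<and> b \<in> M \<and> a ~= b \<and> pt a \<inter> pt b ~= {}}" and W: "k33_free ?N ?W" and fM: "finite M"
  using ml by (auto simp: map_like_def)
 have fin: "finite I" "finite J" using finite_subset[OF IJ(1) fM] finite_subset[OF IJ(2) fM] by auto
 define R where "R = E \<inter> I \<times> J \<union> (E \<inter> I \<times> J)\<inverse>"
 have "k33_free (I \<union> J) R"
 proof (rule k33_free_minor[OF W, where \<mu> = "\<lambda>x. if x \<in> I then insert (Inl x) (Inr ` pt x) else {Inl x}"])
  fix x assume x: "x \<in> I \<union> J"
  hence "x \<in> M" using IJ by auto
  thus "conn ?W (if x \<in> I then insert (Inl x) (Inr ` pt x) else {Inl x}) \<and> (if x \<in> I then insert (Inl x) (Inr ` pt x) else {Inl x}) \<subseteq> ?N"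
   using conn_nation_with_points[of x M pt] by (auto simp: conn_def)
 next
  fix x y assume xy: "x \<in> I \<union> J" "y \<in> I \<union> J" "x ~= y"
  have "pt x \<inter> pt y = {}" if "x \<in> I" "y \<in> I"
  proof -
   have "(x, y) \<notin> E" using ind that by blast
   thus ?thesis using that IJ xy(3) unfolding E by blast
  qed
  thus "(if x \<in> I then insert (Inl x) (Inr ` pt x) else {Inl x}) \<inter> (if y \<in> I then insert (Inl y) (Inr ` pt y) else {Inl y}) = {}"
   using xy by auto
 next
  fix x y assume xy: "x \<in> I \<union> J" "y \<in> I \<union> J" "(x, y) \<in> R"
  hence "(x \<in> I \<and> y \<in> J \<or> y \<in> I \<and> x \<in> J) \<and> x \<in> M \<and> y \<in> M \<and> pt x \<inter> pt y ~= {}" unfolding R_def E by auto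
  thus "\<exists>a\<in>if x \<in> I then insert (Inl x) (Inr ` pt x) else {Inl x}. \<exists>b\<in>if y \<in> I then insert (Inl y) (Inr ` pt y) else {Inl y}. (a, b) \<in> ?W"
   using IJ(3) unfolding incidence_def by auto
 qed
 hence "card R \<le> 40 * card (I \<union> J)"
  by (intro k33_free_card_edges) (use fin E in \<open>auto simp: R_def sym_def irrefl_def\<close>)
 moreover have "card R = 2 * card (E \<inter> I \<times> J)"
 proof -
  have "finite (E \<inter> I \<times> J)" using fin by auto
  moreover have "(E \<inter> I \<times> J) \<inter> (E \<inter> I \<times> J)\<inverse> = {}" using IJ(3) by auto
  ultimately show ?thesis unfolding R_def by (subst card_Un_disjoint) (auto simp: card_inverse)
 qed
 moreover have "card (I \<union> J) = card I + card J" using fin IJ(3) by (simp add: card_Un_disjoint)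
 ultimately show ?thesis by simp
qed

text \<open>Take a largest set \<open>K\<close> of nations that can be given pairwise distinct pairs
  of neighbours. Contracting every \<open>i\<close> of \<open>K\<close> into \<open>a i\<close>
  turns the pairs into the edges of a minor \<open>F\<close> on \<open>J\<close>, so
  \<open>K\<close> is small. By maximality the neighbourhood of any other nation is a clique of
  \<open>F\<close>, and \<open>F\<close> has few cliques.\<close>

lemma map_like_neighbourhoods:
 assumes ml: "map_like M E pt" and IJ: "I \<subseteq> M" "J \<subseteq> M" "I \<inter> J = {}" and nb: "\<And>i. i \<in> I ==> E `` {i} \<subseteq> J"
 shows "card ((\<lambda>i. E `` {i}) ` I) \<le> (2 ^ 40 + 20) * (card J + 1)"
proof -
 let ?N = "Inl ` M \<union> Inr ` (\<Union>(pt ` M))" and ?W = "incidence M pt \<union> (incidence M pt)\<inverse>"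
 have E: "E = {(a, b). a \<in> M \<and> b \<in> M \<and> a ~= b \<and> pt a \<inter> pt b ~= {}}" and W: "k33_free ?N ?W" and fM: "finite M"
  using ml by (auto simp: map_like_def)
 have fin: "finite I" "finite J" using finite_subset[OF IJ(1) fM] finite_subset[OF IJ(2) fM] by auto
 have symE: "(a, b) \<in> E ==> (b, a) \<in> E" for a b unfolding E by auto
 define good where "good K h \<longleftrightarrow> K \<subseteq> I \<and> (\<forall>i\<in>K. fst (h i) \<in> E `` {i} \<and> snd (h i) \<in> E `` {i} \<and> fst (h i) ~= snd (h i)) \<and>
  inj_on (\<lambda>i. {fst (h i), snd (h i)}) K" for K and h :: "'a => 'a \<times> 'a"
 have "good {} h" for h by (simp add: good_def)
 hence "\<exists>K h. good K h \<and> (\<forall>K' h'. good K' h' --> card K' \<le> card K)"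
 proof -
  define P where "P n \<longleftrightarrow> (\<exists>K h. good K h \<and> card K = n)" for n
  have P0: "P 0" unfolding P_def by (rule exI[of _ "{}"]) (simp add: good_def)
  have Pb: "n \<le> card I" if "P n" for n using that card_mono[OF fin(1)] unfolding P_def good_def by auto
  obtain n where n: "P n" "\<And>m. P m ==> m \<le> n" using GreatestI_nat[of P, OF P0] Greatest_le_nat[of P] Pb by metis
  then obtain K h where "good K h" "card K = n" unfolding P_def by blast
  thus ?thesis using n(2) unfolding P_def by blast
 qed
 then obtain K h where g: "good K h" and mx: "\<And>K' h'. good K' h' ==> card K' \<le> card K" by blast
 define a where "a i = fst (h i)" for i
 define b where "b i = snd (h i)" for i
 have K: "K \<subseteq> I" "\<And>i. i \<in> K ==> (i, a i) \<in> E \<and> (i, b i) \<in> E \<and> a i ~= b i" "inj_on (\<lambda>i. {a i, b i}) K"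
  using g unfolding good_def a_def b_def by auto
 have abJ: "a i \<in> J" "b i \<in> J" if "i \<in> K" for i using K that nb by blast+
 define F where "F = (\<lambda>i. (a i, b i)) ` K \<union> (\<lambda>i. (b i, a i)) ` K"
 have "F \<subseteq> J \<times> J" using abJ unfolding F_def by auto
 moreover have "sym F" unfolding F_def sym_def by auto
 moreover have "irrefl F" using K(2) unfolding F_def irrefl_def by (auto dest: sym)
 ultimately have F: "F \<subseteq> J \<times> J" "sym F" "irrefl F" .
 have finK: "finite K" using K(1) fin finite_subset by auto
 have "card F = 2 * card K"
 proof -
  have i1: "inj_on (\<lambda>i. (a i, b i)) K" "inj_on (\<lambda>i. (b i, a i)) K" using K(3) by (auto simp: inj_on_def)
  have "(\<lambda>i. (a i, b i)) ` K \<inter> (\<lambda>i. (b i, a i)) ` K = {}"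
  proof (rule equals0I)
   fix p assume "p \<in> (\<lambda>i. (a i, b i)) ` K \<inter> (\<lambda>i. (b i, a i)) ` K"
   then obtain i j where ij: "i \<in> K" "j \<in> K" "p = (a i, b i)" "p = (b j, a j)" by auto
   hence "{a i, b i} = {a j, b j}" by auto
   hence "i = j" using K(3) ij by (auto dest: inj_onD)
   thus False using ij K(2) by auto
  qed
  thus ?thesis unfolding F_def using finK by (subst card_Un_disjoint) (auto simp: card_image i1)
 qed
 define \<mu> where "\<mu> x = insert (Inl x) (\<Union>i\<in>{i\<in>K. a i = x}. insert (Inl i) (Inr ` pt i))" for x
 have kF: "k33_free J F"
 proof (rule k33_free_minor[OF W, where \<mu> = \<mu>])
  fix x assume x: "x \<in> J"
  have xM: "x \<in> M" using x IJ by auto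
  have "conn ?W (\<mu> x)"
  proof -
   let ?U = "\<mu> x"
   have sW: "sym ?W" by (auto simp: sym_def)
   have 1: "(Inl x, q) \<in> (?W \<inter> ?U \<times> ?U)\<^sup>*" if q: "q \<in> ?U" for q
   proof (cases "q = Inl x")
    case False
    then obtain i where i: "i \<in> K" "a i = x" "q \<in> insert (Inl i) (Inr ` pt i)" using q unfolding \<mu>_def by auto
    hence iM: "i \<in> M" using K IJ by auto
    have "(i, x) \<in> E" using K(2)[OF i(1)] i(2) by auto
    then obtain p where p: "p \<in> pt i" "p \<in> pt x" unfolding E by auto
    have pU: "Inr p \<in> ?U" "Inl x \<in> ?U" using i p unfolding \<mu>_def by auto
    have "(Inl x, Inr p) \<in> ?W" using p xM unfolding incidence_def by auto
    hence s: "(Inl x, Inr p) \<in> ?W \<inter> ?U \<times> ?U" using pU by auto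
    have "(Inr p, q) \<in> (?W \<inter> insert (Inl i) (Inr ` pt i) \<times> insert (Inl i) (Inr ` pt i))\<^sup>*"
     using conn_nation_with_points[OF iM, of pt] i p unfolding conn_def by blast
    hence "(Inr p, q) \<in> (?W \<inter> ?U \<times> ?U)\<^sup>*"
     by (rule rtrancl_restrict_mono[rotated]) (use i in \<open>auto simp: \<mu>_def\<close>)
    with s show ?thesis by (rule converse_rtrancl_into_rtrancl)
   qed auto
   hence 2: "(q, Inl x) \<in> (?W \<inter> ?U \<times> ?U)\<^sup>*" if "q \<in> ?U" for q using rtrancl_restrict_sym[OF sW] that by blast
   have "?U ~= {}" by (simp add: \<mu>_def)
   thus ?thesis using rtrancl_trans[OF 2 1] unfolding conn_def by blast
  qed
  moreover have "\<mu> x \<subseteq> ?N"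
  proof
   fix q assume "q \<in> \<mu> x"
   then consider "q = Inl x" | i where "i \<in> K" "q \<in> insert (Inl i) (Inr ` pt i)" unfolding \<mu>_def by blast
   thus "q \<in> ?N"
   proof cases
    case 2
    hence "i \<in> M" using K(1) IJ(1) by blast
    thus ?thesis using 2 by auto
   qed (use xM in simp)
  qed
  ultimately show "conn ?W (\<mu> x) \<and> \<mu> x \<subseteq> ?N" by simp
 next
  fix x y assume xy: "x \<in> J" "y \<in> J" "x ~= y"
  have "pt i \<inter> pt j = {}" if "i \<in> K" "j \<in> K" "i ~= j" for i j
  proof -
   have "(i, j) \<notin> E" using nb K that IJ by blast
   thus ?thesis using that IJ K unfolding E by blast
  qed
  moreover have "i ~= x" "i ~= y" if "i \<in> K" for i using that K IJ xy by auto
  ultimately show "\<mu> x \<inter> \<mu> y = {}" using xy unfolding \<mu>_def by auto blast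
 next
  fix x y assume xy: "x \<in> J" "y \<in> J" "(x, y) \<in> F"
  have *: "\<exists>p\<in>\<mu> (a i). (p, Inl (b i)) \<in> ?W" if "i \<in> K" for i
  proof -
   have "(i, b i) \<in> E" using K that by auto
   then obtain p where p: "p \<in> pt i" "p \<in> pt (b i)" "b i \<in> M" unfolding E by auto
   hence "(Inr p, Inl (b i)) \<in> ?W" "Inr p \<in> \<mu> (a i)" using that unfolding incidence_def \<mu>_def by auto
   thus ?thesis by blast
  qed
  have sW: "(q, p) \<in> ?W" if "(p, q) \<in> ?W" for p q using that by auto
  have in\<mu>: "Inl z \<in> \<mu> z" for z by (simp add: \<mu>_def)
  from xy(3) obtain i where i: "i \<in> K" "x = a i \<and> y = b i \<or> x = b i \<and> y = a i" unfolding F_def by auto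
  thus "\<exists>a\<in>\<mu> x. \<exists>b\<in>\<mu> y. (a, b) \<in> ?W" using *[OF i(1)] sW in\<mu> by metis
 qed
 have "card F \<le> 40 * card J" using k33_free_card_edges[OF fin(2) F kF] .
 hence cK: "card K \<le> 20 * card J" using \<open>card F = 2 * card K\<close> by simp
 let ?cl = "{Q. Q \<subseteq> J \<and> (\<forall>x\<in>Q. \<forall>y\<in>Q. x ~= y --> (x, y) \<in> F)}"
 have clique: "E `` {i} \<in> ?cl" if i: "i \<in> I" "i \<notin> K" for i
 proof -
  have "(x, y) \<in> F" if xy: "(i, x) \<in> E" "(i, y) \<in> E" "x ~= y" for x y
  proof (rule ccontr)
   assume nF: "(x, y) \<notin> F"
   have "good (insert i K) (h(i := (x, y)))"
    unfolding good_def
   proof (intro conjI ballI)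
    show "insert i K \<subseteq> I" using K i by auto
    show "inj_on (\<lambda>j. {fst ((h(i := (x, y))) j), snd ((h(i := (x, y))) j)}) (insert i K)"
    proof -
     have "{x, y} ~= {a j, b j}" if "j \<in> K" for j
     proof
      assume "{x, y} = {a j, b j}"
      hence "x = a j \<and> y = b j \<or> x = b j \<and> y = a j" by (auto simp: doubleton_eq_iff)
      thus False using nF that unfolding F_def by auto
     qed
     thus ?thesis using K(3) i unfolding a_def b_def inj_on_def by auto
    qed
    fix j assume "j \<in> insert i K"
    thus "fst ((h(i := (x, y))) j) \<in> E `` {j}" "snd ((h(i := (x, y))) j) \<in> E `` {j}"
     "fst ((h(i := (x, y))) j) ~= snd ((h(i := (x, y))) j)" using K(2) xy unfolding a_def b_def by auto
   qed
   hence "card (insert i K) \<le> card K" by (rule mx)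
   thus False using i finK by simp
  qed
  thus ?thesis using nb[OF i(1)] by auto
 qed
 have fincl: "finite ?cl" using fin by simp
 have "(\<lambda>i. E `` {i}) ` I \<subseteq> (\<lambda>i. E `` {i}) ` K \<union> ?cl" using clique by blast
 hence "card ((\<lambda>i. E `` {i}) ` I) \<le> card ((\<lambda>i. E `` {i}) ` K \<union> ?cl)" using fincl finK by (intro card_mono) auto
 also have "\<dots> \<le> card ((\<lambda>i. E `` {i}) ` K) + card ?cl" by (rule card_Un_le)
 also have "\<dots> \<le> 20 * card J + (2 ^ 40 * card J + 1)"
  using card_image_le[OF finK, of "\<lambda>i. E `` {i}"] cK k33_free_card_cliques[OF fin(2) F kF] by (intro add_mono) auto
 also have "\<dots> \<le> (2 ^ 40 + 20) * (card J + 1)" by simp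
 finally show ?thesis .
qed

text \<open>The fat drawing consists of a compact core inside each nation, a star at each vertex of
  the map, and the tails of accessing arcs as connections. The frontier of a nation is a union of
  edges, so each of its boundary vertices lies on an edge contained in the frontier; this gives
  access to the star at that vertex.\<close>

lemma map_graph_map_like:
 fixes G :: "'a pair_pre_digraph"
 assumes "map_graph G" "finite (pverts G)"
 shows "\<exists>pt :: 'a => (real^2) set. map_like (pverts G) (parcs G) pt"
proof -
 obtain V E \<omega> \<phi> where m: "is_map V E \<omega>" and bij: "bij_betw \<phi> (pverts G) (nations V E \<omega>)"
  and arcs: "parcs G = {(u, v). u \<in> pverts G \<and> v \<in> pverts G \<and> u ~= v \<and>
             (\<exists>x \<in> V. x \<in> frontier (\<phi> u) \<and> x \<in> frontier (\<phi> v))}"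
  using assms(1) unfolding map_graph_def by blast
 let ?M = "pverts G"
 have pg: "plane_graph V E" using m by (simp add: is_map_def)
 hence finV: "finite V" by (simp add: plane_graph_def)
 have clS: "closed (V \<union> \<Union>E)"
 proof -
  have "compact e" if "e \<in> E" for e using pg that compact_arc_image unfolding plane_graph_def by metis
  moreover have "finite E" using pg by (simp add: plane_graph_def)
  ultimately show ?thesis using finV by (intro closed_Un closed_Union) (auto intro: finite_imp_closed compact_imp_closed)
 qed
 define pt where "pt a = V \<inter> frontier (\<phi> a)" for a
 have \<phi>: "\<phi> a \<in> faces V E" "bounded_by_cycle V E (\<phi> a)" if "a \<in> ?M" for a
  using bij that m unfolding bij_betw_def nations_def is_map_def by auto
 have face: "open f" "Topological_Spaces.connected f" "f ~= {}" "f \<inter> (V \<union> \<Union>E) = {}" if "f \<in> faces V E" for f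
  using that clS unfolding faces_def
  by (auto intro: open_components in_components_connected dest: in_components_nonempty in_components_subset)
 have disj: "\<phi> a \<inter> \<phi> b = {}" if "a \<in> ?M" "b \<in> ?M" "a ~= b" for a b
 proof -
  have "\<phi> a ~= \<phi> b" using bij that by (auto simp: bij_betw_def dest: inj_onD)
  thus ?thesis using \<phi>(1)[OF that(1)] \<phi>(1)[OF that(2)] unfolding faces_def by (metis components_eq)
 qed
 obtain st where st: "\<And>x. x \<in> V ==> compact (st x) \<and> path_connected (st x) \<and> x \<in> st x \<and> st x \<subseteq> V \<union> \<Union>E"
  "\<And>x y. x \<in> V ==> y \<in> V ==> x ~= y ==> st x \<inter> st y = {}"
  "\<And>x f e. x \<in> V ==> f \<in> faces V E ==> e \<in> E ==> x \<in> e ==> e \<subseteq> frontier f ==>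
   \<exists>g. Path_Connected.arc g \<and> g ` {0..<1} \<subseteq> f \<and> pathfinish g \<in> st x"
  using plane_graph_star[OF pg] by metis
 have acc: "\<exists>g. Path_Connected.arc g \<and> g ` {0..<1} \<subseteq> \<phi> a \<and> pathfinish g \<in> st x" if a: "a \<in> ?M" and x: "x \<in> pt a" for a x
 proof -
  obtain p where p: "frontier (\<phi> a) = \<Union>{e \<in> E. \<exists>(u, v) \<in> set p. e \<inter> V = {u, v}}"
   using \<phi>(2)[OF a] unfolding bounded_by_cycle_def by blast
  then obtain e where "e \<in> E" "x \<in> e" "e \<subseteq> frontier (\<phi> a)" using x unfolding pt_def by blast
  thus ?thesis using st(3)[of x "\<phi> a" e] \<phi>(1)[OF a] x unfolding pt_def by blast
 qed
 have "\<exists>C L. compact C \<and> path_connected C \<and> C ~= {} \<and> C \<subseteq> \<phi> a \<and>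
  (\<forall>x\<in>pt a. path (L x) \<and> pathstart (L x) \<in> C \<and> pathfinish (L x) \<in> st x \<and>
   path_image (L x) \<inter> C \<subseteq> {pathstart (L x)} \<and> path_image (L x) \<subseteq> insert (pathfinish (L x)) (\<phi> a)) \<and>
  (\<forall>x\<in>pt a. \<forall>y\<in>pt a. x ~= y --> path_image (L x) \<inter> path_image (L y) = {})" if a: "a \<in> ?M" for a
 proof -
  obtain g where g: "\<And>x. x \<in> pt a ==> Path_Connected.arc (g x) \<and> g x ` {0..<1} \<subseteq> \<phi> a \<and> pathfinish (g x) \<in> st x"
   using acc[OF a] by metis
  have f: "open (\<phi> a)" "Topological_Spaces.connected (\<phi> a)" "\<phi> a ~= {}" "\<phi> a \<inter> (V \<union> \<Union>E) = {}" using face \<phi>(1)[OF a] by blast+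
  have 1: "Path_Connected.arc (g x) \<and> g x ` {0..<1} \<subseteq> \<phi> a \<and> pathfinish (g x) \<notin> \<phi> a" if x: "x \<in> pt a" for x
  proof -
   have "pathfinish (g x) \<in> V \<union> \<Union>E" using g[OF x] st(1)[of x] x unfolding pt_def by blast
   thus ?thesis using g[OF x] f(4) by blast
  qed
  have 2: "inj_on (\<lambda>x. pathfinish (g x)) (pt a)"
  proof (rule inj_onI)
   fix x y assume xy: "x \<in> pt a" "y \<in> pt a" "pathfinish (g x) = pathfinish (g y)"
   hence "st x \<inter> st y ~= {}" using g[OF xy(1)] g[OF xy(2)] by auto
   thus "x = y" using st(2)[of x y] xy unfolding pt_def by blast
  qed
  have "finite (pt a)" using finV unfolding pt_def by simp
  from open_set_core_with_disjoint_tails[OF f(1-3) this 1 2]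
  obtain C L where C: "compact C" "path_connected C" "C ~= {}" "C \<subseteq> \<phi> a"
   and L: "\<And>x. x \<in> pt a ==> path (L x) \<and> pathstart (L x) \<in> C \<and> pathfinish (L x) = pathfinish (g x) \<and>
   path_image (L x) \<inter> C \<subseteq> {pathstart (L x)} \<and> path_image (L x) \<subseteq> insert (pathfinish (g x)) (\<phi> a)"
   and LL: "\<And>x y. x \<in> pt a ==> y \<in> pt a ==> x ~= y ==> path_image (L x) \<inter> path_image (L y) = {}" by metis
  show ?thesis
  proof (intro exI[of _ C] exI[of _ L] conjI ballI impI)
   fix x assume x: "x \<in> pt a"
   show "pathfinish (L x) \<in> st x" using L[OF x] g[OF x] by simp
   show "path_image (L x) \<subseteq> insert (pathfinish (L x)) (\<phi> a)" using L[OF x] by simp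
  qed (use C L LL in auto)
 qed
 then obtain C L where CL: "\<And>a. a \<in> ?M ==> compact (C a) \<and> path_connected (C a) \<and> C a ~= {} \<and> C a \<subseteq> \<phi> a \<and>
  (\<forall>x\<in>pt a. path (L a x) \<and> pathstart (L a x) \<in> C a \<and> pathfinish (L a x) \<in> st x \<and>
   path_image (L a x) \<inter> C a \<subseteq> {pathstart (L a x)} \<and> path_image (L a x) \<subseteq> insert (pathfinish (L a x)) (\<phi> a)) \<and>
  (\<forall>x\<in>pt a. \<forall>y\<in>pt a. x ~= y --> path_image (L a x) \<inter> path_image (L a y) = {})" by metis
 have C: "compact (C a)" "path_connected (C a)" "C a ~= {}" "C a \<subseteq> \<phi> a" if "a \<in> ?M" for a using CL[OF that] by auto
 have L: "path (L a x)" "pathstart (L a x) \<in> C a" "pathfinish (L a x) \<in> st x"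
  "path_image (L a x) \<inter> C a \<subseteq> {pathstart (L a x)}" "path_image (L a x) \<subseteq> insert (pathfinish (L a x)) (\<phi> a)"
  if "a \<in> ?M" "x \<in> pt a" for a x using CL[OF that(1)] that(2) by auto
 have LL: "path_image (L a x) \<inter> path_image (L a y) = {}" if "a \<in> ?M" "x \<in> pt a" "y \<in> pt a" "x ~= y" for a x y
  using CL[OF that(1)] that(2-4) by auto
 have stf: "st x \<inter> \<phi> a = {}" if "x \<in> V" "a \<in> ?M" for x a using st(1)[OF that(1)] face(4)[OF \<phi>(1)[OF that(2)]] by blast
 have Lst: "path_image (L a x) \<inter> st y \<subseteq> (if x = y then {pathfinish (L a x)} else {})" if "a \<in> ?M" "x \<in> pt a" "y \<in> V" for a x y
 proof -
  have "path_image (L a x) \<inter> st y \<subseteq> {pathfinish (L a x)} \<inter> st y" using L(5)[OF that(1,2)] stf[OF that(3,1)] by blast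
  moreover have "{pathfinish (L a x)} \<inter> st y = {}" if "x ~= y" using that L(3)[OF \<open>a \<in> ?M\<close> \<open>x \<in> pt a\<close>] st(2)[of x y] \<open>y \<in> V\<close> \<open>x \<in> pt a\<close>
   unfolding pt_def by blast
  ultimately show ?thesis by auto
 qed
 define N where "N = Inl ` ?M \<union> Inr ` (\<Union>(pt ` ?M))"
 define P where "P w = (case w of Inl a => C a | Inr x => st x)" for w
 define K where "K w v = (case (w, v) of (Inl a, Inr x) => L a x | _ => linepath 0 0)" for w v :: "'a + real^2"
 have ptV: "pt a \<subseteq> V" for a unfolding pt_def by blast
 have incE: "\<exists>a x. f = Inl a \<and> y = Inr x \<and> a \<in> ?M \<and> x \<in> pt a" if "(f, y) \<in> incidence ?M pt" for f y
  using that unfolding incidence_def by auto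
 have Nc: "(\<exists>a\<in>?M. w = Inl a) \<or> (\<exists>x\<in>V. w = Inr x)" if "w \<in> N" for w using that ptV unfolding N_def by blast
 have "k33_free N (incidence ?M pt \<union> (incidence ?M pt)\<inverse>)"
 proof (rule k33_free_of_fat_drawing[where P = P and L = K])
  show "finite N" unfolding N_def using assms(2) finV by (auto simp: pt_def)
  show "incidence ?M pt \<subseteq> N \<times> N" unfolding incidence_def N_def by auto
  show "compact (P w) \<and> path_connected (P w) \<and> P w ~= {}" if "w \<in> N" for w
  proof (cases w)
   case (Inl a)
   thus ?thesis using Nc[OF that] C[of a] by (auto simp: P_def)
  next
   case (Inr x)
   thus ?thesis using Nc[OF that] st(1)[of x] by (auto simp: P_def)
  qed
  show "P v \<inter> P w = {}" if vw: "v \<in> N" "w \<in> N" "v ~= w" for v w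
  proof -
   have 1: "C a \<inter> C b = {}" if "a \<in> ?M" "b \<in> ?M" "a ~= b" for a b using disj[OF that] C(4) that by blast
   have 2: "C a \<inter> st x = {}" "st x \<inter> C a = {}" if "a \<in> ?M" "x \<in> V" for a x using stf[OF that(2,1)] C(4)[OF that(1)] by blast+
   show ?thesis
    using Nc[OF vw(1)] Nc[OF vw(2)]
   proof (elim disjE bexE)
    fix a b assume "a \<in> ?M" "v = Inl a" "b \<in> ?M" "w = Inl b"
    thus ?thesis using 1[of a b] vw(3) by (simp add: P_def)
   next
    fix a x assume "a \<in> ?M" "v = Inl a" "x \<in> V" "w = Inr x"
    thus ?thesis using 2 by (simp add: P_def)
   next
    fix a x assume "x \<in> V" "v = Inr x" "a \<in> ?M" "w = Inl a"
    thus ?thesis using 2 by (simp add: P_def)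
   next
    fix x y assume "x \<in> V" "v = Inr x" "y \<in> V" "w = Inr y"
    thus ?thesis using st(2)[of x y] vw(3) by (simp add: P_def)
   qed
  qed
  fix f x assume "(f, x) \<in> incidence ?M pt"
  then obtain a p where ap: "f = Inl a" "x = Inr p" "a \<in> ?M" "p \<in> pt a" using incE by blast
  have pV: "p \<in> V" using ap ptV by blast
  show "path (K f x) \<and> pathstart (K f x) \<in> P f \<and> pathfinish (K f x) \<in> P x \<and>
   path_image (K f x) \<inter> P f \<subseteq> {pathstart (K f x)} \<and> path_image (K f x) \<inter> P x \<subseteq> {pathfinish (K f x)}"
   unfolding ap K_def P_def using L[OF ap(3,4)] Lst[OF ap(3,4) pV] by auto
  show "path_image (K f x) \<inter> P w = {}" if w: "w \<in> N" "w ~= f" "w ~= x" for w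
  proof -
   have 1: "path_image (L a p) \<inter> C b = {}" if "b \<in> ?M" "b ~= a" for b
   proof -
    have "pathfinish (L a p) \<notin> C b" using L(3)[OF ap(3,4)] stf[OF pV that(1)] C(4)[OF that(1)] by blast
    moreover have "\<phi> a \<inter> C b = {}" using disj[OF that(1) ap(3) that(2)] C(4)[OF that(1)] by blast
    ultimately show ?thesis using L(5)[OF ap(3,4)] by blast
   qed
   show ?thesis
   proof (cases w)
    case (Inl b)
    hence "b \<in> ?M" "b ~= a" using w ap Nc[OF w(1)] by auto
    thus ?thesis using 1 unfolding ap K_def P_def Inl by simp
   next
    case (Inr y)
    hence "y \<in> V" "p ~= y" using w ap Nc[OF w(1)] by auto
    thus ?thesis using Lst[OF ap(3,4), of y] unfolding ap K_def P_def Inr by simp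
   qed
  qed
  fix g y assume "(g, y) \<in> incidence ?M pt" and ne: "(f, x) ~= (g, y)"
  then obtain b q where bq: "g = Inl b" "y = Inr q" "b \<in> ?M" "q \<in> pt b" using incE by blast
  have "path_image (L a p) \<inter> path_image (L b q) \<subseteq> st p"
  proof (cases "a = b")
   case True
   hence "p ~= q" using ne ap bq by auto
   thus ?thesis using LL[OF ap(3,4), of q] bq True by auto
  next
   case False
   have "\<phi> a \<inter> \<phi> b = {}" using disj[OF ap(3) bq(3) False] .
   moreover have "pathfinish (L b q) \<notin> \<phi> a" using L(3)[OF bq(3,4)] stf[of q a] bq ptV ap by blast
   ultimately have "path_image (L a p) \<inter> path_image (L b q) \<subseteq> {pathfinish (L a p)}"
    using L(5)[OF ap(3,4)] L(5)[OF bq(3,4)] by blast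
   thus ?thesis using L(3)[OF ap(3,4)] by blast
  qed
  moreover have "st p \<subseteq> \<Union>(P ` N)" using ap unfolding N_def P_def by auto
  ultimately show "path_image (K f x) \<inter> path_image (K g y) \<subseteq> \<Union>(P ` N)" unfolding ap bq K_def by simp
 qed
 moreover have "parcs G = {(a, b). a \<in> ?M \<and> b \<in> ?M \<and> a ~= b \<and> pt a \<inter> pt b ~= {}}" unfolding arcs pt_def by auto
 moreover have "finite (pt a)" for a using finV unfolding pt_def by simp
 ultimately show ?thesis unfolding map_like_def N_def using assms(2) by (intro exI[of _ pt]) simp
qed

section \<open>The decomposition of Klein, Plotkin and Rao\<close>

lemma conn_path_image:
 assumes "sym R" "\<And>i. i < n ==> (f i, f (Suc i)) \<in> R"
 shows "conn R (f ` {..n})"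
proof -
 let ?P = "f ` {..n}"
 have 1: "(f 0, f i) \<in> (R \<inter> ?P \<times> ?P)\<^sup>*" if "i \<le> n" for i
  using that
 proof (induction i)
  case (Suc i)
  hence "(f i, f (Suc i)) \<in> R \<inter> ?P \<times> ?P" using assms(2)[of i] by auto
  thus ?case using Suc by (auto intro: rtrancl_into_rtrancl)
 qed simp
 have 2: "(f i, f 0) \<in> (R \<inter> ?P \<times> ?P)\<^sup>*" if "i \<le> n" for i by (rule rtrancl_restrict_sym[OF assms(1) 1[OF that]])
 show ?thesis unfolding conn_def using rtrancl_trans[OF 2 1] by auto
qed

lemma conn_Un:
 assumes "conn R A" "conn R B" "x \<in> A" "x \<in> B"
 shows "conn R (A \<union> B)"
proof -
 have 1: "(y, x) \<in> (R \<inter> (A \<union> B) \<times> (A \<union> B))\<^sup>*" "(x, y) \<in> (R \<inter> (A \<union> B) \<times> (A \<union> B))\<^sup>*" if "y \<in> A \<union> B" for y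
  using that assms rtrancl_restrict_mono[of A "A \<union> B" _ _ R] rtrancl_restrict_mono[of B "A \<union> B" _ _ R]
  unfolding conn_def by auto
 show ?thesis unfolding conn_def using rtrancl_trans[OF 1(1) 1(2)] assms by auto
qed

text \<open>One step of the decomposition of Klein, Plotkin and Rao: \<open>H\<close> is what remains of a component in a band of \<open>d\<close>
 breadth-first levels of \<open>G\<close>. Three nested steps with a large remainder produce a \<open>K\<^sub>3\<^sub>,\<^sub>3\<close> minor.\<close>

definition levelled_band :: "('a \<times> 'a) set => nat => 'a set => 'a set => ('a => nat) => 'a => nat => bool" where
 "levelled_band R d G H lev r L \<longleftrightarrow> H \<subseteq> G \<and> r \<in> G \<and>
  (\<forall>x\<in>G. lev x = 0 --> x = r) \<and> (\<forall>x\<in>G. (r, x) \<in> R ^^ lev x) \<and>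
  (\<forall>x\<in>G. 0 < lev x --> (\<exists>y\<in>G. (x, y) \<in> R \<and> Suc (lev y) = lev x)) \<and>
  (\<forall>x\<in>G. \<forall>y\<in>G. (x, y) \<in> R --> lev y \<le> Suc (lev x)) \<and>
  (\<forall>x\<in>H. L \<le> lev x \<and> lev x < L + d) \<and>
  (\<forall>x\<in>H. \<forall>u\<in>H. \<forall>y\<in>G. (u, y) \<in> R --> L \<le> lev y --> lev y \<le> lev x --> y \<in> H)"

lemma levelled_bandD:
 assumes "levelled_band R d G H lev r L"
 shows "H \<subseteq> G" "r \<in> G" "\<And>x. x \<in> G ==> lev x = 0 ==> x = r" "\<And>x. x \<in> G ==> (r, x) \<in> R ^^ lev x"
  "\<And>x. x \<in> G ==> 0 < lev x ==> \<exists>y\<in>G. (x, y) \<in> R \<and> Suc (lev y) = lev x"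
  "\<And>x y. x \<in> G ==> y \<in> G ==> (x, y) \<in> R ==> lev y \<le> Suc (lev x)"
  "\<And>x. x \<in> H ==> L \<le> lev x" "\<And>x. x \<in> H ==> lev x < L + d"
  "\<And>x u y. x \<in> H ==> u \<in> H ==> y \<in> G ==> (u, y) \<in> R ==> L \<le> lev y ==> lev y \<le> lev x ==> y \<in> H"
 using assms unfolding levelled_band_def by blast+

lemma levelled_band_descent:
 assumes lb: "levelled_band R d G H lev r L" and x: "x \<in> G"
 shows "\<exists>f. f 0 = x \<and> (\<forall>i\<le>lev x. f i \<in> G \<and> lev (f i) = lev x - i) \<and> (\<forall>i<lev x. (f i, f (Suc i)) \<in> R)"
proof -
 obtain p where p: "\<And>y. y \<in> G ==> 0 < lev y ==> p y \<in> G \<and> (y, p y) \<in> R \<and> Suc (lev (p y)) = lev y"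
  using levelled_bandD(5)[OF lb] by metis
 define f where "f i = (p ^^ i) x" for i
 have 1: "f i \<in> G \<and> lev (f i) = lev x - i" if "i \<le> lev x" for i
  using that
 proof (induction i)
  case (Suc i)
  thus ?case using p[of "f i"] unfolding f_def by auto
 qed (simp add: f_def x)
 have "(f i, f (Suc i)) \<in> R" if "i < lev x" for i
  using 1[of i] p[of "f i"] that unfolding f_def by auto
 thus ?thesis using 1 by (intro exI[of _ f]) (auto simp: f_def)
qed

lemma levelled_band_lev_near:
 assumes lb: "levelled_band R d G H lev r L" and "sym R" "(x, y) \<in> (R \<inter> G \<times> G) ^^ n"
 shows "lev y \<le> lev x + n \<and> lev x \<le> lev y + n"
 using assms(3)
proof (induction n arbitrary: y)
 case (Suc n)
 then obtain z where z: "(x, z) \<in> (R \<inter> G \<times> G) ^^ n" "(z, y) \<in> R" "z \<in> G" "y \<in> G" by auto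
 hence "lev y \<le> Suc (lev z)" "lev z \<le> Suc (lev y)"
  using levelled_bandD(6)[OF lb] symD[OF assms(2)] by simp_all
 thus ?case using Suc.IH[OF z(1)] by auto
qed simp

lemma conn_lower_levels:
 assumes lb: "levelled_band R d G H lev r L" and s: "sym R" and l: "0 < l"
 shows "conn R {x \<in> G. lev x < l}"
proof -
 let ?B = "{x \<in> G. lev x < l}"
 have 1: "(x, r) \<in> (R \<inter> ?B \<times> ?B)\<^sup>*" if x: "x \<in> ?B" for x
 proof -
  have "x \<in> G" using x by simp
  obtain f where f: "f 0 = x" "\<And>i. i \<le> lev x ==> f i \<in> G \<and> lev (f i) = lev x - i" "\<And>i. i < lev x ==> (f i, f (Suc i)) \<in> R"
   using levelled_band_descent[OF lb \<open>x \<in> G\<close>] by auto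
  have "f (lev x) = r" using f(2)[of "lev x"] levelled_bandD(3)[OF lb] by simp
  have c: "conn R (f ` {..lev x})" using f(3) by (intro conn_path_image[OF s])
  have sub: "f ` {..lev x} \<subseteq> ?B" using f(2) x by force
  have "(f 0, f (lev x)) \<in> (R \<inter> f ` {..lev x} \<times> f ` {..lev x})\<^sup>*" using c unfolding conn_def by auto
  hence "(x, r) \<in> (R \<inter> f ` {..lev x} \<times> f ` {..lev x})\<^sup>*" using f(1) \<open>f (lev x) = r\<close> by simp
  thus ?thesis by (rule rtrancl_restrict_mono[OF sub])
 qed
 have 2: "(r, x) \<in> (R \<inter> ?B \<times> ?B)\<^sup>*" if "x \<in> ?B" for x using rtrancl_restrict_sym[OF s 1[OF that]] .
 have "r \<in> G" "lev r = 0"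
 proof -
  show "r \<in> G" using lb by (simp add: levelled_band_def)
  obtain f where f: "f 0 = r" "\<And>i. i \<le> lev r ==> f i \<in> G \<and> lev (f i) = lev r - i" "\<And>i. i < lev r ==> (f i, f (Suc i)) \<in> R"
   using levelled_band_descent[OF lb \<open>r \<in> G\<close>] by auto
  have "f (lev r) = r" using f(2)[of "lev r"] levelled_bandD(3)[OF lb] by simp
  thus "lev r = 0" using f(2)[of "lev r"] by simp
 qed
 hence "r \<in> ?B" using l by simp
 thus ?thesis unfolding conn_def using rtrancl_trans[OF 1 2] by blast
qed

text \<open>State of the construction of the minor after \<open>i\<close> bands, taken from the
  innermost outwards. \<open>A j\<close> grows from the far vertex \<open>v j\<close> by at most
  \<open>5 * d\<close> steps per band, \<open>w j\<close> is the tip from which it will grow next,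
  and \<open>B k\<close> consists of the low levels cut off at band \<open>k\<close>. The clause
  about walks of length at most \<open>d\<close> keeps the tips away from the sets
  \<open>B k\<close> already built.\<close>

definition kpr_stage :: "('a \<times> 'a) set => nat => (nat => 'a) => 'a set => nat => (nat => 'a set) => (nat => 'a set) => (nat => 'a) => bool" where
 "kpr_stage R d v G i A B w \<longleftrightarrow>
  (\<forall>j<3. A j \<subseteq> G \<and> w j \<in> A j \<and> conn R (A j) \<and> (\<forall>y\<in>A j. \<exists>n\<le>5 * d * i. (v j, y) \<in> R ^^ n)) \<and>
  (\<forall>k<i. B k \<subseteq> G \<and> conn R (B k)) \<and>
  (\<forall>k<i. \<forall>j<3. A j \<inter> B k = {} \<and> (\<exists>a\<in>A j. \<exists>b\<in>B k. (a, b) \<in> R)) \<and>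
  (\<forall>k<i. \<forall>j<3. \<forall>n\<le>d. \<forall>y. (w j, y) \<in> (R \<inter> G \<times> G) ^^ n --> y \<notin> B k) \<and>
  (\<forall>k<i. \<forall>l<k. B k \<inter> B l = {})"

lemma kpr_stageD:
 assumes "kpr_stage R d v G i A B w"
 shows "\<And>j. j < 3 ==> A j \<subseteq> G" "\<And>j. j < 3 ==> w j \<in> A j" "\<And>j. j < 3 ==> conn R (A j)"
  "\<And>j y. j < 3 ==> y \<in> A j ==> \<exists>n\<le>5 * d * i. (v j, y) \<in> R ^^ n"
  "\<And>k. k < i ==> B k \<subseteq> G" "\<And>k. k < i ==> conn R (B k)"
  "\<And>k j. k < i ==> j < 3 ==> A j \<inter> B k = {}" "\<And>k j. k < i ==> j < 3 ==> \<exists>a\<in>A j. \<exists>b\<in>B k. (a, b) \<in> R"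
  "\<And>k j n y. k < i ==> j < 3 ==> n \<le> d ==> (w j, y) \<in> (R \<inter> G \<times> G) ^^ n ==> y \<notin> B k"
  "\<And>k l. k < i ==> l < k ==> B k \<inter> B l = {}"
proof -
 note a = assms[unfolded kpr_stage_def]
 note a1 = conjunct1[OF a] and a2 = conjunct1[OF conjunct2[OF a]] and a3 = conjunct1[OF conjunct2[OF conjunct2[OF a]]]
  and a4 = conjunct1[OF conjunct2[OF conjunct2[OF conjunct2[OF a]]]] and a5 = conjunct2[OF conjunct2[OF conjunct2[OF conjunct2[OF a]]]]
 show "\<And>j. j < 3 ==> A j \<subseteq> G" "\<And>j. j < 3 ==> w j \<in> A j" "\<And>j. j < 3 ==> conn R (A j)"
  "\<And>j y. j < 3 ==> y \<in> A j ==> \<exists>n\<le>5 * d * i. (v j, y) \<in> R ^^ n" using a1 by simp_all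
 show "\<And>k. k < i ==> B k \<subseteq> G" "\<And>k. k < i ==> conn R (B k)" using a2 by simp_all
 show "\<And>k j. k < i ==> j < 3 ==> A j \<inter> B k = {}" "\<And>k j. k < i ==> j < 3 ==> \<exists>a\<in>A j. \<exists>b\<in>B k. (a, b) \<in> R" using a3 by simp_all
 show "\<And>k j n y. k < i ==> j < 3 ==> n \<le> d ==> (w j, y) \<in> (R \<inter> G \<times> G) ^^ n ==> y \<notin> B k" using a4 by blast
 show "\<And>k l. k < i ==> l < k ==> B k \<inter> B l = {}" using a5 by simp
qed

lemma relpow_mono_rel: "S \<subseteq> T ==> S ^^ n \<subseteq> (T :: ('a \<times> 'a) set) ^^ n"
 by (induction n) (auto simp: relcomp_mono)

lemma relpow_path: "(\<And>j. j < i ==> (f j, f (Suc j)) \<in> R) ==> (f 0, f i) \<in> R ^^ i"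
 by (induction i) auto

text \<open>Every tip descends the breadth-first levels of \<open>G\<close> to level
  \<open>L - 4 * d\<close>, right above the new set \<open>Bi\<close> of all lower levels; the next
  tip is left behind at level \<open>L - 2 * d\<close>. From there both \<open>Bi\<close> and
  \<open>H\<close>, which contains the old \<open>B k\<close>, are more than \<open>d\<close> steps
  away. The descent spends at most \<open>d\<close> steps inside \<open>H\<close>, so by the
  invariant it misses the old \<open>B k\<close>.\<close>

lemma kpr_stage_step:
 assumes st: "kpr_stage R d v H i A B w" and lb: "levelled_band R d G H lev r L" and s: "sym R"
  and L: "4 * d < L" and d: "0 < d"
 shows "\<exists>A' B' w'. kpr_stage R d v G (Suc i) A' B' w'"
proof -
 note A = kpr_stageD(1-4)[OF st] and B = kpr_stageD(5,6)[OF st] and AB = kpr_stageD(7,8)[OF st]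
  and far = kpr_stageD(9)[OF st] and BB = kpr_stageD(10)[OF st]
 have HG: "H \<subseteq> G" using lb by (simp add: levelled_band_def)
 have band: "L \<le> lev x" "lev x < L + d" if "x \<in> H" for x using lb that by (auto simp: levelled_band_def)
 have "\<exists>f. f 0 = w j \<and> (\<forall>i \<le> lev (w j). f i \<in> G \<and> lev (f i) = lev (w j) - i) \<and> (\<forall>i < lev (w j). (f i, f (Suc i)) \<in> R)" if "j < 3" for j
 proof -
  have "w j \<in> G" using A[OF that] HG by blast
  thus ?thesis by (rule levelled_band_descent[OF lb])
 qed
 then obtain f where f: "\<And>j. j < 3 ==> f j 0 = w j \<and> (\<forall>i \<le> lev (w j). f j i \<in> G \<and> lev (f j i) = lev (w j) - i) \<and> (\<forall>i < lev (w j). (f j i, f j (Suc i)) \<in> R)"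
  by metis
 have f0: "f j 0 = w j" if "j < 3" for j using f[OF that] by simp
 have fG: "f j i \<in> G" "lev (f j i) = lev (w j) - i" if "j < 3" "i \<le> lev (w j)" for i j using f[OF that(1)] that(2) by auto
 have fR: "(f j i, f j (Suc i)) \<in> R" if "j < 3" "i < lev (w j)" for i j using f[OF that(1)] that(2) by auto
 have wH: "w j \<in> H" if "j < 3" for j using A[OF that] by blast
 have lw: "L \<le> lev (w j)" "lev (w j) < L + d" if "j < 3" for j using band[OF wH[OF that]] by auto
 define e where "e j = lev (w j) - (L - 4 * d)" for j
 have e: "e j \<le> lev (w j)" "lev (w j) - e j = L - 4 * d" "e j \<le> 5 * d" "e j < lev (w j)" if "j < 3" for j using lw[OF that] L by (auto simp: e_def)
 define A' where "A' j = A j \<union> f j ` {..e j}" for j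
 define Bi where "Bi = {x \<in> G. lev x < L - 4 * d}"
 define w' where "w' j = f j (lev (w j) - (L - 2 * d))" for j
 have w': "lev (w' j) = L - 2 * d" "w' j \<in> A' j" if "j < 3" for j
 proof -
  show "lev (w' j) = L - 2 * d" unfolding w'_def using fG(2)[OF that, of "lev (w j) - (L - 2 * d)"] lw[OF that] by simp
  show "w' j \<in> A' j" unfolding w'_def A'_def e_def by auto
 qed
 have fH: "f j i \<in> H \<and> (w j, f j i) \<in> (R \<inter> H \<times> H) ^^ i" if "j < 3" "i \<le> lev (w j) - L" for i j
  using that(2)
 proof (induction i)
  case 0
  thus ?case using f0[OF that(1)] wH[OF that(1)] by simp
 next
  case (Suc i)
  have IH: "f j i \<in> H" "(w j, f j i) \<in> (R \<inter> H \<times> H) ^^ i" using Suc by auto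
  have R: "(f j i, f j (Suc i)) \<in> R" "f j (Suc i) \<in> G" "lev (f j (Suc i)) = lev (w j) - Suc i"
   using fR[OF that(1), of i] fG[OF that(1), of "Suc i"] Suc.prems by auto
  have "L \<le> lev (f j (Suc i))" "lev (f j (Suc i)) \<le> lev (w j)" using R Suc.prems lw[OF that(1)] by auto
  hence "f j (Suc i) \<in> H" using levelled_bandD(9)[OF lb wH[OF that(1)] IH(1) R(2,1)] by blast
  thus ?case using IH R by auto
 qed
 have Bi_H: "Bi \<inter> H = {}" using band(1) L unfolding Bi_def by force
 have path_Bi: "f j i \<notin> Bi" if "j < 3" "i \<le> e j" for i j using fG(2)[OF that(1), of i] e[OF that(1)] that(2) unfolding Bi_def by auto
 have pB: "f j q \<notin> B k" if k: "k < i" and j: "j < 3" and q: "q \<le> e j" for q j k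
 proof
  assume fB: "f j q \<in> B k"
  hence "f j q \<in> H" using B(1)[OF k] by blast
  hence "L \<le> lev (f j q)" using band by blast
  moreover have "lev (f j q) = lev (w j) - q" using fG(2)[OF j, of q] e[OF j] q by simp
  ultimately have "q \<le> lev (w j) - L" using lw[OF j] L by arith
  hence "(w j, f j q) \<in> (R \<inter> H \<times> H) ^^ q" "q \<le> d" using fH[OF j] lw[OF j] by auto
  thus False using far[OF k j] fB by blast
 qed
 show ?thesis
 proof (rule exI[of _ A'], rule exI[of _ "B(i := Bi)"], rule exI[of _ w'])
  have 1: "A' j \<subseteq> G \<and> w' j \<in> A' j \<and> conn R (A' j) \<and> (\<forall>y\<in>A' j. \<exists>n\<le>5 * d * Suc i. (v j, y) \<in> R ^^ n)" if j: "j < 3" for j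
  proof (intro conjI ballI)
   show "A' j \<subseteq> G" using A(1)[OF j] HG fG(1)[OF j] e(1)[OF j] unfolding A'_def by auto
   show "w' j \<in> A' j" using w' j by blast
   have "conn R (f j ` {..e j})" by (rule conn_path_image[OF s]) (use fR[OF j] e[OF j] in auto)
   moreover have "w j \<in> f j ` {..e j}" using f0[OF j] by force
   ultimately show "conn R (A' j)" unfolding A'_def using conn_Un[OF A(3)[OF j] _ A(2)[OF j]] by blast
   fix y assume "y \<in> A' j"
   then consider "y \<in> A j" | k where "k \<le> e j" "y = f j k" unfolding A'_def by auto
   thus "\<exists>n\<le>5 * d * Suc i. (v j, y) \<in> R ^^ n"
   proof cases
    case 1
    then obtain n where "n \<le> 5 * d * i" "(v j, y) \<in> R ^^ n" using A(4)[OF j] by blast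
    thus ?thesis by (intro exI[of _ n]) auto
   next
    case 2
    obtain n where n: "n \<le> 5 * d * i" "(v j, w j) \<in> R ^^ n" using A(4)[OF j A(2)[OF j]] by blast
    have "(f j 0, f j k) \<in> R ^^ k" by (rule relpow_path) (use fR[OF j] 2 e[OF j] in auto)
    hence "(v j, y) \<in> R ^^ (n + k)" using n f0[OF j] 2 by (auto simp: relpow_add)
    moreover have "n + k \<le> 5 * d * Suc i" using n 2 e[OF j] by simp
    ultimately show ?thesis by blast
   qed
  qed
  have 2: "(B(i := Bi)) k \<subseteq> G \<and> conn R ((B(i := Bi)) k)" if "k < Suc i" for k
  proof (cases "k = i")
   case True
   have "conn R Bi" unfolding Bi_def by (rule conn_lower_levels[OF lb s]) (use L in simp)
   thus ?thesis using True by (auto simp: Bi_def)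
  next
   case False
   hence "k < i" using that by simp
   thus ?thesis using B[of k] HG False by auto
  qed
  have 3: "A' j \<inter> (B(i := Bi)) k = {} \<and> (\<exists>a\<in>A' j. \<exists>b\<in>(B(i := Bi)) k. (a, b) \<in> R)" if k: "k < Suc i" and j: "j < 3" for j k
  proof (cases "k = i")
   case True
   have "A' j \<inter> Bi = {}" using A(1)[OF j] Bi_H path_Bi[OF j] unfolding A'_def by blast
   moreover have "f j (e j) \<in> A' j" unfolding A'_def by auto
   moreover have "(f j (e j), f j (Suc (e j))) \<in> R" using fR[OF j] e(4)[OF j] by simp
   moreover have "f j (Suc (e j)) \<in> Bi" unfolding Bi_def using fG[OF j, of "Suc (e j)"] e[OF j] L by auto
   moreover have "(B(i := Bi)) k = Bi" using True by simp
   ultimately show ?thesis by metis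
  next
   case False
   hence "k < i" using k by simp
   thus ?thesis using AB[OF _ j, of k] pB[OF _ j] False unfolding A'_def by auto
  qed
  have 4: "y \<notin> (B(i := Bi)) k" if "k < Suc i" "j < 3" "n \<le> d" "(w' j, y) \<in> (R \<inter> G \<times> G) ^^ n" for k j n y
  proof -
   have "lev y \<le> lev (w' j) + n" "lev (w' j) \<le> lev y + n" using levelled_band_lev_near[OF lb s that(4)] by auto
   hence "lev y < L" "L - 4 * d \<le> lev y" using w'(1)[OF that(2)] that(3) L d by arith+
   hence "y \<notin> H" "y \<notin> Bi" using band(1)[of y] unfolding Bi_def by auto
   thus ?thesis using B(1)[of k] that(1) by auto
  qed
  have 5: "(B(i := Bi)) k \<inter> (B(i := Bi)) l = {}" if "k < Suc i" "l < k" for k l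
   using that BB[of k l] B(1)[of l] Bi_H by (cases "k = i") auto
  show "kpr_stage R d v G (Suc i) A' (B(i := Bi)) w'"
   unfolding kpr_stage_def using 1 2 3 4 5 by blast
 qed
qed

text \<open>The three bands are processed from \<open>G 3\<close> outwards to \<open>G 0\<close> and
  yield the three sets \<open>B k\<close>. Each \<open>A j\<close> stays within
  \<open>15 * d\<close> of \<open>v j\<close>, so distances above \<open>30 * d\<close> make these
  sets disjoint. A band starting at level \<open>4 * d\<close> or below is impossible, since then
  all \<open>v j\<close> would be within \<open>5 * d\<close> of its root.\<close>

lemma kpr_far_triple:
 fixes v :: "nat => 'a" and G :: "nat => 'a set"
 assumes s: "sym R" and free: "k33_free N R" and d: "0 < d" and G0: "G 0 \<subseteq> N"
  and lb: "\<And>i. i < 3 ==> levelled_band R d (G i) (G (Suc i)) (lev i) (r i) (L i)"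
  and v: "\<And>j. j < 3 ==> v j \<in> G 3"
  and far: "\<And>j k n. j < 3 ==> k < 3 ==> j ~= k ==> n \<le> 30 * d ==> (v j, v k) \<notin> R ^^ n"
 shows False
proof -
 have sub: "G (Suc i) \<subseteq> G i" if "i < 3" for i using lb[OF that] by (simp add: levelled_band_def)
 have G3: "G (Suc (Suc (Suc 0))) \<subseteq> G (Suc (Suc 0))" "G (Suc (Suc 0)) \<subseteq> G (Suc 0)" "G (Suc 0) \<subseteq> G 0"
  using sub[of 0] sub[of "Suc 0"] sub[of "Suc (Suc 0)"] by auto
 have v3: "v j \<in> G (Suc (Suc (Suc 0)))" if "j < 3" for j using v[OF that] by (simp add: numeral_eq_Suc)
 have sp: "(y, x) \<in> R ^^ n" if "(x, y) \<in> R ^^ n" for x y n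
  using that
 proof (induction n arbitrary: y)
  case (Suc n)
  then obtain z where "(x, z) \<in> R ^^ n" "(z, y) \<in> R" by auto
  hence "(z, x) \<in> R ^^ n" "(y, z) \<in> R" using Suc.IH s by (auto dest: symD)
  thus ?case by (rule relpow_Suc_I2[rotated])
 qed simp
 have L: "4 * d < L i" if i: "i < 3" for i
 proof (rule ccontr)
  assume "\<not> 4 * d < L i"
  moreover have vi: "v j \<in> G (Suc i)" if "j < 3" for j
  proof -
   consider "i = 0" | "i = Suc 0" | "i = Suc (Suc 0)" using i by linarith
   thus ?thesis using v3[OF that] G3 by cases blast+
  qed
  ultimately have "(r i, v j) \<in> R ^^ lev i (v j)" "lev i (v j) < 5 * d" if "j < 3" for j
   using levelled_bandD(4)[OF lb[OF i], of "v j"] levelled_bandD(8)[OF lb[OF i], of "v j"] levelled_bandD(1)[OF lb[OF i]] that by force+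
  hence "(v 0, r i) \<in> R ^^ lev i (v 0)" "(r i, v 1) \<in> R ^^ lev i (v 1)" "lev i (v 0) < 5 * d" "lev i (v 1) < 5 * d"
   using sp by auto
  hence "(v 0, v 1) \<in> R ^^ (lev i (v 0) + lev i (v 1))" "lev i (v 0) + lev i (v 1) \<le> 30 * d" by (auto simp: relpow_add)
  thus False using far[of 0 1] by auto
 qed
 have st0: "kpr_stage R d v (G (Suc (Suc (Suc 0)))) 0 (\<lambda>j. {v j}) (\<lambda>_. {}) v"
  using v3 unfolding kpr_stage_def by (auto simp: conn_def)
 have lt: "0 < (3::nat)" "Suc 0 < 3" "Suc (Suc 0) < 3" by auto
 obtain A1 B1 w1 where st1: "kpr_stage R d v (G (Suc (Suc 0))) (Suc 0) A1 B1 w1"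
  using kpr_stage_step[OF st0 lb[OF lt(3)] s L[OF lt(3)] d] by blast
 obtain A2 B2 w2 where st2: "kpr_stage R d v (G (Suc 0)) (Suc (Suc 0)) A2 B2 w2"
  using kpr_stage_step[OF st1 lb[OF lt(2)] s L[OF lt(2)] d] by blast
 obtain A B w where "kpr_stage R d v (G 0) (Suc (Suc (Suc 0))) A B w"
  using kpr_stage_step[OF st2 lb[OF lt(1)] s L[OF lt(1)] d] by blast
 hence st: "kpr_stage R d v (G 0) 3 A B w" by (simp add: numeral_eq_Suc)
 have AA: "A j \<inter> A k = {}" if jk: "j < 3" "k < 3" "j ~= k" for j k
 proof (rule equals0I)
  fix y assume "y \<in> A j \<inter> A k"
  then obtain n m where "n \<le> 15 * d" "m \<le> 15 * d" "(v j, y) \<in> R ^^ n" "(v k, y) \<in> R ^^ m"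
   using kpr_stageD(4)[OF st jk(1), of y] kpr_stageD(4)[OF st jk(2), of y] by (auto simp: mult.commute)
  hence "(v j, v k) \<in> R ^^ (n + m)" "n + m \<le> 30 * d" using sp by (auto simp: relpow_add)
  thus False using far[OF jk] by blast
 qed
 have BB: "B j \<inter> B k = {}" if "j < 3" "k < 3" "j ~= k" for j k
 proof (cases "k < j")
  case True thus ?thesis using kpr_stageD(10)[OF st that(1)] by blast
 next
  case False
  hence "j < k" using that by simp
  hence "B k \<inter> B j = {}" using kpr_stageD(10)[OF st that(2)] by blast
  thus ?thesis by blast
 qed
 have "k33_model N R A B" unfolding k33_model_def
 proof (intro conjI allI impI)
  fix i j :: nat assume ij: "i < 3" "j < 3"
  show "A i \<inter> B j = {}" "\<exists>a\<in>A i. \<exists>b\<in>B j. (a, b) \<in> R" using kpr_stageD(7,8)[OF st ij(2,1)] by blast+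
 next
  fix i j :: nat assume ij: "i < 3" "j < 3" "i ~= j"
  thus "A i \<inter> A j = {}" "B i \<inter> B j = {}" using AA BB by blast+
 next
  fix i :: nat assume i: "i < 3"
  show "A i \<subseteq> N" "B i \<subseteq> N" "conn R (A i)" "conn R (B i)" using kpr_stageD(1,3,5,6)[OF st i] G0 by blast+
 qed
 thus False using free unfolding k33_free_def by blast
qed

definition comp_of :: "('a \<times> 'a) set => 'a set => 'a => 'a set" where
 "comp_of R Q c = {y. (c, y) \<in> (R \<inter> Q \<times> Q)\<^sup>*}"

lemma comp_of_eq:
 assumes "sym R" "x \<in> comp_of R Q c" shows "comp_of R Q x = comp_of R Q c"
 using assms rtrancl_restrict_sym[OF assms(1)] unfolding comp_of_def by (auto intro: rtrancl_trans)

lemma comp_of_subset: "c \<in> Q ==> comp_of R Q c \<subseteq> Q"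
 unfolding comp_of_def using rtrancl_restrict_in[of c _ R Q] by auto

lemma comp_of_mono: "P \<subseteq> Q ==> comp_of R P c \<subseteq> comp_of R Q c"
 unfolding comp_of_def using rtrancl_restrict_mono[of P Q] by auto

lemma conn_subset_comp_of: "conn R C ==> c \<in> C ==> C \<subseteq> Q ==> C \<subseteq> comp_of R Q c"
 unfolding conn_def comp_of_def using rtrancl_restrict_mono[of C Q] by blast

text \<open>Cutting only the levels congruent to \<open>2 s\<close> removes vertices of \<open>N1\<close> only, because these levels are even.\<close>

lemma bipartite_band_cut:
 assumes s: "sym R" and bip: "R \<subseteq> N1 \<times> N2 \<union> N2 \<times> N1" "N1 \<inter> N2 = {}" and fin: "finite (Q \<inter> N1)" and D: "0 < D"
 obtains Z where "Z \<subseteq> Q \<inter> N1" "D * card Z \<le> card (Q \<inter> N1)"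
  "\<And>c. c \<in> Q - Z ==> c \<in> N1 ==> \<exists>lev r L. levelled_band R (2 * D) (comp_of R Q c) (comp_of R (Q - Z) c) lev r L"
proof -
 let ?RQ = "R \<inter> Q \<times> Q"
 \<comment> \<open>The root depends on the component alone, so all vertices of a component measure
   their levels from the same place; as it lies in \<open>N1\<close>, exactly the vertices of
   \<open>N1\<close> have even level.\<close>
 define rt where "rt x = (SOME r. r \<in> comp_of R Q x \<inter> N1)" for x
 define lev where "lev x = (LEAST n. (rt x, x) \<in> ?RQ ^^ n)" for x
 have rtc: "rt c \<in> comp_of R Q c" "rt c \<in> N1" if "c \<in> N1" for c
 proof -
  have "c \<in> comp_of R Q c \<inter> N1" using that by (simp add: comp_of_def)
  hence "rt c \<in> comp_of R Q c \<inter> N1" unfolding rt_def by (rule someI)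
  thus "rt c \<in> comp_of R Q c" "rt c \<in> N1" by auto
 qed
 have rteq: "rt x = rt c" if "x \<in> comp_of R Q c" for x c using comp_of_eq[OF s that] unfolding rt_def by simp
 have reach: "(rt c, x) \<in> ?RQ\<^sup>*" if "c \<in> N1" "x \<in> comp_of R Q c" for x c
  using comp_of_eq[OF s rtc(1)[OF that(1)]] that(2) unfolding comp_of_def by blast
 have levc: "(rt c, x) \<in> ?RQ ^^ lev x" "\<And>n. (rt c, x) \<in> ?RQ ^^ n ==> lev x \<le> n" if cx: "c \<in> N1" "x \<in> comp_of R Q c" for x c
 proof -
  obtain n where "(rt c, x) \<in> ?RQ ^^ n" using reach[OF cx] rtrancl_imp_relpow by blast
  thus "(rt c, x) \<in> ?RQ ^^ lev x" unfolding lev_def rteq[OF cx(2)] by (rule LeastI)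
  show "\<And>n. (rt c, x) \<in> ?RQ ^^ n ==> lev x \<le> n" unfolding lev_def rteq[OF cx(2)] by (rule Least_le)
 qed
 have parity: "(x \<in> N1 \<longleftrightarrow> even n)" if "(q, x) \<in> ?RQ ^^ n" "q \<in> N1" for q x n
  using that(1)
 proof (induction n arbitrary: x)
  case (Suc n)
  then obtain z where z: "(q, z) \<in> ?RQ ^^ n" "(z, x) \<in> R" by auto
  hence "z \<in> N1 \<and> x \<in> N2 \<or> z \<in> N2 \<and> x \<in> N1" using bip(1) by blast
  thus ?case using Suc.IH[OF z(1)] bip(2) by auto
 qed (use that in simp)
 define Z where "Z t = {x \<in> Q \<inter> N1. lev x mod (2 * D) = 2 * t}" for t
 have "\<exists>t<D. D * card (Z t) \<le> card (Q \<inter> N1)"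
 proof (rule ccontr)
  assume "\<not> ?thesis"
  hence big: "card (Q \<inter> N1) < D * card (Z t)" if "t < D" for t using that by force
  have "(\<Sum>t<D. card (Z t)) = card (\<Union>t<D. Z t)"
  proof (rule card_UN_disjoint[symmetric])
   show "\<forall>t\<in>{..<D}. finite (Z t)"
   proof
    show "finite (Z t)" for t by (rule finite_subset[OF _ fin]) (auto simp: Z_def)
   qed
   show "\<forall>t\<in>{..<D}. \<forall>u\<in>{..<D}. t ~= u --> Z t \<inter> Z u = {}" unfolding Z_def by auto
  qed simp
  also have "\<dots> \<le> card (Q \<inter> N1)" using fin by (intro card_mono) (auto simp: Z_def)
  finally have "D * (\<Sum>t<D. card (Z t)) \<le> D * card (Q \<inter> N1)" by simp
  moreover have "(\<Sum>t<D. card (Q \<inter> N1)) < (\<Sum>t<D. D * card (Z t))" using big D by (intro sum_strict_mono) auto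
  ultimately show False by (simp add: sum_distrib_left)
 qed
 then obtain t where t: "t < D" "D * card (Z t) \<le> card (Q \<inter> N1)" by blast
 show ?thesis
 proof (rule that[of "Z t"])
  show "Z t \<subseteq> Q \<inter> N1" by (auto simp: Z_def)
  show "D * card (Z t) \<le> card (Q \<inter> N1)" by (rule t)
  fix c assume c: "c \<in> Q - Z t" "c \<in> N1"
  let ?G = "comp_of R Q c" and ?H = "comp_of R (Q - Z t) c"
  have GQ: "?G \<subseteq> Q" using comp_of_subset[of c Q R] c by blast
  have HQ: "?H \<subseteq> Q - Z t" using comp_of_subset[of c "Q - Z t" R] c by blast
  have HG: "?H \<subseteq> ?G" by (rule comp_of_mono) blast
  \<comment> \<open>The shift by \<open>2 * D - 2 * t\<close> moves the cut levels to the multiples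
    of \<open>2 * D\<close>, so that division by \<open>2 * D\<close> numbers the bands.\<close>
  define a where "a x = lev x + (2 * D - 2 * t)" for x
  have edge: "lev y \<le> Suc (lev x)" if "x \<in> ?G" "y \<in> ?G" "(x, y) \<in> R" for x y
  proof -
   have "(rt c, x) \<in> ?RQ ^^ lev x" using levc(1)[OF c(2) that(1)] .
   moreover have "(x, y) \<in> ?RQ" using that GQ by auto
   ultimately have "(rt c, y) \<in> ?RQ ^^ Suc (lev x)" by auto
   thus ?thesis using levc(2)[OF c(2) that(2)] by blast
  qed
  have aZ: "a x mod (2 * D) ~= 0 \<longleftrightarrow> x \<notin> Z t" if x: "x \<in> ?G" for x
  proof -
   have "even (lev x) \<longleftrightarrow> x \<in> N1" using parity[OF levc(1)[OF c(2) x] rtc(2)[OF c(2)]] by simp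
   moreover have "a x mod (2 * D) = 0 \<longleftrightarrow> lev x mod (2 * D) = 2 * t"
   proof -
    have "a x mod (2 * D) = (lev x mod (2 * D) + (2 * D - 2 * t)) mod (2 * D)" by (simp add: a_def mod_simps)
    moreover have "(p + (2 * D - 2 * t)) mod (2 * D) = 0 \<longleftrightarrow> p = 2 * t" if p: "p < 2 * D" for p
    proof (cases "p < 2 * t")
     case True
     hence "(p + (2 * D - 2 * t)) mod (2 * D) = p + (2 * D - 2 * t)" using t(1) by (intro mod_less) linarith
     thus ?thesis using True t(1) by simp
    next
     case False
     hence "p + (2 * D - 2 * t) = (p - 2 * t) + 2 * D" using t(1) by simp
     hence "(p + (2 * D - 2 * t)) mod (2 * D) = (p - 2 * t) mod (2 * D)" by (simp only: mod_add_self2)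
     also have "\<dots> = p - 2 * t" using p by (intro mod_less) linarith
     finally have "(p + (2 * D - 2 * t)) mod (2 * D) = p - 2 * t" .
     thus ?thesis using False by auto
    qed
    moreover have "lev x mod (2 * D) < 2 * D" using D by simp
    ultimately show ?thesis by simp
   qed
   moreover have "even (lev x)" if "lev x mod (2 * D) = 2 * t"
    using that by (metis dvd_mod_iff dvd_triv_left)
   ultimately show ?thesis using x GQ unfolding Z_def by auto
  qed
  define q where "q = a c div (2 * D)"
  have cG: "c \<in> ?G" "c \<in> ?H" by (auto simp: comp_of_def)
  have same: "a y div (2 * D) = a x div (2 * D)" if "x \<in> ?H" "y \<in> ?H" "(x, y) \<in> R" for x y
  proof -
   have xy: "x \<in> ?G" "y \<in> ?G" "x \<notin> Z t" "y \<notin> Z t" using that HG HQ by auto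
   have "lev y \<le> Suc (lev x)" "lev x \<le> Suc (lev y)" using edge xy that(3) symD[OF s] by auto
   hence "a y = a x \<or> a y = Suc (a x) \<or> a x = Suc (a y)" unfolding a_def by linarith
   moreover have "a x mod (2 * D) ~= 0" "a y mod (2 * D) ~= 0" using aZ xy by auto
   ultimately show ?thesis by (metis div_Suc mod_Suc)
  qed
  have qH: "a x div (2 * D) = q" if "x \<in> ?H" for x
  proof -
   have "(c, x) \<in> (R \<inter> (Q - Z t) \<times> (Q - Z t))\<^sup>*" using that by (simp add: comp_of_def)
   thus ?thesis
   proof (induction rule: rtrancl_induct)
    case base thus ?case by (simp add: q_def)
   next
    case (step y z)
    hence "y \<in> ?H" "z \<in> ?H" unfolding comp_of_def using rtrancl_into_rtrancl[OF step(1,2)] by simp_all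
    thus ?case using same[of y z] step by auto
   qed
  qed
  \<comment> \<open>The first level of band \<open>q\<close>. For \<open>q = 0\<close> the truncated
    subtraction gives level 0, because \<open>2 * D - 2 * t\<close> is positive.\<close>
  define L where "L = q * (2 * D) + 1 - (2 * D - 2 * t)"
  have band: "q * (2 * D) < a x" "a x < (q + 1) * (2 * D)" if "x \<in> ?H" for x
  proof -
   have "a x mod (2 * D) ~= 0" using aZ[of x] that HG HQ by auto
   moreover have "a x = q * (2 * D) + a x mod (2 * D)" using qH[OF that] by (metis div_mult_mod_eq)
   moreover have "a x mod (2 * D) < 2 * D" using D by simp
   ultimately show "q * (2 * D) < a x" "a x < (q + 1) * (2 * D)" by (auto simp: algebra_simps)
  qed
  have "levelled_band R (2 * D) ?G ?H lev (rt c) L"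
   unfolding levelled_band_def
  proof (intro conjI ballI impI)
   show "?H \<subseteq> ?G" "rt c \<in> ?G" using HG rtc c by auto
   fix x assume x: "x \<in> ?G"
   have lx: "(rt c, x) \<in> ?RQ ^^ lev x" using levc(1)[OF c(2) x] .
   show "lev x = 0 ==> x = rt c" using lx by simp
   show "(rt c, x) \<in> R ^^ lev x" using lx relpow_mono_rel[of ?RQ R] by auto
   show "\<exists>y\<in>?G. (x, y) \<in> R \<and> Suc (lev y) = lev x" if pos: "0 < lev x"
   proof -
    obtain n where n: "lev x = Suc n" using pos by (cases "lev x") auto
    then obtain y where y: "(rt c, y) \<in> ?RQ ^^ n" "(y, x) \<in> ?RQ" using lx by auto
    have "(c, rt c) \<in> ?RQ\<^sup>*" using rtc(1)[OF c(2)] by (simp add: comp_of_def)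
    hence yG: "y \<in> ?G" unfolding comp_of_def using relpow_imp_rtrancl[OF y(1)] by (auto intro: rtrancl_trans)
    have "lev y \<le> n" using levc(2)[OF c(2) yG y(1)] .
    moreover have "lev x \<le> Suc (lev y)" using edge[OF yG x] y by auto
    ultimately show ?thesis using n y yG symD[OF s] by auto
   qed
   show "lev y \<le> Suc (lev x)" if "y \<in> ?G" "(x, y) \<in> R" for y using edge[OF x that] .
  next
   fix x assume x: "x \<in> ?H"
   show "L \<le> lev x" "lev x < L + 2 * D" using band[OF x] t(1) unfolding L_def a_def by (auto simp: algebra_simps)
   fix u y assume u: "u \<in> ?H" and y: "y \<in> ?G" "(u, y) \<in> R" "L \<le> lev y" "lev y \<le> lev x"
   have "a y < (q + 1) * (2 * D)" using band(2)[OF x] y(4) unfolding a_def by simp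
   moreover have "q * (2 * D) < a y" using y(3) t(1) unfolding L_def a_def by auto
   ultimately have "a y mod (2 * D) ~= 0"
   proof -
    assume *: "a y < (q + 1) * (2 * D)" "q * (2 * D) < a y"
    show ?thesis
    proof
     assume "a y mod (2 * D) = 0"
     then obtain k where k: "a y = (2 * D) * k" by (auto elim: dvdE)
     hence "(2 * D) * k < (2 * D) * (q + 1)" "(2 * D) * q < (2 * D) * k" using * by (simp_all only: mult.commute)
     hence "k < q + 1" "q < k" by (simp_all only: nat_mult_less_cancel_disj)
     thus False by simp
    qed
   qed
   hence "y \<in> Q - Z t" using aZ[OF y(1)] y(1) GQ by auto
   moreover have "u \<in> Q - Z t" using u HQ by auto
   ultimately have "(u, y) \<in> R \<inter> (Q - Z t) \<times> (Q - Z t)" using y by auto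
   thus "y \<in> ?H" using u unfolding comp_of_def by (auto intro: rtrancl_into_rtrancl)
  qed
  thus "\<exists>lev r L. levelled_band R (2 * D) ?G ?H lev r L" by blast
 qed
qed

lemma card_relpow_ball:
 assumes fin: "finite X" and deg: "\<And>v. v \<in> X ==> card (E `` {v} \<inter> X) < D" and v: "v \<in> X"
 shows "card {u. \<exists>k\<le>n. (v, u) \<in> (E \<inter> X \<times> X) ^^ k} \<le> D ^ n \<and> {u. \<exists>k\<le>n. (v, u) \<in> (E \<inter> X \<times> X) ^^ k} \<subseteq> X"
proof (induction n)
 case 0
 have "{u. \<exists>k\<le>0. (v, u) \<in> (E \<inter> X \<times> X) ^^ k} = {v}" by auto
 thus ?case using v by simp
next
 case (Suc n)
 let ?S = "\<lambda>n. {u. \<exists>k\<le>n. (v, u) \<in> (E \<inter> X \<times> X) ^^ k}"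
 have sub: "?S (Suc n) \<subseteq> (\<Union>u\<in>?S n. insert u (E `` {u} \<inter> X))"
 proof
  fix u assume "u \<in> ?S (Suc n)"
  then obtain k where k: "k \<le> Suc n" "(v, u) \<in> (E \<inter> X \<times> X) ^^ k" by blast
  show "u \<in> (\<Union>u\<in>?S n. insert u (E `` {u} \<inter> X))"
  proof (cases "k \<le> n")
   case True thus ?thesis using k by blast
  next
   case False
   hence "k = Suc n" using k by simp
   then obtain z where "(v, z) \<in> (E \<inter> X \<times> X) ^^ n" "(z, u) \<in> E \<inter> X \<times> X" using k by auto
   thus ?thesis by blast
  qed
 qed
 have SX: "?S n \<subseteq> X" using Suc by blast
 hence finS: "finite (?S n)" using fin finite_subset by blast
 have fX: "finite (E `` {u} \<inter> X)" for u using fin by simp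
 have "card (?S (Suc n)) \<le> card (\<Union>u\<in>?S n. insert u (E `` {u} \<inter> X))" using sub finS fX by (intro card_mono) auto
 also have "\<dots> \<le> (\<Sum>u\<in>?S n. card (insert u (E `` {u} \<inter> X)))" by (rule card_UN_le[OF finS])
 also have "\<dots> \<le> (\<Sum>u\<in>?S n. D)"
 proof (rule sum_mono)
  fix u assume "u \<in> ?S n"
  hence "card (E `` {u} \<inter> X) < D" using deg SX by blast
  thus "card (insert u (E `` {u} \<inter> X)) \<le> D" using card_insert_le_m1[of D "E `` {u} \<inter> X" u] by (simp add: card_insert_if fX)
 qed
 also have "\<dots> \<le> D ^ Suc n" using Suc by (simp add: mult.commute)
 finally have "card (?S (Suc n)) \<le> D ^ Suc n" .
 moreover have "?S (Suc n) \<subseteq> X" using sub SX by blast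
 ultimately show ?case by blast
qed

text \<open>Three rounds each delete at most a fraction \<open>1 / (3 * m)\<close> of
  \<open>X\<close>, with bands of height \<open>6 * m\<close> in the incidence graph. A piece that
  remains contains no three nations at pairwise distance above \<open>30 * (6 * m)\<close>, which is
  \<open>180 * m\<close>, so two balls of this radius cover it. Walks in the incidence graph shorten
  to walks between nations, where the degree bound limits a ball to \<open>D ^ (180 * m)\<close>
  members.\<close>

lemma map_like_hyperfinite:
 fixes pt :: "'a => 'b set"
 assumes ml: "map_like M E pt" and X: "X \<subseteq> M" and deg: "\<And>v. v \<in> X ==> card (E `` {v} \<inter> X) < D" and m: "0 < m"
 shows "\<exists>B\<subseteq>X. m * card B \<le> card X \<and> (\<forall>C. C \<subseteq> X - B --> conn E C --> card C \<le> 2 * D ^ (180 * m))"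
proof -
 have E: "E = {(a, b). a \<in> M \<and> b \<in> M \<and> a ~= b \<and> pt a \<inter> pt b ~= {}}" and fM: "finite M"
  and W: "k33_free (Inl ` M \<union> Inr ` (\<Union>(pt ` M))) (incidence M pt \<union> (incidence M pt)\<inverse>)"
  using ml by (auto simp: map_like_def)
 define N1 :: "('a + 'b) set" where "N1 = Inl ` X"
 define N2 :: "('a + 'b) set" where "N2 = Inr ` (\<Union>(pt ` X))"
 define R where "R = incidence X pt \<union> (incidence X pt)\<inverse>"
 have s: "sym R" by (auto simp: R_def sym_def)
 have bip: "R \<subseteq> N1 \<times> N2 \<union> N2 \<times> N1" "N1 \<inter> N2 = {}" by (auto simp: R_def N1_def N2_def incidence_def)
 have free: "k33_free (N1 \<union> N2) R"
  by (rule k33_free_subset[OF W]) (use X in \<open>auto simp: R_def N1_def N2_def incidence_def\<close>)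
 have finX: "finite X" using X fM finite_subset by blast
 have fin: "finite (Q \<inter> N1)" for Q using finX by (simp add: N1_def)
 have D3: "0 < 3 * m" using m by simp
 let ?d = "2 * (3 * m)"
 define Q0 where "Q0 = N1 \<union> N2"
 obtain Z0 where Z0: "Z0 \<subseteq> Q0 \<inter> N1" "3 * m * card Z0 \<le> card (Q0 \<inter> N1)"
  "\<And>c. c \<in> Q0 - Z0 ==> c \<in> N1 ==> \<exists>lev r L. levelled_band R ?d (comp_of R Q0 c) (comp_of R (Q0 - Z0) c) lev r L"
  using bipartite_band_cut[OF s bip fin[of Q0] D3] by metis
 define Q1 where "Q1 = Q0 - Z0"
 obtain Z1 where Z1: "Z1 \<subseteq> Q1 \<inter> N1" "3 * m * card Z1 \<le> card (Q1 \<inter> N1)"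
  "\<And>c. c \<in> Q1 - Z1 ==> c \<in> N1 ==> \<exists>lev r L. levelled_band R ?d (comp_of R Q1 c) (comp_of R (Q1 - Z1) c) lev r L"
  using bipartite_band_cut[OF s bip fin[of Q1] D3] by metis
 define Q2 where "Q2 = Q1 - Z1"
 obtain Z2 where Z2: "Z2 \<subseteq> Q2 \<inter> N1" "3 * m * card Z2 \<le> card (Q2 \<inter> N1)"
  "\<And>c. c \<in> Q2 - Z2 ==> c \<in> N1 ==> \<exists>lev r L. levelled_band R ?d (comp_of R Q2 c) (comp_of R (Q2 - Z2) c) lev r L"
  using bipartite_band_cut[OF s bip fin[of Q2] D3] by metis
 define Q3 where "Q3 = Q2 - Z2"
 define B where "B = {x \<in> X. Inl x \<in> Z0 \<union> Z1 \<union> Z2}"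
 have cardN1: "card N1 = card X" unfolding N1_def by (simp add: card_image)
 have finZ: "finite Z0" "finite Z1" "finite Z2" using Z0(1) Z1(1) Z2(1) fin finite_subset by blast+
 have "card B = card (Inl ` B :: ('a + 'b) set)" by (simp add: card_image)
 also have "\<dots> \<le> card (Z0 \<union> Z1 \<union> Z2)" using finZ by (intro card_mono) (auto simp: B_def)
 also have "\<dots> \<le> card Z0 + card Z1 + card Z2" by (meson add_mono card_Un_le le_trans order_refl)
 finally have cB: "card B \<le> card Z0 + card Z1 + card Z2" .
 have "card (Q \<inter> N1) \<le> card X" for Q using cardN1 card_mono[of N1 "Q \<inter> N1"] finX by (simp add: N1_def)
 hence "3 * m * card Z0 \<le> card X" "3 * m * card Z1 \<le> card X" "3 * m * card Z2 \<le> card X"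
  using Z0(2) Z1(2) Z2(2) le_trans by blast+
 hence "3 * m * (card Z0 + card Z1 + card Z2) \<le> 3 * card X" by (simp add: algebra_simps)
 moreover have "3 * m * card B \<le> 3 * m * (card Z0 + card Z1 + card Z2)" using cB by simp
 ultimately have "3 * m * card B \<le> 3 * card X" by linarith
 hence "3 * (m * card B) \<le> 3 * card X" by (simp only: mult.assoc)
 hence mB: "m * card B \<le> card X" by simp
 have small: "card C \<le> 2 * D ^ (180 * m)" if C: "C \<subseteq> X - B" "conn E C" for C
 proof -
  define C' where "C' = (\<Union>a\<in>C. insert (Inl a) (Inr ` pt a))"
  have CX: "C \<subseteq> X" using C by blast
  have conn': "conn R C'" unfolding C'_def
  proof (rule conn_Union_image[OF C(2)])
   fix x assume "x \<in> C"
   thus "conn R (insert (Inl x) (Inr ` pt x))" unfolding R_def using CX by (intro conn_nation_with_points) auto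
  next
   fix x y assume xy: "x \<in> C" "y \<in> C" "(x, y) \<in> E"
   then obtain p where "p \<in> pt x" "p \<in> pt y" unfolding E by auto
   thus "\<exists>a\<in>insert (Inl x) (Inr ` pt x). \<exists>b\<in>insert (Inl y) (Inr ` pt y). (a, b) \<in> R"
    using xy CX unfolding R_def incidence_def by (intro bexI[of _ "Inr p"] bexI[of _ "Inl y"]) auto
  qed
  have C'Q: "C' \<subseteq> Q3"
  proof
   fix z assume "z \<in> C'"
   then obtain a where a: "a \<in> C" "z \<in> insert (Inl a) (Inr ` pt a)" unfolding C'_def by blast
   have "z \<in> Q0" using a CX unfolding Q0_def N1_def N2_def by auto
   moreover have "z \<notin> Z0 \<union> Z1 \<union> Z2"
   proof (cases "z = Inl a")
    case True
    thus ?thesis using a C(1) unfolding B_def by blast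
   next
    case False
    thus ?thesis using a Z0(1) Z1(1) Z2(1) unfolding N1_def by auto
   qed
   ultimately show "z \<in> Q3" unfolding Q3_def Q2_def Q1_def by blast
  qed
  obtain c0 where c0: "c0 \<in> C" using C(2) by (auto simp: conn_def)
  let ?c = "Inl c0 :: 'a + 'b"
  have cC: "?c \<in> C'" using c0 unfolding C'_def by blast
  hence cQ: "?c \<in> Q3" using C'Q by blast
  have cN: "?c \<in> N1" using c0 CX unfolding N1_def by blast
  define G where "G i = comp_of R (if i = 0 then Q0 else if i = 1 then Q1 else if i = 2 then Q2 else Q3) ?c" for i :: nat
  have CG: "C' \<subseteq> G 3" unfolding G_def using conn_subset_comp_of[OF conn' cC C'Q] by simp
  have "\<exists>lev r L. levelled_band R ?d (G i) (G (Suc i)) lev r L" if i3: "i < 3" for i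
  proof -
   consider "i = 0" | "i = 1" | "i = 2" using i3 by linarith
   thus ?thesis
   proof cases
    case 1 thus ?thesis using Z0(3)[of ?c] cQ cN unfolding G_def Q3_def Q2_def Q1_def by simp
   next
    case 2 thus ?thesis using Z1(3)[of ?c] cQ cN unfolding G_def Q3_def Q2_def by simp
   next
    case 3 thus ?thesis using Z2(3)[of ?c] cQ cN unfolding G_def Q3_def by simp
   qed
  qed
  then obtain lev r L where lb: "\<And>i. i < 3 ==> levelled_band R ?d (G i) (G (Suc i)) (lev i) (r i) (L i)" by metis
  have G0: "G 0 \<subseteq> N1 \<union> N2" unfolding G_def using comp_of_subset[of ?c Q0 R] cQ unfolding Q0_def[symmetric] Q3_def Q2_def Q1_def by auto
  let ?far = "\<lambda>a b. \<forall>n\<le>180 * m. (Inl a, Inl b) \<notin> R ^^ n"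
  have no3: False if abc: "a \<in> C" "b \<in> C" "c \<in> C" "?far a b" "?far b a" "?far a c" "?far c a" "?far b c" "?far c b" for a b c
  proof -
   define v :: "nat => 'a + 'b" where "v j = (if j = 0 then Inl a else if j = 1 then Inl b else Inl c)" for j
   show False
   proof (rule kpr_far_triple[OF s free _ G0 lb, of v])
    show "0 < ?d" using m by simp
    show "v j \<in> G 3" if "j < 3" for j using abc CG unfolding v_def C'_def by auto
    fix j k n :: nat assume jk: "j < 3" "k < 3" "j ~= k" "n \<le> 30 * ?d"
    have "n \<le> 180 * m" using jk by simp
    moreover have "j = 0 \<or> j = 1 \<or> j = 2" "k = 0 \<or> k = 1 \<or> k = 2" using jk by auto
    ultimately show "(v j, v k) \<notin> R ^^ n" using abc jk(3) unfolding v_def by auto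
   qed
  qed
  have sp: "(y, x) \<in> R ^^ n" if "(x, y) \<in> R ^^ n" for x y n
   using that
  proof (induction n arbitrary: y)
   case (Suc n)
   then obtain z where "(x, z) \<in> R ^^ n" "(z, y) \<in> R" by auto
   hence "(z, x) \<in> R ^^ n" "(y, z) \<in> R" using Suc.IH s by (auto dest: symD)
   thus ?case by (rule relpow_Suc_I2[rotated])
  qed simp
  hence farsym: "?far b a" if "?far a b" for a b using that by blast
  define S where "S a = {u. \<exists>k\<le>180 * m. (a, u) \<in> (E \<inter> X \<times> X) ^^ k}" for a
  have toE: "(case y of Inl b => \<exists>k\<le>n. (a, b) \<in> (E \<inter> X \<times> X) ^^ k | Inr p => \<exists>b k. k \<le> n \<and> (a, b) \<in> (E \<inter> X \<times> X) ^^ k \<and> p \<in> pt b \<and> b \<in> X)"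
   if "(Inl a, y) \<in> R ^^ n" for a y n
   using that
  proof (induction n arbitrary: y)
   case 0
   thus ?case by auto
  next
   case (Suc n)
   then obtain z where z: "(Inl a, z) \<in> R ^^ n" "(z, y) \<in> R" by auto
   show ?case
   proof (cases z)
    case (Inl b)
    then obtain p where p: "y = Inr p" "p \<in> pt b" "b \<in> X" using z(2) unfolding R_def incidence_def by auto
    obtain k where "k \<le> n" "(a, b) \<in> (E \<inter> X \<times> X) ^^ k" using Suc.IH[OF z(1)] Inl by auto
    thus ?thesis using p by (auto intro!: exI[of _ b] exI[of _ k])
   next
    case (Inr p)
    then obtain b' where b': "y = Inl b'" "p \<in> pt b'" "b' \<in> X" using z(2) unfolding R_def incidence_def by auto
    obtain b k where b: "k \<le> n" "(a, b) \<in> (E \<inter> X \<times> X) ^^ k" "p \<in> pt b" "b \<in> X" using Suc.IH[OF z(1)] Inr by auto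
    show ?thesis
    proof (cases "b = b'")
     case True
     hence "(a, b') \<in> (E \<inter> X \<times> X) ^^ k" "k \<le> Suc n" using b by auto
     thus ?thesis unfolding b'(1) sum.case by blast
    next
     case False
     hence "(b, b') \<in> E \<inter> X \<times> X" using b b' X unfolding E by auto
     hence "(a, b') \<in> (E \<inter> X \<times> X) ^^ Suc k" using b by auto
     thus ?thesis using b b' by (auto intro!: exI[of _ "Suc k"] simp del: relpow.simps)
    qed
   qed
  qed
  have near: "b \<in> S a" if nf: "\<not> ?far a b" for a b
  proof -
   obtain n where n: "n \<le> 180 * m" "(Inl a, Inl b) \<in> R ^^ n" using nf by blast
   then obtain k where "k \<le> n" "(a, b) \<in> (E \<inter> X \<times> X) ^^ k" using toE[OF n(2)] by auto
   moreover from this have "k \<le> 180 * m" using n by simp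
   ultimately show ?thesis unfolding S_def by blast
  qed
  have cS: "card (S a) \<le> D ^ (180 * m)" "finite (S a)" if "a \<in> X" for a
   using card_relpow_ball[OF finX deg that, of "180 * m"] finite_subset[OF _ finX] unfolding S_def by blast+
  \<comment> \<open>The second centre is a nation far from \<open>c0\<close>, if there is one; a
    nation far from both centres would complete a forbidden triple.\<close>
  obtain b where b: "b \<in> C" "C \<subseteq> S c0 \<union> S b"
  proof (cases "\<exists>b\<in>C. ?far c0 b")
   case True
   then obtain b where b: "b \<in> C" "?far c0 b" by blast
   have "x \<in> S c0 \<union> S b" if "x \<in> C" for x
   proof (rule ccontr)
    assume "x \<notin> S c0 \<union> S b"
    hence "?far c0 x" "?far b x" using near by blast+
    thus False using no3[OF c0 b(1) that b(2) farsym[OF b(2)]] farsym by blast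
   qed
   thus ?thesis using that b(1) by blast
  next
   case False
   hence "C \<subseteq> S c0" using near by blast
   thus ?thesis using that[of c0] c0 by blast
  qed
  have "card C \<le> card (S c0 \<union> S b)" using b cS c0 CX by (intro card_mono) auto
  also have "\<dots> \<le> card (S c0) + card (S b)" by (rule card_Un_le)
  also have "\<dots> \<le> 2 * D ^ (180 * m)" using cS(1)[of c0] cS(1)[of b] b(1) c0 CX by fastforce
  finally show ?thesis .
 qed
 have "B \<subseteq> X" by (auto simp: B_def)
 thus ?thesis using mB small by blast
qed

section \<open>Tame graphs\<close>

text \<open>Beyond finiteness and simplicity, the three counting clauses are all that is used of the
  geometry. The last one is hyperfiniteness in bounded degree, with an explicit size of the pieces
  because the machine has to compute the size of its moves; the base \<open>D + 2\<close> is at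
  least 2 and absorbs constant and polynomial factors.\<close>

definition tame :: "nat => 'a set => ('a \<times> 'a) set => bool" where
 "tame c V E \<longleftrightarrow> finite V \<and> E \<subseteq> V \<times> V \<and> sym E \<and> irrefl E \<and>
  (\<forall>I J. I \<subseteq> V --> J \<subseteq> V --> I \<inter> J = {} --> E \<inter> I \<times> I = {} --> card (E \<inter> I \<times> J) \<le> c * (card I + card J)) \<and>
  (\<forall>I J. I \<subseteq> V --> J \<subseteq> V --> I \<inter> J = {} --> (\<forall>i\<in>I. E `` {i} \<subseteq> J) --> card ((\<lambda>i. E `` {i}) ` I) \<le> c * (card J + 1)) \<and>
  (\<forall>X D m. X \<subseteq> V --> (\<forall>v\<in>X. card (E `` {v} \<inter> X) < D) --> 0 < m -->
   (\<exists>B\<subseteq>X. m * card B \<le> card X \<and> (\<forall>C. C \<subseteq> X - B --> conn E C --> card C \<le> (D + 2) ^ (c * m))))"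

lemma map_graph_tame:
 assumes "map_graph G" "finite (pverts G)"
 shows "tame (2 ^ 40 + 20) (pverts G) (parcs G)"
proof -
 obtain pt :: "'a => (real^2) set" where ml: "map_like (pverts G) (parcs G) pt" using map_graph_map_like[OF assms] by blast
 have E: "parcs G = {(a, b). a \<in> pverts G \<and> b \<in> pverts G \<and> a ~= b \<and> pt a \<inter> pt b ~= {}}" using ml unfolding map_like_def by blast
 have 0: "parcs G \<subseteq> pverts G \<times> pverts G" "sym (parcs G)" "irrefl (parcs G)" unfolding E by (auto simp: sym_def irrefl_def)
 have 1: "card (parcs G \<inter> I \<times> J) \<le> (2 ^ 40 + 20) * (card I + card J)"
  if "I \<subseteq> pverts G" "J \<subseteq> pverts G" "I \<inter> J = {}" "parcs G \<inter> I \<times> I = {}" for I J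
  using map_like_bipartite_edges[OF ml that] by (rule le_trans) simp
 have 2: "\<exists>B\<subseteq>X. m * card B \<le> card X \<and> (\<forall>C. C \<subseteq> X - B --> conn (parcs G) C --> card C \<le> (D + 2) ^ ((2 ^ 40 + 20) * m))"
  if X: "X \<subseteq> pverts G" "\<forall>v\<in>X. card (parcs G `` {v} \<inter> X) < D" "0 < m" for X D m
 proof -
  obtain B where B: "B \<subseteq> X" "m * card B \<le> card X" "\<And>C. C \<subseteq> X - B ==> conn (parcs G) C ==> card C \<le> 2 * D ^ (180 * m)"
   using map_like_hyperfinite[OF ml X(1) _ X(3), of D] X(2) by blast
  have "2 * D ^ (180 * m) \<le> (D + 2) ^ ((2 ^ 40 + 20) * m)"
  proof -
   have "2 * D ^ (180 * m) \<le> (D + 2) * (D + 2) ^ (180 * m)" by (intro mult_mono power_mono) auto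
   also have "\<dots> = (D + 2) ^ (1 + 180 * m)" by simp
   also have "\<dots> \<le> (D + 2) ^ ((2 ^ 40 + 20) * m)" using X(3) by (intro power_increasing) auto
   finally show ?thesis .
  qed
  thus ?thesis using B by (meson le_trans)
 qed
 show ?thesis unfolding tame_def
 proof (intro conjI allI impI)
  show "\<exists>B\<subseteq>X. m * card B \<le> card X \<and> (\<forall>C. C \<subseteq> X - B --> conn (parcs G) C --> card C \<le> (D + 2) ^ ((2 ^ 40 + 20) * m))"
   if "X \<subseteq> pverts G" "\<forall>v\<in>X. card (parcs G `` {v} \<inter> X) < D" "0 < m" for X D m by (rule 2[OF that])
  show "card (parcs G \<inter> I \<times> J) \<le> (2 ^ 40 + 20) * (card I + card J)"
   if "I \<subseteq> pverts G" "J \<subseteq> pverts G" "I \<inter> J = {}" "parcs G \<inter> I \<times> I = {}" for I J by (rule 1[OF that])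
  show "card ((\<lambda>i. parcs G `` {i}) ` I) \<le> (2 ^ 40 + 20) * (card J + 1)"
   if "I \<subseteq> pverts G" "J \<subseteq> pverts G" "I \<inter> J = {}" "\<forall>i\<in>I. parcs G `` {i} \<subseteq> J" for I J
   using map_like_neighbourhoods[OF ml that(1-3)] that(4) by blast
 qed (use assms(2) 0 in simp_all)
qed

section \<open>Unit disk graphs\<close>

lemma unit_balls_meet_iff:
 fixes x y :: "real^2"
 shows "cball x 1 \<inter> cball y 1 ~= {} \<longleftrightarrow> dist x y \<le> 2"
proof
 assume "cball x 1 \<inter> cball y 1 ~= {}"
 then obtain z where "dist x z \<le> 1" "dist y z \<le> 1" by auto
 thus "dist x y \<le> 2" using dist_triangle2[of x y z] by simp
next
 assume "dist x y \<le> 2"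
 hence "midpoint x y \<in> cball x 1 \<inter> cball y 1" by (simp add: dist_midpoint)
 thus "cball x 1 \<inter> cball y 1 ~= {}" by blast
qed

text \<open>When the first three residues of every block of length \<open>k\<close> are forbidden, a
  step of length at most 2 cannot pass into another block.\<close>

lemma int_block_unique:
 fixes z z' k :: int
 assumes "\<bar>z - z'\<bar> \<le> 2" "2 < z mod k" "2 < z' mod k" "0 < k"
 shows "z' div k = z div k"
proof -
 have "z = k * (z div k) + z mod k" "z' = k * (z' div k) + z' mod k" by simp_all
 moreover have "z mod k < k" "z' mod k < k" using assms by auto
 ultimately have "k * (z' div k) < k * (z div k + 1)" "k * (z div k) < k * (z' div k + 1)" unfolding distrib_left mult_1_right using assms(1-3) by linarith+
 hence "z' div k < z div k + 1" "z div k < z' div k + 1" using assms(4) by (simp_all only: mult_less_cancel_left_pos)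
 thus ?thesis by simp
qed

text \<open>Centres are sorted into unit cells by rounding down. Two vertices in one cell are
  adjacent, since both coordinates differ by less than 1, and adjacent vertices are at most two
  cells apart in either direction. An independent set therefore has at most one vertex in each of
  the 25 cells around a given one, which is the source of the constant.\<close>

lemma unit_disk_graph_tame:
 assumes "unit_disk_graph G"
 shows "tame 25 (pverts G) (parcs G)"
proof -
 let ?V = "pverts G" and ?E = "parcs G"
 obtain p :: "'a => real^2" where fin: "finite ?V" and E0: "?E = {(u, v). u \<in> ?V \<and> v \<in> ?V \<and> u ~= v \<and> cball (p u) 1 \<inter> cball (p v) 1 ~= {}}"
  using assms unfolding unit_disk_graph_def by blast
 have E: "?E = {(u, v). u \<in> ?V \<and> v \<in> ?V \<and> u ~= v \<and> dist (p u) (p v) \<le> 2}" unfolding E0 unit_balls_meet_iff ..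
 have 0: "?E \<subseteq> ?V \<times> ?V" "sym ?E" "irrefl ?E" unfolding E by (auto simp: sym_def irrefl_def dist_commute)
 define ix where "ix u = \<lfloor>p u $ 1\<rfloor>" for u
 define iy where "iy u = \<lfloor>p u $ 2\<rfloor>" for u
 have clique: "(u, v) \<in> ?E" if "u \<in> ?V" "v \<in> ?V" "u ~= v" "ix u = ix v" "iy u = iy v" for u v
 proof -
  have "\<bar>p u $ 1 - p v $ 1\<bar> < 1" "\<bar>p u $ 2 - p v $ 2\<bar> < 1" using that(4,5) unfolding ix_def iy_def by linarith+
  moreover have "norm (p u - p v) \<le> \<bar>p u $ 1 - p v $ 1\<bar> + \<bar>p u $ 2 - p v $ 2\<bar>"
   using norm_le_l1_cart[of "p u - p v"] by (simp add: sum_2)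
  ultimately show ?thesis using that unfolding E by (simp add: dist_norm)
 qed
 have near: "\<bar>ix u - ix v\<bar> \<le> 2" "\<bar>iy u - iy v\<bar> \<le> 2" if "(u, v) \<in> ?E" for u v
 proof -
  have d: "norm (p u - p v) \<le> 2" using that unfolding E by (simp add: dist_norm)
  have "\<bar>p u $ 1 - p v $ 1\<bar> \<le> 2" "\<bar>p u $ 2 - p v $ 2\<bar> \<le> 2"
   using d component_le_norm_cart[of "p u - p v" 1] component_le_norm_cart[of "p u - p v" 2] by auto
  thus "\<bar>ix u - ix v\<bar> \<le> 2" "\<bar>iy u - iy v\<bar> \<le> 2" unfolding ix_def iy_def by linarith+
 qed
 have 1: "card (?E \<inter> I \<times> J) \<le> 25 * card J" if IJ: "I \<subseteq> ?V" "J \<subseteq> ?V" "?E \<inter> I \<times> I = {}" for I J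
 proof -
  have fJ: "finite J" "finite I" using IJ fin finite_subset by blast+
  have "card {i \<in> I. (i, j) \<in> ?E} \<le> 25" for j
  proof -
   let ?S = "{i \<in> I. (i, j) \<in> ?E}" and ?T = "{ix j - 2..ix j + 2} \<times> {iy j - 2..iy j + 2}"
   have "inj_on (\<lambda>i. (ix i, iy i)) ?S"
   proof (rule inj_onI)
    fix a b assume ab: "a \<in> ?S" "b \<in> ?S" "(ix a, iy a) = (ix b, iy b)"
    show "a = b"
    proof (rule ccontr)
     assume "a ~= b"
     hence "(a, b) \<in> ?E" using clique[of a b] ab IJ by auto
     thus False using IJ(3) ab by auto
    qed
   qed
   moreover have "(\<lambda>i. (ix i, iy i)) ` ?S \<subseteq> ?T"
   proof
    fix q assume "q \<in> (\<lambda>i. (ix i, iy i)) ` ?S"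
    then obtain i where "(i, j) \<in> ?E" "q = (ix i, iy i)" by blast
    thus "q \<in> ?T" using near[of i j] by auto
   qed
   ultimately have "card ?S \<le> card ?T" by (intro card_inj_on_le) auto
   thus ?thesis by (simp add: card_cartesian_product)
  qed
  moreover have "?E \<inter> I \<times> J = (\<Union>j\<in>J. (\<lambda>i. (i, j)) ` {i \<in> I. (i, j) \<in> ?E})" by auto
  hence "card (?E \<inter> I \<times> J) \<le> (\<Sum>j\<in>J. card ((\<lambda>i. (i, j)) ` {i \<in> I. (i, j) \<in> ?E}))" by (simp add: card_UN_le fJ(1))
  moreover have "card ((\<lambda>i. (i, j)) ` {i \<in> I. (i, j) \<in> ?E}) \<le> card {i \<in> I. (i, j) \<in> ?E}" for j by (rule card_image_le) (use fJ in simp)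
  ultimately have "card (?E \<inter> I \<times> J) \<le> (\<Sum>j\<in>J. 25)" by (meson le_trans sum_mono)
  thus ?thesis by simp
 qed
 have 2: "card ((\<lambda>i. ?E `` {i}) ` I) \<le> 25 * (card J + 1)" if IJ: "I \<subseteq> ?V" "J \<subseteq> ?V" "I \<inter> J = {}" "\<forall>i\<in>I. ?E `` {i} \<subseteq> J" for I J
 proof -
  have fJ: "finite J" "finite I" using IJ fin finite_subset by blast+
  define I' where "I' = {i \<in> I. ?E `` {i} ~= {}}"
  have "\<forall>i\<in>I'. \<exists>j. (i, j) \<in> ?E" unfolding I'_def by blast
  then obtain h where h: "\<And>i. i \<in> I' ==> (i, h i) \<in> ?E" by metis
  have "card I' \<le> card (?E \<inter> I \<times> J)"
  proof (rule card_inj_on_le[where f = "\<lambda>i. (i, h i)"])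
   show "(\<lambda>i. (i, h i)) ` I' \<subseteq> ?E \<inter> I \<times> J" using h IJ(4) unfolding I'_def by blast
   show "finite (?E \<inter> I \<times> J)" using fJ by simp
  qed (simp add: inj_on_def)
  also have "\<dots> \<le> 25 * card J" using 1[OF IJ(1,2)] IJ(3,4) by blast
  finally have cI: "card I' \<le> 25 * card J" .
  have "(\<lambda>i. ?E `` {i}) ` I \<subseteq> insert {} ((\<lambda>i. ?E `` {i}) ` I')" unfolding I'_def by blast
  hence "card ((\<lambda>i. ?E `` {i}) ` I) \<le> card (insert {} ((\<lambda>i. ?E `` {i}) ` I'))" using fJ by (intro card_mono) (auto simp: I'_def)
  also have "\<dots> \<le> Suc (card ((\<lambda>i. ?E `` {i}) ` I'))" by (simp add: card_insert_if fJ I'_def)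
  also have "\<dots> \<le> Suc (card I')" using card_image_le[of I'] fJ by (simp add: I'_def)
  finally show ?thesis using cI by simp
 qed
 have 3: "\<exists>B\<subseteq>X. m * card B \<le> card X \<and> (\<forall>C. C \<subseteq> X - B --> conn ?E C --> card C \<le> (D + 2) ^ (25 * m))"
  if X: "X \<subseteq> ?V" and deg: "\<forall>v\<in>X. card (?E `` {v} \<inter> X) < D" and m: "0 < m" for X D m
 proof -
  have fX: "finite X" using X fin finite_subset by blast
  \<comment> \<open>Strips three cells wide are removed with period \<open>6 * m\<close> in both
    directions. The \<open>2 * m\<close> shifts by multiples of 3 remove disjoint sets in each
    direction, so some shift removes at most \<open>card X / m\<close> vertices altogether. What
    remains falls into blocks of \<open>6 * m\<close> by \<open>6 * m\<close> cells, and each cell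
    is a clique with at most \<open>D\<close> vertices of \<open>X\<close>.\<close>
  define k where "k = 6 * int m"
  have k: "0 < k" using m by (simp add: k_def)
  define Bx where "Bx s = {v \<in> X. (ix v - 3 * int s) mod k \<le> 2}" for s
  define By where "By s = {v \<in> X. (iy v - 3 * int s) mod k \<le> 2}" for s
  have part: "(\<Sum>s<2 * m. card {v \<in> X. (f v - 3 * int s) mod k \<le> 2}) \<le> card X" for f :: "'a => int"
  proof -
   have "(\<Sum>s<2 * m. card {v \<in> X. (f v - 3 * int s) mod k \<le> 2}) = card (\<Union>s<2 * m. {v \<in> X. (f v - 3 * int s) mod k \<le> 2})"
   proof (rule card_UN_disjoint[symmetric])
    show "\<forall>s\<in>{..<2 * m}. \<forall>t\<in>{..<2 * m}. s ~= t --> {v \<in> X. (f v - 3 * int s) mod k \<le> 2} \<inter> {v \<in> X. (f v - 3 * int t) mod k \<le> 2} = {}"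
    proof (intro ballI impI equals0I)
     fix s t v assume st: "s \<in> {..<2 * m}" "t \<in> {..<2 * m}" "s ~= t"
      and v: "v \<in> {v \<in> X. (f v - 3 * int s) mod k \<le> 2} \<inter> {v \<in> X. (f v - 3 * int t) mod k \<le> 2}"
     define a where "a = f v - 3 * int s"
     define b where "b = f v - 3 * int t"
     have ab: "0 \<le> a mod k" "a mod k \<le> 2" "0 \<le> b mod k" "b mod k \<le> 2" using v k unfolding a_def b_def by auto
     have eq: "a - b = k * (a div k - b div k) + (a mod k - b mod k)"
      using mult_div_mod_eq[of k a] mult_div_mod_eq[of k b] by (simp add: algebra_simps)
     have diff: "a - b = 3 * (int t - int s)" by (simp add: a_def b_def)
     have bound: "\<bar>a - b\<bar> \<le> k - 3" using st unfolding diff k_def by auto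
     have "a div k - b div k = 0"
     proof (rule ccontr)
      assume "a div k - b div k ~= 0"
      hence "1 \<le> \<bar>a div k - b div k\<bar>" by linarith
      hence "k \<le> \<bar>k * (a div k - b div k)\<bar>" using k mult_left_mono[of 1 "\<bar>a div k - b div k\<bar>" k] by (simp add: abs_mult)
      thus False using eq bound ab by linarith
     qed
     hence "\<bar>a - b\<bar> \<le> 2" using eq ab by simp
     thus False using st diff by auto
    qed
   qed (use fX in auto)
   also have "\<dots> \<le> card X" using fX by (intro card_mono) auto
   finally show ?thesis .
  qed
  have "\<exists>s<2 * m. m * card (Bx s \<union> By s) \<le> card X"
  proof (rule ccontr)
   assume "\<not> ?thesis"
   hence big: "card X < m * card (Bx s \<union> By s)" if "s < 2 * m" for s using that by force
   have "(\<Sum>s<2 * m. card X) < (\<Sum>s<2 * m. m * card (Bx s \<union> By s))"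
   proof (rule sum_strict_mono)
    show "{..<2 * m} ~= {}" using m by (simp add: lessThan_empty_iff)
   qed (use big in simp_all)
   also have "\<dots> \<le> (\<Sum>s<2 * m. m * (card (Bx s) + card (By s)))" by (intro sum_mono mult_le_mono2 card_Un_le)
   also have "\<dots> = m * ((\<Sum>s<2 * m. card (Bx s)) + (\<Sum>s<2 * m. card (By s)))" by (simp only: sum_distrib_left[symmetric] sum.distrib)
   also have "\<dots> \<le> m * (card X + card X)" using part[of ix] part[of iy] unfolding Bx_def By_def by (intro mult_le_mono2 add_mono)
   finally show False by simp
  qed
  then obtain s where s: "s < 2 * m" "m * card (Bx s \<union> By s) \<le> card X" by blast
  have "card C \<le> (D + 2) ^ (25 * m)" if C: "C \<subseteq> X - (Bx s \<union> By s)" "conn ?E C" for C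
  proof -
   define zx where "zx v = ix v - 3 * int s" for v
   define zy where "zy v = iy v - 3 * int s" for v
   have CX: "C \<subseteq> X" using C by blast
   have md: "2 < zx v mod k" "2 < zy v mod k" if "v \<in> C" for v using that C(1) unfolding Bx_def By_def zx_def zy_def by auto
   obtain c0 where c0: "c0 \<in> C" using C(2) by (auto simp: conn_def)
   have blk: "zx v div k = zx c0 div k \<and> zy v div k = zy c0 div k" if v: "v \<in> C" for v
   proof -
    have "(c0, v) \<in> (?E \<inter> C \<times> C)\<^sup>*" using C(2) c0 v unfolding conn_def by blast
    thus ?thesis
    proof (induction rule: rtrancl_induct)
     case (step y z)
     hence yz: "(y, z) \<in> ?E" "y \<in> C" "z \<in> C" by auto
     have "\<bar>zx y - zx z\<bar> \<le> 2" "\<bar>zy y - zy z\<bar> \<le> 2" using near[OF yz(1)] unfolding zx_def zy_def by auto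
     hence "zx z div k = zx y div k" "zy z div k = zy y div k"
      using int_block_unique md yz k by blast+
     thus ?case using step.IH by simp
    qed simp
   qed
   define cell where "cell q = {v \<in> X. (zx v, zy v) = q}" for q
   define T where "T = {k * (zx c0 div k)..<k * (zx c0 div k) + k} \<times> {k * (zy c0 div k)..<k * (zy c0 div k) + k}"
   have finT: "finite T" by (simp add: T_def)
   have "C \<subseteq> (\<Union>q\<in>T. cell q)"
   proof
    fix v assume v: "v \<in> C"
    have "k * (zx v div k) \<le> zx v" "zx v < k * (zx v div k) + k" "k * (zy v div k) \<le> zy v" "zy v < k * (zy v div k) + k"
     using k mult_div_mod_eq[of k "zx v"] mult_div_mod_eq[of k "zy v"] pos_mod_bound[OF k, of "zx v"] pos_mod_bound[OF k, of "zy v"]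
      pos_mod_sign[OF k, of "zx v"] pos_mod_sign[OF k, of "zy v"] by linarith+
    hence "(zx v, zy v) \<in> T" using blk[OF v] unfolding T_def by simp
    thus "v \<in> (\<Union>q\<in>T. cell q)" using v CX unfolding cell_def by blast
   qed
   moreover have fc: "finite (cell q)" for q using fX unfolding cell_def by simp
   ultimately have "card C \<le> card (\<Union>q\<in>T. cell q)" using finT by (intro card_mono) auto
   also have "\<dots> \<le> (\<Sum>q\<in>T. card (cell q))" by (rule card_UN_le[OF finT])
   also have "\<dots> \<le> (\<Sum>q\<in>T. D)"
   proof (rule sum_mono)
    fix q
    show "card (cell q) \<le> D"
    proof (cases "cell q = {}")
     case False
     then obtain v where v: "v \<in> cell q" by blast
     have "cell q - {v} \<subseteq> ?E `` {v} \<inter> X"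
     proof
      fix u assume u: "u \<in> cell q - {v}"
      hence "ix v = ix u" "iy v = iy u" "v \<in> ?V" "u \<in> ?V" "v ~= u" using v X unfolding cell_def zx_def zy_def by auto
      hence "(v, u) \<in> ?E" using clique[of v u] by blast
      thus "u \<in> ?E `` {v} \<inter> X" using u unfolding cell_def by auto
     qed
     hence "card (cell q - {v}) \<le> card (?E `` {v} \<inter> X)" using fX by (intro card_mono) auto
     also have "\<dots> < D" using deg v unfolding cell_def by auto
     finally show ?thesis using v fc[of q] by (simp add: card_Diff_singleton)
    qed simp
   qed
   also have "\<dots> = (6 * m) * (6 * m) * D" by (simp add: T_def card_cartesian_product k_def nat_mult_distrib)
   also have "\<dots> \<le> (D + 2) ^ (25 * m)"
   proof -
    have m2: "m \<le> 2 ^ m" by (simp add: less_imp_le)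
    have "6 \<le> (2::nat) ^ (3 * m)" using power_increasing[of 3 "3 * m" "2::nat"] m by simp
    hence "6 * m \<le> 2 ^ (3 * m) * 2 ^ m" using m2 by (rule mult_le_mono)
    hence 1: "6 * m \<le> 2 ^ (4 * m)" by (simp add: power_add[symmetric])
    hence "(6 * m) * (6 * m) * D \<le> 2 ^ (4 * m) * 2 ^ (4 * m) * (D + 2)" by (intro mult_le_mono) auto
    also have "\<dots> = 2 ^ (8 * m) * (D + 2)" by (simp add: power_add[symmetric])
    also have "\<dots> \<le> (D + 2) ^ (8 * m) * (D + 2)" by (intro mult_le_mono1 power_mono) auto
    also have "\<dots> = (D + 2) ^ (8 * m + 1)" by simp
    also have "\<dots> \<le> (D + 2) ^ (25 * m)" using m by (intro power_increasing) auto
    finally show ?thesis .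
   qed
   finally show ?thesis .
  qed
  thus ?thesis using s by (intro exI[of _ "Bx s \<union> By s"]) (auto simp: Bx_def By_def)
 qed
 have one: "card (?E \<inter> I \<times> J) \<le> 25 * (card I + card J)" if "I \<subseteq> ?V" "J \<subseteq> ?V" "?E \<inter> I \<times> I = {}" for I J
  using 1[OF that] by simp
 show ?thesis unfolding tame_def
 proof (intro conjI allI impI)
  show "\<exists>B\<subseteq>X. m * card B \<le> card X \<and> (\<forall>C. C \<subseteq> X - B --> conn ?E C --> card C \<le> (D + 2) ^ (25 * m))"
   if "X \<subseteq> ?V" "\<forall>v\<in>X. card (?E `` {v} \<inter> X) < D" "0 < m" for X D m by (rule 3[OF that])
 qed (use fin 0 one 2 in auto)
qed

section \<open>Potential and local moves\<close>

text \<open>The least vertex of each component. The number of components becomes the number of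
  vertices satisfying a condition, which a machine can count.\<close>

definition reps :: "(nat \<times> nat) set => nat set => nat set" where
 "reps E A = {v \<in> A. \<forall>u\<in>A. (u, v) \<in> (E \<inter> A \<times> A)\<^sup>* --> v \<le> u}"

definition cover :: "(nat \<times> nat) set => nat set => bool" where
 "cover E S \<longleftrightarrow> (\<forall>(u, v)\<in>E. u \<in> S \<or> v \<in> S)"

definition kernel :: "nat => nat set => (nat \<times> nat) set => nat set" where
 "kernel t V E = {v \<in> V. card {u \<in> V. u < v \<and> E `` {u} = E `` {v}} < t}"

definition hubs :: "nat => nat set => (nat \<times> nat) set => nat set" where
 "hubs D K E = {v \<in> K. D \<le> card (E `` {v} \<inter> K)}"

definition admissible :: "nat => nat set => (nat \<times> nat) set => nat set => bool" where
 "admissible D K E S \<longleftrightarrow> S \<subseteq> K \<and> hubs D K E \<subseteq> S \<and> cover E S \<and> S ~= {}"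

text \<open>The weight 2 makes it worthwhile to add a vertex that merges components: it costs 1 and
  saves at least 2.\<close>

definition potential :: "(nat \<times> nat) set => nat set => nat" where
 "potential E S = card S + 2 * card (reps E S)"

text \<open>A single vertex may be a hub; larger carriers \<open>C\<close> avoid hubs, so that they
  can be explored by walks through vertices of degree below \<open>D\<close>. The toggled set
  \<open>T\<close> may be disconnected, only its carrier is connected.\<close>

definition local_move :: "nat => nat => nat set => (nat \<times> nat) set => nat set => bool" where
 "local_move k D K E T \<longleftrightarrow> (\<exists>C. T \<subseteq> C \<and> C \<subseteq> K \<and>
  (card C = 1 \<or> conn E C \<and> card C \<le> k \<and> C \<inter> hubs D K E = {}))"

definition locally_optimal :: "nat => nat => nat set => (nat \<times> nat) set => nat set => bool" where
 "locally_optimal k D K E S \<longleftrightarrow>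
  (\<forall>T. local_move k D K E T --> admissible D K E (sym_diff S T) --> potential E S \<le> potential E (sym_diff S T))"

lemma reps_subset: "reps E A \<subseteq> A" by (auto simp: reps_def)

lemma rep_exists:
 assumes "x \<in> A" "sym E"
 obtains r where "r \<in> reps E A" "(x, r) \<in> (E \<inter> A \<times> A)\<^sup>*"
proof -
 let ?P = "\<lambda>u. u \<in> A \<and> (x, u) \<in> (E \<inter> A \<times> A)\<^sup>*"
 define r where "r = (LEAST u. ?P u)"
 have "?P x" using assms by auto
 hence r: "?P r" unfolding r_def by (rule LeastI)
 have le: "\<And>u. ?P u ==> r \<le> u" unfolding r_def by (rule Least_le)
 have "r \<in> reps E A" unfolding reps_def
 proof (intro CollectI conjI ballI impI)
  fix u assume u: "u \<in> A" "(u, r) \<in> (E \<inter> A \<times> A)\<^sup>*"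
  hence "(r, u) \<in> (E \<inter> A \<times> A)\<^sup>*" using rtrancl_restrict_sym[OF assms(2)] by blast
  thus "r \<le> u" using le u r by (meson rtrancl_trans)
 qed (use r in blast)
 thus ?thesis using that r by blast
qed

lemma reps_unique:
 assumes "sym E" "r \<in> reps E A" "s \<in> reps E A" "(r, s) \<in> (E \<inter> A \<times> A)\<^sup>*"
 shows "r = s"
 using assms rtrancl_restrict_sym[OF assms(1,4)] unfolding reps_def by (auto intro: le_antisym)

text \<open>Representatives of different components reach different points \<open>g i\<close>, so
  choosing an index for each of them is injective.\<close>

lemma card_reps_le:
 assumes "sym E" "finite I" "\<And>x. x \<in> A ==> \<exists>i\<in>I. (x, g i) \<in> (E \<inter> A \<times> A)\<^sup>*"
 shows "card (reps E A) \<le> card I"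
proof -
 obtain h where h: "\<And>x. x \<in> A ==> h x \<in> I \<and> (x, g (h x)) \<in> (E \<inter> A \<times> A)\<^sup>*" using assms(3) by metis
 have "inj_on h (reps E A)"
 proof (rule inj_onI)
  fix x y assume xy: "x \<in> reps E A" "y \<in> reps E A" "h x = h y"
  have A: "x \<in> A" "y \<in> A" using xy reps_subset by blast+
  have "(g (h y), y) \<in> (E \<inter> A \<times> A)\<^sup>*" using h[OF A(2)] rtrancl_restrict_sym[OF assms(1)] by blast
  hence "(x, y) \<in> (E \<inter> A \<times> A)\<^sup>*" using h[OF A(1)] xy(3) by (metis rtrancl_trans)
  thus "x = y" using reps_unique[OF assms(1) xy(1,2)] by blast
 qed
 moreover have "h ` reps E A \<subseteq> I" using h reps_subset by blast
 ultimately show ?thesis using assms(2) by (intro card_inj_on_le)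
qed

lemma conn_card_reps:
 assumes "sym E" "conn E A" shows "card (reps E A) = 1"
proof -
 obtain x where x: "x \<in> A" using assms by (auto simp: conn_def)
 obtain r where r: "r \<in> reps E A" by (rule rep_exists[OF x assms(1)])
 have "reps E A = {r}"
 proof -
  have "s = r" if "s \<in> reps E A" for s
   using reps_unique[OF assms(1) that r] assms(2) that r reps_subset[of E A] unfolding conn_def by blast
  thus ?thesis using r by blast
 qed
 thus ?thesis by simp
qed

lemma card_reps_insert_joining:
 assumes "sym E" "finite S" "v \<notin> S" "a \<in> S" "b \<in> S" "(v, a) \<in> E" "(v, b) \<in> E" "(a, b) \<notin> (E \<inter> S \<times> S)\<^sup>*"
 shows "card (reps E (insert v S)) < card (reps E S)"
proof -
 let ?A = "insert v S"
 obtain ra where ra: "ra \<in> reps E S" "(a, ra) \<in> (E \<inter> S \<times> S)\<^sup>*" by (rule rep_exists[OF assms(4,1)])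
 obtain rb where rb: "rb \<in> reps E S" "(b, rb) \<in> (E \<inter> S \<times> S)\<^sup>*" by (rule rep_exists[OF assms(5,1)])
 have ne: "ra ~= rb" using ra rb assms(8) rtrancl_restrict_sym[OF assms(1)] by (meson rtrancl_trans)
 have fin: "finite (reps E S)" using finite_subset[OF reps_subset assms(2)] .
 have up: "(x, y) \<in> (E \<inter> ?A \<times> ?A)\<^sup>*" if "(x, y) \<in> (E \<inter> S \<times> S)\<^sup>*" for x y
  by (rule rtrancl_restrict_mono[OF _ that]) blast
 have va: "(v, a) \<in> (E \<inter> ?A \<times> ?A)\<^sup>*" "(a, v) \<in> (E \<inter> ?A \<times> ?A)\<^sup>*" "(v, b) \<in> (E \<inter> ?A \<times> ?A)\<^sup>*"
  using assms(3-7) symD[OF assms(1,6)] by (auto intro!: r_into_rtrancl)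
 have vrb: "(v, rb) \<in> (E \<inter> ?A \<times> ?A)\<^sup>*" using va(3) up[OF rb(2)] by (rule rtrancl_trans)
 have "(ra, a) \<in> (E \<inter> ?A \<times> ?A)\<^sup>*" using up[OF rtrancl_restrict_sym[OF assms(1) ra(2)]] .
 hence rarb: "(ra, rb) \<in> (E \<inter> ?A \<times> ?A)\<^sup>*" using va(2) vrb by (meson rtrancl_trans)
 have "card (reps E ?A) \<le> card (reps E S - {ra})"
 proof (rule card_reps_le[OF assms(1), where g = id])
  fix x assume x: "x \<in> ?A"
  show "\<exists>i\<in>reps E S - {ra}. (x, id i) \<in> (E \<inter> ?A \<times> ?A)\<^sup>*"
  proof (cases "x = v")
   case True thus ?thesis using vrb rb ne by (intro bexI[of _ rb]) auto
  next
   case False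
   hence xS: "x \<in> S" using x by simp
   obtain s where s: "s \<in> reps E S" "(x, s) \<in> (E \<inter> S \<times> S)\<^sup>*" by (rule rep_exists[OF xS assms(1)])
   show ?thesis
   proof (cases "s = ra")
    case True
    hence "(x, rb) \<in> (E \<inter> ?A \<times> ?A)\<^sup>*" using up[OF s(2)] rarb by (meson rtrancl_trans)
    thus ?thesis using rb ne by (intro bexI[of _ rb]) auto
   next
    case False thus ?thesis using s up by (intro bexI[of _ s]) auto
   qed
  qed
 qed (use fin in simp)
 also have "\<dots> < card (reps E S)" using ra fin by (intro psubset_card_mono) auto
 finally show ?thesis .
qed

lemma card_reps_remove_isolated:
 assumes "sym E" "finite S" "x \<in> S" "E `` {x} = {}"
 shows "card (reps E (S - {x})) \<le> card (reps E S)"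
proof (rule card_reps_le[OF assms(1), where g = id])
 show "finite (reps E S)" using finite_subset[OF reps_subset assms(2)] .
 fix y assume y: "y \<in> S - {x}"
 hence yS: "y \<in> S" by simp
 obtain s where s: "s \<in> reps E S" "(y, s) \<in> (E \<inter> S \<times> S)\<^sup>*" by (rule rep_exists[OF yS assms(1)])
 have eq: "E \<inter> S \<times> S = E \<inter> (S - {x}) \<times> (S - {x})" using assms(1,4) by (auto dest: symD)
 show "\<exists>i\<in>reps E S. (y, id i) \<in> (E \<inter> (S - {x}) \<times> (S - {x}))\<^sup>*" using s unfolding eq by auto
qed

lemma tameD:
 assumes "tame c V E"
 shows "finite V" "E \<subseteq> V \<times> V" "sym E" "irrefl E"
  "\<And>I J. I \<subseteq> V ==> J \<subseteq> V ==> I \<inter> J = {} ==> E \<inter> I \<times> I = {} ==> card (E \<inter> I \<times> J) \<le> c * (card I + card J)"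
  "\<And>I J. I \<subseteq> V ==> J \<subseteq> V ==> I \<inter> J = {} ==> (\<And>i. i \<in> I ==> E `` {i} \<subseteq> J) ==> card ((\<lambda>i. E `` {i}) ` I) \<le> c * (card J + 1)"
  "\<And>X D m. X \<subseteq> V ==> (\<And>v. v \<in> X ==> card (E `` {v} \<inter> X) < D) ==> 0 < m ==>
   \<exists>B\<subseteq>X. m * card B \<le> card X \<and> (\<forall>C. C \<subseteq> X - B --> conn E C --> card C \<le> (D + 2) ^ (c * m))"
proof -
 note a = assms[unfolded tame_def]
 note a2 = conjunct2[OF a] and a3 = conjunct2[OF conjunct2[OF a]] and a4 = conjunct2[OF conjunct2[OF conjunct2[OF a]]]
 note a5 = conjunct2[OF a4]
 note a6 = conjunct2[OF a5] note a7 = conjunct2[OF a6]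
 show "finite V" by (rule conjunct1[OF a])
 show "E \<subseteq> V \<times> V" by (rule conjunct1[OF a2])
 show "sym E" by (rule conjunct1[OF a3])
 show "irrefl E" by (rule conjunct1[OF a4])
 show "card (E \<inter> I \<times> J) \<le> c * (card I + card J)" if "I \<subseteq> V" "J \<subseteq> V" "I \<inter> J = {}" "E \<inter> I \<times> I = {}" for I J
  using conjunct1[OF a5] that by simp
 show "card ((\<lambda>i. E `` {i}) ` I) \<le> c * (card J + 1)" if "I \<subseteq> V" "J \<subseteq> V" "I \<inter> J = {}" "\<And>i. i \<in> I ==> E `` {i} \<subseteq> J" for I J
  using conjunct1[OF a6, rule_format, OF that(1-3)] that(4) by blast
 show "\<exists>B\<subseteq>X. m * card B \<le> card X \<and> (\<forall>C. C \<subseteq> X - B --> conn E C --> card C \<le> (D + 2) ^ (c * m))"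
  if "X \<subseteq> V" "\<And>v. v \<in> X ==> card (E `` {v} \<inter> X) < D" "0 < m" for X D m
  by (rule a7[rule_format, OF that])
qed

text \<open>The edges from \<open>J\<close> to the rest of \<open>W\<close> number at least
  \<open>d * card J\<close>, and at most \<open>c * (card J + card W)\<close> by sparsity.\<close>

lemma independent_high_degree_bound:
 assumes "tame c V E" "J \<subseteq> V" "W \<subseteq> V" "E \<inter> J \<times> J = {}" "\<And>x. x \<in> J ==> d \<le> card (E `` {x} \<inter> W)"
 shows "(d - c) * card J \<le> c * card W"
proof -
 note t = tameD[OF assms(1)]
 have fin: "finite J" "finite W" using assms t(1) finite_subset by blast+
 have "d * card J \<le> card (E \<inter> J \<times> (W - J))"
 proof -
  have e: "E \<inter> J \<times> (W - J) = Sigma J (\<lambda>x. E `` {x} \<inter> W)" using assms(4) by auto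
  have "card (E \<inter> J \<times> (W - J)) = (\<Sum>x\<in>J. card (E `` {x} \<inter> W))" unfolding e using fin by (intro card_SigmaI) auto
  also have "\<dots> \<ge> (\<Sum>x\<in>J. d)" by (intro sum_mono assms(5))
  finally show ?thesis by (simp add: mult.commute)
 qed
 also have "\<dots> \<le> c * (card J + card (W - J))" using assms by (intro t(5)) auto
 also have "\<dots> \<le> c * (card J + card W)" using fin by (intro mult_le_mono2 add_left_mono card_mono) auto
 finally show ?thesis by (simp add: diff_mult_distrib algebra_simps)
qed

lemma cover_outside_independent: "cover E S ==> E \<inter> (- S) \<times> (- S) = {}"
 by (auto simp: cover_def)

lemma cover_outside_nbrs: "cover E S ==> x \<notin> S ==> E `` {x} \<subseteq> S"
 by (auto simp: cover_def)

lemma conn_insert_cover: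
 assumes "sym E" "irrefl E" "conn E S" "cover E S" "E `` {x} ~= {}"
 shows "conn E (insert x S)"
proof (cases "x \<in> S")
 case True thus ?thesis using assms by (simp add: insert_absorb)
next
 case False
 obtain y where y: "(x, y) \<in> E" using assms(5) by blast
 hence "y \<in> S" using assms(4) False by (auto simp: cover_def)
 have "conn E ({x, y} \<union> S)" by (rule conn_Un[OF conn_pair[OF y assms(1)] assms(3), of y]) (use \<open>y \<in> S\<close> in auto)
 thus ?thesis using \<open>y \<in> S\<close> by (simp add: insert_absorb)
qed

lemma cover_mono: "cover E S ==> S \<subseteq> T ==> cover E T" by (auto simp: cover_def)

lemma conn_Un_cover:
 assumes "sym E" "irrefl E" "conn E S" "cover E S" "finite J" "\<And>x. x \<in> J ==> E `` {x} ~= {}"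
 shows "conn E (S \<union> J)"
 using assms(5,6)
proof (induction J rule: finite_induct)
 case (insert x J)
 hence "conn E (S \<union> J)" by auto
 moreover have "cover E (S \<union> J)" using cover_mono[OF assms(4)] by auto
 ultimately have "conn E (insert x (S \<union> J))" using insert.prems by (intro conn_insert_cover[OF assms(1,2)]) auto
 thus ?case by simp
qed (use assms in simp)

section \<open>The twin kernel\<close>

locale kernel_graph =
 fixes c t D :: nat and V :: "nat set" and E :: "(nat \<times> nat) set"
 assumes tame: "tame c V E" and t: "2 * c < t" and D: "0 < D"
begin

abbreviation K where "K \<equiv> kernel t V E"
abbreviation H where "H \<equiv> hubs D K E"

lemmas tm = tameD[OF tame]

lemma finV: "finite V" by (rule tm)
lemma symE: "(x, y) \<in> E ==> (y, x) \<in> E" using tm(3) by (rule symD)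
lemma KV: "K \<subseteq> V" by (auto simp: kernel_def)
lemma HK: "H \<subseteq> K" by (auto simp: hubs_def)
lemma finK: "finite K" using finite_subset[OF KV finV] .

text \<open>A discarded vertex is sent to its least twin, which has no smaller twin and is therefore
  always kept.\<close>

definition rep :: "nat => nat" where
 "rep v = (if v \<in> K then v else Min {u \<in> V. E `` {u} = E `` {v}})"

lemma rep: assumes "v \<in> V" shows "rep v \<in> K" "E `` {rep v} = E `` {v}"
proof -
 let ?T = "{u \<in> V. E `` {u} = E `` {v}}"
 have T: "finite ?T" "?T ~= {}" using finV assms by auto
 have m: "Min ?T \<in> ?T" by (rule Min_in[OF T])
 have e: "{u \<in> V. u < Min ?T \<and> E `` {u} = E `` {Min ?T}} = {}"
 proof (rule equals0I)
  fix u assume u: "u \<in> {u \<in> V. u < Min ?T \<and> E `` {u} = E `` {Min ?T}}"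
  hence "u \<in> ?T" using m by auto
  hence "Min ?T \<le> u" using T(1) by (rule Min_le[rotated])
  thus False using u by simp
 qed
 have "card {u \<in> V. u < Min ?T \<and> E `` {u} = E `` {Min ?T}} < t" unfolding e using t by simp
 hence "Min ?T \<in> K" unfolding kernel_def using m by blast
 thus "rep v \<in> K" "E `` {rep v} = E `` {v}" using m unfolding rep_def by auto
qed

lemma rep_K: "v \<in> K ==> rep v = v" by (simp add: rep_def)

lemma rep_edge: assumes "(x, y) \<in> E" shows "(rep x, rep y) \<in> E"
proof -
 have V: "x \<in> V" "y \<in> V" using assms tm(2) by auto
 have "(rep x, y) \<in> E" using assms rep(2)[OF V(1)] by blast
 hence "(y, rep x) \<in> E" by (rule symE)
 hence "(rep y, rep x) \<in> E" using rep(2)[OF V(2)] by blast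
 thus ?thesis by (rule symE)
qed

lemma removed_class_large:
 assumes "v \<in> V - K" shows "t \<le> card {u \<in> V. E `` {u} = E `` {v}}"
proof -
 have "t \<le> card {u \<in> V. u < v \<and> E `` {u} = E `` {v}}" using assms unfolding kernel_def by auto
 also have "\<dots> \<le> card {u \<in> V. E `` {u} = E `` {v}}" using finV by (intro card_mono) auto
 finally show ?thesis .
qed

lemma removed_nbr_degree:
 assumes "v \<in> V - K" "(v, x) \<in> E" shows "t \<le> card (E `` {x})"
proof -
 have "{u \<in> V. E `` {u} = E `` {v}} \<subseteq> E `` {x}" using assms(2) symE by blast
 moreover have "finite (E `` {x})" using finite_subset[OF _ finV, of "E `` {x}"] tm(2) by blast
 ultimately show ?thesis using removed_class_large[OF assms(1)] card_mono le_trans by blast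
qed

text \<open>The twin classes of two adjacent discarded vertices would span a complete bipartite
  graph between independent sets of sizes \<open>x\<close> and \<open>y\<close> above
  \<open>2 * c\<close>: it has \<open>x * y\<close> edges, whereas sparsity permits only
  \<open>c * (x + y)\<close>.\<close>

lemma removed_independent:
 assumes "x \<in> V - K" "y \<in> V - K" shows "(x, y) \<notin> E"
proof
 assume xy: "(x, y) \<in> E"
 let ?X = "{u \<in> V. E `` {u} = E `` {x}}" and ?Y = "{u \<in> V. E `` {u} = E `` {y}}"
 have all: "(u, w) \<in> E" if "u \<in> ?X" "w \<in> ?Y" for u w
 proof -
  have "(u, y) \<in> E" using that(1) xy by blast
  hence "(y, u) \<in> E" by (rule symE)
  hence "(w, u) \<in> E" using that(2) by blast
  thus ?thesis by (rule symE)
 qed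
 have ind: "E \<inter> ?X \<times> ?X = {}"
 proof (rule equals0I)
  fix p assume "p \<in> E \<inter> ?X \<times> ?X"
  then obtain a b where ab: "(a, b) \<in> E" "a \<in> ?X" "b \<in> ?X" by auto
  hence "b \<in> E `` {a}" "E `` {a} = E `` {b}" by auto
  hence "(b, b) \<in> E" by blast
  thus False using tm(4) by (auto simp: irrefl_def)
 qed
 have disj: "?X \<inter> ?Y = {}"
 proof (rule equals0I)
  fix u assume u: "u \<in> ?X \<inter> ?Y"
  hence "(u, u) \<in> E" using all[of u u] by blast
  thus False using tm(4) by (auto simp: irrefl_def)
 qed
 have "card ?X * card ?Y = card (?X \<times> ?Y)" by (simp add: card_cartesian_product)
 also have "?X \<times> ?Y = E \<inter> ?X \<times> ?Y" using all by blast
 also have "card \<dots> \<le> c * (card ?X + card ?Y)" using disj ind by (intro tm(5)) auto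
 finally have le: "card ?X * card ?Y \<le> c * (card ?X + card ?Y)" .
 have X: "2 * c < card ?X" "2 * c < card ?Y" using removed_class_large assms t by (meson less_le_trans)+
 have "c * (x + y) < x * y" if "2 * c < x" "2 * c < y" for x y :: nat
 proof -
  have "(2 * c + 1) * y \<le> x * y" by (rule mult_le_mono1) (use that in simp)
  moreover have "x * (2 * c + 1) \<le> x * y" by (rule mult_le_mono2) (use that in simp)
  ultimately have "(2 * c + 1) * y + x * (2 * c + 1) \<le> 2 * (x * y)" by linarith
  moreover have "2 * (c * (x + y)) < (2 * c + 1) * y + x * (2 * c + 1)" using that by (simp add: algebra_simps)
  ultimately show ?thesis by linarith
 qed
 from this[OF X] show False using le by simp
qed

text \<open>Vertices outside the cover have their neighbourhoods inside it, so they form at most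
  \<open>c * (card S + 1)\<close> twin classes, and the kernel keeps at most \<open>t\<close>
  members of each.\<close>

lemma card_kernel_le:
 assumes "cover E S" "S \<subseteq> V"
 shows "card K \<le> card S + t * (c * (card S + 1))"
proof -
 let ?I = "V - S"
 have ind: "\<And>i. i \<in> ?I ==> E `` {i} \<subseteq> S" using cover_outside_nbrs[OF assms(1)] by blast
 have finI: "finite ?I" using finV by simp
 have cl: "card {v \<in> K. E `` {v} = A} \<le> t" for A
 proof (cases "{v \<in> K. E `` {v} = A} = {}")
  case False
  let ?T = "{v \<in> K. E `` {v} = A}"
  have fT: "finite ?T" using finK by simp
  let ?m = "Max ?T"
  have m: "?m \<in> ?T" by (rule Max_in[OF fT False])
  have "?T - {?m} \<subseteq> {u \<in> V. u < ?m \<and> E `` {u} = E `` {?m}}"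
  proof
   fix u assume u: "u \<in> ?T - {?m}"
   hence "u \<le> ?m" using Max_ge[OF fT, of u] by simp
   thus "u \<in> {u \<in> V. u < ?m \<and> E `` {u} = E `` {?m}}" using u m KV by auto
  qed
  hence "card (?T - {?m}) \<le> card {u \<in> V. u < ?m \<and> E `` {u} = E `` {?m}}" using finV by (intro card_mono) auto
  also have "\<dots> < t" using m unfolding kernel_def by auto
  finally show ?thesis using m fT by (simp add: card_Diff_singleton)
 next
  case True
  show ?thesis unfolding True by simp
 qed
 have "K \<subseteq> S \<union> (\<Union>A\<in>(\<lambda>i. E `` {i}) ` ?I. {v \<in> K. E `` {v} = A})" using KV by blast
 hence "card K \<le> card (S \<union> (\<Union>A\<in>(\<lambda>i. E `` {i}) ` ?I. {v \<in> K. E `` {v} = A}))"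
  using finK finI finite_subset[OF assms(2) finV] by (intro card_mono) auto
 also have "\<dots> \<le> card S + card (\<Union>A\<in>(\<lambda>i. E `` {i}) ` ?I. {v \<in> K. E `` {v} = A})" by (rule card_Un_le)
 also have "card (\<Union>A\<in>(\<lambda>i. E `` {i}) ` ?I. {v \<in> K. E `` {v} = A}) \<le> (\<Sum>A\<in>(\<lambda>i. E `` {i}) ` ?I. card {v \<in> K. E `` {v} = A})"
  using finI by (intro card_UN_le) simp
 also have "\<dots> \<le> (\<Sum>A\<in>(\<lambda>i. E `` {i}) ` ?I. t)" by (intro sum_mono cl)
 also have "\<dots> = t * card ((\<lambda>i. E `` {i}) ` ?I)" by (simp add: mult.commute)
 also have "\<dots> \<le> t * (c * (card S + 1))" using assms(2) ind by (intro mult_le_mono2 tm(6)) auto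
 finally show ?thesis by simp
qed

text \<open>An arbitrary connected vertex cover is turned into an admissible one at small cost: vertices outside it
 that are hubs or neighbours of removed twins have large degree into it, hence are few.\<close>

lemma admissible_from_cover:
 assumes W: "W \<subseteq> V" "conn E W" "cover E W"
 obtains P n1 n2 where "admissible D K E P" "conn E P" "card P \<le> card W + n1 + n2"
  "(t - c) * n1 \<le> c * card W" "(D - c) * n2 \<le> c * (card W + n1)"
proof -
 have finO: "finite W" using finite_subset[OF W(1) finV] .
 \<comment> \<open>Neighbours of discarded vertices must join the cover, because the discarded
   vertices are about to be exchanged for kept twins. Each of them is adjacent to a whole twin
   class, hence to at least \<open>t\<close> vertices.\<close>
 define J1 where "J1 = {x \<in> V - W. \<exists>v\<in>V - K. (v, x) \<in> E}"
 define W1 where "W1 = W \<union> J1"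
 have finJ: "finite J1" using finV by (simp add: J1_def)
 have J1: "(t - c) * card J1 \<le> c * card W"
 proof (rule independent_high_degree_bound[OF tame _ W(1)])
  show "J1 \<subseteq> V" by (auto simp: J1_def)
  show "E \<inter> J1 \<times> J1 = {}" using cover_outside_independent[OF W(3)] by (auto simp: J1_def)
  fix x assume x: "x \<in> J1"
  hence "E `` {x} \<inter> W = E `` {x}" using cover_outside_nbrs[OF W(3), of x] by (auto simp: J1_def)
  thus "t \<le> card (E `` {x} \<inter> W)" using removed_nbr_degree x by (auto simp: J1_def)
 qed
 have c1: "conn E W1" unfolding W1_def
 proof (rule conn_Un_cover[OF tm(3,4) W(2,3) finJ])
  fix x assume "x \<in> J1"
  thus "E `` {x} ~= {}" using symE by (auto simp: J1_def)
 qed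
 have cov1: "cover E W1" using cover_mono[OF W(3)] by (auto simp: W1_def)
 have W1V: "W1 \<subseteq> V" using W by (auto simp: W1_def J1_def)
 \<comment> \<open>Since \<open>rep\<close> maps edges to edges, the image is again connected, and
   it is no larger than \<open>W1\<close>.\<close>
 define W2 where "W2 = rep ` W1"
 have W2K: "W2 \<subseteq> K" using rep W1V by (auto simp: W2_def)
 have c2: "conn E W2"
 proof -
  have "conn E (\<Union>((\<lambda>x. {rep x}) ` W1))" by (rule conn_Union_image[OF c1]) (use rep_edge in \<open>auto simp: conn_def\<close>)
  moreover have "\<Union>((\<lambda>x. {rep x}) ` W1) = W2" by (auto simp: W2_def)
  ultimately show ?thesis by simp
 qed
 have cov2: "cover E W2" unfolding cover_def
 proof (clarify, rule ccontr)
  fix u v assume uv: "(u, v) \<in> E" and n: "\<not> u \<in> W2" "v \<notin> W2"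
  have V: "u \<in> V" "v \<in> V" using uv tm(2) by auto
  have nb: "y \<in> W2" if "(x, y) \<in> E" "x \<in> V - K" "y \<in> K" for x y
  proof -
   have "y \<in> W1" using that KV unfolding W1_def J1_def by auto
   thus ?thesis using rep_K[OF that(3)] unfolding W2_def by force
  qed
  have KK: "x \<in> W2" if "x \<in> W1" "x \<in> K" for x using rep_K[OF that(2)] that(1) unfolding W2_def by force
  show False using nb[OF uv] nb[OF symE[OF uv]] n V removed_independent[of u v] uv KK cov1 unfolding cover_def by blast
 qed
 define J2 where "J2 = H - W2"
 have J2: "(D - c) * card J2 \<le> c * card W2"
 proof (rule independent_high_degree_bound[OF tame])
  show "J2 \<subseteq> V" "W2 \<subseteq> V" using HK KV W2K by (auto simp: J2_def)
  show "E \<inter> J2 \<times> J2 = {}" using cover_outside_independent[OF cov2] by (auto simp: J2_def)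
  fix x assume x: "x \<in> J2"
  hence sub: "E `` {x} \<inter> K \<subseteq> E `` {x} \<inter> W2" using cover_outside_nbrs[OF cov2, of x] by (auto simp: J2_def)
  have "D \<le> card (E `` {x} \<inter> K)" using x by (auto simp: J2_def hubs_def)
  also have "\<dots> \<le> card (E `` {x} \<inter> W2)" using sub finite_subset[OF W2K finK] by (intro card_mono) auto
  finally show "D \<le> card (E `` {x} \<inter> W2)" .
 qed
 have finJ2: "finite J2" using finite_subset[OF HK finK] by (simp add: J2_def)
 have "conn E (W2 \<union> J2)"
 proof (rule conn_Un_cover[OF tm(3,4) c2 cov2 finJ2])
  fix x assume "x \<in> J2"
  hence "D \<le> card (E `` {x} \<inter> K)" by (auto simp: J2_def hubs_def)
  thus "E `` {x} ~= {}" using D by auto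
 qed
 moreover have "admissible D K E (W2 \<union> J2)"
  unfolding admissible_def using W2K HK cover_mono[OF cov2] c2 by (auto simp: J2_def conn_def)
 moreover have cO1: "card W1 \<le> card W + card J1" unfolding W1_def by (rule card_Un_le)
 have cO2: "card W2 \<le> card W1" unfolding W2_def using finO finJ by (intro card_image_le) (simp add: W1_def)
 have "card (W2 \<union> J2) \<le> card W + card J1 + card J2" using card_Un_le[of W2 J2] cO1 cO2 by linarith
 moreover have "(D - c) * card J2 \<le> c * (card W + card J1)"
  using J2 cO1 cO2 by (meson le_trans mult_le_mono2)
 ultimately show ?thesis using that J1 by blast
qed

lemma local_move_single: "v \<in> K ==> local_move k D K E {v}"
 unfolding local_move_def by (rule exI[of _ "{v}"]) auto

text \<open>If some vertex of \<open>S\<close> has no neighbour at all, removing it lowers the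
  potential. Otherwise the connected cover \<open>W\<close> ties all of \<open>S\<close> together in
  the graph. A walk from \<open>a\<close> to another component \<open>b\<close> must leave the
  component of \<open>a\<close> together with its outside neighbours; it does so from some
  \<open>x\<close> outside \<open>S\<close>, and the next vertex is in \<open>S\<close> because
  \<open>S\<close> is a cover. The kept twin of \<open>x\<close> thus touches two components, and
  adding it lowers the potential.\<close>

lemma locally_optimal_conn:
 assumes adm: "admissible D K E S" and lo: "locally_optimal k D K E S" and W: "conn E W" "cover E W"
 shows "conn E S"
proof (rule ccontr)
 assume nc: "\<not> conn E S"
 have SK: "S \<subseteq> K" and HS: "H \<subseteq> S" and cov: "cover E S" and ne: "S ~= {}" using adm by (auto simp: admissible_def)
 have finS: "finite S" using finite_subset[OF SK finK] .
 obtain a b where ab: "a \<in> S" "b \<in> S" "(a, b) \<notin> (E \<inter> S \<times> S)\<^sup>*" using nc ne by (auto simp: conn_def)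
 have loD: "potential E S \<le> potential E (sym_diff S {v})" if "v \<in> K" "admissible D K E (sym_diff S {v})" for v
  using lo local_move_single[OF that(1)] that(2) unfolding locally_optimal_def by blast
 show False
 proof (cases "\<exists>x\<in>S. E `` {x} = {}")
  case True
  then obtain x where x: "x \<in> S" "E `` {x} = {}" by blast
  have eq: "sym_diff S {x} = S - {x}" using x by auto
  have "x \<notin> H" using x D by (auto simp: hubs_def)
  moreover have "cover E (S - {x})" using cov x(2) symE unfolding cover_def by blast
  moreover have "S - {x} ~= {}" using ab by auto
  ultimately have "admissible D K E (S - {x})" using SK HS unfolding admissible_def by auto
  hence "potential E S \<le> potential E (S - {x})" using loD[of x] x SK eq by auto
  moreover have "card (S - {x}) < card S" using x finS by (intro psubset_card_mono) auto
  ultimately show False using card_reps_remove_isolated[OF tm(3) finS x] unfolding potential_def by simp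
 next
  case False
  have toO: "\<exists>z\<in>W. (x, z) \<in> E\<^sup>*" if xS: "x \<in> S" for x
  proof -
   obtain y where "(x, y) \<in> E" using False xS by blast
   thus ?thesis using W(2) unfolding cover_def by blast
  qed
  obtain oa ob where oab: "oa \<in> W" "(a, oa) \<in> E\<^sup>*" "ob \<in> W" "(b, ob) \<in> E\<^sup>*" using toO ab by metis
  have "(oa, ob) \<in> E\<^sup>*" using W(1) oab rtrancl_mono[of "E \<inter> W \<times> W" E] unfolding conn_def by blast
  moreover have "(ob, b) \<in> E\<^sup>*" using oab(4) by (rule symD[OF sym_rtrancl[OF tm(3)]])
  ultimately have path: "(a, b) \<in> E\<^sup>*" using oab(2) by (meson rtrancl_trans)
  define A where "A = comp_of E S a"
  define A' where "A' = A \<union> {v. v \<notin> S \<and> (\<exists>u\<in>A. (u, v) \<in> E)}"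
  have AS: "A \<subseteq> S" unfolding A_def by (rule comp_of_subset[OF ab(1)])
  have aA: "a \<in> A'" by (auto simp: A'_def A_def comp_of_def)
  have bA: "b \<notin> A'" using ab by (auto simp: A'_def A_def comp_of_def)
  have "\<exists>x y. (x, y) \<in> E \<and> x \<in> A' \<and> y \<notin> A'"
  proof (rule ccontr)
   assume n: "\<not> ?thesis"
   have "z \<in> A'" if "(a, z) \<in> E\<^sup>*" for z using that by (induction rule: rtrancl_induct) (use aA n in blast)+
   thus False using path bA by blast
  qed
  then obtain x y where xy: "(x, y) \<in> E" "x \<in> A'" "y \<notin> A'" by blast
  have closed: "y \<in> A" if "u \<in> A" "(u, y) \<in> E" "y \<in> S" for u y
   using that AS unfolding A_def comp_of_def by (auto intro: rtrancl_into_rtrancl)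
  have xA: "x \<notin> A" using xy closed unfolding A'_def by blast
  then obtain u where u: "u \<in> A" "(u, x) \<in> E" "x \<notin> S" using xy unfolding A'_def by blast
  have yS: "y \<in> S" "y \<notin> A" using xy u cov unfolding cover_def A'_def by auto
  have xV: "x \<in> V" using xy tm(2) by auto
  let ?v = "rep x"
  have vu: "(?v, u) \<in> E" "(?v, y) \<in> E" using rep(2)[OF xV] symE[OF u(2)] xy(1) by blast+
  have uy: "(u, y) \<notin> (E \<inter> S \<times> S)\<^sup>*"
   using u(1) yS(2) unfolding A_def comp_of_def by (auto intro: rtrancl_trans)
  have vS: "?v \<notin> S"
  proof
   assume v: "?v \<in> S"
   hence "(u, ?v) \<in> E \<inter> S \<times> S" "(?v, y) \<in> E \<inter> S \<times> S" using symE[OF vu(1)] vu(2) u AS yS by auto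
   hence "(u, y) \<in> (E \<inter> S \<times> S)\<^sup>*" by (meson r_into_rtrancl rtrancl_trans)
   thus False using uy by blast
  qed
  have eq: "sym_diff S {?v} = insert ?v S" using vS by auto
  have "admissible D K E (insert ?v S)" using adm rep(1)[OF xV] cover_mono[OF cov, of "insert ?v S"] unfolding admissible_def by auto
  hence "potential E S \<le> potential E (insert ?v S)" using loD[OF rep(1)[OF xV]] eq by simp
  moreover have "card (reps E (insert ?v S)) < card (reps E S)"
   using card_reps_insert_joining[OF tm(3) finS vS _ yS(1) vu uy] u AS by blast
  ultimately show False using vS finS unfolding potential_def by simp
 qed
qed

end

section \<open>The exchange argument for local optima\<close>

lemma comp_of_conn: assumes "sym R" shows "conn R (comp_of R Q c)"
proof -
 let ?C = "comp_of R Q c"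
 have 1: "(c, y) \<in> (R \<inter> ?C \<times> ?C)\<^sup>*" if "(c, y) \<in> (R \<inter> Q \<times> Q)\<^sup>*" for y
  using that
 proof (induction rule: rtrancl_induct)
  case (step y z)
  hence "y \<in> ?C" "z \<in> ?C" unfolding comp_of_def using rtrancl_into_rtrancl[OF step(1,2)] by simp_all
  hence "(y, z) \<in> R \<inter> ?C \<times> ?C" using step(2) by simp
  with step.IH show ?case by (rule rtrancl_into_rtrancl)
 qed simp
 have 2: "(y, c) \<in> (R \<inter> ?C \<times> ?C)\<^sup>*" if "(c, y) \<in> (R \<inter> Q \<times> Q)\<^sup>*" for y
  using rtrancl_restrict_sym[OF assms 1[OF that]] .
 have "c \<in> ?C" by (simp add: comp_of_def)
 thus ?thesis unfolding conn_def using rtrancl_trans[OF 2 1] unfolding comp_of_def by blast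
qed

lemma conn_subset_closed:
 assumes "conn R S" "x \<in> S" "x \<in> W" "\<And>u v. u \<in> W ==> u \<in> S ==> v \<in> S ==> (u, v) \<in> R ==> v \<in> W"
 shows "S \<subseteq> W"
proof
 fix y assume "y \<in> S"
 hence "(x, y) \<in> (R \<inter> S \<times> S)\<^sup>*" using assms(1,2) by (simp add: conn_def)
 thus "y \<in> W" by (induction rule: rtrancl_induct) (use assms(3,4) in auto)
qed

context kernel_graph
begin

text \<open>\<open>P\<close> is the solution to compare with, \<open>B\<close> the cut, and the
  pieces are the components of the remaining non-hubs. In a piece \<open>C\<close>, the local
  optimum \<open>S\<close> is replaced by \<open>P\<close> and the cut vertices next to
  \<open>C\<close> are added. Local optimality gives one inequality for each piece that meets
  \<open>S\<close>, and these are summed. The error comes from the cut itself, from the added cut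
  vertices, in total at most \<open>D * card B\<close>, and from the new components.\<close>

lemma local_optimum_bound:
 assumes adm: "admissible D K E S" and lo: "locally_optimal k D K E S" and cS: "conn E S"
  and admP: "admissible D K E P" and cP: "conn E P"
  and B: "B \<subseteq> K - H" and small: "\<And>C. C \<subseteq> K - H - B ==> conn E C ==> card C \<le> k0" and k: "k0 * (D + 1) \<le> k"
  and ne: "E ~= {}"
 shows "\<exists>J. J \<subseteq> H \<and> E \<inter> J \<times> J = {} \<and> card S \<le> card P + 3 * (D + 1) * card B + 2 * card J"
proof -
 define M where "M = K - H"
 define X where "X = H \<union> B"
 have SK: "S \<subseteq> K" and HS: "H \<subseteq> S" and covS: "cover E S" and Sne: "S ~= {}" using adm by (auto simp: admissible_def)
 have PK: "P \<subseteq> K" and HP: "H \<subseteq> P" and covP: "cover E P" and Pne: "P ~= {}" using admP by (auto simp: admissible_def)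
 have finS: "finite S" and finP: "finite P" and finB: "finite B" and finH: "finite H"
  using finite_subset[OF SK finK] finite_subset[OF PK finK] finite_subset[OF HK finK] finite_subset[OF B] finK by auto
 have BM: "B \<subseteq> M" using B by (simp add: M_def)
 define CC where "CC = comp_of E (M - B) ` (M - B)"
 have finCC: "finite CC" unfolding CC_def M_def using finK by simp
 have C_conn: "conn E C" and C_sub: "C \<subseteq> M - B" and C_small: "card C \<le> k0" and C_fin: "finite C" if C: "C \<in> CC" for C
 proof -
  obtain v where v: "v \<in> M - B" "C = comp_of E (M - B) v" using C unfolding CC_def by blast
  show "conn E C" unfolding v(2) by (rule comp_of_conn[OF tm(3)])
  show "C \<subseteq> M - B" unfolding v(2) by (rule comp_of_subset[OF v(1)])
  thus "card C \<le> k0" "finite C" using small[of C] \<open>conn E C\<close> finite_subset[of C K] finK unfolding M_def by auto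
 qed
 have C_closed: "v \<in> C" if C: "C \<in> CC" and uv: "u \<in> C" "v \<in> M - B" "(u, v) \<in> E" for C u v
 proof -
  obtain x where x: "x \<in> M - B" "C = comp_of E (M - B) x" using C unfolding CC_def by blast
  have "(u, v) \<in> E \<inter> (M - B) \<times> (M - B)" using C uv C_sub by blast
  thus ?thesis using uv(1) unfolding x(2) comp_of_def by (auto intro: rtrancl_into_rtrancl)
 qed
 have C_eq: "C = C'" if "C \<in> CC" "C' \<in> CC" "x \<in> C" "x \<in> C'" for C C' x
  using that comp_of_eq[OF tm(3)] unfolding CC_def by blast
 have C_ex: "\<exists>C\<in>CC. x \<in> C" if "x \<in> M - B" for x unfolding CC_def using that by (auto simp: comp_of_def)
 have C_out: "v \<in> X" if "C \<in> CC" "u \<in> C" "v \<in> K" "v \<notin> C" "(u, v) \<in> E" for C u v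
  using C_closed[OF that(1,2) _ that(5)] that(3,4) unfolding X_def M_def by blast
 have XC: "X \<inter> C = {}" if "C \<in> CC" for C using C_sub[OF that] unfolding X_def M_def by blast
 define NB where "NB C = B \<inter> E `` C" for C
 \<comment> \<open>An edge leaving \<open>C\<close> inside the kernel ends in a hub, which
   \<open>S\<close> contains, or in a vertex of \<open>NB C\<close>; an edge leaving the kernel is
   covered by its end in \<open>P\<close>. So the exchanged set is again a cover.\<close>
 define SC where "SC C = (S - C) \<union> (P \<inter> C) \<union> NB C" for C
 have SCK: "SC C \<subseteq> K" for C using SK PK B unfolding SC_def NB_def by blast
 have X_SC: "X \<inter> SC C = (X \<inter> S) \<union> NB C" if "C \<in> CC" for C using XC[OF that] unfolding SC_def NB_def X_def by blast
 have admSC: "admissible D K E (SC C)" if C: "C \<in> CC" for C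
 proof -
  have "H \<subseteq> SC C" using HS XC[OF C] unfolding SC_def X_def by blast
  have one: "u \<in> SC C \<or> v \<in> SC C" if uv: "(u, v) \<in> E" "u \<in> C" for u v
  proof (cases "v \<in> C")
   case True thus ?thesis using covP uv unfolding cover_def SC_def by blast
  next
   case False
   show ?thesis
   proof (cases "v \<in> K")
    case True
    hence "v \<in> X" using C_out[OF C uv(2) _ False uv(1)] by blast
    thus ?thesis using \<open>H \<subseteq> SC C\<close> uv unfolding X_def SC_def NB_def by blast
   next
    case vK: False
    hence "u \<in> P" using covP uv PK unfolding cover_def by blast
    thus ?thesis using uv unfolding SC_def by blast
   qed
  qed
  have cov: "cover E (SC C)" unfolding cover_def
  proof clarify
   fix u v assume uv: "(u, v) \<in> E" "v \<notin> SC C"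
   show "u \<in> SC C"
   proof (cases "u \<in> C \<or> v \<in> C")
    case True thus ?thesis using one[OF uv(1)] one[OF symE[OF uv(1)]] uv(2) by blast
   next
    case False thus ?thesis using covS uv unfolding cover_def SC_def by blast
   qed
  qed
  moreover have "SC C ~= {}" using cov ne unfolding cover_def by force
  ultimately show ?thesis using SCK \<open>H \<subseteq> SC C\<close> unfolding admissible_def by blast
 qed
 have NBfin: "finite (NB C)" for C using finB by (simp add: NB_def)
 have move: "local_move k D K E (sym_diff S (SC C))" if C: "C \<in> CC" for C
  unfolding local_move_def
 proof (intro exI conjI disjI2)
  show "sym_diff S (SC C) \<subseteq> C \<union> NB C" unfolding SC_def by blast
  show "C \<union> NB C \<subseteq> K" using C_sub[OF C] B unfolding M_def NB_def by blast
  show "(C \<union> NB C) \<inter> H = {}" using C_sub[OF C] B unfolding M_def NB_def by blast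
  have "conn E (C \<union> J)" if "finite J" "J \<subseteq> NB C" for J
   using that
  proof (induction J rule: finite_induct)
   case empty thus ?case using C_conn[OF C] by simp
  next
   case (insert b J)
   then obtain u where u: "u \<in> C" "(u, b) \<in> E" unfolding NB_def by blast
   have CJ: "conn E (C \<union> J)" using insert by auto
   have "conn E (C \<union> J \<union> {u, b})" by (rule conn_Un[OF CJ conn_pair[OF u(2) tm(3)], of u]) (use u in auto)
   moreover have "C \<union> J \<union> {u, b} = C \<union> insert b J" using u(1) by blast
   ultimately show ?case by simp
  qed
  thus "conn E (C \<union> NB C)" using NBfin by blast
  have "NB C \<subseteq> (\<Union>u\<in>C. E `` {u} \<inter> K)" using B unfolding NB_def by blast
  moreover have "finite (\<Union>u\<in>C. E `` {u} \<inter> K)" using C_fin[OF C] finK by auto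
  ultimately have "card (NB C) \<le> card (\<Union>u\<in>C. E `` {u} \<inter> K)" by (rule card_mono[rotated])
  also have "\<dots> \<le> (\<Sum>u\<in>C. card (E `` {u} \<inter> K))" by (rule card_UN_le[OF C_fin[OF C]])
  also have "\<dots> \<le> (\<Sum>u\<in>C. D)"
  proof (rule sum_mono)
   fix u assume "u \<in> C"
   hence "u \<in> K" "u \<notin> H" using C_sub[OF C] unfolding M_def by auto
   thus "card (E `` {u} \<inter> K) \<le> D" unfolding hubs_def by simp
  qed
  finally have "card (NB C) \<le> card C * D" by simp
  hence "card (C \<union> NB C) \<le> card C + card C * D" using card_Un_le[of C "NB C"] by linarith
  also have "\<dots> = card C * (D + 1)" by simp
  also have "\<dots> \<le> k0 * (D + 1)" using C_small[OF C] by (rule mult_le_mono1)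
  finally show "card (C \<union> NB C) \<le> k" using k by simp
 qed
 have sd: "sym_diff S (sym_diff S A) = A" for A by blast
 have cS1: "card (reps E S) = 1" using conn_card_reps[OF tm(3) cS] .
 have better: "card S + 2 \<le> card (SC C) + 2 * card (reps E (SC C))" if C: "C \<in> CC" for C
 proof -
  have "admissible D K E (sym_diff S (sym_diff S (SC C)))" unfolding sd by (rule admSC[OF C])
  hence "potential E S \<le> potential E (sym_diff S (sym_diff S (SC C)))"
   using lo move[OF C] unfolding locally_optimal_def by blast
  hence "potential E S \<le> potential E (SC C)" unfolding sd .
  thus ?thesis unfolding potential_def cS1 by simp
 qed
 show ?thesis
 proof (cases "\<exists>C\<in>CC. S \<union> P \<subseteq> C")
  \<comment> \<open>With both solutions inside a single piece, exchanging all of \<open>S\<close>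
    for \<open>P\<close> is itself a local move.\<close>
  case True
  then obtain C where C: "C \<in> CC" "S \<union> P \<subseteq> C" by blast
  have "local_move k D K E (sym_diff S P)" unfolding local_move_def
  proof (intro exI conjI disjI2)
   show "sym_diff S P \<subseteq> C" using C by blast
   show "C \<subseteq> K" "C \<inter> H = {}" using C_sub[OF C(1)] unfolding M_def by blast+
   show "conn E C" using C_conn[OF C(1)] .
   have "k0 * 1 \<le> k0 * (D + 1)" by (intro mult_le_mono2) simp
   thus "card C \<le> k" using C_small[OF C(1)] k by linarith
  qed
  moreover have "admissible D K E (sym_diff S (sym_diff S P))" unfolding sd by (rule admP)
  ultimately have "potential E S \<le> potential E (sym_diff S (sym_diff S P))" using lo unfolding locally_optimal_def by blast
  hence "potential E S \<le> potential E P" unfolding sd .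
  hence "card S \<le> card P" using cS1 conn_card_reps[OF tm(3) cP] unfolding potential_def by simp
  thus ?thesis by (intro exI[of _ "{}"]) simp
 next
  case notA: False
  define CS where "CS = {C \<in> CC. S \<inter> C ~= {}}"
  define XS where "XS = X \<inter> S"
  \<comment> \<open>The root of the charging scheme, an arbitrary value when \<open>XS\<close> is
    empty. The component that contains it is counted apart; this one cancels against the single
    component of \<open>S\<close> in \<open>better\<close>.\<close>
  define r where "r = (SOME r. r \<in> XS)"
  have rXS: "r \<in> XS" if "XS ~= {}" using that some_in_eq unfolding r_def by blast
  have XS_SC: "XS \<subseteq> SC C" "XS \<subseteq> S" "XS \<inter> C = {}" if "C \<in> CC" for C using XC[OF that] unfolding XS_def SC_def by blast+
  define W where "W C w = comp_of E (SC C) w" for C w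
  have W_closed: "v \<in> W C w" if "u \<in> W C w" "v \<in> SC C" "(u, v) \<in> E" "w \<in> SC C" for C w u v
  proof -
   have "u \<in> SC C" using that(1) comp_of_subset[OF that(4), of E] unfolding W_def by blast
   hence "(u, v) \<in> E \<inter> SC C \<times> SC C" using that by blast
   thus ?thesis using that(1) unfolding W_def comp_of_def by (auto intro: rtrancl_into_rtrancl)
  qed
  have W_sub: "W C w \<subseteq> SC C" if "w \<in> SC C" for C w unfolding W_def by (rule comp_of_subset[OF that])
  have W_self: "w \<in> W C w" for C w by (simp add: W_def comp_of_def)
  \<comment> \<open>A component of \<open>SC C\<close> without hubs and cut vertices lies in one
    piece. In a piece other than \<open>C\<close> it would be all of \<open>S\<close>, although
    \<open>S\<close> meets \<open>C\<close>. In \<open>C\<close> it would be all of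
    \<open>P\<close>; then an edge of \<open>S\<close> leaving \<open>C\<close> starts in it and
    ends in \<open>X\<close>.\<close>
  have meets: "W C w \<inter> X ~= {}" if C: "C \<in> CS" and w: "w \<in> SC C" for C w
  proof
   assume e: "W C w \<inter> X = {}"
   have CC: "C \<in> CC" and SCne: "S \<inter> C ~= {}" using C by (auto simp: CS_def)
   have WM: "W C w \<subseteq> M - B" using e W_sub[OF w] SCK unfolding X_def M_def by blast
   then obtain C' where C': "C' \<in> CC" "w \<in> C'" using C_ex W_self by blast
   have WC': "W C w \<subseteq> C'"
   proof (rule conn_subset_closed[of E "W C w" w])
    show "conn E (W C w)" unfolding W_def by (rule comp_of_conn[OF tm(3)])
    show "v \<in> C'" if "u \<in> C'" "v \<in> W C w" "(u, v) \<in> E" for u v using C_closed[OF C'(1) that(1) _ that(3)] that(2) WM by blast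
   qed (use W_self C' in auto)
   show False
   proof (cases "C' = C")
    case False
    have disj: "C' \<inter> C = {}" using C_eq[OF C'(1) CC] False by blast
    have WS: "W C w \<subseteq> S" using W_sub[OF w] WC' disj WM unfolding SC_def NB_def by blast
    have "S \<subseteq> W C w"
    proof (rule conn_subset_closed[OF cS])
     show "w \<in> S" "w \<in> W C w" using W_self WS by auto
     fix u v assume uv: "u \<in> W C w" "u \<in> S" "v \<in> S" "(u, v) \<in> E"
     have "v \<notin> C"
     proof
      assume v: "v \<in> C"
      hence "v \<in> C'" using C_closed[OF C'(1) _ _ uv(4)] uv(1) WC' C_sub[OF CC] by blast
      thus False using v disj by blast
     qed
     hence "v \<in> SC C" using uv unfolding SC_def by blast
     thus "v \<in> W C w" using W_closed[OF uv(1) _ uv(4) w] by blast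
    qed
    thus False using WC' disj SCne by blast
   next
    case True
    have WP: "W C w \<subseteq> P" using W_sub[OF w] WC' True WM unfolding SC_def NB_def by blast
    have "P \<subseteq> W C w"
    proof (rule conn_subset_closed[OF cP])
     show "w \<in> P" "w \<in> W C w" using W_self WP by auto
     fix u v assume uv: "u \<in> W C w" "u \<in> P" "v \<in> P" "(u, v) \<in> E"
     have uC: "u \<in> C" using uv WC' True by blast
     have "v \<in> SC C"
     proof (cases "v \<in> C")
      case True thus ?thesis using uv unfolding SC_def by blast
     next
      case False
      hence "v \<in> X" using C_out[OF CC uC _ _ uv(4)] uv(3) PK by blast
      thus ?thesis using uC uv(4) HS XC[OF CC] unfolding X_def SC_def NB_def by blast
     qed
     thus "v \<in> W C w" using W_closed[OF uv(1) _ uv(4) w] by blast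
    qed
    hence PC: "P \<subseteq> C" "P \<subseteq> W C w" using WC' True by auto
    hence SnC: "\<not> S \<subseteq> C" using notA CC by blast
    obtain y0 where y0: "y0 \<in> S" "y0 \<in> C" using SCne by blast
    have "\<exists>y x. y \<in> S \<inter> C \<and> x \<in> S - C \<and> (y, x) \<in> E"
     using conn_subset_closed[OF cS y0, of] SnC by blast
    then obtain y x where yx: "y \<in> S" "y \<in> C" "x \<in> S" "x \<notin> C" "(y, x) \<in> E" by blast
    have "x \<in> X" using C_out[OF CC yx(2) _ yx(4,5)] yx(3) SK by blast
    moreover have "y \<in> W C w" using covP yx PC unfolding cover_def by blast
    moreover have "x \<in> SC C" using yx unfolding SC_def by blast
    ultimately show False using W_closed[OF _ _ yx(5) w] e by blast
   qed
  qed
  \<comment> \<open>The components that have to be charged. Those containing a vertex of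
    \<open>NB C\<close> number at most \<open>card (NB C)\<close>, and at most one contains the
    root.\<close>
  define I where "I C = {w \<in> reps E (SC C). W C w \<inter> NB C = {} \<and> r \<notin> W C w}" for C
  have finSC: "finite (SC C)" for C using finite_subset[OF SCK finK] .
  have finI: "finite (I C)" for C using finite_subset[OF reps_subset finSC] unfolding I_def by simp
  have W_unique: "w = w'" if "w \<in> reps E (SC C)" "w' \<in> reps E (SC C)" "x \<in> W C w" "x \<in> W C w'" for C w w' x
  proof (rule reps_unique[OF tm(3) that(1,2)])
   show "(w, w') \<in> (E \<inter> SC C \<times> SC C)\<^sup>*"
    using that(3,4) rtrancl_restrict_sym[OF tm(3)] unfolding W_def comp_of_def by (blast intro: rtrancl_trans)
  qed
  have comps: "card (reps E (SC C)) \<le> card (NB C) + 1 + card (I C)" for C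
  proof -
   let ?A = "{w \<in> reps E (SC C). W C w \<inter> NB C ~= {}}" and ?R = "{w \<in> reps E (SC C). r \<in> W C w}"
   have fR: "finite (reps E (SC C))" using finite_subset[OF reps_subset finSC] .
   define h where "h w = (SOME b. b \<in> W C w \<inter> NB C)" for w
   have h: "h w \<in> W C w \<inter> NB C" if "w \<in> ?A" for w unfolding h_def some_in_eq using that by simp
   have "card ?A \<le> card (NB C)"
   proof (rule card_inj_on_le[where f = h])
    show "inj_on h ?A"
    proof (rule inj_onI)
     fix w w' assume ww: "w \<in> ?A" "w' \<in> ?A" "h w = h w'"
     hence "h w \<in> W C w" "h w \<in> W C w'" using h[OF ww(1)] h[OF ww(2)] by auto
     thus "w = w'" using W_unique[of w C w'] ww by blast
    qed
   qed (use h NBfin in auto)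
   moreover have "card ?R \<le> 1"
   proof -
    have "w = w'" if "w \<in> ?R" "w' \<in> ?R" for w w' using W_unique[of w C w' r] that by blast
    thus ?thesis using fR by (subst card_le_Suc0_iff_eq[unfolded One_nat_def[symmetric]]) auto
   qed
   moreover have "card (reps E (SC C)) \<le> card (?A \<union> ?R \<union> I C)" using fR finI by (intro card_mono) (auto simp: I_def)
   moreover have "card (?A \<union> ?R \<union> I C) \<le> card ?A + card ?R + card (I C)" by (meson add_mono card_Un_le le_trans order_refl)
   ultimately show ?thesis by linarith
  qed
  define dist where "dist y = (LEAST n. (r, y) \<in> (E \<inter> S \<times> S) ^^ n)" for y
  have pred: "\<exists>p\<in>S. (p, y) \<in> E \<and> dist p < dist y" if y: "y \<in> S" "y ~= r" "XS ~= {}" for y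
  proof -
   have "(r, y) \<in> (E \<inter> S \<times> S)\<^sup>*" using cS rXS[OF y(3)] y(1) unfolding conn_def XS_def by blast
   then obtain n where "(r, y) \<in> (E \<inter> S \<times> S) ^^ n" using rtrancl_imp_relpow by blast
   hence d: "(r, y) \<in> (E \<inter> S \<times> S) ^^ dist y" unfolding dist_def by (rule LeastI)
   then obtain n where n: "dist y = Suc n" using y(2) by (cases "dist y") auto
   then obtain p where p: "(r, p) \<in> (E \<inter> S \<times> S) ^^ n" "(p, y) \<in> E \<inter> S \<times> S" using d by auto
   have "dist p \<le> n" unfolding dist_def using p(1) by (rule Least_le)
   thus ?thesis using n p by auto
  qed
  \<comment> \<open>The vertices nearest to the root among those of the component outside
    \<open>C\<close>. The predecessor of such a vertex on a shortest walk in \<open>S\<close> lies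
    in \<open>C\<close>, as otherwise it would be a nearer vertex of the same component. Hence the
    vertex itself is a neighbour of \<open>C\<close> outside \<open>C\<close>, that is, a hub or a
    cut vertex.\<close>
  define low where "low C w y \<longleftrightarrow> y \<in> W C w - C \<and> (\<forall>z\<in>W C w - C. dist y \<le> dist z)" for C w y
  have I_facts: "W C w - C \<subseteq> S" "W C w \<inter> XS ~= {}" "w \<in> SC C" "r \<notin> W C w" if C: "C \<in> CS" and w: "w \<in> I C" for C w
  proof -
   have CC: "C \<in> CC" using C by (simp add: CS_def)
   show wS: "w \<in> SC C" using w reps_subset unfolding I_def by blast
   show "W C w - C \<subseteq> S" using W_sub[OF wS] w unfolding I_def SC_def by blast
   show "W C w \<inter> XS ~= {}" using meets[OF C wS] X_SC[OF CC] W_sub[OF wS] w unfolding I_def XS_def by blast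
   show "r \<notin> W C w" using w by (simp add: I_def)
  qed
  have low_ex: "\<exists>y. low C w y" if C: "C \<in> CS" and w: "w \<in> I C" for C w
  proof -
   have "W C w - C ~= {}" using I_facts(2)[OF C w] XS_SC(3)[of C] C unfolding CS_def by blast
   then obtain z where z: "z \<in> W C w - C" by blast
   show ?thesis unfolding low_def using ex_has_least_nat[of "\<lambda>z. z \<in> W C w - C", OF z, of dist] by blast
  qed
  have low_pred: "p \<in> C" if C: "C \<in> CS" and w: "w \<in> I C" and y: "low C w y" and p: "p \<in> S" "(p, y) \<in> E" "dist p < dist y" for C w y p
  proof (rule ccontr)
   assume "p \<notin> C"
   hence "p \<in> SC C" using p unfolding SC_def by blast
   hence "p \<in> W C w" using W_closed[OF _ _ symE[OF p(2)] I_facts(3)[OF C w]] y unfolding low_def by blast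
   hence "dist y \<le> dist p" using y \<open>p \<notin> C\<close> unfolding low_def by blast
   thus False using p(3) by simp
  qed
  have low_XS: "y \<in> XS \<and> y ~= r" if C: "C \<in> CS" and w: "w \<in> I C" and y: "low C w y" for C w y
  proof -
   have CC: "C \<in> CC" using C by (simp add: CS_def)
   have yS: "y \<in> S" "y \<notin> C" "y \<in> W C w" using y I_facts(1)[OF C w] unfolding low_def by auto
   have "y ~= r" using yS I_facts(4)[OF C w] by blast
   moreover obtain p where p: "p \<in> S" "(p, y) \<in> E" "dist p < dist y" using pred[OF yS(1) calculation] I_facts(2)[OF C w] by blast
   moreover have "p \<in> C" using low_pred[OF C w y p] .
   ultimately show ?thesis using C_out[OF CC _ _ yS(2) p(2)] yS SK unfolding XS_def by blast
  qed
  obtain yy where yy: "\<And>C w. C \<in> CS ==> w \<in> I C ==> low C w (yy C w)" using low_ex by metis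
  have "\<exists>q. q \<in> reps E XS \<and> (yy C w, q) \<in> (E \<inter> XS \<times> XS)\<^sup>*" if "C \<in> CS" "w \<in> I C" for C w
  proof -
   have "yy C w \<in> XS" using low_XS[OF that yy[OF that]] by blast
   then obtain q where "q \<in> reps E XS" "(yy C w, q) \<in> (E \<inter> XS \<times> XS)\<^sup>*" by (rule rep_exists[OF _ tm(3)])
   thus ?thesis by blast
  qed
  then obtain qq where qq: "\<And>C w. C \<in> CS ==> w \<in> I C ==> qq C w \<in> reps E XS \<and> (yy C w, qq C w) \<in> (E \<inter> XS \<times> XS)\<^sup>*" by metis
  have low_near: "z \<in> W C w - C" if C: "C \<in> CS" and w: "w \<in> I C" and z: "(yy C w, z) \<in> (E \<inter> XS \<times> XS)\<^sup>*" for C w z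
  proof -
   have CC: "C \<in> CC" using C by (simp add: CS_def)
   have zX: "z \<in> XS" using rtrancl_restrict_in[OF z] low_XS[OF C w yy[OF C w]] by blast
   have "(yy C w, z) \<in> (E \<inter> SC C \<times> SC C)\<^sup>*" using rtrancl_restrict_mono[OF XS_SC(1)[OF CC] z] .
   moreover have "yy C w \<in> W C w" using yy[OF C w] unfolding low_def by blast
   ultimately have "z \<in> W C w" unfolding W_def comp_of_def by (auto intro: rtrancl_trans)
   thus ?thesis using zX XS_SC(3)[OF CC] by blast
  qed
  have finXS: "finite XS" using finS by (simp add: XS_def)
  \<comment> \<open>If two pairs are charged to one component of \<open>XS\<close>, each nearest
    vertex lies in both components, so their distances agree. A predecessor of one of them then lies
    in both pieces, which makes the pieces equal and after that the components.\<close>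
  have "card (Sigma CS I) \<le> card (reps E XS)"
  proof (rule card_inj_on_le[where f = "\<lambda>(C, w). qq C w"])
   show "finite (reps E XS)" using finite_subset[OF reps_subset finXS] .
   show "(\<lambda>(C, w). qq C w) ` Sigma CS I \<subseteq> reps E XS" using qq by auto
   show "inj_on (\<lambda>(C, w). qq C w) (Sigma CS I)"
   proof (rule inj_onI, clarify)
    fix C w C' w' assume a: "C \<in> CS" "w \<in> I C" "C' \<in> CS" "w' \<in> I C'" and q: "qq C w = qq C' w'"
    let ?y = "yy C w" and ?y' = "yy C' w'"
    have y1: "(?y, qq C w) \<in> (E \<inter> XS \<times> XS)\<^sup>*" and y2: "(?y', qq C w) \<in> (E \<inter> XS \<times> XS)\<^sup>*" using qq[OF a(1,2)] qq[OF a(3,4)] q by auto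
    have 1: "(?y, ?y') \<in> (E \<inter> XS \<times> XS)\<^sup>*" using y1 rtrancl_restrict_sym[OF tm(3) y2] by (rule rtrancl_trans)
    have 2: "(?y', ?y) \<in> (E \<inter> XS \<times> XS)\<^sup>*" using rtrancl_restrict_sym[OF tm(3) 1] .
    have z1: "?y' \<in> W C w - C" using low_near[OF a(1,2) 1] .
    have z2: "?y \<in> W C' w' - C'" using low_near[OF a(3,4) 2] .
    have "dist ?y \<le> dist ?y'" using yy[OF a(1,2)] z1 unfolding low_def by blast
    moreover have "dist ?y' \<le> dist ?y" using yy[OF a(3,4)] z2 unfolding low_def by blast
    ultimately have eq: "dist ?y = dist ?y'" by simp
    have l2: "low C w ?y'" using yy[OF a(1,2)] z1 unfolding low_def eq by blast
    have ys: "?y' \<in> S" "?y' ~= r" "XS ~= {}" using low_XS[OF a(3,4) yy[OF a(3,4)]] unfolding XS_def by auto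
    obtain p where p: "p \<in> S" "(p, ?y') \<in> E" "dist p < dist ?y'" using pred[OF ys] by blast
    have "p \<in> C" "p \<in> C'" using low_pred[OF a(1,2) l2 p] low_pred[OF a(3,4) yy[OF a(3,4)] p] by auto
    hence CC': "C = C'" using C_eq a(1,3) unfolding CS_def by blast
    moreover have "w = w'" using W_unique[of w C w' ?y'] a z1 yy[OF a(3,4)] CC' unfolding I_def low_def by blast
    ultimately show "C = C' \<and> w = w'" by blast
   qed
  qed
  moreover have finCS: "finite CS" using finCC by (simp add: CS_def)
  have "card (Sigma CS I) = (\<Sum>C\<in>CS. card (I C))" using finCS finI by (intro card_SigmaI) auto
  ultimately have sumI: "(\<Sum>C\<in>CS. card (I C)) \<le> card (reps E XS)" by simp
  \<comment> \<open>A vertex of \<open>NB C\<close> costs 1 for its size and 2 for a component it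
    may create, a charged component costs 2.\<close>
  have each: "card (S \<inter> C) \<le> card (P \<inter> C) + 3 * card (NB C) + 2 * card (I C)" if C: "C \<in> CS" for C
  proof -
   have CC: "C \<in> CC" using C by (simp add: CS_def)
   have "card (SC C) \<le> card (S - C) + card (P \<inter> C) + card (NB C)"
    unfolding SC_def by (meson add_mono card_Un_le le_trans order_refl)
   moreover have "card S = card (S - C) + card (S \<inter> C)" using card_Diff_subset_Int[of S C] card_mono[OF finS, of "S \<inter> C"] finS by simp
   ultimately show ?thesis using better[OF CC] comps[of C] by linarith
  qed
  have sumNB: "(\<Sum>C\<in>CS. card (NB C)) \<le> D * card B"
  proof -
   have "(\<Sum>C\<in>CS. card (NB C)) = card (Sigma CS NB)" using finCS NBfin by (intro card_SigmaI[symmetric]) auto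
   also have "\<dots> \<le> card (Sigma B (\<lambda>b. E `` {b} \<inter> K))"
   proof -
    have "\<forall>x\<in>Sigma CS NB. \<exists>u. u \<in> fst x \<and> (u, snd x) \<in> E" unfolding NB_def by auto
    then obtain g where g: "\<And>x. x \<in> Sigma CS NB ==> g x \<in> fst x \<and> (g x, snd x) \<in> E" by metis
    show ?thesis
    proof (rule card_inj_on_le[where f = "\<lambda>x. (snd x, g x)"])
     show "inj_on (\<lambda>x. (snd x, g x)) (Sigma CS NB)"
     proof (rule inj_onI)
      fix x y assume xy: "x \<in> Sigma CS NB" "y \<in> Sigma CS NB" "(snd x, g x) = (snd y, g y)"
      have "fst x = fst y" by (rule C_eq[of _ _ "g x"]) (use xy g[OF xy(1)] g[OF xy(2)] in \<open>auto simp: CS_def\<close>)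
      thus "x = y" using xy by (simp add: prod_eq_iff)
     qed
     show "(\<lambda>x. (snd x, g x)) ` Sigma CS NB \<subseteq> Sigma B (\<lambda>b. E `` {b} \<inter> K)"
     proof
      fix z assume "z \<in> (\<lambda>x. (snd x, g x)) ` Sigma CS NB"
      then obtain x where x: "x \<in> Sigma CS NB" "z = (snd x, g x)" by blast
      have "fst x \<in> CC" "snd x \<in> B" using x unfolding CS_def NB_def by auto
      thus "z \<in> Sigma B (\<lambda>b. E `` {b} \<inter> K)" using g[OF x(1)] x C_sub[of "fst x"] symE unfolding M_def by auto
     qed
     show "finite (Sigma B (\<lambda>b. E `` {b} \<inter> K))" using finB finK by auto
    qed
   qed
   also have "\<dots> = (\<Sum>b\<in>B. card (E `` {b} \<inter> K))" using finB finK by (intro card_SigmaI) auto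
   also have "\<dots> \<le> (\<Sum>b\<in>B. D)"
   proof (rule sum_mono)
    fix b assume "b \<in> B"
    hence "b \<in> K" "b \<notin> H" using B by auto
    thus "card (E `` {b} \<inter> K) \<le> D" unfolding hubs_def by simp
   qed
   finally show ?thesis by (simp add: mult.commute)
  qed
  \<comment> \<open>Components of \<open>XS\<close> that miss the cut consist of hubs, and
    representatives of different components are nonadjacent.\<close>
  define J where "J = {v \<in> reps E XS. comp_of E XS v \<inter> B = {}}"
  have JH: "J \<subseteq> H"
  proof
   fix v assume v: "v \<in> J"
   hence "v \<in> XS" "v \<notin> B" using reps_subset[of E XS] unfolding J_def comp_of_def by auto
   thus "v \<in> H" unfolding XS_def X_def by blast
  qed
  have Jind: "E \<inter> J \<times> J = {}"
  proof (rule equals0I, clarify)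
   fix u v assume uv: "(u, v) \<in> E" "u \<in> J" "v \<in> J"
   hence uvr: "u \<in> reps E XS" "v \<in> reps E XS" unfolding J_def by auto
   hence "(u, v) \<in> (E \<inter> XS \<times> XS)\<^sup>*" using uv(1) reps_subset[of E XS] by blast
   hence "u = v" using reps_unique[OF tm(3) uvr] by blast
   thus False using uv(1) tm(4) by (auto simp: irrefl_def)
  qed
  have cXS: "card (reps E XS) \<le> card B + card J"
  proof -
   let ?A = "{v \<in> reps E XS. comp_of E XS v \<inter> B ~= {}}"
   have fR: "finite (reps E XS)" using finite_subset[OF reps_subset finXS] .
   define h where "h w = (SOME b. b \<in> comp_of E XS w \<inter> B)" for w
   have h: "h w \<in> comp_of E XS w \<inter> B" if "w \<in> ?A" for w unfolding h_def some_in_eq using that by simp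
   have "card ?A \<le> card B"
   proof (rule card_inj_on_le[where f = h])
    show "inj_on h ?A"
    proof (rule inj_onI)
     fix w w' assume ww: "w \<in> ?A" "w' \<in> ?A" "h w = h w'"
     hence "(w, h w) \<in> (E \<inter> XS \<times> XS)\<^sup>*" "(w', h w) \<in> (E \<inter> XS \<times> XS)\<^sup>*" using h[OF ww(1)] h[OF ww(2)] unfolding comp_of_def by auto
     hence "(w, w') \<in> (E \<inter> XS \<times> XS)\<^sup>*" using rtrancl_restrict_sym[OF tm(3)] by (meson rtrancl_trans)
     thus "w = w'" using reps_unique[OF tm(3)] ww by blast
    qed
   qed (use h finB in auto)
   moreover have "reps E XS = ?A \<union> J" unfolding J_def by blast
   ultimately show ?thesis using card_Un_le[of ?A J] by simp
  qed
  have "S \<subseteq> X \<union> (\<Union>C\<in>CS. S \<inter> C)"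
  proof
   fix x assume x: "x \<in> S"
   show "x \<in> X \<union> (\<Union>C\<in>CS. S \<inter> C)"
   proof (cases "x \<in> X")
    case False
    hence "x \<in> M - B" using x SK unfolding X_def M_def by blast
    then obtain C where "C \<in> CC" "x \<in> C" using C_ex by blast
    thus ?thesis using x unfolding CS_def by blast
   qed simp
  qed
  hence "card S \<le> card (X \<union> (\<Union>C\<in>CS. S \<inter> C))"
   using finH finB finCS finS by (intro card_mono) (auto simp: X_def)
  also have "\<dots> \<le> card X + (\<Sum>C\<in>CS. card (S \<inter> C))"
   using card_Un_le[of X "\<Union>C\<in>CS. S \<inter> C"] card_UN_le[OF finCS, of "\<lambda>C. S \<inter> C"] by linarith
  also have "card X \<le> card H + card B" unfolding X_def by (rule card_Un_le)
  also have "(\<Sum>C\<in>CS. card (S \<inter> C)) \<le> (\<Sum>C\<in>CS. card (P \<inter> C) + 3 * card (NB C) + 2 * card (I C))" by (intro sum_mono each)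
  also have "\<dots> = (\<Sum>C\<in>CS. card (P \<inter> C)) + 3 * (\<Sum>C\<in>CS. card (NB C)) + 2 * (\<Sum>C\<in>CS. card (I C))" by (simp add: sum.distrib sum_distrib_left)
  finally have S1: "card S \<le> card H + card B + ((\<Sum>C\<in>CS. card (P \<inter> C)) + 3 * (\<Sum>C\<in>CS. card (NB C)) + 2 * (\<Sum>C\<in>CS. card (I C)))" by simp
  have "card H + (\<Sum>C\<in>CS. card (P \<inter> C)) \<le> card P"
  proof -
   have "(\<Sum>C\<in>CS. card (P \<inter> C)) = card (\<Union>C\<in>CS. P \<inter> C)"
    by (rule card_UN_disjoint[symmetric]) (use finCS finP C_eq in \<open>auto simp: CS_def\<close>)
   moreover have "card (H \<union> (\<Union>C\<in>CS. P \<inter> C)) = card H + card (\<Union>C\<in>CS. P \<inter> C)"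
    by (rule card_Un_disjoint) (use finH finCS finP XC in \<open>auto simp: CS_def X_def\<close>)
   moreover have "card (H \<union> (\<Union>C\<in>CS. P \<inter> C)) \<le> card P" using HP finP by (intro card_mono) auto
   ultimately show ?thesis by simp
  qed
  hence "card S \<le> card P + card B + 3 * (\<Sum>C\<in>CS. card (NB C)) + 2 * (\<Sum>C\<in>CS. card (I C))" using S1 by linarith
  also have "\<dots> \<le> card P + card B + 3 * (D * card B) + 2 * (card B + card J)"
   using sumNB sumI cXS by (intro add_mono mult_le_mono2) auto
  finally have "card S \<le> card P + 3 * (D + 1) * card B + 2 * card J" by (simp add: algebra_simps)
  thus ?thesis using JH Jind by blast
 qed
qed

end

section \<open>Choice of the parameters\<close>

definition par_t :: "nat => nat => nat" where "par_t c q = c * (16 * q + 2)"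
text \<open>Ratio of the size of the kernel to that of a nonempty vertex cover \<open>W\<close>; the
  factor 2 comes from \<open>card W + 1 \<le> 2 * card W\<close>.\<close>

definition par_kap :: "nat => nat => nat" where "par_kap c q = 1 + 2 * (par_t c q * c)"
text \<open>The excess over \<open>c\<close> is such that an independent set of hubs has at most
  \<open>card W / (32 * q)\<close> members.\<close>

definition par_D :: "nat => nat => nat" where "par_D c q = c + 32 * (c * (q * par_kap c q))"
text \<open>Cutting a fraction \<open>1 / m\<close> of the kernel brings the loss
  \<open>3 * (D + 1) * card B\<close> below \<open>card W / (16 * q)\<close>, whence 48.\<close>

definition par_m :: "nat => nat => nat" where "par_m c q = 48 * (q * ((par_D c q + 1) * par_kap c q))"
text \<open>The size of a piece times \<open>D + 1\<close>, as a move also contains the cut vertices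
  next to the piece.\<close>

definition par_k :: "nat => nat => nat" where
 "par_k c q = (par_D c q + 2) ^ (c * par_m c q) * (par_D c q + 1)"

lemma conn_no_edges: assumes "conn {} S" shows "card S = 1"
proof -
 obtain x where x: "x \<in> S" using assms by (auto simp: conn_def)
 have "y = x" if "y \<in> S" for y using assms x that by (auto simp: conn_def)
 hence "S = {x}" using x by blast
 thus ?thesis by simp
qed

text \<open>Four losses add up: \<open>n1\<close> neighbours of discarded twins, \<open>n2\<close>
  hubs that were missing, the cut, and twice the independent set \<open>J\<close> of hubs. Each is
  at most \<open>card W / (16 * q)\<close>, so the sum stays below
  \<open>card W / q\<close>.\<close>

theorem local_optimum_approximates:
 assumes tame: "tame c V E" and c: "0 < c" and q: "0 < q"
  and adm: "admissible (par_D c q) (kernel (par_t c q) V E) E S"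
  and lo: "locally_optimal (par_k c q) (par_D c q) (kernel (par_t c q) V E) E S"
  and W: "W \<subseteq> V" "conn E W" "cover E W"
 shows "conn E S \<and> q * card S \<le> (q + 1) * card W"
proof -
 let ?t = "par_t c q" and ?D = "par_D c q" and ?\<kappa> = "par_kap c q"
 have "2 * c < ?t" using c q by (simp add: par_t_def algebra_simps)
 moreover have "0 < ?D" using c by (simp add: par_D_def)
 ultimately interpret kernel_graph c ?t ?D V E using tame by unfold_locales
 have cS: "conn E S" using locally_optimal_conn[OF adm lo W(2,3)] .
 have finW: "finite W" using finite_subset[OF W(1) finV] .
 have o1: "1 \<le> card W" using W(2) finW by (simp add: conn_def Suc_le_eq card_gt_0_iff)
 have "q * card S \<le> (q + 1) * card W"
 proof (cases "E = {}")
  case True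
  hence "card S = 1" using conn_no_edges cS by simp
  thus ?thesis using o1 mult_le_mono[of q "q + 1" 1 "card W"] by simp
 next
  case False
  obtain P n1 n2 where P: "admissible ?D K E P" "conn E P" "card P \<le> card W + n1 + n2"
   "(?t - c) * n1 \<le> c * card W" "(?D - c) * n2 \<le> c * (card W + n1)"
   by (rule admissible_from_cover[OF W])
  have M: "K - H \<subseteq> V" using KV by blast
  have deg: "card (E `` {v} \<inter> (K - H)) < ?D" if "v \<in> K - H" for v
  proof -
   have "card (E `` {v} \<inter> (K - H)) \<le> card (E `` {v} \<inter> K)" using finK by (intro card_mono) auto
   also have "\<dots> < ?D" using that unfolding hubs_def by auto
   finally show ?thesis .
  qed
  have \<kappa>: "0 < ?\<kappa>" by (simp add: par_kap_def)
  have m: "0 < par_m c q" using q \<kappa> by (simp add: par_m_def)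
  obtain B where B: "B \<subseteq> K - H" "par_m c q * card B \<le> card (K - H)"
   "\<And>C. C \<subseteq> K - H - B ==> conn E C ==> card C \<le> (?D + 2) ^ (c * par_m c q)"
   using tm(7)[OF M deg m] by blast
  obtain J where J: "J \<subseteq> H" "E \<inter> J \<times> J = {}" "card S \<le> card P + 3 * (?D + 1) * card B + 2 * card J"
   using local_optimum_bound[OF adm lo cS P(1,2) B(1,3) _ False] unfolding par_k_def by blast
  have cK: "card K \<le> ?\<kappa> * card W"
  proof -
   have "card K \<le> card W + ?t * (c * (card W + 1))" by (rule card_kernel_le[OF W(3,1)])
   also have "\<dots> \<le> card W + ?t * (c * (2 * card W))" using o1 by (intro add_left_mono mult_le_mono2) simp
   also have "\<dots> = ?\<kappa> * card W" by (simp add: par_kap_def algebra_simps)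
   finally show ?thesis .
  qed
  have e1: "16 * (q * n1) \<le> card W"
  proof -
   \<comment> \<open>This is the reason for the summand 2 in \<open>par_t\<close>: after subtracting
     \<open>c\<close> the factor \<open>16 * q + 1\<close> remains.\<close>
   have "?t - c = c * (16 * q + 1)" by (simp add: par_t_def algebra_simps)
   hence "c * ((16 * q + 1) * n1) \<le> c * card W" using P(4) by (simp only: mult.assoc)
   hence "(16 * q + 1) * n1 \<le> card W" using c by simp
   thus ?thesis by (simp add: algebra_simps)
  qed
  have Dc: "?D - c = 32 * (c * (q * ?\<kappa>))" by (simp add: par_D_def)
  have e2: "16 * (q * n2) \<le> card W"
  proof -
   have "c * (32 * (q * ?\<kappa>) * n2) \<le> c * (card W + n1)" using P(5) unfolding Dc by (simp add: ac_simps)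
   hence "32 * (q * ?\<kappa>) * n2 \<le> card W + n1" using c by simp
   moreover have "32 * (q * n2) * 1 \<le> 32 * (q * n2) * ?\<kappa>" using \<kappa> by (intro mult_le_mono2) simp
   moreover have "32 * (q * n2) * ?\<kappa> = 32 * (q * ?\<kappa>) * n2" by (simp add: ac_simps)
   moreover have "n1 \<le> 16 * (q * n1)" using q by simp
   ultimately have "32 * (q * n2) \<le> card W + card W" using e1 by linarith
   thus ?thesis by simp
  qed
  have e3: "32 * (q * card J) \<le> card W"
  proof -
   have "(?D - c) * card J \<le> c * card K"
   proof (rule independent_high_degree_bound[OF tame _ KV J(2)])
    show "J \<subseteq> V" using J(1) HK KV by blast
    show "?D \<le> card (E `` {x} \<inter> K)" if "x \<in> J" for x using that J(1) unfolding hubs_def by blast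
   qed
   also have "\<dots> \<le> c * (?\<kappa> * card W)" using cK by (rule mult_le_mono2)
   finally have "(c * ?\<kappa>) * (32 * (q * card J)) \<le> (c * ?\<kappa>) * card W" unfolding Dc by (simp add: ac_simps)
   thus ?thesis using c \<kappa> by simp
  qed
  have e4: "16 * (q * (3 * (?D + 1) * card B)) \<le> card W"
  proof -
   have "par_m c q * card B \<le> card K" using B(2) card_mono[OF finK, of "K - H"] by (meson Diff_subset le_trans)
   hence "par_m c q * card B \<le> ?\<kappa> * card W" using cK by (rule le_trans)
   moreover have "par_m c q * card B = ?\<kappa> * (16 * (q * (3 * (?D + 1) * card B)))" by (simp add: par_m_def algebra_simps)
   ultimately show ?thesis using \<kappa> by simp
  qed
  have "16 * (q * card S) \<le> 16 * (q * (card W + n1 + n2 + 3 * (?D + 1) * card B + 2 * card J))"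
   using J(3) P(3) by (intro mult_le_mono2) linarith
  also have "\<dots> = 16 * (q * card W) + 16 * (q * n1) + 16 * (q * n2) + 16 * (q * (3 * (?D + 1) * card B)) + 32 * (q * card J)"
   by (simp add: algebra_simps)
  also have "\<dots> \<le> 16 * (q * card W) + 4 * card W" using e1 e2 e3 e4 by linarith
  finally show ?thesis by simp
 qed
 thus ?thesis using cS by blast
qed

section \<open>A structured language for one-head machines\<close>

datatype com = Skip | MoveL | MoveR | Put nat | Clr nat | Seq com com | If nat com com | While bool nat com

type_synonym tape = "int => nat set"
type_synonym lconf = "com list \<times> tape \<times> int"

fun lstep :: "lconf => lconf" where
 "lstep ([], T, h) = ([], T, h)"
| "lstep (Skip # ks, T, h) = (ks, T, h)"
| "lstep (MoveL # ks, T, h) = (ks, T, h - 1)"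
| "lstep (MoveR # ks, T, h) = (ks, T, h + 1)"
| "lstep (Put t # ks, T, h) = (ks, T(h := insert t (T h)), h)"
| "lstep (Clr t # ks, T, h) = (ks, T(h := T h - {t}), h)"
| "lstep (Seq c d # ks, T, h) = (c # d # ks, T, h)"
| "lstep (If t c d # ks, T, h) = ((if t \<in> T h then c else d) # ks, T, h)"
| "lstep (While b t c # ks, T, h) = (if (t \<in> T h) = b then c # While b t c # ks else ks, T, h)"

text \<open>All stacks of pending commands that can occur while \<open>c\<close> runs above
  \<open>ks\<close>. A loop returns to its own stack after each round, so the set is finite and can
  serve as the state set of a machine.\<close>

fun stacks :: "com => com list => com list set" where
 "stacks (Seq c d) ks = {Seq c d # ks} \<union> stacks c (d # ks) \<union> stacks d ks"
| "stacks (If t c d) ks = {If t c d # ks} \<union> stacks c ks \<union> stacks d ks"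
| "stacks (While b t c) ks = {While b t c # ks} \<union> stacks c (While b t c # ks)"
| "stacks c ks = {c # ks}"

fun tracks :: "com => nat set" where
 "tracks (Put t) = {t}"
| "tracks (Clr t) = {t}"
| "tracks (Seq c d) = tracks c \<union> tracks d"
| "tracks (If t c d) = {t} \<union> tracks c \<union> tracks d"
| "tracks (While b t c) = {t} \<union> tracks c"
| "tracks _ = {}"

lemma finite_stacks: "finite (stacks c ks)" by (induction c arbitrary: ks) auto

lemma stacks_self: "c # ks \<in> stacks c ks" by (cases c) auto

lemma stacks_step:
 "s \<in> stacks c ks ==> fst (lstep (s, T, h)) \<in> stacks c ks \<union> {ks}"
proof (induction c arbitrary: ks)
 case (Seq c d)
 consider "s = Seq c d # ks" | "s \<in> stacks c (d # ks)" | "s \<in> stacks d ks" using Seq.prems by auto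
 thus ?case
  by cases (use Seq.IH(1)[of "d # ks"] Seq.IH(2)[of ks] stacks_self in auto)
next
 case (If t c d)
 consider "s = If t c d # ks" | "s \<in> stacks c ks" | "s \<in> stacks d ks" using If.prems by auto
 thus ?case
  by cases (use If.IH(1)[of ks] If.IH(2)[of ks] stacks_self in auto)
next
 case (While b t c)
 consider "s = While b t c # ks" | "s \<in> stacks c (While b t c # ks)" using While.prems by auto
 thus ?case
  by cases (use While.IH[of "While b t c # ks"] stacks_self in auto)
qed auto

lemma stacks_tracks: "s \<in> stacks c ks ==> \<Union>(tracks ` set s) \<subseteq> tracks c \<union> \<Union>(tracks ` set ks)"
 by (induction c arbitrary: ks) fastforce+

lemma lstep_reachable: "fst ((lstep ^^ k) ([c], T, h)) \<in> stacks c [] \<union> {[]}"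
proof (induction k)
 case (Suc k)
 obtain s T' h' where s: "(lstep ^^ k) ([c], T, h) = (s, T', h')" by (metis surj_pair)
 hence "s \<in> stacks c [] \<union> {[]}" using Suc by simp
 thus ?case using stacks_step[of s c "[]" T' h'] s by auto
qed (simp add: stacks_self)

lemma lstep_tracks:
 assumes "\<Union>(tracks ` set s) \<subseteq> M" "\<And>i. T i \<subseteq> M" "lstep (s, T, h) = (s', T', h')"
 shows "T' i \<subseteq> M"
 using assms
proof (cases s)
 case (Cons c ks)
 thus ?thesis using assms(1,3) subsetD[OF assms(2)] by (cases c) (auto split: if_splits)
qed auto

lemma lstep_reachable_tape:
 assumes "tracks c \<subseteq> M" "\<And>i. T i \<subseteq> M"
 shows "(lstep ^^ k) ([c], T, h) = (s, T', h') ==> T' i \<subseteq> M"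
proof (induction k arbitrary: s T' h' i)
 case (Suc k)
 obtain s1 T1 h1 where s1: "(lstep ^^ k) ([c], T, h) = (s1, T1, h1)" by (metis surj_pair)
 have "s1 \<in> stacks c [] \<union> {[]}" using lstep_reachable[of k c T h] s1 by simp
 hence "\<Union>(tracks ` set s1) \<subseteq> M" using stacks_tracks[of s1 c "[]"] assms(1) by auto
 moreover have "T1 i \<subseteq> M" for i using Suc.IH[OF s1] .
 moreover have "lstep (s1, T1, h1) = (s, T', h')" using Suc.prems s1 by simp
 ultimately show ?case by (rule lstep_tracks)
qed (use assms in simp)

lemma set_encode_less: "A \<subseteq> {..<m} ==> set_encode A < 2 ^ m"
proof -
 assume A: "A \<subseteq> {..<m}"
 have "set_encode A \<le> (\<Sum>i<m. 2 ^ i)" unfolding set_encode_def using A by (intro sum_mono2) auto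
 also have "\<dots> < (2::nat) ^ m" by (induction m) auto
 finally show ?thesis .
qed

lemma set_decode_subset: "a < 2 ^ m ==> set_decode a \<subseteq> {..<m}"
proof
 fix x assume a: "a < 2 ^ m" and x: "x \<in> set_decode a"
 show "x \<in> {..<m}"
 proof (rule ccontr)
  assume "x \<notin> {..<m}"
  hence "(2::nat) ^ m \<le> 2 ^ x" by (intro power_increasing) auto
  hence "a < 2 ^ x" using a by linarith
  hence "a div 2 ^ x = 0" by simp
  thus False using x by (simp add: set_decode_def)
 qed
qed

definition input_tape :: "nat list => tape" where
 "input_tape w i = (if 0 \<le> i \<and> i < int (length w) then set_decode (w ! nat i) else {})"

text \<open>Each step of the stack semantics is one machine step. The state codes the stack, with
  \<open>[c]\<close> as the initial state 0 and the empty stack as the halting state 1, and the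
  symbol codes the set of marked tracks as a binary number. A step looks at the cell under the head
  only, so a transition can be computed on a constant tape.\<close>

lemma tm_of_com:
 "\<exists>M. turing_machine M \<and> (\<forall>w k T h. set w \<subseteq> {..<4} --> (lstep ^^ k) ([c], input_tape w, 0) = ([], T, h) -->
   (tm_step M ^^ k) (tm_start w) = (1, \<lambda>i. set_encode (T i), h))"
proof -
 \<comment> \<open>Tracks 0 and 1 are included because the input symbols 1, 2 and 3 occupy two
   bits.\<close>
 obtain m where m: "tracks c \<union> {0, 1} \<subseteq> {..<m}"
 proof -
  have "finite (tracks c \<union> {0,1})" by (induction c) auto
  thus ?thesis using that finite_nat_set_iff_bounded by (metis lessThan_iff subsetI)
 qed
 define Q where "Q = stacks c [] \<union> {[]} - {[c], []}"
 have finQ: "finite Q" by (simp add: Q_def finite_stacks)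
 obtain f where f: "bij_betw f Q {0..<card Q}" using ex_bij_betw_finite_nat[OF finQ] by blast
 define enc where "enc s = (if s = [c] then 0 else if s = [] then 1 else f s + 2)" for s
 define N where "N = card Q + 2"
 have enc_lt: "enc s < N" if "s \<in> stacks c [] \<union> {[]}" for s
  using f that unfolding enc_def N_def bij_betw_def Q_def by (auto simp: image_iff)
 have enc_inj: "s = s'" if "s \<in> stacks c [] \<union> {[]}" "s' \<in> stacks c [] \<union> {[]}" "enc s = enc s'" for s s'
 proof -
  have "s \<in> Q \<or> s = [c] \<or> s = []" "s' \<in> Q \<or> s' = [c] \<or> s' = []" using that unfolding Q_def by auto
  moreover have "s = s'" if "s \<in> Q" "s' \<in> Q" "f s = f s'" using f that by (auto simp: bij_betw_def dest: inj_onD)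
  ultimately show ?thesis using that(3) unfolding enc_def by (auto split: if_splits)
 qed
 define dec where "dec q = (SOME s. s \<in> stacks c [] \<union> {[]} \<and> enc s = q)" for q
 have dec: "dec (enc s) = s" if "s \<in> stacks c [] \<union> {[]}" for s
 proof -
  have "dec (enc s) \<in> stacks c [] \<union> {[]} \<and> enc (dec (enc s)) = enc s" unfolding dec_def by (rule someI[of _ s]) (use that in simp)
  thus ?thesis using enc_inj that by blast
 qed
 define tr where "tr q a = (if q \<in> enc ` (stacks c [] \<union> {[]}) \<and> a < 2 ^ m then
   (let (s', T', h') = lstep (dec q, (\<lambda>_. set_decode a), 0) in (enc s', set_encode (T' 0), h')) else (0, 0, 0))" for q a
 define M where "M = \<lparr>states = N, symbols = 2 ^ m, trans = tr\<rparr>"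
 have stk: "\<Union>(tracks ` set s) \<subseteq> {..<m}" if "s \<in> stacks c [] \<union> {[]}" for s using stacks_tracks[of s c "[]"] m that by auto
 have local: "lstep (s, T, h) = (s', T', h') ==> s' = s1 \<and> T' = T(h := T1 0) \<and> h' = h + h1 \<and> h1 \<in> {-1, 0, 1}"
  if "lstep (s, (\<lambda>_. T h), 0) = (s1, T1, h1)" for s T h s' T' h' s1 T1 h1
  using that
 proof (cases s)
  case (Cons d ks)
  thus "lstep (s, T, h) = (s', T', h') ==> ?thesis" using that by (cases d) (auto split: if_splits)
 qed auto
 have "(2::nat) ^ 2 \<le> 2 ^ m" using m by (intro power_increasing) (auto simp: subset_iff)
 have tm: "turing_machine M" unfolding turing_machine_def M_def tm.simps
 proof (intro conjI allI impI)
  show "2 \<le> N" by (simp add: N_def)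
  show "4 \<le> (2::nat) ^ m" using \<open>(2::nat) ^ 2 \<le> 2 ^ m\<close> by simp
  fix q a assume "q < N" and a: "a < (2::nat) ^ m"
  show "tr q a \<in> {..<N} \<times> {..<2 ^ m} \<times> {- 1, 0, 1}"
  proof (cases "q \<in> enc ` (stacks c [] \<union> {[]})")
   case True
   then obtain s where s: "s \<in> stacks c [] \<union> {[]}" "q = enc s" by blast
   obtain s1 T1 h1 where l: "lstep (s, (\<lambda>_. set_decode a), 0) = (s1, T1, h1)" by (metis surj_pair)
   have "s1 \<in> stacks c [] \<union> {[]}" using stacks_step[of s c "[]" "\<lambda>_. set_decode a" 0] s(1) l by auto
   moreover have "T1 0 \<subseteq> {..<m}" using lstep_tracks[OF stk[OF s(1)] _ l] set_decode_subset[OF a] by blast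
   moreover have "h1 \<in> {-1, 0, 1}" using local[of s "\<lambda>_. set_decode a" 0 s1 T1 h1 s1 T1 h1] l by simp
   ultimately show ?thesis unfolding tr_def s(2) dec[OF s(1)] l using a enc_lt set_encode_less s(1) by auto
  next
   case False
   thus ?thesis unfolding tr_def by (auto simp: N_def)
  qed
 qed
 have run: "(tm_step M ^^ k) (tm_start w) = (enc s, \<lambda>i. set_encode (T i), h)"
  if w: "set w \<subseteq> {..<4}" and r: "(lstep ^^ k) ([c], input_tape w, 0) = (s, T, h)" for w k s T h
  using r
 proof (induction k arbitrary: s T h)
  case 0
  have "set_encode (input_tape w i) = (if 0 \<le> i \<and> i < int (length w) then w ! nat i else 0)" for i
   unfolding input_tape_def by (simp add: set_decode_inverse)
  thus ?case using 0 by (auto simp: tm_start_def enc_def)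
 next
  case (Suc k)
  obtain s1 T1 h1 where s1: "(lstep ^^ k) ([c], input_tape w, 0) = (s1, T1, h1)" by (metis surj_pair)
  have st1: "s1 \<in> stacks c [] \<union> {[]}" using lstep_reachable[of k c "input_tape w" 0] s1 by simp
  have inp: "input_tape w i \<subseteq> {..<m}" for i
  proof -
   have "x < 4" if "x \<in> set w" for x using w that by auto
   hence a: "set_decode (w ! nat i) \<subseteq> {..<2}" if "0 \<le> i" "i < int (length w)"
    using that by (intro set_decode_subset) (simp add: nat_less_iff)
   have b: "{..<2::nat} \<subseteq> {..<m}" using m by (auto simp: subset_iff)
   show ?thesis
   proof (cases "0 \<le> i \<and> i < int (length w)")
    case True
    hence "input_tape w i = set_decode (w ! nat i)" by (simp add: input_tape_def)
    moreover have "set_decode (w ! nat i) \<subseteq> {..<m}" using a[THEN subset_trans, OF _ _ b] True by blast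
    ultimately show ?thesis by simp
   next
    case False
    hence "input_tape w i = {}" by (auto simp: input_tape_def)
    thus ?thesis by simp
   qed
  qed
  have T1: "T1 i \<subseteq> {..<m}" for i using lstep_reachable_tape[OF _ inp s1] m by auto
  have fin: "finite (T1 i)" for i using T1[of i] finite_subset by blast
  have l: "lstep (s1, T1, h1) = (s, T, h)" using Suc.prems s1 by simp
  obtain s2 T2 h2 where l2: "lstep (s1, (\<lambda>_. T1 h1), 0) = (s2, T2, h2)" by (metis surj_pair)
  have loc: "s = s2" "T = T1(h1 := T2 0)" "h = h1 + h2" using local[OF l2 l] by auto
  have IH: "(tm_step M ^^ k) (tm_start w) = (enc s1, \<lambda>i. set_encode (T1 i), h1)" using Suc.IH[OF s1] .
  show ?case
  proof (cases "s1 = []")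
   case True
   hence "enc s1 = 1" by (simp add: enc_def)
   thus ?thesis using IH l True by simp
  next
   case False
   have "enc s1 ~= 1" using enc_inj[OF st1, of "[]"] False by (auto simp: enc_def)
   moreover have "tr (enc s1) (set_encode (T1 h1)) = (enc s2, set_encode (T2 0), h2)"
   proof -
    have "enc s1 \<in> enc ` (stacks c [] \<union> {[]}) \<and> set_encode (T1 h1) < 2 ^ m" using imageI[OF st1] set_encode_less[OF T1] by blast
    hence "tr (enc s1) (set_encode (T1 h1)) =
     (let (s', T', h') = lstep (dec (enc s1), (\<lambda>_. set_decode (set_encode (T1 h1))), 0) in (enc s', set_encode (T' 0), h'))"
     unfolding tr_def by (rule if_P)
    thus ?thesis unfolding dec[OF st1] set_encode_inverse[OF fin] l2 by simp
   qed
   ultimately show ?thesis using IH loc by (auto simp: M_def fun_eq_iff)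
  qed
 qed
 have "enc [] = 1" by (simp add: enc_def)
 thus ?thesis using tm run by (intro exI[of _ M]) force
qed

text \<open>The quantification over the rest \<open>ks\<close> of the stack makes runs
  composable.\<close>

definition runs :: "com => tape => int => tape => int => nat => bool" where
 "runs c T h T' h' n \<longleftrightarrow> (\<forall>ks. (lstep ^^ n) (c # ks, T, h) = (ks, T', h'))"

lemma runs_act:
 "runs Skip T h T h 1" "runs MoveL T h T (h - 1) 1" "runs MoveR T h T (h + 1) 1"
 "runs (Put t) T h (T(h := insert t (T h))) h 1" "runs (Clr t) T h (T(h := T h - {t})) h 1"
 by (simp_all add: runs_def)

lemma lstep_funpow_add: "(lstep ^^ a) x = y ==> (lstep ^^ b) y = z ==> (lstep ^^ (a + b)) x = z"
 by (simp add: add.commute[of a b] funpow_add)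

lemma runs_Seq: "runs c T h T1 h1 a ==> runs d T1 h1 T2 h2 b ==> runs (Seq c d) T h T2 h2 (Suc (a + b))"
 unfolding runs_def
proof (intro allI)
 fix ks assume "\<forall>ks. (lstep ^^ a) (c # ks, T, h) = (ks, T1, h1)" "\<forall>ks. (lstep ^^ b) (d # ks, T1, h1) = (ks, T2, h2)"
 hence "(lstep ^^ (a + b)) (c # d # ks, T, h) = (ks, T2, h2)" by (intro lstep_funpow_add) auto
 thus "(lstep ^^ Suc (a + b)) (Seq c d # ks, T, h) = (ks, T2, h2)" by (simp add: funpow_swap1 funpow_Suc_right del: funpow.simps)
qed

lemma runs_If: "runs (if t \<in> T h then c else d) T h T1 h1 a ==> runs (If t c d) T h T1 h1 (Suc a)"
 unfolding runs_def by (simp add: funpow_Suc_right del: funpow.simps)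

lemma runs_While_done: "(t \<in> T h) ~= b ==> runs (While b t c) T h T h 1"
 by (simp add: runs_def)

lemma runs_While_step:
 assumes "(t \<in> T h) = b" "runs c T h T1 h1 n" "runs (While b t c) T1 h1 T2 h2 m"
 shows "runs (While b t c) T h T2 h2 (Suc (n + m))"
 unfolding runs_def
proof (intro allI)
 fix ks
 have "(lstep ^^ (n + m)) (c # While b t c # ks, T, h) = (ks, T2, h2)"
  using assms(2,3) unfolding runs_def by (intro lstep_funpow_add) auto
 thus "(lstep ^^ Suc (n + m)) (While b t c # ks, T, h) = (ks, T2, h2)"
  using assms(1) by (simp add: funpow_Suc_right del: funpow.simps)
qed

section \<open>Loop programs\<close>

text \<open>The count of \<open>PRep\<close> is read once, on entry, so programs always terminate
  and their cost can be estimated from the nesting of loops. Comparing registers for equality is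
  cheap in the intended representation, since equal registers have their marks in the same
  cell.\<close>

datatype prog = PSkip | PInc nat | PZero nat | PCopy nat nat | PPut nat nat | PClr nat nat
 | PSeq prog prog (infixr ";;" 60) | PIfBit nat nat prog prog | PIfEq nat nat prog prog | PRep nat prog

type_synonym pstate = "(nat => nat) \<times> (nat => nat => bool)"

fun exec :: "prog => pstate => pstate" where
 "exec PSkip s = s"
| "exec (PInc x) s = ((fst s)(x := Suc (fst s x)), snd s)"
| "exec (PZero x) s = ((fst s)(x := 0), snd s)"
| "exec (PCopy x y) s = ((fst s)(x := fst s y), snd s)"
| "exec (PPut k x) s = (fst s, (snd s)(k := (snd s k)(fst s x := True)))"
| "exec (PClr k x) s = (fst s, (snd s)(k := (snd s k)(fst s x := False)))"
| "exec (PSeq p q) s = exec q (exec p s)"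
| "exec (PIfBit k x p q) s = (if snd s k (fst s x) then exec p s else exec q s)"
| "exec (PIfEq x y p q) s = (if fst s x = fst s y then exec p s else exec q s)"
| "exec (PRep y p) s = (exec p ^^ fst s y) s"

text \<open>The cost also limits growth: registers and head positions rise by at most the cost. The
  2 extra units per round pay for moving the loop counter.\<close>

fun cost :: "prog => pstate => nat" where
 "cost (PSeq p q) s = Suc (cost p s + cost q (exec p s))"
| "cost (PIfBit k x p q) s = Suc (if snd s k (fst s x) then cost p s else cost q s)"
| "cost (PIfEq x y p q) s = Suc (if fst s x = fst s y then cost p s else cost q s)"
| "cost (PRep y p) s = Suc (\<Sum>i<fst s y. cost p ((exec p ^^ i) s) + 2)"
| "cost _ s = 1"

text \<open>Tracks 0 and 1 carry the input, track 2 marks the origin; a variable is a track with a single mark,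
 and loop counters live on separate tracks indexed by the nesting depth.\<close>

definition vtr :: "nat => nat" where "vtr x = 3 * x + 4"
definition btr :: "nat => nat" where "btr k = (if k < 2 then k else 3 * k)"
definition htr :: "nat => nat" where "htr d = 3 * d + 5"

lemma vtr_inj [simp]: "vtr x = vtr y \<longleftrightarrow> x = y" "htr x = htr y \<longleftrightarrow> x = y" "btr x = btr y \<longleftrightarrow> x = y"
 by (auto simp: vtr_def htr_def btr_def split: if_splits)

lemma tr_distinct [simp]: "vtr x ~= htr y" "htr y ~= vtr x" "vtr x ~= btr y" "btr y ~= vtr x" "htr x ~= btr y" "btr y ~= htr x"
 "vtr x ~= 2" "2 ~= vtr x" "htr x ~= 2" "2 ~= htr x" "btr x ~= 2" "2 ~= btr x"
 by (auto simp: vtr_def htr_def btr_def split: if_splits) presburger+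

definition home :: com where "home = While False 2 MoveL"
definition goto :: "nat => com" where "goto t = Seq home (While False t MoveR)"

text \<open>Each access returns to the origin and searches to the right, so no head position has to
  be remembered. A loop copies its bound to its own counter mark, which then moves left until it
  reaches the origin. Copying a register to itself must do nothing, because the target mark is
  erased before the source mark is sought.\<close>

fun code :: "nat => prog => com" where
 "code d PSkip = Skip"
| "code d (PInc x) = Seq (goto (vtr x)) (Seq (Clr (vtr x)) (Seq MoveR (Put (vtr x))))"
| "code d (PZero x) = Seq (goto (vtr x)) (Seq (Clr (vtr x)) (Seq home (Put (vtr x))))"
| "code d (PCopy x y) = (if x = y then Skip else Seq (goto (vtr x)) (Seq (Clr (vtr x)) (Seq (goto (vtr y)) (Put (vtr x)))))"
| "code d (PPut k x) = Seq (goto (vtr x)) (Put (btr k))"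
| "code d (PClr k x) = Seq (goto (vtr x)) (Clr (btr k))"
| "code d (PSeq p q) = Seq (code d p) (code d q)"
| "code d (PIfBit k x p q) = Seq (goto (vtr x)) (If (btr k) (code d p) (code d q))"
| "code d (PIfEq x y p q) = Seq (goto (vtr x)) (If (vtr y) (code d p) (code d q))"
| "code d (PRep y p) =
  Seq (Seq (goto (htr d)) (Seq (Clr (htr d)) (Seq (goto (vtr y)) (Put (htr d))))) (Seq (goto (htr d))
   (While False 2 (Seq (Clr (htr d)) (Seq MoveL (Seq (Put (htr d)) (Seq (code (Suc d) p) (goto (htr d))))))))"

fun wf_prog :: "nat => nat => prog => bool" where
 "wf_prog N d PSkip \<longleftrightarrow> True"
| "wf_prog N d (PInc x) \<longleftrightarrow> x < N"
| "wf_prog N d (PZero x) \<longleftrightarrow> x < N"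
| "wf_prog N d (PCopy x y) \<longleftrightarrow> x < N \<and> y < N"
| "wf_prog N d (PPut k x) \<longleftrightarrow> k < N \<and> x < N"
| "wf_prog N d (PClr k x) \<longleftrightarrow> k < N \<and> x < N"
| "wf_prog N d (PSeq p q) \<longleftrightarrow> wf_prog N d p \<and> wf_prog N d q"
| "wf_prog N d (PIfBit k x p q) \<longleftrightarrow> k < N \<and> x < N \<and> wf_prog N d p \<and> wf_prog N d q"
| "wf_prog N d (PIfEq x y p q) \<longleftrightarrow> x < N \<and> y < N \<and> wf_prog N d p \<and> wf_prog N d q"
| "wf_prog N d (PRep y p) \<longleftrightarrow> y < N \<and> d < N \<and> wf_prog N (Suc d) p"

lemma wf_prog_mono: "wf_prog N d p ==> N \<le> N' ==> wf_prog N' d p"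
 by (induction p arbitrary: d) auto

lemma wf_prog_exists: "\<exists>N. wf_prog N d p"
proof (induction p arbitrary: d)
 case (PSeq p q)
 then obtain N N' where "wf_prog N d p" "wf_prog N' d q" by blast
 thus ?case using wf_prog_mono[of N d p "max N N'"] wf_prog_mono[of N' d q "max N N'"] by (intro exI[of _ "max N N'"]) auto
next
 case (PIfBit k x p q)
 then obtain N N' where "wf_prog N d p" "wf_prog N' d q" by blast
 thus ?case using wf_prog_mono[of N d p "Max {N, N', Suc k, Suc x}"] wf_prog_mono[of N' d q "Max {N, N', Suc k, Suc x}"]
  by (intro exI[of _ "Max {N, N', Suc k, Suc x}"]) (auto simp: less_max_iff_disj)
next
 case (PIfEq x y p q)
 then obtain N N' where "wf_prog N d p" "wf_prog N' d q" by blast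
 thus ?case using wf_prog_mono[of N d p "Max {N, N', Suc y, Suc x}"] wf_prog_mono[of N' d q "Max {N, N', Suc y, Suc x}"]
  by (intro exI[of _ "Max {N, N', Suc y, Suc x}"]) (auto simp: less_max_iff_disj)
next
 case (PRep y p)
 then obtain N where "wf_prog N (Suc d) p" by blast
 thus ?case using wf_prog_mono[of N "Suc d" p "Max {N, Suc d, Suc y}"]
  by (intro exI[of _ "Max {N, Suc d, Suc y}"]) (auto simp: less_max_iff_disj)
next
 case (PCopy x y) thus ?case by (intro exI[of _ "Suc (max x y)"]) auto
next
 case (PPut x y) thus ?case by (intro exI[of _ "Suc (max x y)"]) auto
next
 case (PClr x y) thus ?case by (intro exI[of _ "Suc (max x y)"]) auto
qed auto

section \<open>Tapes as marked cells on tracks\<close>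

type_synonym marks = "nat => nat set"

definition tape_of :: "marks => tape" where "tape_of C i = (if i < 0 then {} else {t. nat i \<in> C t})"

lemma tape_of_mem [simp]: "t \<in> tape_of C (int h) \<longleftrightarrow> h \<in> C t" by (simp add: tape_of_def)

lemma tape_of_put: "(tape_of C)(int h := insert t (tape_of C (int h))) = tape_of (C(t := insert h (C t)))"
 by (auto simp: tape_of_def fun_eq_iff)

lemma tape_of_clr: "(tape_of C)(int h := tape_of C (int h) - {t}) = tape_of (C(t := C t - {h}))"
 by (auto simp: tape_of_def fun_eq_iff)

definition rn :: "com => marks => nat => marks => nat => nat => bool" where
 "rn c C h C' h' n \<longleftrightarrow> runs c (tape_of C) (int h) (tape_of C') (int h') n"

lemma rn_act:
 "rn Skip C h C h 1" "rn MoveL C (Suc h) C h 1" "rn MoveR C h C (Suc h) 1"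
 "rn (Put t) C h (C(t := insert h (C t))) h 1" "rn (Clr t) C h (C(t := C t - {h})) h 1"
 unfolding rn_def using runs_act(1)[of "tape_of C" "int h"] runs_act(2)[of "tape_of C" "int (Suc h)"]
  runs_act(3)[of "tape_of C" "int h"] runs_act(4)[of t "tape_of C" "int h"] runs_act(5)[of t "tape_of C" "int h"]
 by (simp_all add: tape_of_put tape_of_clr add.commute)

lemma rn_Seq: "rn c C h C1 h1 a ==> rn d C1 h1 C2 h2 b ==> rn (Seq c d) C h C2 h2 (Suc (a + b))"
 unfolding rn_def by (rule runs_Seq)

lemma rn_If: "rn (if h \<in> C t then c else d) C h C1 h1 a ==> rn (If t c d) C h C1 h1 (Suc a)"
 unfolding rn_def by (rule runs_If) simp

lemma rn_While_done: "(h \<in> C t) ~= b ==> rn (While b t c) C h C h 1"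
 unfolding rn_def by (rule runs_While_done) simp

lemma rn_While_step: "(h \<in> C t) = b ==> rn c C h C1 h1 n ==> rn (While b t c) C1 h1 C2 h2 m ==> rn (While b t c) C h C2 h2 (Suc (n + m))"
 unfolding rn_def by (rule runs_While_step) simp_all

lemma rn_home: assumes "C 2 = {0}" shows "rn home C h C 0 (2 * h + 1)"
 unfolding home_def
proof (induction h)
 case 0
 thus ?case using rn_While_done[of 0 C 2 False MoveL] assms by simp
next
 case (Suc h)
 have "rn (While False 2 MoveL) C (Suc h) C 0 (Suc (1 + (2 * h + 1)))"
  by (rule rn_While_step[OF _ rn_act(2) Suc]) (use assms in simp)
 thus ?case by simp
qed

lemma rn_seek: assumes "C t = {h + j}" shows "rn (While False t MoveR) C h C (h + j) (2 * j + 1)"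
 using assms
proof (induction j arbitrary: h)
 case 0
 thus ?case using rn_While_done[of h C t False MoveR] by simp
next
 case (Suc j)
 have "rn (While False t MoveR) C h C (Suc h + j) (Suc (1 + (2 * j + 1)))"
  by (rule rn_While_step[OF _ rn_act(3) Suc.IH]) (use Suc.prems in auto)
 thus ?case by simp
qed

lemma rn_goto: assumes "C 2 = {0}" "C t = {p}" shows "rn (goto t) C h C p (2 * h + 2 * p + 3)"
proof -
 have "rn (While False t MoveR) C 0 C (0 + p) (2 * p + 1)" by (rule rn_seek) (use assms in simp)
 hence "rn (goto t) C h C (0 + p) (Suc (2 * h + 1 + (2 * p + 1)))"
  unfolding goto_def using rn_Seq[OF rn_home[where C = C and h = h, OF assms(1)]] by blast
 moreover have "Suc (2 * h + 1 + (2 * p + 1)) = 2 * h + 2 * p + 3" by simp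
 ultimately show ?thesis by (metis add_0)
qed

definition rel :: "nat => (nat => nat) => pstate => marks => bool" where
 "rel N \<eta> s C \<longleftrightarrow> C 2 = {0} \<and> (\<forall>x<N. C (vtr x) = {fst s x}) \<and> (\<forall>k<N. C (btr k) = {i. snd s k i}) \<and> (\<forall>d<N. C (htr d) = {\<eta> d})"

lemma relD: "rel N \<eta> s C ==> C 2 = {0}" "rel N \<eta> s C ==> x < N ==> C (vtr x) = {fst s x}"
 "rel N \<eta> s C ==> k < N ==> C (btr k) = {i. snd s k i}" "rel N \<eta> s C ==> d < N ==> C (htr d) = {\<eta> d}"
 by (auto simp: rel_def)

definition fits :: "nat => nat => (nat => nat) => pstate => nat => bool" where
 "fits N P \<eta> s h \<longleftrightarrow> h \<le> P \<and> (\<forall>x<N. fst s x \<le> P) \<and> (\<forall>d<N. \<eta> d \<le> P)"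

lemma fitsD: "fits N P \<eta> s h ==> h \<le> P" "fits N P \<eta> s h ==> x < N ==> fst s x \<le> P" "fits N P \<eta> s h ==> d < N ==> \<eta> d \<le> P"
 by (auto simp: fits_def)

lemma fits_mono: "fits N P \<eta> s h ==> P \<le> P' ==> fits N P' \<eta> s h" by (force simp: fits_def)

lemma rn_assign:
 assumes "C 2 = {0}" "C t = {p}" "C u = {r}" "t ~= u" "t ~= 2"
 shows "rn (Seq (goto t) (Seq (Clr t) (Seq (goto u) (Put t)))) C h (C(t := {r})) r (2 * h + 4 * p + 2 * r + 11)"
proof -
 let ?C1 = "C(t := C t - {p})"
 have 1: "rn (goto t) C h C p (2 * h + 2 * p + 3)" by (rule rn_goto[OF assms(1,2)])
 have 2: "rn (Clr t) C p ?C1 p 1" by (rule rn_act)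
 have 3: "rn (goto u) ?C1 p ?C1 r (2 * p + 2 * r + 3)" by (rule rn_goto) (use assms in auto)
 have "rn (Put t) ?C1 r (?C1(t := insert r (?C1 t))) r 1" by (rule rn_act)
 hence 4: "rn (Put t) ?C1 r (C(t := {r})) r 1" using assms(2) by simp
 show ?thesis using rn_Seq[OF 1 rn_Seq[OF 2 rn_Seq[OF 3 4]]] by (simp add: algebra_simps)
qed

lemma rn_eqn: "rn c C h C' h' n ==> n = m ==> rn c C h C' h' m" by simp

lemma rel_update_bit: "rel N \<eta> s C ==> k < N ==> rel N \<eta> (fst s, (snd s)(k := g)) (C(btr k := {i. g i}))"
 by (simp add: rel_def)

text \<open>\<open>B\<close> bounds every position that is ever visited, \<open>P\<close> those visited so far.\<close>

definition simul :: "nat => nat => nat => prog => (nat => nat) => pstate => marks => nat => nat => bool" where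
 "simul N B d p \<eta> s C P h \<longleftrightarrow> (\<exists>C' h' n \<eta>'. rn (code d p) C h C' h' n \<and> rel N \<eta>' (exec p s) C' \<and> (\<forall>e<d. \<eta>' e = \<eta> e) \<and>
  fits N (P + cost p s) \<eta>' (exec p s) h' \<and> n \<le> 40 * (B + 1) * cost p s)"

lemma simulE:
 assumes "simul N B d p \<eta> s C P h"
 obtains C' h' n \<eta>' where "rn (code d p) C h C' h' n" "rel N \<eta>' (exec p s) C'" "\<forall>e<d. \<eta>' e = \<eta> e"
  "fits N (P + cost p s) \<eta>' (exec p s) h'" "n \<le> 40 * (B + 1) * cost p s"
 using assms unfolding simul_def by blast

lemma simulI:
 "rn (code d p) C h C' h' n ==> rel N \<eta>' (exec p s) C' ==> \<forall>e<d. \<eta>' e = \<eta> e ==>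
  fits N (P + cost p s) \<eta>' (exec p s) h' ==> n \<le> 40 * (B + 1) * cost p s ==> simul N B d p \<eta> s C P h"
 unfolding simul_def by blast

text \<open>The common shape of register accesses: one walk to the mark of \<open>x\<close>, paid
  from one unit of cost, and a continuation \<open>c\<close> paid from the rest.\<close>

lemma simul_goto:
 assumes r: "rel N \<eta> s C" "fits N P \<eta> s h" "x < N" "P + cost p s \<le> B" and c: "code d p = Seq (goto (vtr x)) c"
  "rn c C (fst s x) C' h' m" "m \<le> 40 * (B + 1) * (cost p s - 1) + 2 * fst s x + 20" "0 < cost p s"
  and e: "rel N \<eta>' (exec p s) C'" "\<forall>e<d. \<eta>' e = \<eta> e" "fits N (P + cost p s) \<eta>' (exec p s) h'"
 shows "simul N B d p \<eta> s C P h"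
proof (rule simulI[OF _ e])
 have "rn (goto (vtr x)) C h C (fst s x) (2 * h + 2 * fst s x + 3)" by (rule rn_goto) (use relD[OF r(1)] r(3) in auto)
 thus "rn (code d p) C h C' h' (Suc (2 * h + 2 * fst s x + 3 + m))" unfolding c(1) by (rule rn_Seq[OF _ c(2)])
 obtain k where k: "cost p s = Suc k" using c(4) gr0_conv_Suc by blast
 show "Suc (2 * h + 2 * fst s x + 3 + m) \<le> 40 * (B + 1) * cost p s"
  using c(3) fitsD(1)[OF r(2)] fitsD(2)[OF r(2,3)] r(4) unfolding k by simp
qed

lemma simul_branch:
 assumes r: "rel N \<eta> s C" "fits N P \<eta> s h" "x < N" "P + cost p s \<le> B" and c: "code d p = Seq (goto (vtr x)) (If t c1 c2)"
  and e: "(if fst s x \<in> C t then c1 else c2) = code d r" "exec p s = exec r s" "cost p s = Suc (cost r s)"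
  and IH: "\<And>P h. fits N P \<eta> s h ==> P + cost r s \<le> B ==> simul N B d r \<eta> s C P h"
 shows "simul N B d p \<eta> s C P h"
proof -
 have "fits N P \<eta> s (fst s x)" using r(2,3) by (auto simp: fits_def)
 hence "simul N B d r \<eta> s C P (fst s x)" using IH r(4) e(3) by simp
 then obtain C' h' n \<eta>' where 2: "rn (code d r) C (fst s x) C' h' n" "rel N \<eta>' (exec r s) C'" "\<forall>e<d. \<eta>' e = \<eta> e"
  "fits N (P + cost r s) \<eta>' (exec r s) h'" "n \<le> 40 * (B + 1) * cost r s" by (rule simulE)
 have "rn (If t c1 c2) C (fst s x) C' h' (Suc n)" by (rule rn_If) (use 2(1) e(1) in simp)
 thus ?thesis by (rule simul_goto[OF r c]) (use 2 e fits_mono[OF 2(4), of "P + cost p s"] in auto)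
qed

text \<open>A unit of cost pays for a bounded number of walks within the first \<open>B\<close>
  cells, hence the factor \<open>40 * (B + 1)\<close>. In a loop the induction runs over the
  counter; the body may change counters of deeper loops but keeps those below its depth, so the
  counter of the loop is intact when the body ends.\<close>

lemma code_correct:
 assumes "wf_prog N d p" "rel N \<eta> s C" "fits N P \<eta> s h" "P + cost p s \<le> B"
 shows "simul N B d p \<eta> s C P h"
 using assms
proof (induction p arbitrary: d \<eta> s C P h)
 case PSkip
 show ?case using rn_act(1)[of C h] PSkip fits_mono[of N P \<eta> s h "P + 1"] by (intro simulI[where \<eta>' = \<eta>]) auto
next
 case (PInc x)
 let ?p = "fst s x" let ?C1 = "C(vtr x := C (vtr x) - {?p})"
 have x: "x < N" using PInc.prems by simp
 have "rn (Put (vtr x)) ?C1 (Suc ?p) (?C1(vtr x := insert (Suc ?p) (?C1 (vtr x)))) (Suc ?p) 1" by (rule rn_act)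
 hence 4: "rn (Put (vtr x)) ?C1 (Suc ?p) (C(vtr x := {Suc ?p})) (Suc ?p) 1" using relD(2)[OF PInc.prems(2) x] by simp
 show ?case
  by (rule simul_goto[OF PInc.prems(2,3) x PInc.prems(4) code.simps(2) rn_Seq[OF rn_act(5) rn_Seq[OF rn_act(3) 4]], where \<eta>' = \<eta>])
   (use PInc.prems(2,3) x in \<open>auto simp: rel_def fits_def le_SucI\<close>)
next
 case (PZero x)
 let ?p = "fst s x" let ?C1 = "C(vtr x := C (vtr x) - {?p})"
 have x: "x < N" using PZero.prems by simp
 have 3: "rn home ?C1 ?p ?C1 0 (2 * ?p + 1)" by (rule rn_home) (use relD[OF PZero.prems(2)] in auto)
 have "rn (Put (vtr x)) ?C1 0 (?C1(vtr x := insert 0 (?C1 (vtr x)))) 0 1" by (rule rn_act)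
 hence 4: "rn (Put (vtr x)) ?C1 0 (C(vtr x := {0})) 0 1" using relD(2)[OF PZero.prems(2) x] by simp
 show ?case
  by (rule simul_goto[OF PZero.prems(2,3) x PZero.prems(4) code.simps(3) rn_Seq[OF rn_act(5) rn_Seq[OF 3 4]], where \<eta>' = \<eta>])
   (use PZero.prems(2,3) x in \<open>auto simp: rel_def fits_def le_SucI\<close>)
next
 case (PCopy x y)
 note w = fitsD[OF PCopy.prems(3)]
 have x: "x < N" "y < N" using PCopy.prems by auto
 let ?r = "fst s y" and ?p = "fst s x"
 show ?case
 proof (cases "x = y")
  case True
  thus ?thesis using rn_act(1)[of C h] PCopy.prems fits_mono[of N P \<eta> s h "P + 1"] by (intro simulI[where \<eta>' = \<eta>]) auto
 next
  case False
  have r: "rn (code d (PCopy x y)) C h (C(vtr x := {?r})) ?r (2 * h + 4 * ?p + 2 * ?r + 11)"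
   using rn_assign[of C "vtr x" ?p "vtr y" ?r h] relD[OF PCopy.prems(2)] x False by simp
  have "2 * h + 4 * ?p + 2 * ?r + 11 \<le> 40 * (B + 1)" using w(1) w(2)[OF x(1)] w(2)[OF x(2)] PCopy.prems(4) by simp
  thus ?thesis using PCopy.prems(2,3) x by (intro simulI[OF r, where \<eta>' = \<eta>]) (auto simp: rel_def fits_def le_SucI)
 qed
next
 case (PPut k x)
 let ?p = "fst s x"
 have x: "x < N" "k < N" using PPut.prems by auto
 have "insert ?p (C (btr k)) = {i. ((snd s k)(?p := True)) i}" using relD(3)[OF PPut.prems(2) x(2)] by auto
 hence "rel N \<eta> (exec (PPut k x) s) (C(btr k := insert ?p (C (btr k))))"
  using rel_update_bit[OF PPut.prems(2) x(2)] by (simp only: exec.simps)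
 thus ?case
  by (intro simul_goto[OF PPut.prems(2,3) x(1) PPut.prems(4) code.simps(5) rn_act(4), where \<eta>' = \<eta>])
   (use PPut.prems(3) x in \<open>auto simp: fits_def le_SucI\<close>)
next
 case (PClr k x)
 let ?p = "fst s x"
 have x: "x < N" "k < N" using PClr.prems by auto
 have "C (btr k) - {?p} = {i. ((snd s k)(?p := False)) i}" using relD(3)[OF PClr.prems(2) x(2)] by auto
 hence "rel N \<eta> (exec (PClr k x) s) (C(btr k := C (btr k) - {?p}))"
  using rel_update_bit[OF PClr.prems(2) x(2)] by (simp only: exec.simps)
 thus ?case
  by (intro simul_goto[OF PClr.prems(2,3) x(1) PClr.prems(4) code.simps(6) rn_act(5), where \<eta>' = \<eta>])
   (use PClr.prems(3) x in \<open>auto simp: fits_def le_SucI\<close>)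
next
 case (PSeq p q)
 have wf: "wf_prog N d p" "wf_prog N d q" using PSeq.prems by auto
 have b1: "P + cost p s \<le> B" and b2: "P + cost p s + cost q (exec p s) \<le> B" using PSeq.prems(4) by auto
 obtain C1 h1 n1 \<eta>1 where 1: "rn (code d p) C h C1 h1 n1" "rel N \<eta>1 (exec p s) C1" "\<forall>e<d. \<eta>1 e = \<eta> e"
  "fits N (P + cost p s) \<eta>1 (exec p s) h1" "n1 \<le> 40 * (B + 1) * cost p s"
  using PSeq.IH(1)[OF wf(1) PSeq.prems(2,3) b1] by (rule simulE)
 obtain C2 h2 n2 \<eta>2 where 2: "rn (code d q) C1 h1 C2 h2 n2" "rel N \<eta>2 (exec q (exec p s)) C2" "\<forall>e<d. \<eta>2 e = \<eta>1 e"
  "fits N (P + cost p s + cost q (exec p s)) \<eta>2 (exec q (exec p s)) h2" "n2 \<le> 40 * (B + 1) * cost q (exec p s)"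
  using PSeq.IH(2)[OF wf(2) 1(2,4) b2] by (rule simulE)
 have "rn (code d (p ;; q)) C h C2 h2 (Suc (n1 + n2))" using rn_Seq[OF 1(1) 2(1)] by simp
 moreover have "Suc (n1 + n2) \<le> 40 * (B + 1) * cost (p ;; q) s" using 1(5) 2(5) by (simp add: distrib_left)
 moreover have "fits N (P + cost (p ;; q) s) \<eta>2 (exec (p ;; q) s) h2" using fits_mono[OF 2(4)] by simp
 ultimately show ?case using 1(3) 2(2,3) by (intro simulI[where \<eta>' = \<eta>2]) auto
next
 case (PIfBit k x p q)
 have x: "x < N" "k < N" using PIfBit.prems by auto
 have "fst s x \<in> C (btr k) \<longleftrightarrow> snd s k (fst s x)" using relD(3)[OF PIfBit.prems(2) x(2)] by simp
 moreover have "simul N B d (if snd s k (fst s x) then p else q) \<eta> s C P h"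
  if "fits N P \<eta> s h" "P + cost (if snd s k (fst s x) then p else q) s \<le> B" for P h
  using PIfBit.IH PIfBit.prems(1,2) that by (cases "snd s k (fst s x)") simp_all
 ultimately show ?case
  by (intro simul_branch[where r = "if snd s k (fst s x) then p else q", OF PIfBit.prems(2,3) x(1) PIfBit.prems(4) code.simps(8)]) simp_all
next
 case (PIfEq x y p q)
 have x: "x < N" "y < N" using PIfEq.prems by auto
 have "fst s x \<in> C (vtr y) \<longleftrightarrow> fst s x = fst s y" using relD(2)[OF PIfEq.prems(2) x(2)] by auto
 moreover have "simul N B d (if fst s x = fst s y then p else q) \<eta> s C P h"
  if "fits N P \<eta> s h" "P + cost (if fst s x = fst s y then p else q) s \<le> B" for P h
  using PIfEq.IH PIfEq.prems(1,2) that by (cases "fst s x = fst s y") simp_all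
 ultimately show ?case
  by (intro simul_branch[where r = "if fst s x = fst s y then p else q", OF PIfEq.prems(2,3) x(1) PIfEq.prems(4) code.simps(9)]) simp_all
next
 case (PRep y p)
 note w = fitsD[OF PRep.prems(3)]
 have y: "y < N" "d < N" and wf: "wf_prog N (Suc d) p" using PRep.prems by auto
 let ?body = "Seq (Clr (htr d)) (Seq MoveL (Seq (Put (htr d)) (Seq (code (Suc d) p) (goto (htr d)))))"
 let ?lc = "\<lambda>j s. \<Sum>i<j. cost p ((exec p ^^ i) s) + 2"
 have loop: "\<exists>C' h' n \<eta>'. rn (While False 2 ?body) C j C' h' n \<and> rel N \<eta>' ((exec p ^^ j) s) C' \<and> (\<forall>e<d. \<eta>' e = \<eta> e) \<and>
  fits N (P + ?lc j s) \<eta>' ((exec p ^^ j) s) h' \<and> n \<le> 40 * (B + 1) * ?lc j s + 1"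
  if "rel N \<eta> s C" "\<eta> d = j" "fits N P \<eta> s j" "P + ?lc j s \<le> B" for j \<eta> s C P
  using that
 proof (induction j arbitrary: \<eta> s C P)
  case 0
  have "rn (While False 2 ?body) C 0 C 0 1" by (rule rn_While_done) (use relD(1)[OF 0(1)] in simp)
  thus ?case using 0 by (intro exI[of _ C] exI[of _ 0] exI[of _ 1] exI[of _ \<eta>]) auto
 next
  case (Suc j)
  have lcS: "?lc (Suc j) s = cost p s + 2 + ?lc j (exec p s)"
   unfolding sum.lessThan_Suc_shift by (simp add: funpow_swap1)
  have eS: "(exec p ^^ Suc j) s = (exec p ^^ j) (exec p s)" by (simp add: funpow_swap1)
  let ?\<eta>1 = "\<eta>(d := j)"
  have e0: "C (htr d) = {Suc j}" using relD(4)[OF Suc.prems(1) y(2)] Suc.prems(2) by simp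
  let ?C1 = "C(htr d := C (htr d) - {Suc j})" let ?C2 = "C(htr d := {j})"
  have a1: "rn (Clr (htr d)) C (Suc j) ?C1 (Suc j) 1" by (rule rn_act)
  have a2: "rn MoveL ?C1 (Suc j) ?C1 j 1" by (rule rn_act)
  have "rn (Put (htr d)) ?C1 j (?C1(htr d := insert j (?C1 (htr d)))) j 1" by (rule rn_act)
  hence a3: "rn (Put (htr d)) ?C1 j ?C2 j 1" using e0 by simp
  have r2: "rel N ?\<eta>1 s ?C2" using Suc.prems(1) y unfolding rel_def by auto
  have w2: "fits N P ?\<eta>1 s j" using Suc.prems(3) unfolding fits_def by auto
  have b2: "P + cost p s \<le> B" using Suc.prems(4) unfolding lcS by simp
  obtain C3 h3 n3 \<eta>3 where 3: "rn (code (Suc d) p) ?C2 j C3 h3 n3" "rel N \<eta>3 (exec p s) C3" "\<forall>e<Suc d. \<eta>3 e = ?\<eta>1 e"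
   "fits N (P + cost p s) \<eta>3 (exec p s) h3" "n3 \<le> 40 * (B + 1) * cost p s"
   using PRep.IH[OF wf r2 w2 b2] by (rule simulE)
  have d3: "\<eta>3 d = j" using 3(3) by simp
  have jB: "j \<le> P" "h3 \<le> P + cost p s" using fitsD(1)[OF w2] fitsD(1)[OF 3(4)] by auto
  have a5: "rn (goto (htr d)) C3 h3 C3 j (2 * h3 + 2 * j + 3)" by (rule rn_goto) (use relD[OF 3(2)] y d3 in auto)
  have body: "rn ?body C (Suc j) C3 j (n3 + 2 * h3 + 2 * j + 10)"
   using rn_Seq[OF a1 rn_Seq[OF a2 rn_Seq[OF a3 rn_Seq[OF 3(1) a5]]]] by (simp add: algebra_simps)
  have w3: "fits N (P + cost p s) \<eta>3 (exec p s) j" using 3(4) jB unfolding fits_def by auto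
  have b3: "P + cost p s + ?lc j (exec p s) \<le> B" using Suc.prems(4) unfolding lcS by simp
  obtain C4 h4 n4 \<eta>4 where 4: "rn (While False 2 ?body) C3 j C4 h4 n4" "rel N \<eta>4 ((exec p ^^ j) (exec p s)) C4" "\<forall>e<d. \<eta>4 e = \<eta>3 e"
   "fits N (P + cost p s + ?lc j (exec p s)) \<eta>4 ((exec p ^^ j) (exec p s)) h4" "n4 \<le> 40 * (B + 1) * ?lc j (exec p s) + 1"
   using Suc.IH[OF 3(2) d3 w3 b3] by blast
  have "rn (While False 2 ?body) C (Suc j) C4 h4 (Suc (n3 + 2 * h3 + 2 * j + 10 + n4))"
   by (rule rn_While_step[OF _ body 4(1)]) (use relD(1)[OF Suc.prems(1)] in simp)
  moreover have "Suc (n3 + 2 * h3 + 2 * j + 10 + n4) \<le> 40 * (B + 1) * ?lc (Suc j) s + 1"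
  proof -
   have "2 * h3 + 2 * j + 11 \<le> 40 * (B + 1) * 2" using jB b2 by simp
   moreover have "40 * (B + 1) * (cost p s + 2 + ?lc j (exec p s)) = 40 * (B + 1) * cost p s + 40 * (B + 1) * 2 + 40 * (B + 1) * ?lc j (exec p s)"
    by (simp only: distrib_left)
   ultimately show ?thesis unfolding lcS using 3(5) 4(5) by linarith
  qed
  moreover have "fits N (P + ?lc (Suc j) s) \<eta>4 ((exec p ^^ Suc j) s) h4" unfolding lcS eS by (rule fits_mono[OF 4(4)]) simp
  moreover have "\<forall>e<d. \<eta>4 e = \<eta> e" using 3(3) 4(3) by simp
  ultimately show ?case using 4(2) unfolding eS by blast
 qed
 let ?j = "fst s y" let ?\<eta>1 = "\<eta>(d := ?j)" let ?C1 = "C(htr d := {?j})"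
 have as: "rn (Seq (goto (htr d)) (Seq (Clr (htr d)) (Seq (goto (vtr y)) (Put (htr d))))) C h ?C1 ?j (2 * h + 4 * \<eta> d + 2 * ?j + 11)"
  by (rule rn_assign) (use relD[OF PRep.prems(2)] y in auto)
 have r1: "rel N ?\<eta>1 s ?C1" using PRep.prems(2) y unfolding rel_def by auto
 have w1: "fits N P ?\<eta>1 s ?j" using PRep.prems(3) y unfolding fits_def by auto
 have g: "rn (goto (htr d)) ?C1 ?j ?C1 ?j (2 * ?j + 2 * ?j + 3)" by (rule rn_goto) (use relD[OF r1] y in auto)
 have b1: "P + ?lc ?j s \<le> B" using PRep.prems(4) by simp
 obtain C2 h2 n2 \<eta>2 where 2: "rn (While False 2 ?body) ?C1 ?j C2 h2 n2" "rel N \<eta>2 ((exec p ^^ ?j) s) C2" "\<forall>e<d. \<eta>2 e = ?\<eta>1 e"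
   "fits N (P + ?lc ?j s) \<eta>2 ((exec p ^^ ?j) s) h2" "n2 \<le> 40 * (B + 1) * ?lc ?j s + 1"
  using loop[OF r1 _ w1 b1] by auto
 have "rn (code d (PRep y p)) C h C2 h2 (Suc (2 * h + 4 * \<eta> d + 2 * ?j + 11 + Suc (2 * ?j + 2 * ?j + 3 + n2)))"
  unfolding code.simps by (rule rn_Seq[OF as rn_Seq[OF g 2(1)]])
 moreover have "Suc (2 * h + 4 * \<eta> d + 2 * ?j + 11 + Suc (2 * ?j + 2 * ?j + 3 + n2)) \<le> 40 * (B + 1) * cost (PRep y p) s"
  using 2(5) w(1) w(2)[OF y(1)] w(3)[OF y(2)] b1 by (simp add: distrib_left)
 moreover have "fits N (P + cost (PRep y p) s) \<eta>2 (exec (PRep y p) s) h2" using fits_mono[OF 2(4)] by simp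
 moreover have "\<forall>e<d. \<eta>2 e = \<eta> e" using 2(3) by simp
 moreover have "rel N \<eta>2 (exec (PRep y p) s) C2" using 2(2) by simp
 ultimately show ?case by (intro simulI)
qed

section \<open>Preparing the tape and cleaning up the output\<close>

fun putall :: "nat list => com" where
 "putall [] = Skip"
| "putall (t # ts) = Seq (Put t) (putall ts)"

fun clrall :: "nat list => com" where
 "clrall [] = Skip"
| "clrall (t # ts) = Seq (Clr t) (clrall ts)"

lemma rn_putall: "rn (putall ts) C h (\<lambda>t. if t \<in> set ts then insert h (C t) else C t) h (2 * length ts + 1)"
proof (induction ts arbitrary: C)
 case Nil
 thus ?case using rn_act(1)[of C h] by simp
next
 case (Cons u ts)
 have "(\<lambda>t. if t \<in> set ts then insert h ((C(u := insert h (C u))) t) else (C(u := insert h (C u))) t)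
   = (\<lambda>t. if t \<in> set (u # ts) then insert h (C t) else C t)" by (auto simp: fun_eq_iff)
 hence "rn (putall ts) (C(u := insert h (C u))) h (\<lambda>t. if t \<in> set (u # ts) then insert h (C t) else C t) h (2 * length ts + 1)"
  using Cons[of "C(u := insert h (C u))"] by metis
 thus ?case unfolding putall.simps by (rule rn_eqn[OF rn_Seq[OF rn_act(4)]]) simp
qed

lemma rn_clrall: "rn (clrall ts) C h (\<lambda>t. if t \<in> set ts then C t - {h} else C t) h (2 * length ts + 1)"
proof (induction ts arbitrary: C)
 case Nil
 thus ?case using rn_act(1)[of C h] by simp
next
 case (Cons u ts)
 have "(\<lambda>t. if t \<in> set ts then (C(u := C u - {h})) t - {h} else (C(u := C u - {h})) t)
   = (\<lambda>t. if t \<in> set (u # ts) then C t - {h} else C t)" by (auto simp: fun_eq_iff)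
 hence "rn (clrall ts) (C(u := C u - {h})) h (\<lambda>t. if t \<in> set (u # ts) then C t - {h} else C t) h (2 * length ts + 1)"
  using Cons[of "C(u := C u - {h})"] by metis
 thus ?case unfolding clrall.simps by (rule rn_eqn[OF rn_Seq[OF rn_act(5)]]) simp
qed

text \<open>Input symbols have bit 0 or bit 1 set, so the first cell with neither is the end of the
  input. Track 3 belongs to no register, counter or work track and serves as a temporary stop
  flag.\<close>

definition scan :: com where "scan = While False 3 (If 0 MoveR (If 1 MoveR (Put 3)))"

lemma rn_scan:
 assumes "C 3 = {}" "\<And>i. i < h + j ==> i \<in> C 0 \<or> i \<in> C 1" "h + j \<notin> C 0" "h + j \<notin> C 1"
 shows "\<exists>n\<le>4 * j + 5. rn scan C h (C(3 := {h + j})) (h + j) n"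
 using assms
proof (induction j arbitrary: h)
 case 0
 have "rn (Put 3) C h (C(3 := insert h (C 3))) h 1" by (rule rn_act)
 hence p: "rn (Put 3) C h (C(3 := {h})) h 1" using 0 by simp
 have "rn (If 1 MoveR (Put 3)) C h (C(3 := {h})) h (Suc 1)" by (rule rn_If) (use p 0 in simp)
 hence "rn (If 0 MoveR (If 1 MoveR (Put 3))) C h (C(3 := {h})) h (Suc (Suc 1))" by (intro rn_If) (use 0 in simp)
 hence "rn scan C h (C(3 := {h})) h (Suc (Suc (Suc 1) + 1))" unfolding scan_def
  by (rule rn_While_step[OF _ _ rn_While_done, rotated]) (use 0 in simp_all)
 hence "rn scan C h (C(3 := {h + 0})) (h + 0) 5" by (simp add: eval_nat_numeral)
 moreover have "(5::nat) \<le> 4 * 0 + 5" by simp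
 ultimately show ?case by blast
next
 case (Suc j)
 have "\<exists>n\<le>3. rn (If 0 MoveR (If 1 MoveR (Put 3))) C h C (Suc h) n"
 proof (cases "h \<in> C 0")
  case True
  have "rn (If 0 MoveR (If 1 MoveR (Put 3))) C h C (Suc h) (Suc 1)" by (rule rn_If) (use True rn_act(3) in simp)
  thus ?thesis by (intro exI[of _ "Suc 1"]) simp
 next
  case False
  hence "h \<in> C 1" using Suc.prems(2)[of h] by simp
  hence "rn (If 1 MoveR (Put 3)) C h C (Suc h) (Suc 1)" by (intro rn_If) (use rn_act(3) in simp)
  hence "rn (If 0 MoveR (If 1 MoveR (Put 3))) C h C (Suc h) (Suc (Suc 1))" by (intro rn_If) (use False in simp)
  thus ?thesis by (intro exI[of _ "Suc (Suc 1)"]) simp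
 qed
 then obtain n where n: "n \<le> 3" "rn (If 0 MoveR (If 1 MoveR (Put 3))) C h C (Suc h) n" by blast
 have "\<exists>n\<le>4 * j + 5. rn scan C (Suc h) (C(3 := {Suc h + j})) (Suc h + j) n"
  by (rule Suc.IH) (use Suc.prems in simp_all)
 then obtain m where m: "m \<le> 4 * j + 5" "rn scan C (Suc h) (C(3 := {Suc h + j})) (Suc h + j) m" by blast
 have "rn scan C h (C(3 := {Suc h + j})) (Suc h + j) (Suc (n + m))"
  unfolding scan_def by (rule rn_While_step[OF _ n(2) m(2)[unfolded scan_def]]) (use Suc.prems(1) in simp)
 hence "rn scan C h (C(3 := {h + Suc j})) (h + Suc j) (Suc (n + m))" by simp
 moreover have "Suc (n + m) \<le> 4 * Suc j + 5" using n(1) m(1) by simp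
 ultimately show ?case by blast
qed

lemma rn_sweep:
 assumes "C v = {h + j}"
 shows "rn (While False v (Seq (clrall ts) MoveR)) C h (\<lambda>t. if t \<in> set ts then C t - {h..<h + j} else C t) (h + j) (j * (2 * length ts + 4) + 1)"
 using assms
proof (induction j arbitrary: h C)
 case 0
 have e: "(\<lambda>t. if t \<in> set ts then C t - {h..<h + 0} else C t) = C" by (auto simp: fun_eq_iff)
 show ?case unfolding e using rn_While_done[of h C v False] 0 by simp
next
 case (Suc j)
 let ?C1 = "\<lambda>t. if t \<in> set ts then C t - {h} else C t"
 have 1: "rn (Seq (clrall ts) MoveR) C h ?C1 (Suc h) (Suc (2 * length ts + 1 + 1))" by (rule rn_Seq[OF rn_clrall rn_act(3)])
 have "?C1 v = {Suc h + j}" using Suc.prems by auto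
 note 2 = Suc.IH[of ?C1 "Suc h", OF this]
 have e: "(\<lambda>t. if t \<in> set ts then ?C1 t - {Suc h..<Suc h + j} else ?C1 t) = (\<lambda>t. if t \<in> set ts then C t - {h..<h + Suc j} else C t)"
  by (auto simp: fun_eq_iff)
 have "rn (While False v (Seq (clrall ts) MoveR)) C h (\<lambda>t. if t \<in> set ts then C t - {h..<h + Suc j} else C t) (Suc h + j)
  (Suc (Suc (2 * length ts + 1 + 1) + (j * (2 * length ts + 4) + 1)))"
  by (rule rn_While_step[OF _ 1 2[unfolded e]]) (use Suc.prems in simp)
 moreover have "Suc (Suc (2 * length ts + 1 + 1) + (j * (2 * length ts + 4) + 1)) = Suc j * (2 * length ts + 4) + 1" by simp
 ultimately show ?case by (metis add_Suc_shift)
qed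

definition init_com :: "nat => com" where
 "init_com N = Seq (putall (2 # map vtr [1..<N] @ map htr [0..<N])) (Seq scan (Seq (Clr 3) (Put (vtr 0))))"

text \<open>Output symbols may carry tracks 0 and 1 only, so all other tracks are erased from the
  origin up to the cell given by register \<open>v\<close>. This last cell is included, as it has to
  end the output by being blank.\<close>

definition final_com :: "nat => nat => com" where
 "final_com N v = Seq home (Seq (While False (vtr v) (Seq (clrall [2..<3 * N + 6]) MoveR)) (clrall [2..<3 * N + 6]))"

definition init_state :: "nat list => pstate" where
 "init_state w = (\<lambda>x. if x = 0 then length w else 0, \<lambda>k i. k < 2 \<and> i < length w \<and> k \<in> set_decode (w ! i))"

definition init_marks :: "nat list => marks" where
 "init_marks w t = {i. t < 2 \<and> i < length w \<and> t \<in> set_decode (w ! i)}"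

lemma input_tape_marks: assumes "set w \<subseteq> {..<4}" shows "input_tape w = tape_of (init_marks w)"
proof
 fix i
 show "input_tape w i = tape_of (init_marks w) i"
 proof (cases "0 \<le> i \<and> i < int (length w)")
  case True
  hence "w ! nat i \<in> set w" by (simp add: nat_less_iff)
  hence "w ! nat i < 2 ^ 2" using assms by auto
  hence "set_decode (w ! nat i) \<subseteq> {..<2}" by (rule set_decode_subset)
  thus ?thesis using True by (auto simp: input_tape_def tape_of_def init_marks_def nat_less_iff)
 next
  case False
  thus ?thesis by (auto simp: input_tape_def tape_of_def init_marks_def nat_less_iff)
 qed
qed

lemma set_decode_small: "x ~= 0 ==> x < 4 ==> 0 \<in> set_decode x \<or> 1 \<in> set_decode x"
proof -
 assume "x ~= 0" "x < 4"
 hence "x = 1 \<or> x = 2 \<or> x = 3" by linarith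
 thus ?thesis by (auto simp: set_decode_def)
qed

lemma rn_init:
 assumes w: "set w \<subseteq> {1, 2, 3}" and N: "0 < N"
 shows "\<exists>C h n. rn (init_com N) (init_marks w) 0 C h n \<and> rel N (\<lambda>_. 0) (init_state w) C \<and> h = length w \<and> n \<le> 4 * length w + 4 * N + 20"
proof -
 let ?ts = "2 # map vtr [1..<N] @ map htr [0..<N]"
 let ?C1 = "\<lambda>t. if t \<in> set ?ts then insert 0 (init_marks w t) else init_marks w t"
 let ?l = "length w"
 have sm: "0 \<notin> set ?ts" "1 \<notin> set ?ts" "3 \<notin> set ?ts" by (auto simp: vtr_def htr_def)
 have big: "init_marks w t = {}" if "2 \<le> t" for t using that by (simp add: init_marks_def)
 have 1: "rn (putall ?ts) (init_marks w) 0 ?C1 0 (2 * length ?ts + 1)" by (rule rn_putall)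
 have ini: "i \<in> init_marks w 0 \<or> i \<in> init_marks w 1" if "i < ?l" for i
 proof -
  have "w ! i \<in> set w" using that by simp
  hence "w ! i ~= 0" "w ! i < 4" using w by auto
  thus ?thesis using set_decode_small[of "w ! i"] that by (auto simp: init_marks_def)
 qed
 have "\<exists>n\<le>4 * ?l + 5. rn scan ?C1 0 (?C1(3 := {0 + ?l})) (0 + ?l) n"
 proof (rule rn_scan)
  show "?C1 3 = {}" using sm big by simp
  show "i \<in> ?C1 0 \<or> i \<in> ?C1 1" if "i < 0 + ?l" for i using ini[of i] that sm by simp
  show "0 + ?l \<notin> ?C1 0" "0 + ?l \<notin> ?C1 1" using sm by (simp_all add: init_marks_def)
 qed
 then obtain n where n: "n \<le> 4 * ?l + 5" "rn scan ?C1 0 (?C1(3 := {?l})) ?l n" by auto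
 have "rn (Clr 3) (?C1(3 := {?l})) ?l ((?C1(3 := {?l}))(3 := (?C1(3 := {?l})) 3 - {?l})) ?l 1" by (rule rn_act)
 moreover have "(?C1(3 := {?l}))(3 := (?C1(3 := {?l})) 3 - {?l}) = ?C1" using sm big by (auto simp: fun_eq_iff)
 ultimately have 3: "rn (Clr 3) (?C1(3 := {?l})) ?l ?C1 ?l 1" by simp
 have 4: "rn (Put (vtr 0)) ?C1 ?l (?C1(vtr 0 := insert ?l (?C1 (vtr 0)))) ?l 1" by (rule rn_act)
 let ?C = "?C1(vtr 0 := insert ?l (?C1 (vtr 0)))"
 have r: "rn (init_com N) (init_marks w) 0 ?C ?l (Suc (2 * length ?ts + 1 + Suc (n + Suc (1 + 1))))"
  unfolding init_com_def by (rule rn_Seq[OF 1 rn_Seq[OF n(2) rn_Seq[OF 3 4]]])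
 have v0: "vtr 0 \<notin> set ?ts" by auto
 have "rel N (\<lambda>_. 0) (init_state w) ?C" unfolding rel_def
 proof (intro conjI allI impI)
  show "?C 2 = {0}" using big by simp
  fix x assume x: "x < N"
  show "?C (vtr x) = {fst (init_state w) x}"
  proof (cases "x = 0")
   case True
   thus ?thesis using v0 big[of "vtr 0"] by (simp add: init_state_def vtr_def)
  next
   case False
   hence "vtr x \<in> set ?ts" using x by auto
   thus ?thesis using False big[of "vtr x"] by (simp add: init_state_def vtr_def)
  qed
  show "?C (htr x) = {0}"
  proof -
   have "htr x \<in> set ?ts" using x by auto
   thus ?thesis using big[of "htr x"] by (simp add: htr_def vtr_def)
  qed
  have "btr x \<notin> set ?ts" by auto
  thus "?C (btr x) = {i. snd (init_state w) x i}"
   by (auto simp: init_state_def init_marks_def btr_def vtr_def)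
 qed
 moreover have "Suc (2 * length ?ts + 1 + Suc (n + Suc (1 + 1))) \<le> 4 * ?l + 4 * N + 20" using n(1) by simp
 ultimately show ?thesis using r by blast
qed

lemma tracks_code: "wf_prog N d p ==> tracks (code d p) \<subseteq> {..<3 * N + 6}"
 by (induction p arbitrary: d) (auto simp: goto_def home_def vtr_def htr_def btr_def)

lemma tracks_all: "tracks (clrall ts) = set ts" "tracks (putall ts) = set ts"
 by (induction ts) auto

lemma tracks_init_final: "v < N ==> tracks (init_com N) \<subseteq> {..<3 * N + 6}" "v < N ==> tracks (final_com N v) \<subseteq> {..<3 * N + 6}"
 by (auto simp: init_com_def final_com_def scan_def home_def tracks_all vtr_def htr_def)

lemma tm_step_halted: "(tm_step M ^^ k) c = (1, t, h) ==> k \<le> m ==> (tm_step M ^^ m) c = (1, t, h)"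
proof (induction m)
 case (Suc m)
 thus ?case by (cases "k = Suc m") auto
qed simp

definition tm_simulates :: "tm => nat => prog => nat => nat list => bool" where
 "tm_simulates M K p v w \<longleftrightarrow> (let s = exec p (init_state w); c = cost p (init_state w) in
  tm_halts_within M w (K * (length w + c + 1) * (c + 1)) \<and>
  (\<forall>out. length out = fst s v --> (\<forall>i<length out. out ! i = set_encode {k. k < 2 \<and> snd s k i}) -->
    \<not> snd s 0 (length out) --> \<not> snd s 1 (length out) --> tm_outputs M w out))"

theorem loop_program_tm:
 "\<exists>M K. turing_machine M \<and> (\<forall>w. set w \<subseteq> {1, 2, 3} --> tm_simulates M K p v w)"
proof -
 obtain N0 where "wf_prog N0 0 p" using wf_prog_exists by blast
 hence wf: "wf_prog (Max {N0, Suc v, 2}) 0 p" by (rule wf_prog_mono) simp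
 define N where "N = Max {N0, Suc v, 2}"
 have N: "wf_prog N 0 p" "v < N" "2 \<le> N" using wf by (auto simp: N_def)
 define com where "com = Seq (init_com N) (Seq (code 0 p) (final_com N v))"
 let ?ts = "[2..<3 * N + 6]"
 obtain M where M: "turing_machine M" "\<And>w k T h. set w \<subseteq> {..<4} ==> (lstep ^^ k) ([com], input_tape w, 0) = ([], T, h) ==>
   (tm_step M ^^ k) (tm_start w) = (1, \<lambda>i. set_encode (T i), h)" using tm_of_com[of com] by blast
 define K where "K = 200 + 20 * N"
 show ?thesis
 proof (intro exI[of _ M] exI[of _ K] conjI allI impI)
  show "turing_machine M" by (rule M)
  fix w assume w: "set w \<subseteq> {1, 2, 3::nat}"
  let ?s = "exec p (init_state w)" and ?c = "cost p (init_state w)" let ?B = "length w + cost p (init_state w)"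
  obtain C1 n1 where 1: "rn (init_com N) (init_marks w) 0 C1 (length w) n1" "rel N (\<lambda>_. 0) (init_state w) C1" "n1 \<le> 4 * length w + 4 * N + 20"
   using rn_init[OF w, of N] N by auto
  have f1: "fits N (length w) (\<lambda>_. 0) (init_state w) (length w)" by (simp add: fits_def init_state_def)
  obtain C2 h2 n2 \<eta>2 where 2: "rn (code 0 p) C1 (length w) C2 h2 n2" "rel N \<eta>2 ?s C2" "fits N ?B \<eta>2 ?s h2" "n2 \<le> 40 * (?B + 1) * ?c"
   using code_correct[OF N(1) 1(2) f1 order_refl] by (rule simulE)
  let ?n = "fst ?s v"
  have nB: "?n \<le> ?B" "h2 \<le> ?B" using fitsD[OF 2(3)] N by auto
  have 3: "rn home C2 h2 C2 0 (2 * h2 + 1)" by (rule rn_home[where C = C2 and h = h2, OF relD(1)[OF 2(2)]])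
  let ?C3 = "\<lambda>t. if t \<in> set ?ts then C2 t - {0..<0 + ?n} else C2 t"
  have 4: "rn (While False (vtr v) (Seq (clrall ?ts) MoveR)) C2 0 ?C3 (0 + ?n) (?n * (2 * length ?ts + 4) + 1)"
   by (rule rn_sweep) (use relD(2)[OF 2(2)] N in simp)
  let ?C4 = "\<lambda>t. if t \<in> set ?ts then ?C3 t - {0 + ?n} else ?C3 t"
  have 5: "rn (clrall ?ts) ?C3 (0 + ?n) ?C4 (0 + ?n) (2 * length ?ts + 1)" by (rule rn_clrall)
  let ?k = "Suc (n1 + Suc (n2 + Suc (2 * h2 + 1 + Suc (?n * (2 * length ?ts + 4) + 1 + (2 * length ?ts + 1)))))"
  have "rn com (init_marks w) 0 ?C4 (0 + ?n) ?k"
   unfolding com_def final_com_def by (rule rn_Seq[OF 1(1) rn_Seq[OF 2(1) rn_Seq[OF 3 rn_Seq[OF 4 5]]]])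
  hence lrun: "(lstep ^^ ?k) ([com], tape_of (init_marks w), 0) = ([], tape_of ?C4, int (0 + ?n))" unfolding rn_def runs_def by simp
  have w4: "set w \<subseteq> {..<4}" using w by auto
  have run: "(tm_step M ^^ ?k) (tm_start w) = (1, \<lambda>i. set_encode (tape_of ?C4 i), int (0 + ?n))"
   by (rule M(2)[OF w4 lrun[folded input_tape_marks[OF w4]]])
  have len: "length ?ts = 3 * N + 4" by simp
  have "?k \<le> K * (?B + 1) * (?c + 1)"
  proof -
   have a: "?n * (2 * length ?ts + 4) \<le> ?B * (6 * N + 12)" using nB(1) unfolding len by (intro mult_le_mono) simp_all
   have arith: "Suc (n1 + Suc (n2 + Suc (2 * h2 + 1 + Suc (X + 1 + (2 * L + 1))))) \<le> 4 * B + 4 * N + 20 + Y + 2 * B + Z + 6 * N + 20"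
    if "n1 \<le> 4 * l + 4 * N + 20" "n2 \<le> Y" "h2 \<le> B" "X \<le> Z" "l \<le> B" "L = 3 * N + 4" for n1 n2 h2 X L B Y Z l :: nat
    using that by linarith
   have "?k \<le> 4 * ?B + 4 * N + 20 + 40 * (?B + 1) * ?c + 2 * ?B + ?B * (6 * N + 12) + 6 * N + 20"
    by (intro arith[OF 1(3) 2(4) nB(2) a]) (simp_all add: len)
   also have "\<dots> \<le> (60 + 20 * N) * (?B + 1) + 40 * (?B + 1) * ?c" by (simp add: algebra_simps)
   also have "\<dots> \<le> K * (?B + 1) + K * (?B + 1) * ?c" unfolding K_def by (intro add_mono mult_right_mono) simp_all
   also have "\<dots> = K * (?B + 1) * (?c + 1)" by simp
   finally show ?thesis .
  qed
  hence halt: "tm_halts_within M w (K * (?B + 1) * (?c + 1))"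
   unfolding tm_halts_within_def using tm_step_halted[OF run] by simp
  have cell: "tape_of ?C4 (int i) = {k. k < 2 \<and> snd ?s k i}" if i: "i \<le> ?n" for i
  proof -
   have b: "C2 t = {i. snd ?s t i}" if "t < 2" for t using relD(3)[OF 2(2), of t] that N by (simp add: btr_def)
   have "i \<in> ?C4 t \<longleftrightarrow> t < 2 \<and> i \<in> C2 t" if "t < 3 * N + 6" for t using i that by auto
   moreover have "i \<notin> ?C4 t" if "3 * N + 6 \<le> t" for t
   proof -
    have "tracks com \<subseteq> {..<3 * N + 6}"
     using tracks_code[OF N(1)] tracks_init_final[OF N(2)] by (simp add: com_def)
    moreover have "input_tape w i \<subseteq> {..<3 * N + 6}" for i
     using input_tape_marks[OF w4] by (auto simp: tape_of_def init_marks_def)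
    ultimately have "tape_of ?C4 (int i) \<subseteq> {..<3 * N + 6}"
     by (rule lstep_reachable_tape[OF _ _ lrun[folded input_tape_marks[OF w4]]])
    thus ?thesis using tape_of_mem[of t ?C4 i] that by (meson lessThan_iff not_less subsetD)
   qed
   ultimately have "i \<in> ?C4 t \<longleftrightarrow> t < 2 \<and> snd ?s t i" for t using b[of t] by (cases "t < 3 * N + 6") auto
   thus ?thesis using tape_of_mem[of _ ?C4 i] by blast
  qed
  show "tm_simulates M K p v w" unfolding tm_simulates_def Let_def
  proof (intro conjI allI impI)
   show "tm_halts_within M w (K * (?B + 1) * (?c + 1))" by (rule halt)
   fix out :: "nat list" assume o: "length out = ?n" "\<forall>i<length out. out ! i = set_encode {k. k < 2 \<and> snd ?s k i}"
    "\<not> snd ?s 0 (length out)" "\<not> snd ?s 1 (length out)"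
   have "{k. k < 2 \<and> snd ?s k ?n} = {}" using o(1,3,4) less_2_cases by fastforce
   hence "set_encode (tape_of ?C4 (int (length out))) = 0" unfolding o(1) using cell[OF order_refl] by (simp only: set_encode_empty)
   moreover have "set_encode (tape_of ?C4 (int i)) = out ! i" if "i < length out" for i using cell[of i] o that by simp
   ultimately show "tm_outputs M w out" unfolding tm_outputs_def using run by blast
  qed
 qed
qed

section \<open>Frames and running times of loop programs\<close>

fun mods :: "prog => nat set" where
 "mods (PInc x) = {x}" | "mods (PZero x) = {x}" | "mods (PCopy x y) = {x}"
| "mods (PSeq p q) = mods p \<union> mods q" | "mods (PIfBit k x p q) = mods p \<union> mods q"
| "mods (PIfEq x y p q) = mods p \<union> mods q" | "mods (PRep y p) = mods p" | "mods _ = {}"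

fun tmods :: "prog => nat set" where
 "tmods (PPut k x) = {k}" | "tmods (PClr k x) = {k}"
| "tmods (PSeq p q) = tmods p \<union> tmods q" | "tmods (PIfBit k x p q) = tmods p \<union> tmods q"
| "tmods (PIfEq x y p q) = tmods p \<union> tmods q" | "tmods (PRep y p) = tmods p" | "tmods _ = {}"

fun rvars :: "prog => nat set" where
 "rvars (PSeq p q) = rvars p \<union> rvars q" | "rvars (PIfBit k x p q) = rvars p \<union> rvars q"
| "rvars (PIfEq x y p q) = rvars p \<union> rvars q" | "rvars (PRep y p) = insert y (rvars p)" | "rvars _ = {}"

lemma exec_frame: "x \<notin> mods p ==> fst (exec p s) x = fst s x"
proof (induction p arbitrary: s)
 case (PRep y p)
 have "fst ((exec p ^^ n) s) x = fst s x" for n using PRep by (induction n) auto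
 thus ?case by simp
qed auto

lemma exec_frame_track: "k \<notin> tmods p ==> snd (exec p s) k = snd s k"
proof (induction p arbitrary: s)
 case (PRep y p)
 have "snd ((exec p ^^ n) s) k = snd s k" for n using PRep by (induction n) auto
 thus ?case by simp
qed auto

fun psize :: "prog => nat" where
 "psize (PSeq p q) = Suc (psize p + psize q)" | "psize (PIfBit k x p q) = Suc (psize p + psize q)"
| "psize (PIfEq x y p q) = Suc (psize p + psize q)" | "psize (PRep y p) = psize p + 3" | "psize _ = 1"

fun pdepth :: "prog => nat" where
 "pdepth (PSeq p q) = max (pdepth p) (pdepth q)" | "pdepth (PIfBit k x p q) = max (pdepth p) (pdepth q)"
| "pdepth (PIfEq x y p q) = max (pdepth p) (pdepth q)" | "pdepth (PRep y p) = Suc (pdepth p)" | "pdepth _ = 0"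

lemma pow_max: "a * (M + 1) ^ d + b * (M + 1) ^ e \<le> (a + b) * (M + 1::nat) ^ max d e"
proof -
 have "a * (M + 1) ^ d \<le> a * (M + 1) ^ max d e" "b * (M + 1) ^ e \<le> b * (M + 1) ^ max d e"
  by (intro mult_left_mono power_increasing; simp)+
 thus ?thesis unfolding distrib_right by (rule add_mono)
qed

text \<open>Loop bounds that are never modified let every loop run at most \<open>M\<close> times,
  and nesting multiplies. The exponent depends on the program alone, which is what keeps the power
  of the input size independent of the precision.\<close>

lemma cost_constant_bounds:
 assumes "rvars p \<subseteq> X" "mods p \<inter> X = {}" "\<And>x. x \<in> X ==> fst s x \<le> M"
 shows "cost p s \<le> psize p * (M + 1) ^ pdepth p"
proof -
 have branch: "Suc (if b then x else y) \<le> Suc (m + m') * (M + 1) ^ max d e"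
  if "x \<le> m * (M + 1) ^ d" "y \<le> m' * (M + 1) ^ e" for b x y m m' d e
 proof -
  have "1 \<le> (M + 1) ^ max d e" by simp
  thus ?thesis using pow_max[of m M d m' e] that unfolding mult_Suc by (split if_split) linarith
 qed
 show ?thesis using assms
 proof (induction p arbitrary: s)
  case (PSeq p q)
  have fr: "\<And>x. x \<in> X ==> fst (exec p s) x \<le> M" using PSeq.prems exec_frame[of _ p s] by force
  have "cost p s \<le> psize p * (M + 1) ^ pdepth p" by (rule PSeq.IH(1)) (use PSeq.prems in auto)
  moreover have "cost q (exec p s) \<le> psize q * (M + 1) ^ pdepth q" by (rule PSeq.IH(2)) (use PSeq.prems fr in auto)
  moreover have "1 \<le> (M + 1) ^ max (pdepth p) (pdepth q)" by simp
  ultimately show ?case using pow_max[of "psize p" M "pdepth p" "psize q" "pdepth q"]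
   unfolding cost.simps psize.simps pdepth.simps mult_Suc by linarith
 next
  case (PIfBit k x p q)
  show ?case unfolding cost.simps psize.simps pdepth.simps by (intro branch PIfBit.IH) (use PIfBit.prems in auto)
 next
  case (PIfEq x y p q)
  show ?case unfolding cost.simps psize.simps pdepth.simps by (intro branch PIfEq.IH) (use PIfEq.prems in auto)
 next
  case (PRep y p)
  let ?B = "psize p * (M + 1) ^ pdepth p"
  have y: "y \<in> X" "rvars p \<subseteq> X" "mods p \<inter> X = {}" using PRep.prems by auto
  have fr: "fst ((exec p ^^ i) s) x = fst s x" if "x \<in> X" for i x
  proof -
   have "x \<notin> mods p" using that y(3) by blast
   thus ?thesis by (induction i) (simp_all add: exec_frame)
  qed
  have c: "cost p ((exec p ^^ i) s) \<le> ?B" for i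
   by (rule PRep.IH[OF y(2,3)]) (use fr PRep.prems(3) in simp)
  have "(\<Sum>i<fst s y. cost p ((exec p ^^ i) s) + 2) \<le> (\<Sum>i<fst s y. ?B + 2)" using c by (intro sum_mono) simp
  also have "\<dots> = fst s y * (?B + 2)" by simp
  also have "\<dots> \<le> M * (?B + 2)" using PRep.prems(3)[OF y(1)] by (rule mult_right_mono) simp
  finally have "cost (PRep y p) s \<le> Suc (M * (?B + 2))" by simp
  also have "\<dots> \<le> (M + 1) * (?B + 3)" unfolding distrib_left distrib_right by linarith
  also have "\<dots> \<le> (M + 1) * (?B + 3 * (M + 1) ^ pdepth p)" by (intro mult_left_mono add_left_mono) simp_all
  also have "\<dots> = psize (PRep y p) * (M + 1) ^ pdepth (PRep y p)" by (simp add: algebra_simps)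
  finally show ?case .
 qed (auto simp: Suc_le_eq)
qed

fun pvars :: "prog => nat set" where
 "pvars (PInc x) = {x}" | "pvars (PZero x) = {x}" | "pvars (PCopy x y) = {x, y}"
| "pvars (PSeq p q) = pvars p \<union> pvars q"
| "pvars (PIfEq x y p q) = {x, y} \<union> pvars p \<union> pvars q" | "pvars (PRep y p) = insert y (pvars p)" | "pvars _ = {}"

fun numeric :: "prog => bool" where
 "numeric (PPut k x) \<longleftrightarrow> False" | "numeric (PClr k x) \<longleftrightarrow> False" | "numeric (PIfBit k x p q) \<longleftrightarrow> False"
| "numeric (PSeq p q) \<longleftrightarrow> numeric p \<and> numeric q" | "numeric (PIfEq x y p q) \<longleftrightarrow> numeric p \<and> numeric q"
| "numeric (PRep y p) \<longleftrightarrow> numeric p" | "numeric _ \<longleftrightarrow> True"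

text \<open>Without access to work tracks, cost and results are functions of the registers
  mentioned. Hence computing the parameters has a cost that depends on \<open>q\<close>
  alone.\<close>

lemma numeric_cong:
 assumes "numeric p" "pvars p \<subseteq> X" "\<And>x. x \<in> X ==> fst s x = fst s' x"
 shows "cost p s = cost p s' \<and> (\<forall>x\<in>X. fst (exec p s) x = fst (exec p s') x)"
 using assms
proof (induction p arbitrary: s s')
 case (PSeq p q)
 have 1: "cost p s = cost p s' \<and> (\<forall>x\<in>X. fst (exec p s) x = fst (exec p s') x)"
  by (rule PSeq.IH(1)) (use PSeq.prems in auto)
 have "cost q (exec p s) = cost q (exec p s') \<and> (\<forall>x\<in>X. fst (exec q (exec p s)) x = fst (exec q (exec p s')) x)"
  by (rule PSeq.IH(2)) (use PSeq.prems 1 in auto)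
 thus ?case using 1 by simp
next
 case (PIfEq x y p q)
 have "fst s x = fst s' x" "fst s y = fst s' y" using PIfEq.prems by auto
 moreover have "cost p s = cost p s' \<and> (\<forall>x\<in>X. fst (exec p s) x = fst (exec p s') x)"
  by (rule PIfEq.IH(1)) (use PIfEq.prems in auto)
 moreover have "cost q s = cost q s' \<and> (\<forall>x\<in>X. fst (exec q s) x = fst (exec q s') x)"
  by (rule PIfEq.IH(2)) (use PIfEq.prems in auto)
 ultimately show ?case by auto
next
 case (PRep y p)
 have y: "fst s y = fst s' y" "numeric p" "pvars p \<subseteq> X" using PRep.prems by auto
 have it: "\<forall>x\<in>X. fst ((exec p ^^ i) s) x = fst ((exec p ^^ i) s') x" for i
 proof (induction i)
  case (Suc i)
  thus ?case using PRep.IH[OF y(2,3), of "(exec p ^^ i) s" "(exec p ^^ i) s'"] by simp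
 qed (use PRep.prems(3) in simp)
 hence "cost p ((exec p ^^ i) s) = cost p ((exec p ^^ i) s')" for i
  using PRep.IH[OF y(2,3), of "(exec p ^^ i) s" "(exec p ^^ i) s'"] by simp
 thus ?case using it[of "fst s' y"] y(1) by simp
qed auto

definition upd :: "pstate => nat => nat => pstate" where "upd s x j = ((fst s)(x := j), snd s)"

lemma upd_simps [simp]: "fst (upd s x j) y = (if y = x then j else fst s y)" "snd (upd s x j) = snd s"
 by (simp_all add: upd_def)

definition PFor :: "nat => nat => prog => prog" where "PFor i y b = PZero i ;; PRep y (b ;; PInc i)"

lemma PFor_simps [simp]: "mods (PFor i y b) = insert i (mods b)" "tmods (PFor i y b) = tmods b"
 "rvars (PFor i y b) = insert y (rvars b)"
 by (auto simp: PFor_def)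

lemma PRep_rule:
 assumes "I 0 s" "\<And>j t. j < fst s y ==> I j t ==> I (Suc j) (exec p t)"
 shows "I (fst s y) (exec (PRep y p) s)"
proof -
 have "j \<le> fst s y ==> I j ((exec p ^^ j) s)" for j by (induction j) (use assms in auto)
 thus ?thesis by simp
qed

lemma PFor_rule:
 assumes "i ~= y" "i \<notin> mods b" "I 0 (upd s i 0)"
  and "\<And>j t. j < fst s y ==> fst t i = j ==> I j t ==> I (Suc j) (upd (exec b t) i (Suc j))"
 shows "I (fst s y) (exec (PFor i y b) s) \<and> fst (exec (PFor i y b) s) i = fst s y"
proof -
 let ?s = "upd s i 0"
 have "(\<lambda>j t. I j t \<and> fst t i = j) (fst ?s y) (exec (PRep y (b ;; PInc i)) ?s)"
 proof (rule PRep_rule)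
  fix j t assume j: "j < fst ?s y" "I j t \<and> fst t i = j"
  hence "exec (b ;; PInc i) t = upd (exec b t) i (Suc j)" using exec_frame[OF assms(2), of t] by (simp add: upd_def)
  moreover have "I (Suc j) (upd (exec b t) i (Suc j))" using assms(1,4) j by simp
  ultimately show "I (Suc j) (exec (b ;; PInc i) t) \<and> fst (exec (b ;; PInc i) t) i = Suc j" by simp
 qed (use assms(3) in simp)
 thus ?thesis using assms(1) by (simp add: PFor_def upd_def)
qed

section \<open>Counting formulas\<close>

text \<open>Register 0 holds the length of the input, 1 the number of vertices, 3 the position of the adjacency
 matrix and 4 the number one. Register 10 returns truth values; 11 to 14 and those from 100 on are scratch.\<close>

datatype fm = FBit nat nat | FEq nat nat | FLt nat nat | FAdj nat nat | FNot fm | FAnd fm fm | FGe nat nat fm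

definition gr :: "pstate => (nat \<times> nat) set" where
 "gr s = {(i, j). i < fst s 1 \<and> j < fst s 1 \<and> snd s 1 (fst s 3 + i * fst s 1 + j)}"

text \<open>The second conjunct for \<open>FLt\<close> reflects its code, which counts upwards from
  \<open>x\<close> for \<open>fst s 0\<close> rounds; it is true whenever \<open>y\<close> holds at
  most the length of the input. \<open>FGe x y a\<close> states that at least \<open>y\<close>
  vertices satisfy \<open>a\<close>, which expresses existence, degrees and ranks alike.\<close>

fun sat :: "pstate => fm => bool" where
 "sat s (FBit k x) \<longleftrightarrow> snd s k (fst s x)"
| "sat s (FEq x y) \<longleftrightarrow> fst s x = fst s y"
| "sat s (FLt x y) \<longleftrightarrow> fst s x < fst s y \<and> fst s y \<le> fst s x + fst s 0"
| "sat s (FAdj x y) \<longleftrightarrow> (fst s x, fst s y) \<in> gr s"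
| "sat s (FNot a) \<longleftrightarrow> \<not> sat s a"
| "sat s (FAnd a b) \<longleftrightarrow> sat s a \<and> sat s b"
| "sat s (FGe x y a) \<longleftrightarrow> fst s y \<le> card {j. j < fst s 1 \<and> sat (upd s x j) a}"

fun fv :: "fm => nat set" where
 "fv (FBit k x) = {x}" | "fv (FEq x y) = {x, y}" | "fv (FLt x y) = {x, y}" | "fv (FAdj x y) = {x, y}"
| "fv (FNot a) = fv a" | "fv (FAnd a b) = fv a \<union> fv b" | "fv (FGe x y a) = insert y (fv a - {x})"

fun bv :: "fm => nat set" where
 "bv (FNot a) = bv a" | "bv (FAnd a b) = bv a \<union> bv b" | "bv (FGe x y a) = insert x (bv a)" | "bv _ = {}"

fun ftr :: "fm => nat set" where
 "ftr (FBit k x) = {k}" | "ftr (FAdj x y) = {1}"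
| "ftr (FNot a) = ftr a" | "ftr (FAnd a b) = ftr a \<union> ftr b" | "ftr (FGe x y a) = ftr a" | "ftr _ = {}"

definition reg :: "nat => bool" where "reg x \<longleftrightarrow> x < 10 \<or> 20 \<le> x \<and> x < 100"

fun ok :: "fm => bool" where
 "ok (FBit k x) \<longleftrightarrow> reg x" | "ok (FEq x y) \<longleftrightarrow> reg x \<and> reg y" | "ok (FLt x y) \<longleftrightarrow> reg x \<and> reg y" | "ok (FAdj x y) \<longleftrightarrow> reg x \<and> reg y"
| "ok (FNot a) \<longleftrightarrow> ok a" | "ok (FAnd a b) \<longleftrightarrow> ok a \<and> ok b \<and> bv a \<inter> fv b = {}"
| "ok (FGe x y a) \<longleftrightarrow> ok a \<and> reg x \<and> reg y \<and> 20 \<le> x \<and> x ~= y \<and> x \<notin> bv a \<and> y \<notin> bv a \<and> fv a \<inter> bv a = {}"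

text \<open>The counter for \<open>FGe\<close> stops at the threshold, so that a test for equality
  decides the inequality in the end. The matrix is not addressed by computing an offset: register 11
  runs through all of it while 12 and 13 run through the index pairs.\<close>

fun fcode :: "nat => fm => prog" where
 "fcode d (FBit k x) = PIfBit k x (PCopy 10 4) (PZero 10)"
| "fcode d (FEq x y) = PIfEq x y (PCopy 10 4) (PZero 10)"
| "fcode d (FLt x y) = PZero 10 ;; PCopy 14 x ;; PRep 0 (PInc 14 ;; PIfEq 14 y (PCopy 10 4) PSkip)"
| "fcode d (FAdj x y) = PZero 10 ;; PCopy 11 3 ;; PFor 12 1 (PFor 13 1
  (PIfEq 12 x (PIfEq 13 y (PIfBit 1 11 (PCopy 10 4) PSkip) PSkip) PSkip ;; PInc 11))"
| "fcode d (FNot a) = fcode d a ;; PIfEq 10 4 (PZero 10) (PCopy 10 4)"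
| "fcode d (FAnd a b) = fcode d a ;; PIfEq 10 4 (fcode d b) PSkip"
| "fcode d (FGe x y a) = PZero (100 + d) ;;
  PFor x 1 (fcode (Suc d) a ;; PIfEq 10 4 (PIfEq (100 + d) y PSkip (PInc (100 + d))) PSkip) ;;
  PIfEq (100 + d) y (PCopy 10 4) (PZero 10)"

lemma mods_fcode: "mods (fcode d a) \<subseteq> {10..14} \<union> {100 + d..} \<union> bv a" "tmods (fcode d a) = {}" "rvars (fcode d a) \<subseteq> {0, 1}"
proof (induction a arbitrary: d)
 case (FGe x y a)
 { case 1 show ?case using FGe(1)[of "Suc d"] by (fastforce simp: subset_iff) }
 { case 2 show ?case using FGe(2)[of "Suc d"] by auto }
 { case 3 show ?case using FGe(3)[of "Suc d"] by auto }
next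
 case (FAnd a b)
 { case 1 show ?case using FAnd(1)[of d] FAnd(4)[of d] by auto }
 { case 2 show ?case using FAnd(2)[of d] FAnd(5)[of d] by auto }
 { case 3 show ?case using FAnd(3)[of d] FAnd(6)[of d] by auto }
next
 case (FNot a)
 { case 1 show ?case using FNot(1)[of d] by auto }
 { case 2 show ?case using FNot(2)[of d] by auto }
 { case 3 show ?case using FNot(3)[of d] by auto }
qed auto

lemma ok_regs: "ok a ==> x \<in> bv a ==> reg x \<and> 20 \<le> x" "ok a ==> x \<in> fv a ==> reg x"
 by (induction a) auto

lemma bv_small: "ok a ==> x < 20 ==> x \<notin> bv a" using ok_regs(1)[of a x] by auto

lemma sat_cong:
 assumes "\<forall>x\<in>fv a. fst s x = fst s' x" "fst s 0 = fst s' 0" "fst s 1 = fst s' 1" "fst s 3 = fst s' 3"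
  "\<forall>k\<in>ftr a. snd s k = snd s' k" "\<forall>x\<in>bv a. 20 \<le> x"
 shows "sat s a \<longleftrightarrow> sat s' a"
 using assms
proof (induction a arbitrary: s s')
 case (FGe x y a)
 have "sat (upd s x j) a \<longleftrightarrow> sat (upd s' x j) a" for j by (rule FGe.IH) (use FGe.prems in auto)
 thus ?case using FGe.prems by simp
next
 case (FAdj x y)
 hence "gr s = gr s'" by (simp add: gr_def)
 thus ?case using FAdj by simp
next
 case (FAnd a b)
 have "sat s a \<longleftrightarrow> sat s' a" by (rule FAnd.IH(1)) (use FAnd.prems in auto)
 moreover have "sat s b \<longleftrightarrow> sat s' b" by (rule FAnd.IH(2)) (use FAnd.prems in auto)
 ultimately show ?case by simp
qed auto

lemma fcode_FLt:
 assumes "fst s 4 = 1" "reg x" "reg y"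
 shows "fst (exec (fcode d (FLt x y)) s) 10 = of_bool (sat s (FLt x y))"
proof -
 let ?s = "exec (PZero 10 ;; PCopy 14 x) s"
 have ne: "x ~= 10" "y ~= 10" "x ~= 14" "y ~= 14" using assms(2,3) by (auto simp: reg_def)
 define I where "I j t \<longleftrightarrow> fst t 14 = fst s x + j \<and> fst t 4 = 1 \<and> fst t y = fst s y \<and>
   fst t 10 = of_bool (fst s x < fst s y \<and> fst s y \<le> fst s x + j)" for j and t :: pstate
 have "I (fst ?s 0) (exec (PRep 0 (PInc 14 ;; PIfEq 14 y (PCopy 10 4) PSkip)) ?s)"
 proof (rule PRep_rule)
  show "I 0 ?s" using assms ne by (simp add: I_def)
  fix j t assume "I j t"
  thus "I (Suc j) (exec (PInc 14 ;; PIfEq 14 y (PCopy 10 4) PSkip) t)" using ne by (auto simp: I_def)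
 qed
 thus ?thesis by (simp add: I_def)
qed

lemma fcode_FAdj:
 assumes "fst s 4 = 1" "reg x" "reg y"
 shows "fst (exec (fcode d (FAdj x y)) s) 10 = of_bool (sat s (FAdj x y))"
proof -
 let ?s = "exec (PZero 10 ;; PCopy 11 3) s" and ?n = "fst s 1"
 let ?body = "PIfEq 12 x (PIfEq 13 y (PIfBit 1 11 (PCopy 10 4) PSkip) PSkip) PSkip ;; PInc 11"
 have ne: "x \<notin> {10, 11, 12, 13}" "y \<notin> {10, 11, 12, 13}" using assms(2,3) by (auto simp: reg_def)
 define J where "J t \<longleftrightarrow> fst t 4 = 1 \<and> fst t x = fst s x \<and> fst t y = fst s y \<and> fst t 1 = ?n \<and> snd t = snd s" for t :: pstate
 define e where "e i j \<longleftrightarrow> snd s 1 (fst s 3 + i * ?n + j)" for i j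
 define I where "I i t \<longleftrightarrow> J t \<and> fst t 11 = fst s 3 + i * ?n \<and> fst t 10 = of_bool (fst s x < i \<and> fst s y < ?n \<and> e (fst s x) (fst s y))" for i and t :: pstate
 have "I (fst ?s 1) (exec (PFor 12 1 (PFor 13 1 ?body)) ?s) \<and> fst (exec (PFor 12 1 (PFor 13 1 ?body)) ?s) 12 = fst ?s 1"
 proof (rule PFor_rule)
  show "I 0 (upd ?s 12 0)" using assms ne by (simp add: I_def J_def)
  fix i t assume i: "fst t 12 = i" "I i t"
  define L where "L j u \<longleftrightarrow> J u \<and> fst u 12 = i \<and> fst u 11 = fst s 3 + i * ?n + j \<and>
   fst u 10 = of_bool (fst s y < ?n \<and> e (fst s x) (fst s y) \<and> (fst s x < i \<or> fst s x = i \<and> fst s y < j))" for j and u :: pstate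
  have "L (fst t 1) (exec (PFor 13 1 ?body) t) \<and> fst (exec (PFor 13 1 ?body) t) 13 = fst t 1"
  proof (rule PFor_rule)
   show "L 0 (upd t 13 0)" using i ne by (auto simp: I_def J_def L_def)
   fix j u assume j: "j < fst t 1" "fst u 13 = j" "L j u"
   have "fst t 1 = ?n" using i by (simp add: I_def J_def)
   define g where "g \<longleftrightarrow> fst s x = i \<and> fst s y = j \<and> e i j"
   have u: "J u" "fst u 12 = i" "fst u 11 = fst s 3 + i * ?n + j"
    "fst u 10 = of_bool (fst s y < ?n \<and> e (fst s x) (fst s y) \<and> (fst s x < i \<or> fst s x = i \<and> fst s y < j))"
    using j(3) by (simp_all add: L_def)
   have b: "exec ?body u = upd (if g then upd u 10 1 else u) 11 (Suc (fst u 11))"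
    using u j(2) by (auto simp: upd_def J_def g_def e_def)
   have "J (upd (exec ?body u) 13 (Suc j))" unfolding b using u(1) ne by (auto simp: J_def)
   moreover have "fst (exec ?body u) 10 = of_bool (fst s y < ?n \<and> e (fst s x) (fst s y) \<and> (fst s x < i \<or> fst s x = i \<and> fst s y < Suc j))"
   proof (cases g)
    case True
    thus ?thesis unfolding b using j(1) \<open>fst t 1 = ?n\<close> by (auto simp: g_def)
   next
    case False
    thus ?thesis unfolding b using u(4) by (auto simp: g_def less_Suc_eq)
   qed
   moreover have "fst (exec ?body u) 12 = i" "fst (exec ?body u) 11 = fst s 3 + i * ?n + Suc j"
    unfolding b using u(2,3) by auto
   ultimately show "L (Suc j) (upd (exec ?body u) 13 (Suc j))" unfolding L_def by simp
  qed simp_all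
  moreover have "fst t 1 = ?n" using i by (simp add: I_def J_def)
  ultimately show "I (Suc i) (upd (exec (PFor 13 1 ?body) t) 12 (Suc i))" using ne by (auto simp: I_def L_def J_def less_Suc_eq)
 qed simp_all
 thus ?thesis by (simp add: I_def gr_def e_def)
qed

lemma fcode_correct:
 assumes "ok a" "fst s 4 = 1"
 shows "fst (exec (fcode d a) s) 10 = of_bool (sat s a)"
 using assms
proof (induction a arbitrary: d s)
 case (FLt x y) thus ?case by (intro fcode_FLt) auto
next
 case (FAdj x y) thus ?case by (intro fcode_FAdj) auto
next
 case (FNot a)
 let ?t = "exec (fcode d a) s"
 have "4 \<notin> mods (fcode d a)" using mods_fcode(1)[of d a] ok_regs(1)[of a 4] FNot.prems by auto
 hence "fst ?t 4 = 1" using FNot.prems exec_frame by simp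
 thus ?case using FNot.IH[of s d] FNot.prems by simp
next
 case (FAnd a b)
 let ?t = "exec (fcode d a) s"
 have fr: "fst ?t x = fst s x" if "reg x" "x \<notin> bv a" for x
  using mods_fcode(1)[of d a] that by (intro exec_frame) (auto simp: reg_def)
 have snd: "snd ?t = snd s" using exec_frame_track[of _ "fcode d a" s] mods_fcode(2)[of d a] by auto
 have r: "reg 4" "reg 0" "reg 1" "reg 3" "4 \<notin> bv a" "0 \<notin> bv a" "1 \<notin> bv a" "3 \<notin> bv a"
  using bv_small[of a] FAnd.prems by (simp_all add: reg_def)
 have 4: "fst ?t 4 = 1" using fr r FAnd.prems by simp
 have "sat ?t b \<longleftrightarrow> sat s b"
 proof (rule sat_cong)
  show "\<forall>x\<in>fv b. fst ?t x = fst s x" using fr ok_regs(2)[of b] FAnd.prems by auto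
  show "\<forall>x\<in>bv b. 20 \<le> x" using ok_regs(1)[of b] FAnd.prems by auto
 qed (use fr r snd in auto)
 thus ?case using FAnd.IH(1)[of s d] FAnd.IH(2)[of ?t d] FAnd.prems 4 by simp
next
 case (FGe x y a)
 let ?c = "100 + d" and ?n = "fst s 1"
 let ?b = "fcode (Suc d) a ;; PIfEq 10 4 (PIfEq ?c y PSkip (PInc ?c)) PSkip"
 let ?s = "exec (PZero ?c) s"
 have okx: "ok a" "reg x" "reg y" "20 \<le> x" "x ~= y" "x \<notin> bv a" "y \<notin> bv a" "fv a \<inter> bv a = {}" using FGe.prems by auto
 have mb: "mods ?b \<subseteq> {10..14} \<union> {100 + d..} \<union> bv a" using mods_fcode(1)[of "Suc d" a] by auto
 define A where "A j = {i. i < j \<and> sat (upd s x i) a}" for j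
 define I where "I j t \<longleftrightarrow> (\<forall>z. reg z --> z \<notin> bv a --> z ~= x --> fst t z = fst s z) \<and> snd t = snd s \<and>
  fst t ?c = min (fst s y) (card (A j))" for j and t :: pstate
 have "I (fst ?s 1) (exec (PFor x 1 ?b) ?s) \<and> fst (exec (PFor x 1 ?b) ?s) x = fst ?s 1"
 proof (rule PFor_rule)
  show "x ~= 1" using okx by auto
  show "x \<notin> mods ?b" using mb okx by (auto simp: reg_def)
  show "I 0 (upd ?s x 0)" using okx by (auto simp: I_def A_def reg_def)
  fix j t assume j: "j < fst ?s 1" "fst t x = j" "I j t"
  let ?t = "exec (fcode (Suc d) a) t"
  have fr: "fst ?t z = fst t z" if "reg z \<and> z \<notin> bv a \<or> z = ?c" for z
   using mods_fcode(1)[of "Suc d" a] that ok_regs(1)[OF okx(1), of z] by (intro exec_frame) (auto simp: reg_def)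
  have r: "reg 4" "reg 0" "reg 1" "reg 3" "4 \<notin> bv a" "0 \<notin> bv a" "1 \<notin> bv a" "3 \<notin> bv a" "x \<notin> {0, 1, 3, 4}"
   using bv_small[OF okx(1)] okx(4) by (simp_all add: reg_def)
  have t4: "fst t 4 = 1" using j r FGe.prems by (simp add: I_def)
  have "sat t a \<longleftrightarrow> sat (upd s x j) a"
  proof (rule sat_cong)
   show "\<forall>z\<in>fv a. fst t z = fst (upd s x j) z" using j okx ok_regs(2)[OF okx(1)] by (auto simp: I_def)
   show "\<forall>z\<in>bv a. 20 \<le> z" using ok_regs(1)[OF okx(1)] by auto
  qed (use j r in \<open>auto simp: I_def\<close>)
  hence f: "fst ?t 10 = of_bool (sat (upd s x j) a)" using FGe.IH[OF okx(1) t4, of "Suc d"] by simp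
  have snd: "snd ?t = snd s" using exec_frame_track[of _ "fcode (Suc d) a" t] mods_fcode(2)[of "Suc d" a] j by (auto simp: I_def)
  have A: "A (Suc j) = (if sat (upd s x j) a then insert j (A j) else A j)" "finite (A j)" "j \<notin> A j"
   by (auto simp: A_def less_Suc_eq)
  have yc: "fst ?t y = fst s y" "fst ?t ?c = min (fst s y) (card (A j))" "fst ?t 4 = 1"
   using fr[of y] fr[of ?c] fr[of 4] j okx r t4 by (auto simp: I_def)
  have b: "exec ?b t = (if sat (upd s x j) a \<and> card (A j) < fst s y then upd ?t ?c (Suc (fst ?t ?c)) else ?t)"
   using f yc by (auto simp: upd_def)
  have cs: "fst (exec ?b t) ?c = min (fst s y) (card (A (Suc j)))" unfolding b A(1) using yc A(2,3) by auto
  have "fst (exec ?b t) z = fst s z" if "reg z" "z \<notin> bv a" "z ~= x" for z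
  proof -
   have "z ~= ?c" using that by (auto simp: reg_def)
   thus ?thesis unfolding b using fr[of z] that j by (auto simp: I_def)
  qed
  moreover have "snd (exec ?b t) = snd s" unfolding b using snd by simp
  moreover have "?c ~= x" using okx by (auto simp: reg_def)
  ultimately show "I (Suc j) (upd (exec ?b t) x (Suc j))" using cs unfolding I_def by simp
 qed
 hence I: "I ?n (exec (PFor x 1 ?b) ?s)" by simp
 have r: "reg 4" "4 \<notin> bv a" "x ~= 4" using bv_small[OF okx(1)] okx(4) by (simp_all add: reg_def)
 let ?u = "exec (PFor x 1 ?b) ?s"
 have "fst ?u ?c = min (fst s y) (card (A ?n))" "fst ?u y = fst s y" "fst ?u 4 = 1"
  using I r okx FGe.prems(2) by (auto simp: I_def)
 hence "fst (exec (fcode d (FGe x y a)) s) 10 = of_bool (fst s y \<le> card (A ?n))" by (simp add: min_def)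
 thus ?case unfolding A_def by simp
qed auto

definition PFill :: "nat => nat => fm => prog" where
 "PFill k x a = PFor x 1 (fcode 0 a ;; PIfEq 10 4 (PPut k x) (PClr k x))"

lemma mods_PFill: "mods (PFill k x a) \<subseteq> {10..14} \<union> {100..} \<union> insert x (bv a)" "tmods (PFill k x a) = {k}" "rvars (PFill k x a) \<subseteq> {0, 1}"
 using mods_fcode[of 0 a] by (auto simp: PFill_def)

text \<open>The formula is evaluated while track \<open>k\<close> is being overwritten, so it must
  not read that track.\<close>

lemma PFill_correct:
 assumes ok: "ok a" "reg x" "20 \<le> x" "x \<notin> bv a" "fv a \<inter> bv a = {}" "k \<notin> ftr a" and 4: "fst s 4 = 1"
 shows "snd (exec (PFill k x a) s) = (snd s)(k := (\<lambda>j. if j < fst s 1 then sat (upd s x j) a else snd s k j))"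
proof -
 let ?b = "fcode 0 a ;; PIfEq 10 4 (PPut k x) (PClr k x)"
 define I where "I j t \<longleftrightarrow> (\<forall>z. reg z --> z \<notin> bv a --> z ~= x --> fst t z = fst s z) \<and>
  snd t = (snd s)(k := (\<lambda>i. if i < j then sat (upd s x i) a else snd s k i))" for j and t :: pstate
 have "I (fst s 1) (exec (PFor x 1 ?b) s) \<and> fst (exec (PFor x 1 ?b) s) x = fst s 1"
 proof (rule PFor_rule)
  show "x ~= 1" using ok by auto
  show "x \<notin> mods ?b" using mods_fcode(1)[of 0 a] ok by (auto simp: reg_def)
  show "I 0 (upd s x 0)" by (auto simp: I_def)
  fix j t assume j: "fst t x = j" "I j t"
  let ?t = "exec (fcode 0 a) t"
  have fr: "fst ?t z = fst t z" if "reg z \<and> z \<notin> bv a" for z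
   using mods_fcode(1)[of 0 a] that by (intro exec_frame) (auto simp: reg_def)
  have r: "reg 4" "reg 0" "reg 1" "reg 3" "4 \<notin> bv a" "0 \<notin> bv a" "1 \<notin> bv a" "3 \<notin> bv a" "x \<notin> {0, 1, 3, 4}"
   using bv_small[OF ok(1)] ok(3) by (simp_all add: reg_def)
  have t4: "fst t 4 = 1" using j r 4 by (simp add: I_def)
  have "sat t a \<longleftrightarrow> sat (upd s x j) a"
  proof (rule sat_cong)
   show "\<forall>z\<in>fv a. fst t z = fst (upd s x j) z" using j ok ok_regs(2)[OF ok(1)] by (auto simp: I_def)
   show "\<forall>z\<in>bv a. 20 \<le> z" using ok_regs(1)[OF ok(1)] by auto
  qed (use j r ok in \<open>auto simp: I_def\<close>)
  hence f: "fst ?t 10 = of_bool (sat (upd s x j) a)" using fcode_correct[OF ok(1) t4, of 0] by simp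
  have snd: "snd ?t = snd t" using exec_frame_track[of _ "fcode 0 a" t] mods_fcode(2)[of 0 a] by auto
  have xt: "fst ?t x = j" "fst ?t 4 = 1" using fr[of x] fr[of 4] ok j r t4 by auto
  have b: "exec ?b t = (fst ?t, (snd t)(k := (snd t k)(j := sat (upd s x j) a)))" using f xt snd by auto
  show "I (Suc j) (upd (exec ?b t) x (Suc j))" unfolding I_def b using j(2) fr
   by (auto simp: I_def fun_eq_iff less_Suc_eq)
 qed
 thus ?thesis unfolding PFill_def I_def by simp
qed

section \<open>Encoding local moves by words\<close>

definition nth_nbr :: "nat set => (nat \<times> nat) set => nat => nat => nat => bool" where
 "nth_nbr K E u d x \<longleftrightarrow> x \<in> K \<and> (u, x) \<in> E \<and> card {y \<in> K. y < x \<and> (u, y) \<in> E} = d"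

text \<open>A digit that names no neighbour leaves the walk where it is, so every word describes a
  walk.\<close>

definition nbr :: "nat set => (nat \<times> nat) set => nat => nat => nat" where
 "nbr K E u d = (if \<exists>x. nth_nbr K E u d x then SOME x. nth_nbr K E u d x else u)"

text \<open>Digits below \<open>D\<close> walk to a neighbour, the digit \<open>D\<close> toggles the current vertex, and \<open>D + 1\<close> is
 used for padding.\<close>

fun wstep :: "nat => nat set => (nat \<times> nat) set => nat \<times> nat set => nat => nat \<times> nat set" where
 "wstep D K E (u, S) d = (if d = D then (u, sym_diff S {u}) else (nbr K E u d, S))"

definition digits :: "nat => nat => nat => nat list" where
 "digits b l z = map (\<lambda>i. z div b ^ i mod b) [0..<l]"

definition candidate :: "nat => nat => nat set => (nat \<times> nat) set => nat set => nat => nat => nat set" where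
 "candidate l D K E S v z = snd (foldl (wstep D K E) (v, S) (digits (D + 2) l z))"

lemma nth_nbr_unique:
 assumes "nth_nbr K E u d x" "nth_nbr K E u d x'" "finite K" shows "x = x'"
proof -
 have "\<not> a < b" if "nth_nbr K E u d a" "nth_nbr K E u d b" for a b
 proof
  assume "a < b"
  hence "{y \<in> K. y < a \<and> (u, y) \<in> E} \<subset> {y \<in> K. y < b \<and> (u, y) \<in> E}" using that by (auto simp: nth_nbr_def)
  hence "card {y \<in> K. y < a \<and> (u, y) \<in> E} < card {y \<in> K. y < b \<and> (u, y) \<in> E}" using assms(3) by (intro psubset_card_mono) auto
  thus False using that by (simp add: nth_nbr_def)
 qed
 thus ?thesis using assms(1,2) by (meson linorder_neqE_nat)
qed

lemma nbr_eq: assumes "nth_nbr K E u d x" "finite K" shows "nbr K E u d = x"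
 using nth_nbr_unique[OF _ assms(1,2)] someI[of "nth_nbr K E u d", OF assms(1)] assms(1) by (auto simp: nbr_def)

lemma nbr_surj:
 assumes "u \<in> K" "u \<notin> hubs D K E" "x \<in> K" "(u, x) \<in> E" "finite K"
 shows "\<exists>d<D. nbr K E u d = x"
proof -
 let ?A = "{y \<in> K. y < x \<and> (u, y) \<in> E}"
 have "card ?A \<le> card (E `` {u} \<inter> K)" using assms(5) by (intro card_mono) auto
 hence "card ?A < D" using assms(1,2) by (simp add: hubs_def)
 moreover have "nth_nbr K E u (card ?A) x" using assms by (simp add: nth_nbr_def)
 ultimately show ?thesis using nbr_eq assms(5) by blast
qed

lemma digits_surj: "set ws \<subseteq> {..<b} ==> \<exists>z<b ^ length ws. digits b (length ws) z = ws"
proof (induction ws)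
 case (Cons w ws)
 then obtain z where z: "z < b ^ length ws" "digits b (length ws) z = ws" by auto
 let ?z = "w + b * z"
 have w: "w < b" using Cons.prems by auto
 have "?z < b * Suc z" using w by simp
 also have "\<dots> \<le> b * b ^ length ws" using z(1) by (intro mult_le_mono) simp_all
 finally have "?z < b ^ length (w # ws)" by simp
 moreover have "?z div b ^ Suc i = z div b ^ i" for i using w by (simp add: div_mult2_eq)
 hence "digits b (length (w # ws)) ?z = w # digits b (length ws) z"
  using w by (simp add: digits_def upt_conv_Cons map_Suc_upt[symmetric] del: upt_Suc)
 ultimately show ?case using z(2) by metis
qed (simp add: digits_def)

lemma walk_word:
 assumes "(u, x) \<in> (E \<inter> C \<times> C) ^^ m" "C \<subseteq> K" "C \<inter> hubs D K E = {}" "finite K"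
 shows "\<exists>ws. length ws = m \<and> set ws \<subseteq> {..<D} \<and> (\<forall>S. foldl (wstep D K E) (u, S) ws = (x, S))"
 using assms(1)
proof (induction m arbitrary: x)
 case (Suc m)
 then obtain y where y: "(u, y) \<in> (E \<inter> C \<times> C) ^^ m" "(y, x) \<in> E \<inter> C \<times> C" by auto
 obtain ws where ws: "length ws = m" "set ws \<subseteq> {..<D}" "\<forall>S. foldl (wstep D K E) (u, S) ws = (y, S)" using Suc.IH[OF y(1)] by blast
 have "y \<in> K" "y \<notin> hubs D K E" "x \<in> K" "(y, x) \<in> E" using y(2) assms(2,3) by auto
 from nbr_surj[OF this assms(4)] obtain d where d: "d < D" "nbr K E y d = x" by blast
 thus ?case using ws by (intro exI[of _ "ws @ [d]"]) auto
qed simp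

text \<open>The members of \<open>T\<close> are visited one after another. The relation inside
  \<open>C\<close> has at most \<open>k * k\<close> pairs, so each walk takes at most
  \<open>k * k\<close> digits, and one more digit toggles. The walk is independent of the set being
  toggled, so the same word works for all \<open>S\<close>.\<close>

lemma toggle_word:
 assumes C: "conn E C" "card C \<le> k" "C \<subseteq> K" "C \<inter> hubs D K E = {}" "finite K" and "finite T" "T \<subseteq> C" "u \<in> C"
 shows "\<exists>ws. length ws \<le> card T * (k * k + 1) \<and> set ws \<subseteq> {..D} \<and> (\<forall>S. \<exists>y\<in>C. foldl (wstep D K E) (u, S) ws = (y, sym_diff S T))"
 using assms(6,7)
proof (induction T rule: finite_induct)
 case empty
 thus ?case using assms(8) by (intro exI[of _ "[]"]) auto
next
 case (insert x T)
 let ?R = "E \<inter> C \<times> C"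
 have fC: "finite C" using finite_subset[OF C(3,5)] .
 have reach: "\<exists>m\<le>k * k. (y, x) \<in> ?R ^^ m" if "y \<in> C" for y
 proof -
  have "(y, x) \<in> ?R\<^sup>*" using C(1) that insert.prems by (auto simp: conn_def)
  moreover have f: "finite ?R" using fC by auto
  ultimately obtain m where m: "m \<le> card ?R" "(y, x) \<in> ?R ^^ m" unfolding rtrancl_finite_eq_relpow[OF f] by auto
  have "card ?R \<le> card (C \<times> C)" using fC by (intro card_mono) auto
  also have "\<dots> \<le> k * k" using C(2) by (simp add: card_cartesian_product mult_le_mono)
  finally show ?thesis using m le_trans by blast
 qed
 obtain ws where ws: "length ws \<le> card T * (k * k + 1)" "set ws \<subseteq> {..D}"
  "\<forall>S. \<exists>y\<in>C. foldl (wstep D K E) (u, S) ws = (y, sym_diff S T)" using insert by auto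
 have pos: "fst (foldl (wstep D K E) (u, S) ws) = fst (foldl (wstep D K E) (u, S') ws)" for S S' u
 proof (induction ws arbitrary: u S S')
  case (Cons w ws)
  thus ?case by (cases "w = D") auto
 qed simp
 define y where "y = fst (foldl (wstep D K E) (u, {}) ws)"
 have y: "foldl (wstep D K E) (u, S) ws = (y, sym_diff S T)" "y \<in> C" for S
 proof -
  obtain y' where y': "y' \<in> C" "foldl (wstep D K E) (u, S) ws = (y', sym_diff S T)" using ws(3) by blast
  hence "y' = y" using pos[of u S "{}"] by (simp add: y_def)
  thus "foldl (wstep D K E) (u, S) ws = (y, sym_diff S T)" "y \<in> C" using y' by auto
 qed
 obtain m where m: "m \<le> k * k" "(y, x) \<in> ?R ^^ m" using reach[OF y(2)] by blast
 obtain vs where vs: "length vs = m" "set vs \<subseteq> {..<D}" "\<forall>S. foldl (wstep D K E) (y, S) vs = (x, S)"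
  using walk_word[OF m(2) C(3,4,5)] by blast
 have "sym_diff (sym_diff S T) {x} = sym_diff S (insert x T)" for S using insert.hyps(2) by auto
 hence "foldl (wstep D K E) (u, S) (ws @ vs @ [D]) = (x, sym_diff S (insert x T))" for S using y(1) vs(3) by simp
 moreover have "length (ws @ vs @ [D]) \<le> card (insert x T) * (k * k + 1)" using ws(1) vs(1) m(1) insert.hyps by simp
 moreover have "set (ws @ vs @ [D]) \<subseteq> {..D}" using ws(2) vs(2) by auto
 ultimately show ?case using insert.prems by blast
qed

lemma pad_word: "snd (foldl (wstep D K E) c (replicate m (D + 1))) = snd c"
proof (induction m arbitrary: c)
 case (Suc m)
 thus ?case by (cases c) simp
qed simp

text \<open>A singleton needs the one digit \<open>D\<close>, which is also available at a hub;
  other moves need at most \<open>k\<close> visits. Padding gives all words the same length, so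
  moves are enumerated by a start vertex and a number below \<open>(D + 2) ^ l\<close>.\<close>

lemma local_move_candidate:
 assumes mv: "local_move k D K E T" and k: "0 < k" and K: "finite K"
 shows "\<exists>v\<in>K. \<exists>z<(D + 2) ^ (k * (k * k + 1)). candidate (k * (k * k + 1)) D K E S v z = sym_diff S T"
proof -
 let ?l = "k * (k * k + 1)"
 obtain C where C: "T \<subseteq> C" "C \<subseteq> K" "card C = 1 \<or> conn E C \<and> card C \<le> k \<and> C \<inter> hubs D K E = {}"
  using mv by (auto simp: local_move_def)
 have "\<exists>v\<in>C. \<exists>ws. length ws \<le> ?l \<and> set ws \<subseteq> {..D} \<and> snd (foldl (wstep D K E) (v, S) ws) = sym_diff S T"
 proof (cases "card C = 1")
  case True
  then obtain v where v: "C = {v}" using card_1_singletonE by blast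
  then consider "T = {}" | "T = {v}" using C(1) by blast
  thus ?thesis
  proof cases
   case 1
   thus ?thesis using v by (intro bexI[of _ v] exI[of _ "[]"]) auto
  next
   case 2
   have "1 \<le> ?l" using k by simp
   thus ?thesis using 2 v by (intro bexI[of _ v] exI[of _ "[D]"]) auto
  qed
 next
  case False
  hence c: "conn E C" "card C \<le> k" "C \<inter> hubs D K E = {}" using C(3) by auto
  have f: "finite C" "finite T" using finite_subset[OF C(2) K] C(1) finite_subset by auto
  obtain v where v: "v \<in> C" using c(1) by (auto simp: conn_def)
  obtain ws where ws: "length ws \<le> card T * (k * k + 1)" "set ws \<subseteq> {..D}"
   "\<forall>S. \<exists>y\<in>C. foldl (wstep D K E) (v, S) ws = (y, sym_diff S T)"
   using toggle_word[OF c(1,2) C(2) c(3) K f(2) C(1) v] by blast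
  have "card T \<le> k" using card_mono[OF f(1) C(1)] c(2) by simp
  hence "card T * (k * k + 1) \<le> ?l" by (rule mult_right_mono) simp
  hence "length ws \<le> ?l" using ws(1) by linarith
  moreover have "snd (foldl (wstep D K E) (v, S) ws) = sym_diff S T" using ws(3) by (metis snd_conv)
  ultimately show ?thesis using ws(2) v by blast
 qed
 then obtain v ws where w: "v \<in> C" "length ws \<le> ?l" "set ws \<subseteq> {..D}" "snd (foldl (wstep D K E) (v, S) ws) = sym_diff S T" by blast
 let ?ws = "ws @ replicate (?l - length ws) (D + 1)"
 have len: "length ?ws = ?l" using w(2) by simp
 have "set ?ws \<subseteq> {..<D + 2}" using w(3) by (auto split: if_splits)
 then obtain z where z: "z < (D + 2) ^ ?l" "digits (D + 2) ?l z = ?ws" using digits_surj[of ?ws] unfolding len by blast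
 have "candidate ?l D K E S v z = sym_diff S T"
  unfolding candidate_def z(2) foldl_append pad_word by (rule w(4))
 thus ?thesis using z(1) w(1) C(2) by blast
qed

section \<open>The local search program\<close>

definition ts :: "pstate => nat => nat set" where "ts s k = {i. snd s k i}"

lemma ts_upd [simp]: "ts (upd s x j) = ts s" by (simp add: ts_def fun_eq_iff upd_def)
lemma ts_cong: "snd s k = snd s' k ==> ts s k = ts s' k" by (simp add: ts_def)
lemma ts_mem [simp]: "snd s k i \<longleftrightarrow> i \<in> ts s k" by (simp add: ts_def)

lemma gr_upd [simp]: "x ~= 1 ==> x ~= 3 ==> gr (upd s x j) = gr s" by (simp add: gr_def upd_def)

abbreviation FEx :: "nat => fm => fm" where "FEx x a \<equiv> FGe x 4 a"

lemma sat_FEx: assumes "fst s 4 = 1" shows "sat s (FEx x a) \<longleftrightarrow> (\<exists>j<fst s 1. sat (upd s x j) a)"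
proof -
 have "1 \<le> card {j. j < fst s 1 \<and> sat (upd s x j) a} \<longleftrightarrow> {j. j < fst s 1 \<and> sat (upd s x j) a} ~= {}"
  by (simp add: Suc_le_eq card_gt_0_iff)
 thus ?thesis using assms by auto
qed

text \<open>Tracks: 2 kernel, 3 current solution, 4 candidate, 5 and 7 set reached so far, 6 hubs. Registers: 2 and 5 to 9
 \<open>q\<close>, \<open>t\<close>, \<open>D\<close>, \<open>D + 2\<close>, length and number of words; 30 bound on the current potential; 31 and 33 position and
 remaining word of a move; 32 and 34 its start and word.\<close>

definition fm_kernel :: fm where
 "fm_kernel = FNot (FGe 22 5 (FAnd (FLt 22 21) (FNot (FEx 23 (FNot (FAnd
  (FNot (FAnd (FAdj 22 23) (FNot (FAdj 21 23)))) (FNot (FAnd (FAdj 21 23) (FNot (FAdj 22 23))))))))))"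

definition fm_hub :: fm where
 "fm_hub = FAnd (FBit 2 21) (FGe 22 6 (FAnd (FBit 2 22) (FAdj 21 22)))"

definition fm_below :: fm where "fm_below = FAnd (FLt 22 21) (FAnd (FBit 2 22) (FAdj 31 22))"

definition fm_nbr :: fm where
 "fm_nbr = FAnd (FBit 2 21) (FAnd (FAdj 31 21) (FAnd (FGe 22 35 fm_below) (FNot (FGe 22 38 fm_below))))"

definition fm_grow :: fm where
 "fm_grow = FNot (FAnd (FNot (FBit 5 21)) (FNot (FEx 22 (FAnd (FBit 5 22) (FAnd (FBit 4 22) (FAnd (FBit 4 21) (FAdj 22 21)))))))"

definition fm_rep :: fm where
 "fm_rep = FAnd (FBit 4 41) (FNot (FEx 22 (FAnd (FLt 22 41) (FAnd (FBit 4 22) (FBit 5 22)))))"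

definition fm_admissible :: fm where
 "fm_admissible = FAnd (FNot (FEx 21 (FAnd (FBit 4 21) (FNot (FBit 2 21)))))
  (FAnd (FNot (FEx 21 (FAnd (FBit 6 21) (FNot (FBit 4 21)))))
  (FAnd (FEx 21 (FBit 4 21))
   (FNot (FEx 21 (FEx 22 (FAnd (FAdj 21 22) (FAnd (FNot (FBit 4 21)) (FNot (FBit 4 22)))))))))"

text \<open>Division by \<open>D + 2\<close> through counting: register 37 counts up to the number
  in 33, with 35 as running remainder and 36 as quotient. The loop bound is the number of words,
  which is no less than the number to be divided.\<close>

definition p_digit :: prog where
 "p_digit = PZero 35 ;; PZero 36 ;; PZero 37 ;;
  PRep 9 (PIfEq 37 33 PSkip (PInc 37 ;; PInc 35 ;; PIfEq 35 7 (PZero 35 ;; PInc 36) PSkip)) ;; PCopy 33 36"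

definition p_walk :: prog where
 "p_walk = PCopy 38 35 ;; PInc 38 ;; PCopy 39 31 ;; PFor 21 1 (fcode 0 fm_nbr ;; PIfEq 10 4 (PCopy 39 21) PSkip) ;; PCopy 31 39"

definition p_toggle :: prog where "p_toggle = PIfBit 4 31 (PClr 4 31) (PPut 4 31)"

definition p_candidate :: prog where
 "p_candidate = PFill 4 21 (FBit 3 21) ;; PCopy 31 32 ;; PCopy 33 34 ;; PRep 8 (p_digit ;; PIfEq 35 6 p_toggle p_walk)"

text \<open>Reachability from register 41 within the candidate. The grown set is built on track 7
  and copied back, since a track cannot be filled from itself.\<close>

definition p_mark :: prog where
 "p_mark = PFill 5 21 (FEq 21 41) ;; PRep 0 (PFill 7 21 fm_grow ;; PFill 5 21 (FBit 7 21))"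

definition p_potential :: prog where
 "p_potential = PZero 40 ;; PFor 41 1 (PIfBit 4 41 (PInc 40) PSkip ;; p_mark ;; fcode 0 fm_rep ;;
  PIfEq 10 4 (PInc 40 ;; PInc 40) PSkip)"

definition p_improve :: prog where
 "p_improve = p_potential ;; fcode 0 (FAnd fm_admissible (FLt 40 30)) ;;
  PIfEq 10 4 (PFill 3 21 (FBit 4 21) ;; PCopy 30 40) PSkip"

definition p_pass :: prog where
 "p_pass = PFor 32 1 (PFor 34 9 (p_candidate ;; p_improve))"

definition p_search :: prog where
 "p_search = PFill 2 21 fm_kernel ;; PFill 6 21 fm_hub ;; PFill 3 21 (FBit 2 21) ;; PCopy 30 0 ;; PRep 0 p_pass"

definition p_output :: prog where
 "p_output = PFill 1 21 (FBit 3 21) ;; PFill 0 21 (FNot (FBit 3 21)) ;; PClr 0 1 ;; PClr 1 1"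

text \<open>Formulas that bind registers 21 to 29 only; evaluating them leaves the registers that
  hold the state of the search untouched.\<close>

definition okf :: "fm => bool" where "okf a \<longleftrightarrow> ok a \<and> bv a \<subseteq> {21..29} \<and> fv a \<inter> bv a = {}"

lemmas fm_defs = fm_kernel_def fm_hub_def fm_below_def fm_nbr_def fm_grow_def fm_rep_def fm_admissible_def

lemma okf_formulas: "okf fm_kernel" "okf fm_hub" "okf fm_nbr" "okf fm_grow" "okf fm_rep" "okf (FAnd fm_admissible (FLt 40 30))"
 by (simp_all add: fm_defs okf_def reg_def)

lemma okf_atoms: "reg x ==> okf (FBit k x)" "reg x ==> reg y ==> okf (FEq x y)" "okf a ==> okf (FNot a)"
 by (simp_all add: okf_def)

lemma bv_formulas: "21 \<notin> bv fm_kernel" "21 \<notin> bv fm_hub" "21 \<notin> bv fm_nbr" "21 \<notin> bv fm_grow"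
 by (simp_all add: fm_defs)

lemma ftr_formulas: "ftr fm_kernel = {1}" "ftr fm_hub = {1, 2}" "ftr fm_grow = {1, 4, 5}"
 by (auto simp: fm_defs)

lemma mods_small:
 assumes "okf a" shows "mods (fcode d a) \<subseteq> {10..29} \<union> {100..}" "mods (PFill k 21 a) \<subseteq> {10..29} \<union> {100..}"
 using mods_fcode(1)[of d a] mods_PFill(1)[of k 21 a] assms unfolding okf_def by fastforce+

lemma frame_small:
 assumes "okf a" "z < 10 \<or> 30 \<le> z \<and> z < 100"
 shows "fst (exec (fcode d a) s) z = fst s z" "fst (exec (PFill k 21 a) s) z = fst s z"
 using mods_small[OF assms(1)] assms(2) by (intro exec_frame; fastforce)+

lemma mods_programs: "mods p_digit = {33, 35, 36, 37}" "mods p_walk \<subseteq> {10..29} \<union> {31, 38, 39} \<union> {100..}" "mods p_toggle = {}"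
 "mods p_mark \<subseteq> {10..29} \<union> {100..}" "mods p_potential \<subseteq> {10..29} \<union> {40, 41} \<union> {100..}"
 "tmods p_digit = {}" "tmods p_walk = {}" "tmods p_toggle = {4}" "tmods p_mark \<subseteq> {5, 7}" "tmods p_potential \<subseteq> {5, 7}"
proof -
 show "mods p_digit = {33, 35, 36, 37}" "tmods p_digit = {}" "mods p_toggle = {}" "tmods p_toggle = {4}"
  by (auto simp: p_digit_def p_toggle_def)
 show "mods p_walk \<subseteq> {10..29} \<union> {31, 38, 39} \<union> {100..}"
  using mods_small(1)[OF okf_formulas(3), of 0] unfolding p_walk_def by auto
 show "tmods p_walk = {}" by (simp add: p_walk_def mods_fcode)
 show m: "mods p_mark \<subseteq> {10..29} \<union> {100..}"
  using mods_small(2)[OF okf_formulas(4), of 7] mods_small(2)[OF okf_atoms(1)[of 21 7], of 5] mods_small(2)[OF okf_atoms(2)[of 21 41], of 5]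
  unfolding p_mark_def by (simp add: reg_def)
 show t: "tmods p_mark \<subseteq> {5, 7}" by (simp add: p_mark_def mods_PFill)
 show "mods p_potential \<subseteq> {10..29} \<union> {40, 41} \<union> {100..}"
  using mods_small(1)[OF okf_formulas(5), of 0] m unfolding p_potential_def by auto
 show "tmods p_potential \<subseteq> {5, 7}" using t by (auto simp: p_potential_def mods_fcode)
qed

lemma mods_candidate: "mods p_candidate \<subseteq> {10..29} \<union> {31, 33} \<union> {35..39} \<union> {100..}" "tmods p_candidate = {4}"
 using mods_programs(1-3,6-8) mods_small(2)[OF okf_atoms(1)[of 21 3], of 4] mods_PFill(2)[of 4 21 "FBit 3 21"]
 unfolding p_candidate_def by (auto simp: reg_def)

lemma mods_improve: "mods p_improve \<subseteq> {10..30} \<union> {40, 41} \<union> {100..}"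
proof -
 have "mods (PFill 3 21 (FBit 4 21)) \<subseteq> {10..29} \<union> {100..}" by (rule mods_small) (simp add: okf_def reg_def)
 thus ?thesis using mods_programs(5) mods_small(1)[OF okf_formulas(6), of 0] unfolding p_improve_def by fastforce
qed

locale search =
 fixes n len bs t D l :: nat and mt :: "nat => bool" and E :: "(nat \<times> nat) set"
 assumes len: "n * n \<le> len" "3 * n \<le> len"
  and E: "E = {(i, j). i < n \<and> j < n \<and> mt (bs + i * n + j)}" and sym: "sym E"
begin

definition ctx :: "pstate => bool" where
 "ctx s \<longleftrightarrow> fst s 0 = len \<and> fst s 1 = n \<and> fst s 3 = bs \<and> fst s 4 = 1 \<and> fst s 5 = t \<and> fst s 6 = D \<and>
  fst s 7 = D + 2 \<and> fst s 8 = l \<and> fst s 9 = (D + 2) ^ l \<and> snd s 1 = mt \<and> (\<forall>k\<ge>2. ts s k \<subseteq> {..<n})"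

lemma ctxD:
 assumes "ctx s"
 shows "fst s 0 = len" "fst s 1 = n" "fst s (Suc 0) = n" "fst s 4 = 1" "fst s 5 = t" "fst s 6 = D" "fst s 7 = D + 2"
  "fst s 8 = l" "fst s 9 = (D + 2) ^ l" "gr s = E" "2 \<le> k ==> ts s k \<subseteq> {..<n}"
 using assms unfolding ctx_def gr_def E by (simp_all del: ts_mem)

lemma ctx_upd [simp]: "10 \<le> x ==> ctx (upd s x j) = ctx s"
 by (simp add: ctx_def del: ts_mem)

lemma ctx_exec:
 assumes "ctx s" "mods p \<inter> {..<10} = {}" "1 \<notin> tmods p" "\<And>k. 2 \<le> k ==> k \<in> tmods p ==> ts (exec p s) k \<subseteq> {..<n}"
 shows "ctx (exec p s)"
proof -
 have "fst (exec p s) x = fst s x" if "x < 10" for x using assms(2) that by (intro exec_frame) auto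
 moreover have "snd (exec p s) 1 = snd s 1" using assms(3) by (rule exec_frame_track)
 moreover have "ts (exec p s) k \<subseteq> {..<n}" if "2 \<le> k" for k
  using that assms(4)[of k] ts_cong[OF exec_frame_track, of k p s] ctxD(11)[OF assms(1), of k] by (cases "k \<in> tmods p") auto
 ultimately show ?thesis using assms(1) unfolding ctx_def by simp
qed

lemma PFill_ctx:
 assumes s: "ctx s" and a: "okf a" "21 \<notin> bv a" "k \<notin> ftr a" "2 \<le> k"
 shows "ctx (exec (PFill k 21 a) s)" "ts (exec (PFill k 21 a) s) k = {j. j < n \<and> sat (upd s 21 j) a}"
proof -
 have e: "snd (exec (PFill k 21 a) s) = (snd s)(k := (\<lambda>j. if j < fst s 1 then sat (upd s 21 j) a else snd s k j))"
  by (rule PFill_correct) (use a ctxD[OF s] in \<open>auto simp: okf_def reg_def\<close>)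
 show t: "ts (exec (PFill k 21 a) s) k = {j. j < n \<and> sat (upd s 21 j) a}"
  unfolding ts_def e using ctxD(2)[OF s] ctxD(11)[OF s a(4)] by (auto simp del: ts_mem simp: ts_def)
 show "ctx (exec (PFill k 21 a) s)"
 proof (rule ctx_exec[OF s])
  show "mods (PFill k 21 a) \<inter> {..<10} = {}" using mods_small(2)[OF a(1), of k] by fastforce
  show "1 \<notin> tmods (PFill k 21 a)" using a(4) by (simp add: mods_PFill)
  fix k' assume "k' \<in> tmods (PFill k 21 a)"
  hence "k' = k" by (simp add: mods_PFill)
  thus "ts (exec (PFill k 21 a) s) k' \<subseteq> {..<n}" using t by auto
 qed
qed

lemma PFill_other: "k' ~= k ==> ts (exec (PFill k x a) s) k' = ts s k'"
 by (intro ts_cong exec_frame_track) (simp add: mods_PFill)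

lemma fcode_ctx:
 assumes s: "ctx s" and a: "okf a"
 shows "ctx (exec (fcode 0 a) s)" "fst (exec (fcode 0 a) s) 10 = of_bool (sat s a)" "ts (exec (fcode 0 a) s) = ts s"
  "fst (exec (fcode 0 a) s) 4 = 1"
proof -
 show c: "ctx (exec (fcode 0 a) s)"
  by (rule ctx_exec[OF s]) (use mods_small(1)[OF a, of 0] mods_fcode(2)[of 0 a] in fastforce)+
 show "fst (exec (fcode 0 a) s) 10 = of_bool (sat s a)" using fcode_correct[of a s 0] a ctxD(4)[OF s] by (simp add: okf_def)
 show "ts (exec (fcode 0 a) s) = ts s" by (intro ext ts_cong exec_frame_track) (simp add: mods_fcode)
 show "fst (exec (fcode 0 a) s) 4 = 1" by (rule ctxD(4)[OF c])
qed

lemma E_less: "(i, j) \<in> E ==> i < n \<and> j < n" by (simp add: E)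

lemma sat_kernel:
 assumes s: "ctx s" and v: "v < n" shows "sat (upd s 21 v) fm_kernel \<longleftrightarrow> v \<in> kernel t {..<n} E"
proof -
 have nl: "n \<le> len" using len by simp
 have "E `` {u} = E `` {v} \<longleftrightarrow> (\<forall>x<n. (u, x) \<in> E \<longleftrightarrow> (v, x) \<in> E)" for u using E_less by blast
 hence "{j. j < n \<and> sat (upd (upd s 21 v) 22 j) (FAnd (FLt 22 21) (FNot (FEx 23 (FNot (FAnd
  (FNot (FAnd (FAdj 22 23) (FNot (FAdj 21 23)))) (FNot (FAnd (FAdj 21 23) (FNot (FAdj 22 23)))))))))}
  = {u \<in> {..<n}. u < v \<and> E `` {u} = E `` {v}}"
  using v nl by (auto simp: ctxD[OF s] Suc_le_eq card_gt_0_iff)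
 thus ?thesis unfolding fm_kernel_def kernel_def using v by (simp add: ctxD[OF s] not_le del: sat.simps(1-4,6))
qed

lemma sat_hub:
 assumes s: "ctx s" and v: "v < n" shows "sat (upd s 21 v) fm_hub \<longleftrightarrow> v \<in> hubs D (ts s 2) E"
proof -
 have "{j. j < n \<and> j \<in> ts s 2 \<and> (v, j) \<in> E} = E `` {v} \<inter> ts s 2" using E_less by auto
 thus ?thesis by (simp add: fm_hub_def hubs_def ctxD[OF s])
qed

lemma sat_nbr:
 assumes s: "ctx s" and x: "x < n" and r: "fst s 38 = Suc (fst s 35)"
 shows "sat (upd s 21 x) fm_nbr \<longleftrightarrow> nth_nbr (ts s 2) E (fst s 31) (fst s 35) x"
proof -
 let ?A = "{y \<in> ts s 2. y < x \<and> (fst s 31, y) \<in> E}"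
 have "{j. j < n \<and> j < x \<and> x \<le> j + len \<and> j \<in> ts s 2 \<and> (fst s 31, j) \<in> E} = ?A"
  using x len E_less by auto
 hence "sat (upd s 21 x) (FGe 22 35 fm_below) \<longleftrightarrow> fst s 35 \<le> card ?A" "sat (upd s 21 x) (FGe 22 38 fm_below) \<longleftrightarrow> Suc (fst s 35) \<le> card ?A"
  by (simp_all add: fm_below_def ctxD[OF s] r)
 hence "sat (upd s 21 x) fm_nbr \<longleftrightarrow> x \<in> ts s 2 \<and> (fst s 31, x) \<in> E \<and> fst s 35 \<le> card ?A \<and> \<not> Suc (fst s 35) \<le> card ?A"
  unfolding fm_nbr_def by (simp add: ctxD[OF s] del: sat.simps(7))
 thus ?thesis unfolding nth_nbr_def by linarith
qed

lemma sat_admissible: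
 assumes s: "ctx s" "ts s 6 = hubs D (ts s 2) E"
 shows "sat s fm_admissible \<longleftrightarrow> admissible D (ts s 2) E (ts s 4)"
proof -
 have b: "ts s 4 \<subseteq> {..<n}" "ts s 2 \<subseteq> {..<n}" using ctxD(11)[OF s(1), of 4] ctxD(11)[OF s(1), of 2] by auto
 hence h: "hubs D (ts s 2) E \<subseteq> {..<n}" by (auto simp: hubs_def)
 have "cover E (ts s 4) \<longleftrightarrow> \<not> (\<exists>u<n. \<exists>v<n. (u, v) \<in> E \<and> u \<notin> ts s 4 \<and> v \<notin> ts s 4)"
  using E_less by (auto simp: cover_def)
 moreover have "ts s 4 \<subseteq> ts s 2 \<longleftrightarrow> \<not> (\<exists>u<n. u \<in> ts s 4 \<and> u \<notin> ts s 2)" using b by auto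
 moreover have "hubs D (ts s 2) E \<subseteq> ts s 4 \<longleftrightarrow> \<not> (\<exists>u<n. u \<in> hubs D (ts s 2) E \<and> u \<notin> ts s 4)" using h by auto
 moreover have "ts s 4 ~= {} \<longleftrightarrow> (\<exists>u<n. u \<in> ts s 4)" using b by auto
 moreover have "sat s fm_admissible \<longleftrightarrow> \<not> (\<exists>u<n. u \<in> ts s 4 \<and> u \<notin> ts s 2) \<and> \<not> (\<exists>u<n. u \<in> hubs D (ts s 2) E \<and> u \<notin> ts s 4) \<and>
   (\<exists>u<n. u \<in> ts s 4) \<and> \<not> (\<exists>u<n. \<exists>v<n. (u, v) \<in> E \<and> u \<notin> ts s 4 \<and> v \<notin> ts s 4)"
  unfolding fm_admissible_def by (simp add: sat_FEx ctxD[OF s(1)] s(2) del: sat.simps(7))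
 ultimately show ?thesis unfolding admissible_def by argo
qed

lemma p_digit:
 assumes s: "ctx s" and y: "fst s 33 \<le> (D + 2) ^ l"
 shows "fst (exec p_digit s) 35 = fst s 33 mod (D + 2)" "fst (exec p_digit s) 33 = fst s 33 div (D + 2)"
proof -
 let ?y = "fst s 33" and ?s = "exec (PZero 35 ;; PZero 36 ;; PZero 37) s"
 let ?b = "PIfEq 37 33 PSkip (PInc 37 ;; PInc 35 ;; PIfEq 35 7 (PZero 35 ;; PInc 36) PSkip)"
 define I where "I j u \<longleftrightarrow> fst u 33 = ?y \<and> fst u 7 = D + 2 \<and> fst u 37 = min j ?y \<and> fst u 37 = fst u 36 * (D + 2) + fst u 35 \<and> fst u 35 < D + 2"
  for j and u :: pstate
 define R where "R = exec (PRep 9 ?b) ?s"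
 have "I (fst ?s 9) R" unfolding R_def
 proof (rule PRep_rule)
  show "I 0 ?s" by (simp add: I_def ctxD[OF s])
  fix j u assume "I j u"
  thus "I (Suc j) (exec ?b u)" by (cases "j < ?y") (auto simp: I_def min_def)
 qed
 hence I: "I ((D + 2) ^ l) R" by (simp add: ctxD[OF s])
 have I': "fst R 36 * (D + 2) + fst R 35 = ?y" "fst R 35 < D + 2" using I y unfolding I_def min_def by presburger+
 have e: "exec p_digit s = upd R 33 (fst R 36)" by (simp add: p_digit_def upd_def R_def)
 have y': "?y = fst R 35 + fst R 36 * (D + 2)" using I'(1) by linarith
 have "?y div (D + 2) = fst R 36" unfolding y' by (subst div_mult_self1) (use I'(2) in simp_all)
 moreover have "?y mod (D + 2) = fst R 35" unfolding y' mod_mult_self1 by (rule mod_less[OF I'(2)])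
 ultimately show "fst (exec p_digit s) 35 = ?y mod (D + 2)" "fst (exec p_digit s) 33 = ?y div (D + 2)" unfolding e by simp_all
qed

lemma p_walk:
 assumes s: "ctx s" and u: "fst s 31 < n"
 shows "fst (exec p_walk s) 31 = nbr (ts s 2) E (fst s 31) (fst s 35)" "fst (exec p_walk s) 31 < n"
proof -
 let ?s = "exec (PCopy 38 35 ;; PInc 38 ;; PCopy 39 31) s" let ?K = "ts s 2" and ?u = "fst s 31" and ?d = "fst s 35"
 let ?b = "fcode 0 fm_nbr ;; PIfEq 10 4 (PCopy 39 21) PSkip"
 have K: "?K \<subseteq> {..<n}" "finite ?K" using ctxD(11)[OF s, of 2] finite_subset by auto
 define I where "I j r \<longleftrightarrow> ctx r \<and> ts r = ts s \<and> fst r 31 = ?u \<and> fst r 35 = ?d \<and> fst r 38 = Suc ?d \<and>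
  fst r 39 = (if \<exists>x<j. nth_nbr ?K E ?u ?d x then nbr ?K E ?u ?d else ?u)" for j r
 have s': "?s = upd (upd s 38 (Suc ?d)) 39 ?u" by (simp add: upd_def)
 have "I (fst ?s 1) (exec (PFor 21 1 ?b) ?s) \<and> fst (exec (PFor 21 1 ?b) ?s) 21 = fst ?s 1"
 proof (rule PFor_rule)
  show "21 \<notin> mods ?b" using mods_fcode(1)[of 0 fm_nbr] bv_formulas(3) by auto
  show "I 0 (upd ?s 21 0)" unfolding s' I_def using s by simp
  fix j r assume j: "j < fst ?s 1" "fst r 21 = j" "I j r"
  have jn: "j < n" using j(1) unfolding s' by (simp add: ctxD[OF s])
  have r: "ctx r" "ts r = ts s" "fst r 31 = ?u" "fst r 35 = ?d" "fst r 38 = Suc ?d" using j(3) by (auto simp: I_def)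
  let ?r = "exec (fcode 0 fm_nbr) r"
  note f = fcode_ctx[OF r(1) okf_formulas(3)]
  have fr: "fst ?r z = fst r z" if "30 \<le> z" "z < 100" for z using frame_small(1)[OF okf_formulas(3)] that by simp
  have "upd r 21 j = r" using j(2) by (auto simp: upd_def)
  hence sa: "sat r fm_nbr \<longleftrightarrow> nth_nbr ?K E ?u ?d j" using sat_nbr[OF r(1) jn] r by simp
  have "21 \<notin> mods (fcode 0 fm_nbr)" using mods_fcode(1)[of 0 fm_nbr] bv_formulas(3) by auto
  hence 21: "fst ?r 21 = j" using exec_frame j(2) by simp
  have b: "exec ?b r = (if nth_nbr ?K E ?u ?d j then upd ?r 39 j else ?r)" using f(2,4) sa 21 by (auto simp: upd_def)
  have "fst (exec ?b r) 39 = (if \<exists>x<Suc j. nth_nbr ?K E ?u ?d x then nbr ?K E ?u ?d else ?u)"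
   unfolding b using fr[of 39] j(3) nbr_eq[OF _ K(2), of E ?u ?d j] by (auto simp: I_def less_Suc_eq)
  thus "I (Suc j) (upd (exec ?b r) 21 (Suc j))" unfolding I_def b using f(1,3) fr r by auto
 qed simp
 hence "fst (exec (PFor 21 1 ?b) ?s) 39 = (if \<exists>x<n. nth_nbr ?K E ?u ?d x then nbr ?K E ?u ?d else ?u)"
  unfolding s' by (simp add: I_def ctxD[OF s])
 moreover have "nth_nbr ?K E ?u ?d x ==> x < n" for x using K by (auto simp: nth_nbr_def)
 ultimately have 39: "fst (exec (PFor 21 1 ?b) ?s) 39 = nbr ?K E ?u ?d" by (auto simp: nbr_def)
 thus e: "fst (exec p_walk s) 31 = nbr ?K E ?u ?d" by (simp add: p_walk_def)
 show "fst (exec p_walk s) 31 < n"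
 proof (cases "\<exists>x. nth_nbr ?K E ?u ?d x")
  case True
  then obtain x where x: "nth_nbr ?K E ?u ?d x" by blast
  thus ?thesis using nbr_eq[OF x K(2)] e K(1) by (auto simp: nth_nbr_def)
 next
  case False
  thus ?thesis using u e by (simp add: nbr_def)
 qed
qed

lemma p_candidate:
 assumes s: "ctx s" "fst s 32 < n" "fst s 34 < (D + 2) ^ l"
 shows "ctx (exec p_candidate s)" "ts (exec p_candidate s) 4 = candidate l D (ts s 2) E (ts s 3) (fst s 32) (fst s 34)"
proof -
 let ?s0 = "exec (PFill 4 21 (FBit 3 21)) s" let ?s = "upd (upd ?s0 31 (fst s 32)) 33 (fst s 34)"
 let ?v = "fst s 32" and ?z = "fst s 34" and ?K = "ts s 2" and ?S = "ts s 3"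
 have okb: "okf (FBit 3 21)" by (rule okf_atoms) (simp add: reg_def)
 have f: "ctx ?s0" "ts ?s0 4 = ?S"
  using PFill_ctx[OF s(1) okb, of 4] ctxD(11)[OF s(1), of 3] by auto
 have e: "exec p_candidate s = exec (PRep 8 (p_digit ;; PIfEq 35 6 p_toggle p_walk)) ?s"
  using frame_small(2)[OF okb, of 32 4 s] frame_small(2)[OF okb, of 34 4 s] by (simp add: p_candidate_def upd_def)
 define w where "w = foldl (wstep D ?K E) (?v, ?S)"
 define I where "I j r \<longleftrightarrow> ctx r \<and> ts r 2 = ?K \<and> fst r 31 < n \<and> fst r 33 = ?z div (D + 2) ^ j \<and>
  (fst r 31, ts r 4) = w (map (\<lambda>i. ?z div (D + 2) ^ i mod (D + 2)) [0..<j])" for j r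
 have "I (fst ?s 8) (exec (PRep 8 (p_digit ;; PIfEq 35 6 p_toggle p_walk)) ?s)"
 proof (rule PRep_rule)
  show "I 0 ?s" using f s PFill_other[of 2 4 21 "FBit 3 21" s] by (simp add: I_def w_def)
  fix j r assume j: "I j r"
  have r: "ctx r" "ts r 2 = ?K" "fst r 31 < n" "fst r 33 = ?z div (D + 2) ^ j" using j by (auto simp: I_def)
  let ?r = "exec p_digit r" and ?d = "?z div (D + 2) ^ j mod (D + 2)"
  have "?z div (D + 2) ^ j \<le> (D + 2) ^ l" using s(3) div_le_dividend[of ?z] by (meson le_trans less_imp_le)
  note d = p_digit[OF r(1), unfolded r(4), OF this]
  have tr: "ts ?r = ts r" by (intro ext ts_cong exec_frame_track) (simp add: mods_programs)
  have c: "ctx ?r" by (rule ctx_exec[OF r(1)]) (simp_all add: mods_programs)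
  have 31: "fst ?r 31 = fst r 31" by (rule exec_frame) (simp add: mods_programs)
  have 33: "fst ?r 33 = ?z div (D + 2) ^ Suc j" using d(2) by (simp only: power_Suc2 div_mult2_eq)
  have ws: "w (map (\<lambda>i. ?z div (D + 2) ^ i mod (D + 2)) [0..<Suc j]) = wstep D ?K E (fst r 31, ts r 4) ?d"
   using j by (simp add: I_def w_def)
  show "I (Suc j) (exec (p_digit ;; PIfEq 35 6 p_toggle p_walk) r)"
  proof (cases "?d = D")
   case True
   let ?q = "exec p_toggle ?r"
   have q: "exec (p_digit ;; PIfEq 35 6 p_toggle p_walk) r = ?q" using True d(1) by (simp add: ctxD[OF c])
   have t4: "ts ?q 4 = sym_diff (ts r 4) {fst r 31}"
    using 31 tr by (auto simp: p_toggle_def ts_def fun_eq_iff simp del: ts_mem split: if_splits)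
   have "ctx ?q"
   proof (rule ctx_exec[OF c])
    fix k assume "k \<in> tmods p_toggle"
    hence "k = 4" by (simp add: mods_programs)
    thus "ts (exec p_toggle ?r) k \<subseteq> {..<n}" using t4 r(3) ctxD(11)[OF r(1), of 4] by auto
   qed (simp_all add: mods_programs)
   moreover have "ts ?q 2 = ?K" using tr r(2) ts_cong[OF exec_frame_track, of 2 p_toggle ?r] by (simp add: mods_programs)
   moreover have "fst ?q z = fst ?r z" for z by (rule exec_frame) (simp add: mods_programs)
   ultimately show ?thesis unfolding q I_def ws using True t4 31 33 r(3) by simp
  next
   case False
   let ?q = "exec p_walk ?r"
   have q: "exec (p_digit ;; PIfEq 35 6 p_toggle p_walk) r = ?q" using False d(1) by (simp add: ctxD[OF c])
   note w = p_walk[OF c, unfolded 31 tr r(2) d(1), OF r(3)]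
   have tq: "ts ?q = ts r" using tr ts_cong[OF exec_frame_track, of _ p_walk ?r] by (auto simp: mods_programs)
   have "ctx ?q" by (rule ctx_exec[OF c]) (use mods_programs in auto)
   moreover have "fst ?q 33 = fst ?r 33" by (rule exec_frame) (use mods_programs in auto)
   ultimately show ?thesis unfolding q I_def ws using False w tq 33 r(2) by simp
  qed
 qed
 hence I: "I l (exec p_candidate s)" unfolding e using ctxD(8)[OF f(1)] by simp
 thus "ctx (exec p_candidate s)" by (simp add: I_def)
 have "(fst (exec p_candidate s) 31, ts (exec p_candidate s) 4) = w (digits (D + 2) l ?z)" using I by (simp add: I_def digits_def)
 thus "ts (exec p_candidate s) 4 = candidate l D ?K E ?S ?v ?z" unfolding candidate_def w_def by (metis snd_conv)
qed

lemma p_mark: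
 assumes s: "ctx s" and v: "fst s 41 < n"
 shows "ctx (exec p_mark s)" "ts (exec p_mark s) 5 = {x. (fst s 41, x) \<in> (E \<inter> ts s 4 \<times> ts s 4)\<^sup>*}"
proof -
 let ?s = "exec (PFill 5 21 (FEq 21 41)) s" and ?v = "fst s 41" and ?S = "ts s 4"
 let ?b = "PFill 7 21 fm_grow ;; PFill 5 21 (FBit 7 21)" and ?R = "E \<inter> ts s 4 \<times> ts s 4"
 have oke: "okf (FEq 21 41)" "okf (FBit 7 21)" by (rule okf_atoms; simp add: reg_def)+
 define I where "I j r \<longleftrightarrow> ctx r \<and> ts r 4 = ?S \<and> ts r 5 = {x. \<exists>m\<le>j. (?v, x) \<in> ?R ^^ m}" for j r
 have "I (fst ?s 0) (exec (PRep 0 ?b) ?s)"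
 proof (rule PRep_rule)
  show "I 0 ?s" using PFill_ctx[OF s oke(1), of 5] PFill_other[of 4 5 21 "FEq 21 41" s] v by (auto simp: I_def)
  fix j r assume "I j r"
  hence r: "ctx r" "ts r 4 = ?S" "ts r 5 = {x. \<exists>m\<le>j. (?v, x) \<in> ?R ^^ m}" by (auto simp: I_def)
  let ?r = "exec (PFill 7 21 fm_grow) r" and ?q = "exec ?b r"
  have f: "ctx ?r" "ts ?r 7 = {x. x < n \<and> sat (upd r 21 x) fm_grow}" "ts ?r 4 = ?S"
   using PFill_ctx[OF r(1) okf_formulas(4) bv_formulas(4), of 7] PFill_other[of 4 7 21 fm_grow r] r(2) ftr_formulas(3) by auto
  have "sat (upd r 21 x) fm_grow \<longleftrightarrow> x \<in> ts r 5 \<or> (\<exists>u<n. u \<in> ts r 5 \<and> u \<in> ?S \<and> x \<in> ?S \<and> (u, x) \<in> E)" for x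
   unfolding fm_grow_def by (auto simp: sat_FEx ctxD[OF r(1)] r(2) simp del: sat.simps(7))
  moreover have "ts r 5 \<subseteq> {..<n}" using ctxD(11)[OF r(1), of 5] by simp
  ultimately have 7: "ts ?r 7 = ts r 5 \<union> ?R `` ts r 5" unfolding f(2) using E_less by auto
  have q: "ctx ?q" "ts ?q 5 = {x. x < n \<and> x \<in> ts ?r 7}" "ts ?q 4 = ?S"
   using PFill_ctx[OF f(1) oke(2), of 5] PFill_other[of 4 5 21 "FBit 7 21" ?r] f(3) by auto
  have "ts ?r 7 \<subseteq> {..<n}" using ctxD(11)[OF f(1), of 7] by simp
  hence "ts ?q 5 = ts r 5 \<union> ?R `` ts r 5" using q(2) 7 by auto
  also have "\<dots> = {x. \<exists>m\<le>Suc j. (?v, x) \<in> ?R ^^ m}"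
  proof (intro equalityI subsetI)
   fix x assume "x \<in> ts r 5 \<union> ?R `` ts r 5"
   then consider m where "m \<le> j" "(?v, x) \<in> ?R ^^ m" | m u where "m \<le> j" "(?v, u) \<in> ?R ^^ m" "(u, x) \<in> ?R" unfolding r(3) by blast
   thus "x \<in> {x. \<exists>m\<le>Suc j. (?v, x) \<in> ?R ^^ m}"
   proof cases
    case 1 thus ?thesis using le_SucI by blast
   next
    case 2
    hence "(?v, x) \<in> ?R ^^ Suc m" by auto
    thus ?thesis using 2(1) Suc_le_mono by blast
   qed
  next
   fix x assume "x \<in> {x. \<exists>m\<le>Suc j. (?v, x) \<in> ?R ^^ m}"
   then obtain m where m: "m \<le> Suc j" "(?v, x) \<in> ?R ^^ m" by blast
   show "x \<in> ts r 5 \<union> ?R `` ts r 5"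
   proof (cases "m \<le> j")
    case True thus ?thesis unfolding r(3) using m(2) by blast
   next
    case False
    hence "m = Suc j" using m(1) by simp
    then obtain u where "(?v, u) \<in> ?R ^^ j" "(u, x) \<in> ?R" using m(2) by auto
    thus ?thesis unfolding r(3) by blast
   qed
  qed
  finally show "I (Suc j) ?q" using q by (simp add: I_def)
 qed
 moreover have c: "ctx ?s" using PFill_ctx[OF s oke(1), of 5] by simp
 ultimately have I: "I len (exec p_mark s)" using ctxD(1)[OF c] by (simp add: p_mark_def)
 thus "ctx (exec p_mark s)" by (simp add: I_def)
 have sub: "?R \<subseteq> {..<n} \<times> {..<n}" using E_less by auto
 have fin: "finite ?R" using finite_subset[OF sub] by simp
 have "card ?R \<le> n * n" using card_mono[OF _ sub] by (simp add: card_cartesian_product)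
 hence "card ?R \<le> len" using len(1) by simp
 have "(?v, x) \<in> ?R\<^sup>* \<longleftrightarrow> (\<exists>m\<le>len. (?v, x) \<in> ?R ^^ m)" for x
 proof
  assume "(?v, x) \<in> ?R\<^sup>*"
  thus "\<exists>m\<le>len. (?v, x) \<in> ?R ^^ m" unfolding rtrancl_finite_eq_relpow[OF fin] using \<open>card ?R \<le> len\<close> le_trans by blast
 qed (use relpow_imp_rtrancl in blast)
 thus "ts (exec p_mark s) 5 = {x. (?v, x) \<in> ?R\<^sup>*}" using I by (simp add: I_def)
qed

lemma p_potential:
 assumes s: "ctx s"
 shows "ctx (exec p_potential s)" "fst (exec p_potential s) 40 = potential E (ts s 4)"
proof -
 let ?S = "ts s 4" let ?R = "E \<inter> ?S \<times> ?S" let ?s = "upd s 40 0"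
 let ?b = "PIfBit 4 41 (PInc 40) PSkip ;; p_mark ;; fcode 0 fm_rep ;; PIfEq 10 4 (PInc 40 ;; PInc 40) PSkip"
 have S: "?S \<subseteq> {..<n}" using ctxD(11)[OF s, of 4] by simp
 define f where "f j = card (?S \<inter> {..<j}) + 2 * card (reps E ?S \<inter> {..<j})" for j
 define I where "I j r \<longleftrightarrow> ctx r \<and> ts r 4 = ?S \<and> fst r 40 = f j" for j r
 have "I (fst ?s 1) (exec (PFor 41 1 ?b) ?s) \<and> fst (exec (PFor 41 1 ?b) ?s) 41 = fst ?s 1"
 proof (rule PFor_rule)
  show "41 \<notin> mods ?b" using mods_programs(4) mods_small(1)[OF okf_formulas(5), of 0] by auto
  show "I 0 (upd ?s 41 0)" using s by (simp add: I_def f_def)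
  fix j r assume j: "j < fst ?s 1" "fst r 41 = j" "I j r"
  have jn: "j < n" using j(1) by (simp add: ctxD[OF s])
  have r: "ctx r" "ts r 4 = ?S" "fst r 40 = f j" using j(3) by (auto simp: I_def)
  define r1 where "r1 = upd r 40 (f j + of_bool (j \<in> ?S))"
  have e1: "exec (PIfBit 4 41 (PInc 40) PSkip) r = r1" by (cases "j \<in> ?S") (simp_all add: r1_def upd_def r(2) j(2) flip: r(3))
  have c1: "ctx r1" "fst r1 41 = j" "ts r1 4 = ?S" using r j(2) by (simp_all add: r1_def)
  define r2 where "r2 = exec p_mark r1"
  have c2: "ctx r2" "ts r2 5 = {x. (j, x) \<in> ?R\<^sup>*}" "ts r2 4 = ?S" "fst r2 40 = f j + of_bool (j \<in> ?S)" "fst r2 41 = j"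
  proof -
   show "ctx r2" "ts r2 5 = {x. (j, x) \<in> ?R\<^sup>*}" using p_mark[OF c1(1)] c1 jn unfolding r2_def by simp_all
   have "4 \<notin> tmods p_mark" using mods_programs(9) by auto
   thus "ts r2 4 = ?S" unfolding r2_def using c1(3) ts_cong[OF exec_frame_track] by metis
   have "40 \<notin> mods p_mark" "41 \<notin> mods p_mark" using mods_programs(4) by auto
   thus "fst r2 40 = f j + of_bool (j \<in> ?S)" "fst r2 41 = j" unfolding r2_def using c1(2) by (simp_all add: exec_frame r1_def)
  qed
  let ?r3 = "exec (fcode 0 fm_rep) r2"
  note c3 = fcode_ctx[OF c2(1) okf_formulas(5)]
  have 40: "fst ?r3 40 = f j + of_bool (j \<in> ?S)" using frame_small(1)[OF okf_formulas(5), of 40] c2(4) by simp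
  have "sat r2 fm_rep \<longleftrightarrow> j \<in> ?S \<and> \<not> (\<exists>u<n. u < j \<and> j \<le> u + len \<and> u \<in> ?S \<and> (j, u) \<in> ?R\<^sup>*)"
   unfolding fm_rep_def by (simp add: sat_FEx ctxD[OF c2(1)] c2 del: sat.simps(7))
  also have "\<dots> \<longleftrightarrow> j \<in> reps E ?S"
  proof -
   have "(j, u) \<in> ?R\<^sup>* \<longleftrightarrow> (u, j) \<in> ?R\<^sup>*" for u using rtrancl_restrict_sym[OF sym] by blast
   moreover have "j \<le> len" using jn len(2) by simp
   ultimately show ?thesis unfolding reps_def using jn by (auto simp: not_less intro: ccontr)
  qed
  finally have sa: "sat r2 fm_rep \<longleftrightarrow> j \<in> reps E ?S" .
  have b: "exec ?b r = (if j \<in> reps E ?S then upd ?r3 40 (Suc (Suc (fst ?r3 40))) else ?r3)"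
   unfolding exec.simps(7) e1 r2_def[symmetric] using c3(2,4) sa by (auto simp: upd_def)
  have ins: "card (A \<inter> {..<Suc j}) = card (A \<inter> {..<j}) + of_bool (j \<in> A)" for A
   by (cases "j \<in> A") (simp_all add: lessThan_Suc)
  have "fst (exec ?b r) 40 = f (Suc j)" unfolding b f_def ins using 40 by (simp add: f_def)
  moreover have "ctx (exec ?b r)" "ts (exec ?b r) 4 = ?S" unfolding b using c3(1,3) c2(3) by auto
  ultimately show "I (Suc j) (upd (exec ?b r) 41 (Suc j))" by (simp add: I_def)
 qed simp
 moreover have "exec p_potential s = exec (PFor 41 1 ?b) ?s" by (simp add: p_potential_def upd_def)
 ultimately have I: "I n (exec p_potential s)" using ctxD(2)[OF s] by simp
 thus "ctx (exec p_potential s)" by (simp add: I_def)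
 have "?S \<inter> {..<n} = ?S" "reps E ?S \<inter> {..<n} = reps E ?S" using S reps_subset[of E ?S] by auto
 thus "fst (exec p_potential s) 40 = potential E ?S" using I by (simp add: I_def f_def potential_def)
qed

lemma p_improve:
 assumes s: "ctx s" "ts s 6 = hubs D (ts s 2) E" "fst s 30 \<le> len"
 defines "c \<equiv> admissible D (ts s 2) E (ts s 4) \<and> potential E (ts s 4) < fst s 30"
 shows "ctx (exec p_improve s)" "ts (exec p_improve s) 3 = (if c then ts s 4 else ts s 3)"
  "fst (exec p_improve s) 30 = (if c then potential E (ts s 4) else fst s 30)"
  "k \<in> {2, 6} ==> ts (exec p_improve s) k = ts s k"
proof -
 let ?a = "FAnd fm_admissible (FLt 40 30)"
 define r1 where "r1 = exec p_potential s"
 have r1: "ctx r1" "fst r1 40 = potential E (ts s 4)" "fst r1 30 = fst s 30" "k \<in> {2, 3, 4, 6} ==> ts r1 k = ts s k" for k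
 proof -
  show "ctx r1" "fst r1 40 = potential E (ts s 4)" using p_potential[OF s(1)] by (simp_all add: r1_def)
  show "fst r1 30 = fst s 30" unfolding r1_def by (rule exec_frame) (use mods_programs(5) in auto)
  show "k \<in> {2, 3, 4, 6} ==> ts r1 k = ts s k" unfolding r1_def by (rule ts_cong, rule exec_frame_track) (use mods_programs(10) in auto)
 qed
 let ?r2 = "exec (fcode 0 ?a) r1"
 note c2 = fcode_ctx[OF r1(1) okf_formulas(6)]
 have "sat r1 ?a \<longleftrightarrow> c" unfolding c_def using sat_admissible[OF r1(1)] r1 s(2,3) by (simp add: ctxD[OF r1(1)])
 hence f: "fst ?r2 10 = of_bool c" using c2(2) by simp
 have okb: "okf (FBit 4 21)" by (rule okf_atoms) (simp add: reg_def)
 let ?r3 = "exec (PFill 3 21 (FBit 4 21)) ?r2"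
 have fr: "fst ?r2 30 = fst s 30" "fst ?r3 40 = potential E (ts s 4)"
  using frame_small(1)[OF okf_formulas(6)] frame_small(2)[OF okb] r1 by simp_all
 have e: "exec p_improve s = (if c then upd ?r3 30 (fst ?r3 40) else ?r2)"
  using f c2(4) by (auto simp: p_improve_def r1_def upd_def)
 have c3: "ctx ?r3" "ts ?r3 3 = ts s 4"
  using PFill_ctx[OF c2(1) okb, of 3] c2(3) r1(4)[of 4] ctxD(11)[OF s(1), of 4] by auto
 show "ctx (exec p_improve s)" unfolding e using c2(1) c3(1) by simp
 show "ts (exec p_improve s) 3 = (if c then ts s 4 else ts s 3)" unfolding e using c2(3) c3(2) r1(4)[of 3] by simp
 show "fst (exec p_improve s) 30 = (if c then potential E (ts s 4) else fst s 30)" unfolding e using fr by simp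
 assume "k \<in> {2, 6}"
 hence "k ~= 3" "k \<in> {2, 3, 4, 6}" by auto
 thus "ts (exec p_improve s) k = ts s k" unfolding e using c2(3) r1(4) PFill_other[of k 3 21 "FBit 4 21" ?r2] by simp
qed

definition better :: "nat set => nat set => nat => nat => nat => bool" where
 "better K S P v z \<longleftrightarrow> admissible D K E (candidate l D K E S v z) \<and> potential E (candidate l D K E S v z) < P"

text \<open>Register 30 is an upper bound of the potential: it starts as the input length and
  becomes the exact potential with the first improvement.\<close>

definition inv :: "nat set => pstate => bool" where
 "inv K s \<longleftrightarrow> ctx s \<and> ts s 2 = K \<and> ts s 6 = hubs D K E \<and> fst s 30 \<le> len \<and> admissible D K E (ts s 3) \<and> potential E (ts s 3) \<le> fst s 30"

lemma inv_step:
 assumes s: "inv K s" "fst s 32 < n" "fst s 34 < (D + 2) ^ l"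
 defines "r \<equiv> exec (p_candidate ;; p_improve) s"
 shows "inv K r" "fst r 30 \<le> fst s 30"
  "fst r 30 = fst s 30 ==> ts r 3 = ts s 3 \<and> \<not> better K (ts s 3) (fst s 30) (fst s 32) (fst s 34)"
  "fst r 30 ~= fst s 30 ==> better K (ts s 3) (fst s 30) (fst s 32) (fst s 34)"
proof -
 have i: "ctx s" "ts s 2 = K" "ts s 6 = hubs D K E" "fst s 30 \<le> len" "admissible D K E (ts s 3)" "potential E (ts s 3) \<le> fst s 30"
  using s(1) by (auto simp: inv_def)
 define q where "q = exec p_candidate s"
 have q: "ctx q" "ts q 4 = candidate l D K E (ts s 3) (fst s 32) (fst s 34)" using p_candidate[OF i(1) s(2,3)] i(2) by (simp_all add: q_def)
 have t: "ts q k = ts s k" if "k ~= 4" for k unfolding q_def by (rule ts_cong, rule exec_frame_track) (use that mods_candidate(2) in auto)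
 have 30: "fst q 30 = fst s 30" unfolding q_def by (rule exec_frame) (use mods_candidate(1) in auto)
 have r: "r = exec p_improve q" by (simp add: r_def q_def)
 have h: "ts q 6 = hubs D (ts q 2) E" "fst q 30 \<le> len" using t i 30 by simp_all
 have K: "ts q 2 = K" "ts q 3 = ts s 3" using t i(2) by simp_all
 let ?b = "better K (ts s 3) (fst s 30) (fst s 32) (fst s 34)"
 note m = p_improve[OF q(1) h, folded r, unfolded K q(2) 30, folded better_def]
 have r26: "ts r 2 = K" "ts r 6 = hubs D K E" using m(4)[of 2] m(4)[of 6] K(1) h(1) by simp_all
 show le: "fst r 30 \<le> fst s 30" using m(3) by (simp add: better_def)
 show "inv K r" unfolding inv_def using m(1-3) r26 i le by (auto simp: better_def)
 show "fst r 30 = fst s 30 ==> ts r 3 = ts s 3 \<and> \<not> ?b" using m(2,3) by (auto simp: better_def split: if_splits)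
 show "fst r 30 ~= fst s 30 ==> ?b" using m(3) by (auto split: if_splits)
qed

lemma inv_upd: "10 \<le> x ==> x ~= 30 ==> inv K (upd s x j) = inv K s"
 by (simp add: inv_def)

lemma inv_pass:
 assumes s: "inv K s"
 defines "r \<equiv> exec p_pass s"
 shows "inv K r" "fst r 30 < fst s 30 \<or> (\<forall>v<n. \<forall>z<(D + 2) ^ l. \<not> better K (ts r 3) (fst r 30) v z)"
  "\<forall>v<n. \<forall>z<(D + 2) ^ l. \<not> better K (ts s 3) (fst s 30) v z ==> fst r 30 = fst s 30"
proof -
 let ?S = "ts s 3" and ?P = "fst s 30" and ?Z = "(D + 2) ^ l" let ?c = "p_candidate ;; p_improve"
 have md: "32 \<notin> mods ?c" "34 \<notin> mods ?c" using mods_candidate(1) mods_improve by auto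
 \<comment> \<open>\<open>X\<close> contains the moves already tried. While register 30 keeps its
   value, the solution is unchanged and none of them improves; once it has dropped, some move was
   improving at the start of the pass.\<close>
 define J where "J X u \<longleftrightarrow> inv K u \<and> fst u 30 \<le> ?P \<and> (fst u 30 = ?P --> ts u 3 = ?S \<and> (\<forall>(v, z)\<in>X. \<not> better K ?S ?P v z)) \<and>
  (fst u 30 ~= ?P --> (\<exists>v<n. \<exists>z<?Z. better K ?S ?P v z))" for X u
 have Ju: "J X (upd u x j) = J X u" if "x = 32 \<or> x = 34" for X u x j
 proof -
  have "inv K (upd u x j) = inv K u" by (rule inv_upd) (use that in auto)
  moreover have "fst (upd u x j) 30 = fst u 30" using that by auto
  ultimately show ?thesis unfolding J_def ts_upd by presburger
 qed
 have ci: "fst u 1 = n" "fst u 9 = ?Z" if "inv K u" for u using that ctxD[of u] by (auto simp: inv_def)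
 have "J ({..<fst s 1} \<times> {..<?Z}) (exec (PFor 32 1 (PFor 34 9 ?c)) s) \<and> fst (exec (PFor 32 1 (PFor 34 9 ?c)) s) 32 = fst s 1"
 proof (rule PFor_rule)
  show "J ({..<0} \<times> {..<?Z}) (upd s 32 0)" using s inv_upd[of 32] by (simp add: J_def)
  fix v u assume v: "v < fst s 1" "fst u 32 = v" "J ({..<v} \<times> {..<?Z}) u"
  have Z: "fst u 9 = ?Z" using v(3) ci by (auto simp: J_def)
  have "(\<lambda>z u. J ({..<v} \<times> {..<?Z} \<union> {v} \<times> {..<z}) u \<and> fst u 32 = v) (fst u 9) (exec (PFor 34 9 ?c) u) \<and> fst (exec (PFor 34 9 ?c) u) 34 = fst u 9"
  proof (rule PFor_rule)
   show "J ({..<v} \<times> {..<?Z} \<union> {v} \<times> {..<0}) (upd u 34 0) \<and> fst (upd u 34 0) 32 = v" using v Ju by simp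
   fix z w assume z: "z < fst u 9" "fst w 34 = z" "J ({..<v} \<times> {..<?Z} \<union> {v} \<times> {..<z}) w \<and> fst w 32 = v"
   have w: "inv K w" "fst w 32 < n" "fst w 34 < ?Z" using z Z v(1) ci(1)[OF s] by (auto simp: J_def)
   note st = inv_step[OF w]
   let ?w = "exec ?c w"
   have "J ({..<v} \<times> {..<?Z} \<union> {v} \<times> {..<Suc z}) ?w" unfolding J_def
   proof (intro conjI impI)
    show "inv K ?w" by (rule st)
    show "fst ?w 30 \<le> ?P" using st(2) z(3) by (simp add: J_def)
    assume e: "fst ?w 30 = ?P"
    hence e': "fst w 30 = ?P" "fst ?w 30 = fst w 30" using st(2) z(3) by (auto simp: J_def)
    hence "ts w 3 = ?S" "\<forall>(v, z)\<in>{..<v} \<times> {..<?Z} \<union> {v} \<times> {..<z}. \<not> better K ?S ?P v z" using z(3) by (auto simp: J_def)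
    thus "ts ?w 3 = ?S" "\<forall>(v, z)\<in>{..<v} \<times> {..<?Z} \<union> {v} \<times> {..<Suc z}. \<not> better K ?S ?P v z"
     using st(3)[OF e'(2)] e'(1) z(2,3) by (auto simp: less_Suc_eq)
   next
    assume ne: "fst ?w 30 ~= ?P"
    show "\<exists>v<n. \<exists>z<?Z. better K ?S ?P v z"
    proof (cases "fst w 30 = ?P")
     case True
     hence "ts w 3 = ?S" "better K (ts w 3) (fst w 30) (fst w 32) (fst w 34)" using z(3) st(4) ne by (auto simp: J_def)
     thus ?thesis using w(2,3) True by auto
    next
     case False
     thus ?thesis using z(3) by (simp add: J_def)
    qed
   qed
   moreover have "fst ?w 32 = v" using exec_frame[OF md(1)] z(3) by simp
   ultimately show "J ({..<v} \<times> {..<?Z} \<union> {v} \<times> {..<Suc z}) (upd ?w 34 (Suc z)) \<and> fst (upd ?w 34 (Suc z)) 32 = v" using Ju by simp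
  qed (use md in simp_all)
  hence "J ({..<v} \<times> {..<?Z} \<union> {v} \<times> {..<?Z}) (exec (PFor 34 9 ?c) u)" using Z by simp
  moreover have "{..<v} \<times> {..<?Z} \<union> {v} \<times> {..<?Z} = {..<Suc v} \<times> {..<?Z}" by auto
  ultimately show "J ({..<Suc v} \<times> {..<?Z}) (upd (exec (PFor 34 9 ?c) u) 32 (Suc v))" using Ju by simp
 qed (use md in simp_all)
 hence J: "J ({..<n} \<times> {..<?Z}) r" using ci(1)[OF s] by (simp add: r_def p_pass_def)
 thus "inv K r" by (simp add: J_def)
 show "fst r 30 < ?P \<or> (\<forall>v<n. \<forall>z<?Z. \<not> better K (ts r 3) (fst r 30) v z)"
  using J by (cases "fst r 30 = ?P") (auto simp: J_def)
 show "\<forall>v<n. \<forall>z<?Z. \<not> better K ?S ?P v z ==> fst r 30 = ?P" using J by (auto simp: J_def)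
qed

text \<open>A pass lowers register 30 or certifies that no move improves, and after a certificate
  nothing changes any more. There are \<open>len\<close> passes and the register starts at
  \<open>len\<close>; it stays positive because the solution is nonempty, so a certificate is
  reached. At the end the register lies between the potential of the solution and that of every
  admissible candidate, which is local optimality.\<close>

lemma p_search_correct:
 assumes s: "ctx s" and K: "K = kernel t {..<n} E" "admissible D K E K" and l: "l = k * (k * k + 1)" "0 < k"
 shows "ctx (exec p_search s)" "admissible D K E (ts (exec p_search s) 3)" "locally_optimal k D K E (ts (exec p_search s) 3)"
proof -
 have okb: "okf (FBit 2 21)" by (rule okf_atoms) (simp add: reg_def)
 define r1 where "r1 = exec (PFill 2 21 fm_kernel) s"
 have "{j. j < n \<and> sat (upd s 21 j) fm_kernel} = K" using sat_kernel[OF s] unfolding K(1) by (auto simp: kernel_def)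
 hence 1: "ctx r1" "ts r1 2 = K" using PFill_ctx[OF s okf_formulas(1) bv_formulas(1), of 2] ftr_formulas(1) by (simp_all add: r1_def)
 define r2 where "r2 = exec (PFill 6 21 fm_hub) r1"
 have Kn: "K \<subseteq> {..<n}" "finite K" using K(1) by (auto simp: kernel_def)
 have "{j. j < n \<and> sat (upd r1 21 j) fm_hub} = hubs D K E" using sat_hub[OF 1(1)] Kn unfolding 1(2) by (auto simp: hubs_def)
 hence 2: "ctx r2" "ts r2 2 = K" "ts r2 6 = hubs D K E"
  using PFill_ctx[OF 1(1) okf_formulas(2) bv_formulas(2), of 6] ftr_formulas(2) PFill_other[of 2 6 21 fm_hub r1] 1(2) by (simp_all add: r2_def)
 define r3 where "r3 = exec (PFill 3 21 (FBit 2 21)) r2"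
 have 3: "ctx r3" "ts r3 2 = K" "ts r3 6 = hubs D K E" "ts r3 3 = K"
  using PFill_ctx[OF 2(1) okb, of 3] PFill_other[of 2 3 21 "FBit 2 21" r2] PFill_other[of 6 3 21 "FBit 2 21" r2] 2 Kn by (auto simp: r3_def)
 let ?r4 = "upd r3 30 len"
 have pot: "potential E K \<le> len"
 proof -
  have "card (reps E K) \<le> card K" using Kn(2) reps_subset by (rule card_mono)
  moreover have "card K \<le> n" using card_mono[OF _ Kn(1)] by simp
  ultimately show ?thesis unfolding potential_def using len(2) by linarith
 qed
 have e: "exec p_search s = exec (PRep 0 p_pass) ?r4"
  using ctxD(1)[OF 3(1)] by (simp add: p_search_def r1_def r2_def r3_def upd_def)
 have i4: "inv K ?r4" using 3 K(2) pot by (simp add: inv_def)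
 define Q where "Q u \<longleftrightarrow> (\<forall>v<n. \<forall>z<(D + 2) ^ l. \<not> better K (ts u 3) (fst u 30) v z)" for u
 have "(\<lambda>j u. inv K u \<and> (Q u \<or> fst u 30 + j \<le> len)) (fst ?r4 0) (exec (PRep 0 p_pass) ?r4)"
 proof (rule PRep_rule)
  show "inv K ?r4 \<and> (Q ?r4 \<or> fst ?r4 30 + 0 \<le> len)" using i4 by simp
  fix j u assume u: "inv K u \<and> (Q u \<or> fst u 30 + j \<le> len)"
  note p = inv_pass[OF conjunct1[OF u]]
  have "Q (exec p_pass u) \<or> fst (exec p_pass u) 30 + Suc j \<le> len"
  proof (cases "Q (exec p_pass u)")
   case False
   hence lt: "fst (exec p_pass u) 30 < fst u 30" using p(2) unfolding Q_def by blast
   show ?thesis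
   proof (cases "Q u")
    case True
    have "fst (exec p_pass u) 30 = fst u 30" using p(3) True by (simp add: Q_def)
    thus ?thesis using lt by simp
   next
    case False
    thus ?thesis using u lt by simp
   qed
  qed simp
  thus "inv K (exec p_pass u) \<and> (Q (exec p_pass u) \<or> fst (exec p_pass u) 30 + Suc j \<le> len)" using p(1) by simp
 qed
 hence fin: "inv K (exec p_search s)" "Q (exec p_search s) \<or> fst (exec p_search s) 30 + len \<le> len"
  unfolding e using ctxD(1)[OF 3(1)] by simp_all
 let ?S = "ts (exec p_search s) 3"
 show "ctx (exec p_search s)" and adm: "admissible D K E ?S" using fin(1) by (simp_all add: inv_def)
 have S: "finite ?S" "?S ~= {}" using adm Kn(2) finite_subset by (auto simp: admissible_def)
 hence "0 < card ?S" by (simp add: card_gt_0_iff)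
 hence "0 < fst (exec p_search s) 30" using fin(1) by (simp add: inv_def potential_def)
 hence Q: "Q (exec p_search s)" using fin(2) by simp
 show "locally_optimal k D K E ?S" unfolding locally_optimal_def
 proof (intro allI impI)
  fix T assume T: "local_move k D K E T" "admissible D K E (sym_diff ?S T)"
  obtain v z where v: "v \<in> K" "z < (D + 2) ^ l" "candidate l D K E ?S v z = sym_diff ?S T"
   using local_move_candidate[OF T(1) l(2) Kn(2), of ?S] unfolding l(1) by blast
  have "\<not> better K ?S (fst (exec p_search s) 30) v z" using Q v(1,2) Kn(1) by (auto simp: Q_def)
  hence "fst (exec p_search s) 30 \<le> potential E (sym_diff ?S T)" using T(2) v(3) by (simp add: better_def)
  thus "potential E ?S \<le> potential E (sym_diff ?S T)" using fin(1) by (simp add: inv_def)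
 qed
qed

end

section \<open>Reading the input and computing the parameters\<close>

text \<open>The separator 3 has both bits set, the unary digit 2 only bit 1. Register 51 counts
  separators: digits after the first belong to the denominator \<open>q\<close>, digits after the
  second to \<open>n\<close>, and the cell after the third begins the matrix.\<close>

definition p_parse :: prog where
 "p_parse = PInc 4 ;; PInc 52 ;; PInc 52 ;; PFor 50 0 (PIfBit 0 50 (PIfBit 1 50 (PInc 51 ;; PCopy 3 50 ;; PInc 3) PSkip)
  (PIfEq 51 4 (PInc 2) (PIfEq 51 52 (PInc 1) PSkip)))"

text \<open>Abstract run of the parser: position, number of separators seen, \<open>q\<close>,
  \<open>n\<close>, and the cell after the latest separator.\<close>

fun pst :: "nat \<times> nat \<times> nat \<times> nat \<times> nat => nat => nat \<times> nat \<times> nat \<times> nat \<times> nat" where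
 "pst (i, h, q, n, b) a = (Suc i, if a = 3 then Suc h else h, if a = 2 \<and> h = 1 then Suc q else q,
  if a = 2 \<and> h = 2 then Suc n else n, if a = 3 then Suc i else b)"

lemma pst_replicate: "foldl pst (i, h, q, n, b) (replicate m 2) = (i + m, h, if h = 1 then q + m else q, if h = 2 then n + m else n, b)"
 by (induction m arbitrary: i q n) auto

lemma pst_matrix: "set M \<subseteq> {1, 2} ==> 3 \<le> h ==> foldl pst (i, h, q, n, b) M = (i + length M, h, q, n, b)"
 by (induction M arbitrary: i) auto

lemma pst_input:
 assumes "set M \<subseteq> {1, 2}" "w = replicate p 2 @ [3] @ replicate q 2 @ [3] @ replicate n 2 @ [3] @ M"
 shows "foldl pst (0, 0, 0, 0, 0) w = (length w, 3, q, n, p + q + n + 3)"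
 using assms by (simp add: pst_replicate pst_matrix)

lemma decode_symbol:
 assumes "a \<in> {1, 2, 3::nat}"
 shows "0 \<in> set_decode a \<longleftrightarrow> a ~= 2" "1 \<in> set_decode a \<longleftrightarrow> a ~= 1" "Suc 0 \<in> set_decode a \<longleftrightarrow> a ~= 1"
 using assms by (auto simp: set_decode_def)

lemma p_parse:
 assumes w: "set w \<subseteq> {1, 2, 3}" "foldl pst (0, 0, 0, 0, 0) w = (length w, h, q, n, b)"
 defines "r \<equiv> exec p_parse (init_state w)"
 shows "fst r 1 = n" "fst r 2 = q" "fst r 3 = b" "fst r 4 = 1"
proof -
 let ?b = "PIfBit 0 50 (PIfBit 1 50 (PInc 51 ;; PCopy 3 50 ;; PInc 3) PSkip) (PIfEq 51 4 (PInc 2) (PIfEq 51 52 (PInc 1) PSkip))"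
 let ?s = "exec (PInc 4 ;; PInc 52 ;; PInc 52) (init_state w)"
 define I where "I j u \<longleftrightarrow> (j, fst u 51, fst u 2, fst u 1, fst u 3) = foldl pst (0, 0, 0, 0, 0) (take j w) \<and> fst u 4 = 1 \<and> fst u 52 = 2 \<and>
  snd u = snd (init_state w)" for j and u :: pstate
 have "I (fst ?s 0) (exec (PFor 50 0 ?b) ?s) \<and> fst (exec (PFor 50 0 ?b) ?s) 50 = fst ?s 0"
 proof (rule PFor_rule)
  show "I 0 (upd ?s 50 0)" by (simp add: I_def init_state_def)
  fix j u assume j: "j < fst ?s 0" "fst u 50 = j" "I j u"
  have jw: "j < length w" using j(1) by (simp add: init_state_def)
  hence a: "w ! j \<in> {1, 2, 3}" using w(1) nth_mem by blast
  have tk: "foldl pst (0, 0, 0, 0, 0) (take (Suc j) w) = pst (j, fst u 51, fst u 2, fst u 1, fst u 3) (w ! j)"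
   using j(3) jw by (simp add: I_def take_Suc_conv_app_nth)
  have bits: "snd u 0 j \<longleftrightarrow> w ! j ~= 2" "snd u 1 j \<longleftrightarrow> w ! j ~= 1" "snd u (Suc 0) j \<longleftrightarrow> w ! j ~= 1"
   using j(3) jw decode_symbol[OF a] unfolding I_def init_state_def by (simp_all del: ts_mem)
  have u: "fst u 4 = 1" "fst u 52 = 2" "snd u = snd (init_state w)" using j(3) by (simp_all add: I_def)
  show "I (Suc j) (upd (exec ?b u) 50 (Suc j))"
   unfolding I_def tk using a bits u(1,2) j(2) by (auto simp del: ts_mem simp: u(3))
 qed simp_all
 moreover have "fst ?s 0 = length w" by (simp add: init_state_def)
 moreover have "r = exec (PFor 50 0 ?b) ?s" by (simp add: r_def p_parse_def)
 ultimately have "I (length w) r" by simp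
 thus "fst r 1 = n" "fst r 2 = q" "fst r 3 = b" "fst r 4 = 1" using w(2) by (simp_all add: I_def)
qed

section \<open>Register arithmetic and computation of the parameters\<close>

fun p_lit :: "nat => nat => prog" where
 "p_lit x 0 = PZero x" | "p_lit x (Suc m) = p_lit x m ;; PInc x"

definition p_add :: "nat => nat => nat => prog" where "p_add z x y = PCopy z x ;; PRep y (PInc z)"
definition p_mul :: "nat => nat => nat => prog" where "p_mul z x y = PZero z ;; PRep x (PRep y (PInc z))"
definition p_pow :: "nat => nat => nat => prog" where
 "p_pow z x y = PZero z ;; PInc z ;; PRep y (p_mul 90 z x ;; PCopy z 90) ;; PZero 90"

lemma exec_lit: "exec (p_lit x m) s = upd s x m" by (induction m) (auto simp: upd_def)

lemma exec_incs: "(exec (PInc z) ^^ m) s = upd s z (fst s z + m)" by (induction m) (auto simp: upd_def)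

lemma exec_add: "z ~= y ==> exec (p_add z x y) s = upd s z (fst s x + fst s y)"
 by (auto simp: p_add_def exec_incs upd_def)

lemma exec_mul: assumes "z ~= x" "z ~= y" shows "exec (p_mul z x y) s = upd s z (fst s x * fst s y)"
proof -
 have "(exec (PRep y (PInc z)) ^^ m) u = upd u z (fst u z + m * fst u y)" for m u
  by (induction m) (use assms in \<open>auto simp: exec_incs upd_def\<close>)
 thus ?thesis using assms by (simp add: p_mul_def) (auto simp: upd_def)
qed

lemma exec_pow: assumes "z ~= x" "z ~= y" "90 \<notin> {x, y, z}" shows "exec (p_pow z x y) s = upd (upd s z (fst s x ^ fst s y)) 90 0"
proof -
 let ?b = "p_mul 90 z x ;; PCopy z 90"
 have b: "exec ?b u = upd (upd u 90 (fst u z * fst u x)) z (fst u z * fst u x)" for u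
  using assms by (simp add: exec_mul) (auto simp: upd_def)
 define B where "B = exec ?b"
 have ex: "\<exists>v. (B ^^ m) u = upd (upd u 90 v) z (fst u z * fst u x ^ m)" for m u
 proof (induction m)
  case 0
  thus ?case by (intro exI[of _ "fst u 90"]) (auto simp: upd_def)
 next
  case (Suc m)
  then obtain v where v: "(B ^^ m) u = upd (upd u 90 v) z (fst u z * fst u x ^ m)" by blast
  have "(B ^^ Suc m) u = B (upd (upd u 90 v) z (fst u z * fst u x ^ m))" using v by simp
  also have "\<dots> = upd (upd u 90 (fst u z * fst u x ^ Suc m)) z (fst u z * fst u x ^ Suc m)"
   unfolding B_def b using assms by (auto simp: upd_def fun_eq_iff)
  finally show ?case by blast
 qed
 obtain v where "(B ^^ fst s y) (upd s z 1) = upd (upd (upd s z 1) 90 v) z (fst (upd s z 1) z * fst (upd s z 1) x ^ fst s y)"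
  using ex by blast
 hence v: "(B ^^ fst s y) (upd s z 1) = upd (upd (upd s z 1) 90 v) z (fst s x ^ fst s y)" using assms(1) by simp
 have "exec (p_pow z x y) s = upd ((B ^^ fst s y) (upd s z 1)) 90 0"
  unfolding p_pow_def B_def exec.simps(7)[of "PZero z"] exec.simps(7)[of "PInc z"] exec.simps(7)[of "PRep y ?b"] exec.simps(10)
  using assms(2) by (simp add: upd_def)
 thus ?thesis unfolding v by (simp add: upd_def)
qed

definition p_params1 :: "nat => prog" where
 "p_params1 c = p_lit 60 c ;; p_lit 61 16 ;; p_lit 62 2 ;; p_mul 63 61 2 ;; p_add 64 63 62 ;; p_mul 5 60 64 ;;
  p_mul 65 5 60 ;; p_mul 66 62 65 ;; p_add 67 4 66 ;;
  p_mul 68 2 67 ;; p_mul 69 60 68 ;; p_lit 70 32 ;; p_mul 71 70 69 ;; p_add 6 60 71 ;; p_add 7 6 62"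

definition p_params2 :: prog where
 "p_params2 = p_add 72 6 4 ;; p_mul 73 72 67 ;; p_mul 74 2 73 ;; p_lit 75 48 ;; p_mul 76 75 74 ;;
  p_mul 77 60 76 ;; p_pow 78 7 77 ;; p_mul 79 78 72"

definition p_params :: "nat => prog" where
 "p_params c = p_params1 c ;; p_params2 ;; p_mul 80 79 79 ;; p_add 81 80 4 ;; p_mul 8 79 81 ;; p_pow 9 7 8"

definition par_l :: "nat => nat => nat" where "par_l c q = par_k c q * (par_k c q * par_k c q + 1)"

lemma p_params:
 fixes c :: nat
 assumes "fst s 2 = q" "fst s 4 = 1"
 defines "r \<equiv> exec (p_params c) s"
 shows "fst r 5 = par_t c q" "fst r 6 = par_D c q" "fst r 7 = par_D c q + 2" "fst r 8 = par_l c q" "fst r 9 = (par_D c q + 2) ^ par_l c q"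
proof -
 note ex = exec.simps(7) exec_lit exec_add exec_mul exec_pow
 define r1 where "r1 = exec (p_params1 c) s"
 have 1: "fst r1 60 = c" "fst r1 5 = par_t c q" "fst r1 67 = par_kap c q" "fst r1 6 = par_D c q" "fst r1 7 = par_D c q + 2" "fst r1 2 = q" "fst r1 4 = 1"
  by (simp_all add: r1_def p_params1_def ex assms(1,2) par_t_def par_kap_def par_D_def)
 define r2 where "r2 = exec p_params2 r1"
 have 2: "fst r2 79 = par_k c q" "fst r2 5 = par_t c q" "fst r2 6 = par_D c q" "fst r2 7 = par_D c q + 2" "fst r2 4 = 1"
  by (simp_all add: r2_def p_params2_def ex 1 par_m_def par_k_def)
 have r: "r = exec (p_mul 80 79 79 ;; p_add 81 80 4 ;; p_mul 8 79 81 ;; p_pow 9 7 8) r2" by (simp add: r_def p_params_def r1_def r2_def)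
 show "fst r 5 = par_t c q" "fst r 6 = par_D c q" "fst r 7 = par_D c q + 2" "fst r 8 = par_l c q" "fst r 9 = (par_D c q + 2) ^ par_l c q"
  by (simp_all add: r ex 2 par_l_def)
qed

lemma macro_simps:
 "mods (p_lit x m) = {x}" "tmods (p_lit x m) = {}" "pvars (p_lit x m) = {x}" "numeric (p_lit x m)"
 "mods (p_add x y z) = {x}" "tmods (p_add x y z) = {}" "pvars (p_add x y z) = {x, y, z}" "numeric (p_add x y z)"
 "mods (p_mul x y z) = {x}" "tmods (p_mul x y z) = {}" "pvars (p_mul x y z) = {x, y, z}" "numeric (p_mul x y z)"
 "mods (p_pow x y z) = {x, 90}" "tmods (p_pow x y z) = {}" "pvars (p_pow x y z) = {x, y, z, 90}" "numeric (p_pow x y z)"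
 by (auto simp: p_add_def p_mul_def p_pow_def) (induction m; auto)+

lemma mods_params: "mods (p_params c) \<inter> {..<5} = {}" "tmods (p_params c) = {}" "pvars (p_params c) \<subseteq> {2} \<union> {4..9} \<union> {60..90}" "numeric (p_params c)"
 by (auto simp: p_params_def p_params1_def p_params2_def macro_simps)

lemma p_output:
 assumes "fst s 4 = 1"
 defines "r \<equiv> exec p_output s"
 shows "fst r 1 = fst s 1" "i < fst s 1 ==> snd r 0 i \<longleftrightarrow> i \<notin> ts s 3" "i < fst s 1 ==> snd r 1 i \<longleftrightarrow> i \<in> ts s 3"
  "\<not> snd r 0 (fst s 1)" "\<not> snd r 1 (fst s 1)"
proof -
 let ?r1 = "exec (PFill 1 21 (FBit 3 21)) s" let ?r2 = "exec (PFill 0 21 (FNot (FBit 3 21))) ?r1"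
 have ok: "okf (FBit 3 21)" "okf (FNot (FBit 3 21))" by (simp_all add: okf_def reg_def)
 have f1: "fst ?r1 z = fst s z" if "z < 10" for z using frame_small(2)[OF ok(1)] that by simp
 have f2: "fst ?r2 z = fst s z" if "z < 10" for z using frame_small(2)[OF ok(2)] f1 that by simp
 have s1: "snd ?r1 = (snd s)(1 := (\<lambda>j. if j < fst s 1 then sat (upd s 21 j) (FBit 3 21) else snd s 1 j))"
  by (rule PFill_correct) (use assms(1) ok in \<open>auto simp: okf_def reg_def\<close>)
 have s2: "snd ?r2 = (snd ?r1)(0 := (\<lambda>j. if j < fst ?r1 1 then sat (upd ?r1 21 j) (FNot (FBit 3 21)) else snd ?r1 0 j))"
  by (rule PFill_correct) (use assms(1) ok f1[of 4] in \<open>auto simp: okf_def reg_def\<close>)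
 have e: "r = exec (PClr 0 1 ;; PClr 1 1) ?r2" by (simp add: r_def p_output_def)
 have 31: "snd ?r1 3 = snd s 3" unfolding s1 by simp
 show "fst r 1 = fst s 1" unfolding e using f2[of 1] by simp
 have r: "snd r 0 i = (i ~= fst s 1 \<and> snd ?r2 0 i)" "snd r 1 i = (i ~= fst s 1 \<and> snd ?r2 1 i)" for i
  unfolding e using f2[of 1] by (auto simp del: ts_mem)
 show "\<not> snd r 0 (fst s 1)" "\<not> snd r 1 (fst s 1)" unfolding r by simp_all
 show "i < fst s 1 ==> snd r 0 i \<longleftrightarrow> i \<notin> ts s 3" unfolding r s2 using f1[of 1] 31 by (auto simp del: ts_mem simp: ts_def)
 show "i < fst s 1 ==> snd r 1 i \<longleftrightarrow> i \<in> ts s 3" unfolding r s2 s1 by (auto simp del: ts_mem simp: ts_def)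
qed

lemma search_loops:
 "rvars (p_search ;; p_output) \<subseteq> {0, 1, 8, 9}" "mods (p_search ;; p_output) \<inter> {0, 1, 8, 9} = {}" "4 \<notin> mods p_search"
proof -
 have rf: "rvars (fcode 0 a) \<subseteq> {0, 1, 8, 9}" "rvars (PFill k 21 a) \<subseteq> {0, 1, 8, 9}" for a k
  using mods_fcode(3)[of 0 a] mods_PFill(3)[of k 21 a] by auto
 have "rvars p_candidate \<subseteq> {0, 1, 8, 9}" "rvars p_improve \<subseteq> {0, 1, 8, 9}"
  unfolding p_candidate_def p_improve_def p_digit_def p_toggle_def p_walk_def p_potential_def p_mark_def using rf by simp_all
 thus "rvars (p_search ;; p_output) \<subseteq> {0, 1, 8, 9}"
  unfolding p_search_def p_output_def p_pass_def using rf by simp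
 have "mods (PFill k 21 a) \<inter> {..<10} = {}" if "okf a" for k a using mods_small(2)[OF that, of k] by fastforce
 moreover have "okf (FBit 2 21)" "okf (FBit 3 21)" "okf (FNot (FBit 3 21))" by (simp_all add: okf_def reg_def)
 moreover have "mods p_pass \<inter> {..<10} = {}" unfolding p_pass_def using mods_candidate(1) mods_improve by fastforce
 ultimately have "mods (p_search ;; p_output) \<inter> {..<10} = {}" unfolding p_search_def p_output_def using okf_formulas(1,2)
  by (simp add: Int_Un_distrib2)
 thus "mods (p_search ;; p_output) \<inter> {0, 1, 8, 9} = {}" "4 \<notin> mods p_search" by fastforce+
qed

definition p_eptas :: "nat => prog" where "p_eptas c = p_parse ;; p_params c ;; p_search ;; p_output"

text \<open>Evaluated in a state that has only \<open>q\<close> and the constant 1 set; the actual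
  run costs the same by \<open>numeric_cong\<close>.\<close>

definition params_cost :: "nat => nat => nat" where
 "params_cost c q = cost (p_params c) (\<lambda>x. if x = 2 then q else if x = 4 then 1 else 0, \<lambda>_ _. False)"

lemma p_eptas_correct:
 fixes c :: nat
 assumes w: "w = replicate p 2 @ [3] @ replicate q 2 @ [3] @ replicate n 2 @ [3] @ M" "set M \<subseteq> {1, 2}" "length M = n * n"
  and E: "E = {(i, j). i < n \<and> j < n \<and> M ! (i * n + j) = 2}" "sym E" and p: "0 < p" "0 < q"
 defines "r \<equiv> exec (p_eptas c) (init_state w)"
 defines "F \<equiv> par_l c q + (par_D c q + 2) ^ par_l c q + params_cost c q"
 shows "fst r 1 = n" "cost (p_eptas c) (init_state w) \<le> psize p_parse * (length w + F + 1) ^ pdepth p_parse + F +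
   psize (p_search ;; p_output) * (length w + F + 1) ^ pdepth (p_search ;; p_output) + 2" (is ?time)
  "\<not> snd r 0 n" "\<not> snd r 1 n" "\<exists>S\<subseteq>{..<n}. (\<forall>i<n. (snd r 0 i \<longleftrightarrow> i \<notin> S) \<and> (snd r 1 i \<longleftrightarrow> i \<in> S)) \<and>
   (let K = kernel (par_t c q) {..<n} E; D = par_D c q in admissible D K E K --> admissible D K E S \<and> locally_optimal (par_k c q) D K E S)" (is ?solution)
proof -
 have ws: "set w \<subseteq> {1, 2, 3}" using w by auto
 have lw: "length w = p + q + n + 3 + n * n" using w by simp
 define r1 where "r1 = exec p_parse (init_state w)"
 define r2 where "r2 = exec (p_params c) r1"
 define r3 where "r3 = exec p_search r2"
 have r: "r = exec p_output r3" by (simp add: r_def r1_def r2_def r3_def p_eptas_def)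
 have 1: "fst r1 1 = n" "fst r1 2 = q" "fst r1 3 = p + q + n + 3" "fst r1 4 = 1"
  using p_parse[OF ws pst_input[OF w(2,1)]] by (simp_all add: r1_def)
 have mp: "mods p_parse = {1, 2, 3, 4, 50, 51, 52}" "tmods p_parse = {}" by (auto simp: p_parse_def)
 have 0: "fst r1 x = fst (init_state w) x" if "x \<notin> {1, 2, 3, 4, 50, 51, 52}" for x
  unfolding r1_def by (rule exec_frame) (use mp that in simp)
 have s1: "snd r1 = snd (init_state w)" unfolding r1_def by (rule ext, rule exec_frame_track) (simp add: mp)
 have f2: "fst r2 x = fst r1 x" if "x < 5" for x unfolding r2_def by (rule exec_frame) (use mods_params(1)[of c] that in auto)
 have s2: "snd r2 = snd (init_state w)" unfolding s1[symmetric] r2_def by (rule ext, rule exec_frame_track) (simp add: mods_params)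
 note pr = p_params[OF 1(2,4), of c, folded r2_def]
 let ?bs = "p + q + n + 3"
 define mt where "mt i \<longleftrightarrow> i < length w \<and> 1 \<in> set_decode (w ! i)" for i
 have mat: "w ! (?bs + k) = M ! k" for k using w(1) by (simp add: nth_append)
 have E': "E = {(i, j). i < n \<and> j < n \<and> mt (?bs + i * n + j)}"
 proof -
  have "mt (?bs + i * n + j) \<longleftrightarrow> M ! (i * n + j) = 2" if "i < n" "j < n" for i j
  proof -
   have "i * n + j < Suc i * n" using that by simp
   also have "\<dots> \<le> n * n" using that by (intro mult_le_mono1) simp
   finally have k: "i * n + j < n * n" .
   hence "M ! (i * n + j) \<in> set M" using w(3) by simp
   hence "M ! (i * n + j) \<in> {1, 2}" using w(2) by blast
   moreover have "w ! (?bs + i * n + j) = M ! (i * n + j)" using mat[of "i * n + j"] by (simp add: add.assoc)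
   ultimately show ?thesis using k lw decode_symbol(2)[of "M ! (i * n + j)"] by (auto simp: mt_def)
  qed
  thus ?thesis unfolding E(1) by auto
 qed
 \<comment> \<open>The input is at least this long: the matrix, the unary \<open>n\<close>, three
   separators, and one digit each of numerator and denominator.\<close>
 have "3 * n \<le> n * n + n + 5"
 proof (cases "n \<le> 2")
  case False
  hence "2 * n \<le> n * n" by (intro mult_le_mono1) simp
  thus ?thesis by linarith
 next
  case True
  hence "3 * n \<le> n + 5" by simp
  thus ?thesis by linarith
 qed
 hence ln: "n * n \<le> length w" "3 * n \<le> length w" using lw p by simp_all
 interpret search n "length w" ?bs "par_t c q" "par_D c q" "par_l c q" mt E
  by unfold_locales (use ln E' E(2) in auto)
 have ctx2: "ctx r2" unfolding ctx_def
 proof (intro conjI)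
  show "fst r2 0 = length w" using f2[of 0] 0[of 0] by (simp add: init_state_def)
  show "fst r2 1 = n" "fst r2 3 = ?bs" "fst r2 4 = 1" using f2 1 by simp_all
  show "snd r2 1 = mt" unfolding s2 by (auto simp: init_state_def mt_def fun_eq_iff simp del: ts_mem)
  show "\<forall>k\<ge>2. ts r2 k \<subseteq> {..<n}" unfolding ts_def s2 by (auto simp: init_state_def simp del: ts_mem)
 qed (use pr in auto)
 have m3: "mods p_search \<inter> {0, 1, 8, 9} = {}" using search_loops(2) by auto
 have 3: "fst r3 1 = n" "fst r3 4 = 1"
 proof -
  show "fst r3 1 = n" unfolding r3_def using ctxD(2)[OF ctx2] m3 by (subst exec_frame) auto
  show "fst r3 4 = 1" unfolding r3_def using ctxD(4)[OF ctx2] search_loops(3) by (subst exec_frame) auto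
 qed
 note out = p_output[OF 3(2), folded r, unfolded 3(1)]
 show "fst r 1 = n" "\<not> snd r 0 n" "\<not> snd r 1 n" by (rule out)+
 let ?K = "kernel (par_t c q) {..<n} E"
 have k: "0 < par_k c q" by (simp add: par_k_def)
 show ?solution
 proof (intro exI[of _ "ts r3 3 \<inter> {..<n}"] conjI)
  show "\<forall>i<n. (snd r 0 i \<longleftrightarrow> i \<notin> ts r3 3 \<inter> {..<n}) \<and> (snd r 1 i \<longleftrightarrow> i \<in> ts r3 3 \<inter> {..<n})" using out(2,3) by auto
  have "admissible (par_D c q) ?K E (ts r3 3) \<and> locally_optimal (par_k c q) (par_D c q) ?K E (ts r3 3)" "ts r3 3 \<inter> {..<n} = ts r3 3"
   if "admissible (par_D c q) ?K E ?K"
  proof -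
   note sc = p_search_correct[OF ctx2 refl that par_l_def k, folded r3_def]
   show "admissible (par_D c q) ?K E (ts r3 3) \<and> locally_optimal (par_k c q) (par_D c q) ?K E (ts r3 3)" using sc by simp
   show "ts r3 3 \<inter> {..<n} = ts r3 3" using ctxD(11)[OF sc(1), of 3] by auto
  qed
  thus "let K = ?K; D = par_D c q in admissible D K E K --> admissible D K E (ts r3 3 \<inter> {..<n}) \<and>
    locally_optimal (par_k c q) D K E (ts r3 3 \<inter> {..<n})" unfolding Let_def by simp
 qed simp
 have cA: "cost p_parse (init_state w) \<le> psize p_parse * (length w + F + 1) ^ pdepth p_parse"
  by (rule cost_constant_bounds[where X = "{0}"]) (auto simp: mp init_state_def, simp add: p_parse_def)
 have "cost (p_params c) r1 = params_cost c q" unfolding params_cost_def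
  by (rule conjunct1, rule numeric_cong[OF mods_params(4,3)]) (use 1 0 in \<open>auto simp: init_state_def\<close>)
 hence cB: "cost (p_params c) r1 \<le> F" by (simp add: F_def)
 have cC: "cost (p_search ;; p_output) r2 \<le> psize (p_search ;; p_output) * (length w + F + 1) ^ pdepth (p_search ;; p_output)"
 proof (rule cost_constant_bounds[OF search_loops(1,2)])
  fix x assume "x \<in> {0, 1, 8, 9::nat}"
  thus "fst r2 x \<le> length w + F" using ctxD[OF ctx2] lw by (auto simp: F_def)
 qed
 have "cost (p_eptas c) (init_state w) = cost p_parse (init_state w) + cost (p_params c) r1 + cost (p_search ;; p_output) r2 + 2"
  by (simp add: p_eptas_def r1_def r2_def)
 thus ?time using cA cB cC by linarith
qed

section \<open>The approximation scheme\<close>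

text \<open>\<open>Digraph_Component.connected\<close> passes to the symmetric closure, which for a
  symmetric graph has the same ends of arcs, and its reachability within the vertex set agrees with
  the reflexive transitive closure there.\<close>

lemma connected_vertex_cover_iff:
 assumes "pair_graph G"
 shows "connected_vertex_cover G S \<longleftrightarrow> S \<subseteq> pverts G \<and> conn (parcs G) S \<and> cover (parcs G) S"
proof -
 interpret pair_graph G by (rule assms)
 let ?R = "parcs G \<inter> S \<times> S"
 have sy: "(u, v) \<in> parcs G ==> (v, u) \<in> parcs G" for u v using arcs_symmetric by simp
 have ends: "arcs_ends (with_proj (mk_symmetric (with_proj G \<restriction> S))) = ?R"
  using sy by (force simp: mk_symmetric_def arcs_ends_def arc_to_ends_def)
 have vs: "verts (with_proj (mk_symmetric (with_proj G \<restriction> S))) = S" by (simp add: mk_symmetric_def)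
 have "(u, v) \<in> rtrancl_on S ?R \<longleftrightarrow> (u, v) \<in> ?R\<^sup>*" if "u \<in> S" "v \<in> S" for u v
  using that rtrancl_on_rtranclI rtrancl_consistent_rtrancl_on[of u v ?R S] by auto
 hence "Digraph_Component.connected (with_proj G \<restriction> S) \<longleftrightarrow> conn (parcs G) S"
  unfolding Digraph_Component.connected_def strongly_connected_def reachable_def ends vs conn_def by auto
 thus ?thesis by (auto simp: connected_vertex_cover_def cover_def)
qed

lemma concat_map_nth:
 "i < m ==> j < n ==> concat (map (\<lambda>i. map (f i) [0..<n]) [0..<m]) ! (i * n + j) = f i j"
proof (induction m)
 case (Suc m)
 have len: "length (concat (map (\<lambda>i. map (f i) [0..<n]) [0..<m])) = m * n" by (simp add: length_concat comp_def sum_list_triv)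
 show ?case
 proof (cases "i = m")
  case True
  thus ?thesis using Suc.prems len by (simp add: nth_append)
 next
  case False
  hence i: "i < m" using Suc.prems by simp
  have "i * n + j < Suc i * n" using Suc.prems by simp
  also have "\<dots> \<le> m * n" using i by (intro mult_le_mono1) simp
  finally show ?thesis using Suc.IH[OF i Suc.prems(2)] len by (simp add: nth_append)
 qed
qed simp

text \<open>Discarded vertices are pairwise nonadjacent, so the kernel itself is a vertex cover; it
  is the initial solution of the search.\<close>

lemma kernel_admissible:
 assumes tame: "tame c V E" and c: "0 < c" "0 < q" and W: "W \<subseteq> V" "W ~= {}"
 shows "admissible (par_D c q) (kernel (par_t c q) V E) E (kernel (par_t c q) V E)"
proof -
 interpret kernel_graph c "par_t c q" "par_D c q" V E
  by unfold_locales (use tame c in \<open>simp_all add: par_t_def par_D_def\<close>)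
 have "cover E K" unfolding cover_def
 proof clarify
  fix u v assume e: "(u, v) \<in> E" "v \<notin> K"
  hence "u \<in> V" "v \<in> V" using tm(2) by auto
  thus "u \<in> K" using removed_independent[of u v] e by blast
 qed
 moreover have "K ~= {}" using rep(1) W by blast
 ultimately show ?thesis by (auto simp: admissible_def hubs_def)
qed

lemma tm_halts_mono: "tm_halts_within M w k ==> k \<le> m ==> tm_halts_within M w m"
proof -
 assume k: "tm_halts_within M w k" "k \<le> m"
 obtain q t h where c: "(tm_step M ^^ k) (tm_start w) = (q, t, h)" by (metis surj_pair)
 hence "q = 1" using k(1) by (simp add: tm_halts_within_def)
 thus ?thesis using tm_step_halted[of k M "tm_start w" t h m] c k(2) by (simp add: tm_halts_within_def)
qed

text \<open>Cost and length are at most a constant times the power \<open>dA + dC + 1\<close> of a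
  number quadratic in \<open>N\<close>, and the machine time multiplies two such quantities;
  together this gives the exponent \<open>4 * (dA + dC + 1)\<close>.\<close>

lemma running_time_bound:
 fixes a d K L A B C dA dC N :: nat
 assumes L: "L + A + 1 \<le> a * N ^ 2" and d: "d \<le> B * (L + A + 1) ^ dA + A + C * (L + A + 1) ^ dC + 2" and N: "1 \<le> N"
 shows "K * (L + d + 1) * (d + 1) \<le> K * ((B + C + 5) * (B + C + 5)) * a ^ (2 * (dA + dC + 1)) * N ^ (4 * (dA + dC + 1))"
proof -
 let ?X = "a * N ^ 2" and ?e = "dA + dC + 1"
 have X1: "1 \<le> ?X" using L by linarith
 have p: "(L + A + 1) ^ i \<le> ?X ^ ?e" if "i \<le> ?e" for i
 proof -
  have "(L + A + 1) ^ i \<le> ?X ^ i" using L by (rule power_mono) simp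
  also have "\<dots> \<le> ?X ^ ?e" using that X1 by (rule power_increasing)
  finally show ?thesis .
 qed
 have "B * (L + A + 1) ^ dA \<le> B * ?X ^ ?e" "C * (L + A + 1) ^ dC \<le> C * ?X ^ ?e" by (intro mult_le_mono2 p; simp)+
 moreover have "L + A + 1 \<le> ?X ^ ?e" using p[of 1] by simp
 moreover have "1 \<le> ?X ^ ?e" using X1 by (rule one_le_power)
 ultimately have "L + d + 1 \<le> (B + C + 5) * ?X ^ ?e" "d + 1 \<le> (B + C + 5) * ?X ^ ?e"
  using d unfolding distrib_right by linarith+
 hence "K * (L + d + 1) * (d + 1) \<le> K * ((B + C + 5) * ?X ^ ?e) * ((B + C + 5) * ?X ^ ?e)" by (intro mult_le_mono) simp_all
 also have "\<dots> = K * ((B + C + 5) * (B + C + 5)) * (?X ^ ?e * ?X ^ ?e)" by (simp only: ac_simps)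
 also have "?X ^ ?e * ?X ^ ?e = ?X ^ (2 * ?e)" by (simp add: mult_2 power_add)
 also have "\<dots> = a ^ (2 * ?e) * (N ^ 2) ^ (2 * ?e)" by (rule power_mult_distrib)
 also have "(N ^ 2) ^ (2 * ?e) = N ^ (2 * (2 * ?e))" by (rule power_mult[symmetric])
 also have "2 * (2 * ?e) = 4 * ?e" by simp
 finally show ?thesis by (simp only: mult.assoc)
qed

text \<open>The constant \<open>c\<close> of the class is built into the program, so one machine
  serves all precisions; the other parameters are computed from the denominator found in the input.
  The running time is established for every input of the class, feasible or not.\<close>

theorem tame_class_EPTAS:
 assumes c: "0 < c" and tame: "\<And>G n. pair_graph G ==> pverts G = {..<n} ==> Cl G ==> tame c (pverts G) (parcs G)"
 shows "admits_EPTAS connected_vertex_cover Cl"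
proof -
 obtain M K where M: "turing_machine M" and run: "\<And>w. set w \<subseteq> {1, 2, 3} ==> tm_simulates M K (p_eptas c) 1 w"
  using loop_program_tm[of "p_eptas c" 1] by blast
 define F where "F q = par_l c q + (par_D c q + 2) ^ par_l c q + params_cost c q" for q
 define num den where "num r = nat (fst (quotient_of r))" and "den r = nat (snd (quotient_of r))" for r :: rat
 let ?B = "psize p_parse" and ?C = "psize (p_search ;; p_output)" let ?e = "pdepth p_parse + pdepth (p_search ;; p_output) + 1"
 \<comment> \<open>The argument of \<open>g\<close> is \<open>1 / \<epsilon>\<close>, so
   \<open>1 / r\<close> recovers \<open>\<epsilon>\<close>. Numerator and denominator account for
   the length of its code, \<open>F\<close> for the parameters and their computation.\<close>
 define g where "g r = K * ((?B + ?C + 5) * (?B + ?C + 5)) * (num (1 / r) + den (1 / r) + F (den (1 / r)) + 4) ^ (2 * ?e)" for r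
 show ?thesis unfolding admits_EPTAS_def
 proof (intro exI[of _ M] exI[of _ g] exI[of _ "4 * ?e"] conjI allI impI)
  show "turing_machine M" by (rule M)
  fix n G and \<epsilon> :: rat assume asm: "pair_graph G \<and> pverts G = {..<n} \<and> Cl G \<and> 0 < \<epsilon>"
  hence G: "pair_graph G" "pverts G = {..<n}" "Cl G" and eps: "0 < \<epsilon>" by auto
  let ?p = "num \<epsilon>" and ?q = "den \<epsilon>" and ?E = "parcs G"
  have tm: "tame c {..<n} ?E" using tame[OF G] G(2) by simp
  have "0 < snd (quotient_of \<epsilon>)" by (rule quotient_of_denom_pos')
  moreover have qd: "\<epsilon> = of_int (fst (quotient_of \<epsilon>)) / of_int (snd (quotient_of \<epsilon>))" by (rule quotient_of_div) simp
  ultimately have "0 < fst (quotient_of \<epsilon>)" using eps by (metis of_int_0_less_iff zero_less_divide_iff less_asym)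
  hence pq: "0 < ?p" "0 < ?q" using \<open>0 < snd (quotient_of \<epsilon>)\<close> by (simp_all add: num_def den_def)
  have eps_eq: "\<epsilon> = of_nat ?p / of_nat ?q"
   using qd \<open>0 < fst (quotient_of \<epsilon>)\<close> \<open>0 < snd (quotient_of \<epsilon>)\<close> by (simp add: num_def den_def)
  define Mx where "Mx = concat (map (\<lambda>i. map (\<lambda>j. bit_symbol ((i, j) \<in> ?E)) [0..<n]) [0..<n])"
  define w where "w = encode_rat \<epsilon> @ [3] @ encode_graph n G"
  have w: "w = replicate ?p 2 @ [3] @ replicate ?q 2 @ [3] @ replicate n 2 @ [3] @ Mx"
   by (simp add: w_def encode_rat_def encode_graph_def Mx_def num_def den_def split_beta Let_def)
  have Mset: "set Mx \<subseteq> {1, 2}" by (auto simp: Mx_def bit_symbol_def)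
  have Mlen: "length Mx = n * n" by (simp add: Mx_def length_concat comp_def sum_list_triv)
  have E: "?E = {(i, j). i < n \<and> j < n \<and> Mx ! (i * n + j) = 2}"
  proof -
   have "?E \<subseteq> {..<n} \<times> {..<n}" by (rule tameD(2)[OF tm])
   moreover have "Mx ! (i * n + j) = 2 \<longleftrightarrow> (i, j) \<in> ?E" if "i < n" "j < n" for i j
    unfolding Mx_def concat_map_nth[OF that] by (simp add: bit_symbol_def)
   ultimately show ?thesis by auto
  qed
  have symE: "sym ?E" by (rule tameD(3)[OF tm])
  have wset: "set w \<subseteq> {1, 2, 3}" unfolding w using Mset by auto
  define s where "s = exec (p_eptas c) (init_state w)"
  define d where "d = cost (p_eptas c) (init_state w)"
  note ec = p_eptas_correct[OF w Mset Mlen E symE pq, of c, folded s_def d_def F_def]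
  have halt: "tm_halts_within M w (K * (length w + d + 1) * (d + 1))"
   and outp: "\<And>out. length out = fst s 1 ==> (\<forall>i<length out. out ! i = set_encode {k. k < 2 \<and> snd s k i}) ==>
     \<not> snd s 0 (length out) ==> \<not> snd s 1 (length out) ==> tm_outputs M w out"
   using run[OF wset] unfolding tm_simulates_def Let_def s_def[symmetric] d_def[symmetric] by blast+
  have lw: "length w + F ?q + 1 \<le> (?p + ?q + F ?q + 4) * Suc n ^ 2"
  proof -
   have "length w + F ?q + 1 = (?p + ?q + F ?q + 3) * 1 + (n * n + n + 1)" unfolding w using Mlen by simp
   also have "\<dots> \<le> (?p + ?q + F ?q + 3) * Suc n ^ 2 + Suc n ^ 2"
    by (intro add_mono mult_le_mono2) (simp_all add: power2_eq_square)
   also have "\<dots> = (?p + ?q + F ?q + 4) * Suc n ^ 2" by (simp add: algebra_simps)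
   finally show ?thesis .
  qed
  have "K * (length w + d + 1) * (d + 1) \<le> g (1 / \<epsilon>) * Suc n ^ (4 * ?e)"
   using running_time_bound[OF lw ec(2), of K] by (simp add: g_def)
  hence halts: "tm_halts_within M w (g (1 / \<epsilon>) * Suc n ^ (4 * ?e))" by (rule tm_halts_mono[OF halt])
  obtain S where S: "S \<subseteq> {..<n}" "\<forall>i<n. (snd s 0 i \<longleftrightarrow> i \<notin> S) \<and> (snd s 1 i \<longleftrightarrow> i \<in> S)"
   and opt: "admissible (par_D c ?q) (kernel (par_t c ?q) {..<n} ?E) ?E (kernel (par_t c ?q) {..<n} ?E) ==>
    admissible (par_D c ?q) (kernel (par_t c ?q) {..<n} ?E) ?E S \<and>
    locally_optimal (par_k c ?q) (par_D c ?q) (kernel (par_t c ?q) {..<n} ?E) ?E S"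
   using ec(5) unfolding Let_def by blast
  have "tm_outputs M w (encode_set n S)"
  proof (rule outp)
   show "length (encode_set n S) = fst s 1" using ec(1) by (simp add: encode_set_def)
   show "\<not> snd s 0 (length (encode_set n S))" "\<not> snd s 1 (length (encode_set n S))" using ec(3,4) by (simp_all add: encode_set_def del: ts_mem)
   show "\<forall>i<length (encode_set n S). encode_set n S ! i = set_encode {k. k < 2 \<and> snd s k i}"
   proof (intro allI impI)
    fix i assume "i < length (encode_set n S)"
    hence i: "i < n" by (simp add: encode_set_def)
    have "{k. k < 2 \<and> snd s k i} = (if i \<in> S then {1} else {0})" using S(2) i by (auto simp: less_2_cases_iff simp del: ts_mem)
    thus "encode_set n S ! i = set_encode {k. k < 2 \<and> snd s k i}" using i by (simp add: encode_set_def bit_symbol_def set_encode_def)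
   qed
  qed
  moreover have "connected_vertex_cover G S \<and> of_nat (card S) \<le> (1 + \<epsilon>) * of_nat (opt_size connected_vertex_cover G)"
   if ex: "\<exists>W. connected_vertex_cover G W"
  proof -
   have "\<exists>k W. connected_vertex_cover G W \<and> card W = k" using ex by blast
   hence "\<exists>W. connected_vertex_cover G W \<and> card W = opt_size connected_vertex_cover G" unfolding opt_size_def by (rule LeastI_ex)
   then obtain W where W: "connected_vertex_cover G W" "card W = opt_size connected_vertex_cover G" by blast
   hence W': "W \<subseteq> {..<n}" "conn ?E W" "cover ?E W" using connected_vertex_cover_iff[OF G(1)] G(2) by auto
   have "admissible (par_D c ?q) (kernel (par_t c ?q) {..<n} ?E) ?E (kernel (par_t c ?q) {..<n} ?E)"
    by (rule kernel_admissible[OF tm c pq(2) W'(1)]) (use W'(2) in \<open>auto simp: conn_def\<close>)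
   note lo = opt[OF this]
   have r: "conn ?E S \<and> ?q * card S \<le> (?q + 1) * card W"
    by (rule local_optimum_approximates[OF tm c pq(2)]) (use lo W' in auto)
   have "connected_vertex_cover G S" using connected_vertex_cover_iff[OF G(1)] G(2) r S(1) lo by (auto simp: admissible_def)
   moreover have "(of_nat (card S) :: rat) \<le> (1 + \<epsilon>) * of_nat (card W)"
   proof -
    have q: "(0::rat) < of_nat ?q" using pq(2) by simp
    have "of_nat ?q * of_nat (card S) \<le> (of_nat ?q + 1) * (of_nat (card W) :: rat)"
     using r of_nat_mono[of "?q * card S" "(?q + 1) * card W", where 'a = rat] by (simp add: algebra_simps)
    \<comment> \<open>The ratio \<open>1 + 1/q\<close> that has been reached is relaxed to
      \<open>1 + p/q\<close>, using \<open>1 \<le> p\<close>.\<close>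
    also have "\<dots> \<le> (of_nat ?q + of_nat ?p) * of_nat (card W)" using pq(1) by (intro mult_right_mono) auto
    also have "\<dots> = of_nat ?q * ((1 + \<epsilon>) * of_nat (card W))" unfolding mult.assoc[symmetric] using q by (subst eps_eq) (simp add: field_simps)
    finally show ?thesis using q by (simp only: mult_le_cancel_left_pos)
   qed
   ultimately show ?thesis using W(2) by simp
  qed
  ultimately show "let w = encode_rat \<epsilon> @ [3] @ encode_graph n G in tm_halts_within M w (g (1 / \<epsilon>) * Suc n ^ (4 * ?e)) \<and>
    ((\<exists>S. connected_vertex_cover G S) --> (\<exists>S\<subseteq>{..<n}. tm_outputs M w (encode_set n S) \<and> connected_vertex_cover G S \<and>
     of_nat (card S) \<le> (1 + \<epsilon>) * of_nat (opt_size connected_vertex_cover G)))"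
   unfolding Let_def w_def[symmetric] using halts S(1) by blast
 qed
qed

theorem theorem6:
 shows "admits_EPTAS connected_vertex_cover unit_disk_graph \<and>
    admits_EPTAS connected_vertex_cover map_graph"
proof
 show "admits_EPTAS connected_vertex_cover unit_disk_graph"
  by (rule tame_class_EPTAS[of 25]) (simp, rule unit_disk_graph_tame)
 show "admits_EPTAS connected_vertex_cover map_graph"
  by (rule tame_class_EPTAS[of "2 ^ 40 + 20"]) (simp, rule map_graph_tame, simp_all)
qed

end
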